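(* Let $\mathcal V$ be a conformal Poisson vertex superalgebra (PVA) over a field $\mathbb F$ of characteristic $0$ and let $M$ be a conformal $\mathcal V$-module. Assume that, as a differential superalgebra, $\mathcal V$ is a superalgebra of differential polynomials in even or odd variables. Then the energy operator $E$ acting on the variational PVA cohomology $H_{\mathrm{PV}}(\mathcal V,M)=\bigoplus_{n\ge 0}H^n_{\mathrm{PV}}(\mathcal V,M)$ is diagonalizable with only eigenvalues $0$ and $1$ (i.e. every eigenvalue is $0$ or $1$).
   Context: $\mathbb F$ is a field of characteristic $0$. All superspaces are over $\mathbb F$, with parity $p$; $\bar p=1-p$ is the opposite parity. Formulas with signs are for parity-homogeneous elements. LCA: a Lie conformal superalgebra is a superspace $R$ with an even endomorphism $\partial$ and a parity-preserving bilinear map $R\otimes R\to R[\lambda]$, $a\otimes b\mapsto[a_\lambda b]$ ($\lambda$ even), with $[\partial a_\lambda b]=-\lambda[a_\lambda b]$, $[a_\lambda\partial b]=(\lambda+\partial)[a_\lambda b]$, $[a_\lambda b]=-(-1)^{p(a)p(b)}[b_{-\lambda-\partial}a]$ ($\partial$ acting from the left on coefficients), $[a_\lambda[b_\mu c]]-(-1)^{p(a)p(b)}[b_\mu[a_\lambda c]]=[[a_\lambda b]_{\lambda+\mu}c]$. An LCA module is a superspace $M$ with an even endomorphism $\partial$ and a parity-preserving bilinear map $R\otimes M\to M[\lambda]$, $a\otimes m\mapsto a_\lambda m$, with $(\partial a)_\lambda m=-\lambda a_\lambda m$, $a_\lambda(\partial m)=(\lambda+\partial)(a_\lambda m)$,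 $a_\lambda(b_\mu m)-(-1)^{p(a)p(b)}b_\mu(a_\lambda m)=[a_\lambda b]_{\lambda+\mu}m$. PVA: a (supercommutative) commutative associative unital superalgebra $\mathcal V$ with an even derivation $\partial$ and an LCA $\lambda$-bracket satisfying $[a_\lambda bc]=[a_\lambda b]c+(-1)^{p(b)p(c)}[a_\lambda c]b$. A PVA module $M$ is a module over the differential superalgebra $\mathcal V$ and over the LCA $\mathcal V$ (same $\partial$) with $a_\lambda(bm)=[a_\lambda b]m+(-1)^{p(a)p(b)}b(a_\lambda m)$ and $(ab)_\lambda m=(e^{\partial\partial_\lambda}a)(b_\lambda m)+(-1)^{p(a)p(b)}(e^{\partial\partial_\lambda}b)(a_\lambda m)$, where $(e^{\partial\partial_\lambda}a)P(\lambda)=\sum_{k\ge0}\frac1{k!}(\partial^ka)\frac{d^kP}{d\lambda^k}$. Variational PVA complex: $C^n_{\mathrm{PV}}(\mathcal V,M)$, $n\ge0$, is the superspace of linear maps $Y:\mathcal V^{\otimes n}\to M[\lambda_1,\dots,\lambda_n]/\langle\partial+\lambda_1+\cdots+\lambda_n\rangle$ ($\langle\Phi\rangle$ = image of $\Phi$), with parity $\bar p(Y)$ given by $\bar p(Y(a_1\otimes\cdots\otimes a_n))=\bar p(Y)+\sum\bar p(a_i)$, satisfying: sesquilinearity $Y_{\lambda_1,\dots,\lambda_n}(\cdots\otimes\partial a_i\otimes\cdots)=-\lambda_iY_{\lambda_1,\dots,\lambda_n}(\cdots\otimes a_i\otimes\cdots)$; symmetry: $Y$ is multiplied by $(-1)^{\bar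 p(a_i)\bar p(a_{i+1})}$ when $a_i,a_{i+1}$ and $\lambda_i,\lambda_{i+1}$ are simultaneously interchanged; Leibniz rules $Y(\cdots\otimes b_ic_i\otimes\cdots)=(-1)^{p(b_i)s_i}(e^{\partial\partial_{\lambda_i}}b_i)Y(\cdots\otimes c_i\otimes\cdots)+(-1)^{p(c_i)(p(b_i)+s_i)}(e^{\partial\partial_{\lambda_i}}c_i)Y(\cdots\otimes b_i\otimes\cdots)$, $s_i=\bar p(Y)+\bar p(a_1)+\dots+\bar p(a_{i-1})$. In particular $C^0_{\mathrm{PV}}=M/\partial M$. The differential $d:C^n_{\mathrm{PV}}\to C^{n+1}_{\mathrm{PV}}$, $d^2=0$, is $$(dY)_{\lambda_0,\dots,\lambda_n}(a_0\otimes\cdots\otimes a_n)=\sum_{i=0}^n(-1)^{\gamma_i}{a_i}_{\lambda_i}Y_{\lambda_0,\overset{i}{\check\dots},\lambda_n}(a_0\otimes\overset{i}{\check\cdots}\otimes a_n)+\sum_{i<j}(-1)^{\gamma_{ij}}Y_{\lambda_i+\lambda_j,\lambda_0,\overset{i}{\check\dots}\overset{j}{\check\dots},\lambda_n}([{a_i}_{\lambda_i}a_j]\otimes a_0\otimes\overset{i}{\check\cdots}\overset{j}{\check\cdots}\otimes a_n),$$ with $\check{}$ meaning omission, $\gamma_i=\bar p(a_i)(\bar p(Y)+\bar p(a_0)+\dots+\bar p(a_{i-1})+1)+1$, $\gamma_{ij}=\bar p(Y)+\bar p(a_i)(\bar p(a_0)+\dots+\bar p(a_{i-1})+1)+\bar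 p(a_j)(\bar p(a_0)+\overset{i}{\check\dots}+\bar p(a_{j-1}))$. $H^n_{\mathrm{PV}}(\mathcal V,M)=\ker(d|_{C^n_{\mathrm{PV}}})/d(C^{n-1}_{\mathrm{PV}})$. Superalgebra of differential polynomials: the free supercommutative unital superalgebra on variables $u_i^{(k)}$ ($i$ in some index set, $k\ge0$, $u_i^{(k)}$ of the parity of $u_i$) with $\partial u_i^{(k)}=u_i^{(k+1)}$. Conformal: $\mathcal V$ is conformal if it is endowed with an even element $L$ (Virasoro element) such that $[L_\lambda L]=(\partial+2\lambda)L+\frac c{12}\lambda^3$ for some $c\in\mathbb F$, $L_{(0)}:=[L_\lambda\,\cdot\,]|_{\lambda=0}=\partial$, and $L_{(1)}:=\frac d{d\lambda}[L_\lambda\,\cdot\,]|_{\lambda=0}$ is diagonalizable on $\mathcal V$. A $\mathcal V$-module $M$ is conformal if $(L_\lambda\,\cdot\,)|_{\lambda=0}=\partial$ on $M$ and $L^M_{(1)}:=\frac d{d\lambda}(L_\lambda\,\cdot\,)|_{\lambda=0}$ is diagonalizable on $M$. Energy operator: the operator $E=L_{(1)}^M+\sum_{i=1}^n\lambda_i\frac{d}{d\lambda_i}$ on $M[\lambda_1,\dots,\lambda_n]$ descends to $M[\lambda_1,\dots,\lambda_n]/\langle\partial+\lambda_1+\dots+\lambda_n\rangle$. The energy operator on $C^n_{\mathrm{PV}}(\mathcal V,M)$ is $$(EY)_{\lambda_1,\dots,\lambda_n}(a_1\otimes\cdots\otimes a_n)=(E+n)\big(Y_{\lambda_1,\dots,\lambda_n}(a_1\otimes\cdots\otimes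 a_n)\big)-\sum_{i=1}^nY_{\lambda_1,\dots,\lambda_n}(a_1\otimes\cdots\otimes L_{(1)}a_i\otimes\cdots\otimes a_n).$$ It commutes with $d$, hence acts on $H_{\mathrm{PV}}(\mathcal V,M)$. *)

theory Defs
  imports
    "HOL-Computational_Algebra.Polynomial"
    "HOL-Library.Poly_Mapping"
    "HOL-Library.Z2"
    "HOL-Algebra.AbelCoset"
    "HOL-Algebra.Module"
begin

section \<open>Vector spaces with a carrier\<close>

text \<open>
  Vector spaces that are not a full type (quotients, cochains, cohomology) are records of type
  \<^typ>\<open>('f, 'a) module\<close>; their multiplicative fields play no role.
\<close>

definition vspace ::
  "'a set \<Rightarrow> 'a \<Rightarrow> ('a \<Rightarrow> 'a \<Rightarrow> 'a) \<Rightarrow> ('f \<Rightarrow> 'a \<Rightarrow> 'a) \<Rightarrow> ('f, 'a) module" where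
  "vspace A z pl sc =
     \<lparr>carrier = A, monoid.mult = undefined, one = undefined, zero = z, add = pl, smult = sc\<rparr>"

definition quotient_space :: "('f, 'a) module \<Rightarrow> 'a set \<Rightarrow> ('f, 'a set) module" where
  "quotient_space W N =
     vspace (a_rcosets\<^bsub>W\<^esub> N) N (\<lambda>X Y. X <+>\<^bsub>W\<^esub> Y) (\<lambda>c X. \<Union>x\<in>X. N +>\<^bsub>W\<^esub> (c \<odot>\<^bsub>W\<^esub> x))"

definition induced_map :: "('f, 'a) module \<Rightarrow> 'a set \<Rightarrow> ('a \<Rightarrow> 'a) \<Rightarrow> 'a set \<Rightarrow> 'a set" where
  "induced_map W N T X = (\<Union>x\<in>X. N +>\<^bsub>W\<^esub> T x)"

definition direct_sum :: "(nat \<Rightarrow> ('f, 'a) module) \<Rightarrow> ('f, nat \<Rightarrow> 'a) module" where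
  "direct_sum W =
     vspace {h. (\<forall>n. h n \<in> carrier (W n)) \<and> finite {n. h n \<noteq> \<zero>\<^bsub>W n\<^esub>}}
       (\<lambda>n. \<zero>\<^bsub>W n\<^esub>) (\<lambda>g h n. g n \<oplus>\<^bsub>W n\<^esub> h n) (\<lambda>c h n. c \<odot>\<^bsub>W n\<^esub> h n)"

definition is_eigenvalue :: "('f, 'a) module \<Rightarrow> ('a \<Rightarrow> 'a) \<Rightarrow> 'f \<Rightarrow> bool" where
  "is_eigenvalue W T c \<longleftrightarrow> (\<exists>x\<in>carrier W. x \<noteq> \<zero>\<^bsub>W\<^esub> \<and> T x = c \<odot>\<^bsub>W\<^esub> x)"

definition diagonalizable :: "('f, 'a) module \<Rightarrow> ('a \<Rightarrow> 'a) \<Rightarrow> bool" where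
  "diagonalizable W T \<longleftrightarrow>
     (\<forall>w\<in>carrier W. \<exists>A. finite A \<and> A \<subseteq> {x \<in> carrier W. \<exists>c. T x = c \<odot>\<^bsub>W\<^esub> x} \<and>
        w = (\<Oplus>\<^bsub>W\<^esub>x\<in>A. x))"


section \<open>Superspaces with an even endomorphism\<close>

text \<open>
  The underlying space is a full type. Parities live in \<open>\<int>/2\<close>, the type \<^typ>\<open>bit\<close>;
  \<open>par S \<alpha>\<close> is the subspace of elements of parity \<open>\<alpha>\<close> and \<open>der S\<close> is the endomorphism \<open>\<partial>\<close>.
  The opposite parity of \<open>\<alpha>\<close> is \<open>1 + \<alpha>\<close>.
\<close>

record ('f, 'm) dspace =
  scl :: "'f \<Rightarrow> 'm \<Rightarrow> 'm"
  par :: "bit \<Rightarrow> 'm set"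
  der :: "'m \<Rightarrow> 'm"

definition sg :: "bit \<Rightarrow> 'f::ring_1" where
  "sg \<alpha> = (if \<alpha> = 0 then 1 else - 1)"

definition full_space :: "('f, 'm::ab_group_add, 'z) dspace_scheme \<Rightarrow> ('f, 'm) module" where
  "full_space S = vspace UNIV 0 (+) (scl S)"

definition diff_superspace :: "('f::field, 'm::ab_group_add, 'z) dspace_scheme \<Rightarrow> bool" where
  "diff_superspace S \<longleftrightarrow>
     vector_space (scl S) \<and>
     (\<forall>\<alpha>. Modules.module.subspace (scl S) (par S \<alpha>)) \<and>
     par S 0 \<inter> par S 1 = {0} \<and>
     (\<forall>v. \<exists>a\<in>par S 0. \<exists>b\<in>par S 1. v = a + b) \<and>
     Vector_Spaces.linear (scl S) (scl S) (der S) \<and>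
     (\<forall>\<alpha>. \<forall>a\<in>par S \<alpha>. der S a \<in> par S \<alpha>)"

definition hcomp :: "('f, 'm::ab_group_add, 'z) dspace_scheme \<Rightarrow> bit \<Rightarrow> 'm \<Rightarrow> 'm" where
  "hcomp S \<alpha> v = (THE a. a \<in> par S \<alpha> \<and> v - a \<in> par S (1 + \<alpha>))"


section \<open>Polynomials in several variables with coefficients in a vector space\<close>

text \<open>
  The variables are \<open>\<lambda>\<^sub>0, \<lambda>\<^sub>1, \<dots>\<close>; a monomial is the finitely supported function of its exponents.
  In particular the variables of an \<open>n\<close>-cochain are \<open>\<lambda>\<^sub>0, \<dots>, \<lambda>\<^sub>n\<^sub>-\<^sub>1\<close>.
\<close>

type_synonym 'm lpoly = "(nat \<Rightarrow>\<^sub>0 nat) \<Rightarrow>\<^sub>0 'm"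

definition const :: "'m::zero \<Rightarrow> 'm lpoly" where
  "const m = Poly_Mapping.single 0 m"

definition lmonom :: "(nat \<Rightarrow>\<^sub>0 nat) \<Rightarrow> 'm::comm_monoid_add lpoly \<Rightarrow> 'm lpoly" where
  "lmonom e P = (\<Sum>f\<in>Poly_Mapping.keys P. Poly_Mapping.single (e + f) (Poly_Mapping.lookup P f))"

definition lam :: "nat \<Rightarrow> 'm::comm_monoid_add lpoly \<Rightarrow> 'm lpoly" where
  "lam i = lmonom (Poly_Mapping.single i 1)"

definition lder ::
  "('f::field, 'm::ab_group_add, 'z) dspace_scheme \<Rightarrow> nat \<Rightarrow> 'm lpoly \<Rightarrow> 'm lpoly" where
  "lder S i P =
     (\<Sum>e\<in>Poly_Mapping.keys P. Poly_Mapping.single (e - Poly_Mapping.single i 1)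
        (scl S (of_nat (Poly_Mapping.lookup e i)) (Poly_Mapping.lookup P e)))"

text \<open>
  \<open>psubst T p\<close> substitutes the operator \<open>T\<close> (such as \<open>\<lambda>\<^sub>i\<close> or \<open>\<lambda>\<^sub>i + \<lambda>\<^sub>j\<close>) for the variable of \<open>p\<close>;
  \<open>lsubst Ts P\<close> substitutes the operators \<open>Ts ! 0, Ts ! 1, \<dots>\<close> for \<open>\<lambda>\<^sub>0, \<lambda>\<^sub>1, \<dots>\<close>.
\<close>

definition psubst :: "('m lpoly \<Rightarrow> 'm lpoly) \<Rightarrow> 'm::comm_monoid_add poly \<Rightarrow> 'm lpoly" where
  "psubst T p = (\<Sum>k\<le>degree p. (T ^^ k) (const (coeff p k)))"

definition lsubst :: "('m lpoly \<Rightarrow> 'm lpoly) list \<Rightarrow> 'm::comm_monoid_add lpoly \<Rightarrow> 'm lpoly" where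
  "lsubst Ts P =
     (\<Sum>e\<in>Poly_Mapping.keys P. foldr (\<lambda>j. (Ts ! j) ^^ Poly_Mapping.lookup e j) [0..<length Ts] (const (Poly_Mapping.lookup P e)))"

text \<open>
  For \<open>A a m\<close> standing for \<open>a\<^sub>\<lambda> m\<close>, this is \<open>a\<^sub>T P\<close>, where \<open>a\<close> acts on the coefficients of \<open>P\<close>.
\<close>

definition lact ::
  "('v \<Rightarrow> 'm \<Rightarrow> 'm::comm_monoid_add poly) \<Rightarrow> ('m lpoly \<Rightarrow> 'm lpoly) \<Rightarrow> 'v \<Rightarrow> 'm lpoly \<Rightarrow> 'm lpoly" where
  "lact A T a P = (\<Sum>e\<in>Poly_Mapping.keys P. lmonom e (psubst T (A a (Poly_Mapping.lookup P e))))"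


section \<open>Poisson vertex superalgebras and their modules\<close>

record (overloaded) ('f, 'v::zero) pva = "('f, 'v) dspace" +
  lbr :: "'v \<Rightarrow> 'v \<Rightarrow> 'v poly"

record (overloaded) ('v, 'f, 'm::zero) pva_mod = "('f, 'm) dspace" +
  vmul :: "'v \<Rightarrow> 'm \<Rightarrow> 'm"
  vact :: "'v \<Rightarrow> 'm \<Rightarrow> 'm poly"

text \<open>\<open>A\<close> is an action of the Lie conformal superalgebra \<open>R\<close> on \<open>S\<close>; for \<open>S = R\<close> and \<open>A = lbr R\<close>
  the last clause is the Jacobi identity, with \<open>\<lambda> = \<lambda>\<^sub>0\<close> and \<open>\<mu> = \<lambda>\<^sub>1\<close>.\<close>

definition lca_action ::
  "('f::field, 'v::ab_group_add) pva \<Rightarrow> ('f, 'm::ab_group_add, 'z) dspace_scheme \<Rightarrow>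
   ('v \<Rightarrow> 'm \<Rightarrow> 'm poly) \<Rightarrow> bool" where
  "lca_action R S A \<longleftrightarrow>
     (\<forall>m k. Vector_Spaces.linear (scl R) (scl S) (\<lambda>a. coeff (A a m) k)) \<and>
     (\<forall>a k. Vector_Spaces.linear (scl S) (scl S) (\<lambda>m. coeff (A a m) k)) \<and>
     (\<forall>\<alpha> \<beta>. \<forall>a\<in>par R \<alpha>. \<forall>m\<in>par S \<beta>. \<forall>k. coeff (A a m) k \<in> par S (\<alpha> + \<beta>)) \<and>
     (\<forall>a m. A (der R a) m = - pCons 0 (A a m)) \<and>
     (\<forall>a m. A a (der S m) = pCons 0 (A a m) + map_poly (der S) (A a m)) \<and>
     (\<forall>\<alpha> \<beta>. \<forall>a\<in>par R \<alpha>. \<forall>b\<in>par R \<beta>. \<forall>m.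
        lact A (lam 0) a (psubst (lam 1) (A b m))
        - Poly_Mapping.map (scl S (sg (\<alpha> * \<beta>))) (lact A (lam 1) b (psubst (lam 0) (A a m)))
        = (\<Sum>k\<le>degree (lbr R a b).
             (lam 0 ^^ k) (psubst (\<lambda>P. lam 0 P + lam 1 P) (A (coeff (lbr R a b) k) m))))"

definition lie_conformal :: "('f::field, 'v::ab_group_add) pva \<Rightarrow> bool" where
  "lie_conformal R \<longleftrightarrow>
     diff_superspace R \<and> lca_action R R (lbr R) \<and>
     (\<forall>\<alpha> \<beta>. \<forall>a\<in>par R \<alpha>. \<forall>b\<in>par R \<beta>.
        lbr R a b = - map_poly (scl R (sg (\<alpha> * \<beta>)))
          (\<Sum>k\<le>degree (lbr R b a).
             ((\<lambda>p. - pCons 0 p - map_poly (der R) p) ^^ k) [:coeff (lbr R b a) k:]))"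

definition diff_superalgebra :: "('f::field, 'v::ring_1, 'z) dspace_scheme \<Rightarrow> bool" where
  "diff_superalgebra V \<longleftrightarrow>
     diff_superspace V \<and>
     (\<forall>c a b. scl V c (a * b) = scl V c a * b \<and> scl V c (a * b) = a * scl V c b) \<and>
     1 \<in> par V 0 \<and>
     (\<forall>\<alpha> \<beta>. \<forall>a\<in>par V \<alpha>. \<forall>b\<in>par V \<beta>.
        a * b \<in> par V (\<alpha> + \<beta>) \<and> a * b = scl V (sg (\<alpha> * \<beta>)) (b * a)) \<and>
     (\<forall>a b. der V (a * b) = der V a * b + a * der V b)"

definition poisson_vertex :: "('f::field, 'v::ring_1) pva \<Rightarrow> bool" where
  "poisson_vertex V \<longleftrightarrow>
     diff_superalgebra V \<and> lie_conformal V \<and>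
     (\<forall>\<beta> \<gamma> a. \<forall>b\<in>par V \<beta>. \<forall>c\<in>par V \<gamma>.
        lbr V a (b * c) = map_poly (\<lambda>x. x * c) (lbr V a b)
          + map_poly (\<lambda>x. scl V (sg (\<beta> * \<gamma>)) (x * b)) (lbr V a c))"

text \<open>The operator \<open>e\<^bsup>\<partial>\<partial>\<^sub>\<lambda>\<^esup> a\<close> for \<open>\<lambda> = \<lambda>\<^sub>i\<close>; only finitely many summands are nonzero.\<close>

definition exp_der ::
  "('f::field_char_0, 'v::ring_1) pva \<Rightarrow> ('v, 'f, 'm::ab_group_add) pva_mod \<Rightarrow> nat \<Rightarrow> 'v \<Rightarrow>
   'm lpoly \<Rightarrow> 'm lpoly" where
  "exp_der V M i a P =
     Sum_any (\<lambda>k. Poly_Mapping.map (\<lambda>m. scl M (1 / fact k) (vmul M ((der V ^^ k) a) m))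
       ((lder M i ^^ k) P))"

definition pva_module ::
  "('f::field_char_0, 'v::ring_1) pva \<Rightarrow> ('v, 'f, 'm::ab_group_add) pva_mod \<Rightarrow> bool" where
  "pva_module V M \<longleftrightarrow>
     diff_superspace M \<and>
     (\<forall>m. Vector_Spaces.linear (scl V) (scl M) (\<lambda>a. vmul M a m)) \<and>
     (\<forall>a. Vector_Spaces.linear (scl M) (scl M) (vmul M a)) \<and>
     (\<forall>\<alpha> \<beta>. \<forall>a\<in>par V \<alpha>. \<forall>m\<in>par M \<beta>. vmul M a m \<in> par M (\<alpha> + \<beta>)) \<and>
     (\<forall>a b m. vmul M (a * b) m = vmul M a (vmul M b m)) \<and>
     (\<forall>m. vmul M 1 m = m) \<and>
     (\<forall>a m. der M (vmul M a m) = vmul M (der V a) m + vmul M a (der M m)) \<and>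
     lca_action V M (vact M) \<and>
     (\<forall>\<alpha> \<beta>. \<forall>a\<in>par V \<alpha>. \<forall>b\<in>par V \<beta>. \<forall>m.
        vact M a (vmul M b m) = map_poly (\<lambda>x. vmul M x m) (lbr V a b)
          + map_poly (\<lambda>x. scl M (sg (\<alpha> * \<beta>)) (vmul M b x)) (vact M a m)) \<and>
     (\<forall>\<alpha> \<beta>. \<forall>a\<in>par V \<alpha>. \<forall>b\<in>par V \<beta>. \<forall>m.
        psubst (lam 0) (vact M (a * b) m) =
          exp_der V M 0 a (psubst (lam 0) (vact M b m))
          + Poly_Mapping.map (scl M (sg (\<alpha> * \<beta>))) (exp_der V M 0 b (psubst (lam 0) (vact M a m))))"

definition conformal_pva :: "('f::field_char_0, 'v::ring_1) pva \<Rightarrow> 'v \<Rightarrow> bool" where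
  "conformal_pva V L \<longleftrightarrow>
     poisson_vertex V \<and> L \<in> par V 0 \<and>
     (\<exists>c. lbr V L L = [:der V L, scl V 2 L, 0, scl V (c / 12) 1:]) \<and>
     (\<forall>a. coeff (lbr V L a) 0 = der V a) \<and>
     diagonalizable (full_space V) (\<lambda>a. coeff (lbr V L a) 1)"

definition conformal_module ::
  "('f::field_char_0, 'v::ring_1) pva \<Rightarrow> 'v \<Rightarrow> ('v, 'f, 'm::ab_group_add) pva_mod \<Rightarrow> bool" where
  "conformal_module V L M \<longleftrightarrow>
     pva_module V M \<and>
     (\<forall>m. coeff (vact M L m) 0 = der M m) \<and>
     diagonalizable (full_space M) (\<lambda>m. coeff (vact M L m) 1)"


section \<open>Superalgebras of differential polynomials\<close>

text \<open>
  The free supercommutative superalgebra on the variables \<open>u\<^sub>i\<^sup>(\<^sup>k\<^sup>)\<close>, \<open>i \<in> I\<close>, is the free associative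
  algebra, with basis the words in the pairs \<open>(i, k)\<close>, modulo the two-sided ideal generated by
  the supercommutators of the variables. \<open>V\<close> is identified with it by the homomorphism that sends
  \<open>u\<^sub>i\<^sup>(\<^sup>k\<^sup>)\<close> to \<open>\<partial>\<^sup>k u\<^sub>i\<close>; \<open>q i\<close> is the parity of \<open>u\<^sub>i\<close>.
\<close>

definition word_eval ::
  "('f::field, 'v::ring_1, 'z) dspace_scheme \<Rightarrow> ('i \<Rightarrow> 'v) \<Rightarrow> (('i \<times> nat) list \<Rightarrow>\<^sub>0 'f) \<Rightarrow> 'v" where
  "word_eval V u f =
     (\<Sum>w\<in>Poly_Mapping.keys f. scl V (Poly_Mapping.lookup f w) (prod_list (map (\<lambda>(i, k). (der V ^^ k) (u i)) w)))"

definition supercommutator_ideal :: "'i set \<Rightarrow> ('i \<Rightarrow> bit) \<Rightarrow> (('i \<times> nat) list \<Rightarrow>\<^sub>0 'f::field) set" where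
  "supercommutator_ideal I q =
     Modules.module.span (\<lambda>c. Poly_Mapping.map ((*) c))
       {Poly_Mapping.single (v @ [x, y] @ w) 1
          - Poly_Mapping.single (v @ [y, x] @ w) (sg (q (fst x) * q (fst y))) | v w x y.
        v \<in> lists (I \<times> UNIV) \<and> w \<in> lists (I \<times> UNIV) \<and> x \<in> I \<times> UNIV \<and> y \<in> I \<times> UNIV}"

definition diff_polynomials ::
  "('f::field, 'v::ring_1, 'z) dspace_scheme \<Rightarrow> 'i set \<Rightarrow> ('i \<Rightarrow> 'v) \<Rightarrow> bool" where
  "diff_polynomials V I u \<longleftrightarrow>
     diff_superalgebra V \<and>
     (\<exists>q. (\<forall>i\<in>I. u i \<in> par V (q i)) \<and>
        word_eval V u ` {f. Poly_Mapping.keys f \<subseteq> lists (I \<times> UNIV)} = UNIV \<and>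
        {f. Poly_Mapping.keys f \<subseteq> lists (I \<times> UNIV) \<and> word_eval V u f = 0} = supercommutator_ideal I q)"


section \<open>The variational complex\<close>

definition lpoly_space :: "('f, 'm::ab_group_add, 'z) dspace_scheme \<Rightarrow> nat \<Rightarrow> ('f, 'm lpoly) module" where
  "lpoly_space S n =
     vspace {P. \<forall>e\<in>Poly_Mapping.keys P. Poly_Mapping.keys e \<subseteq> {..<n}} 0 (+) (\<lambda>c. Poly_Mapping.map (scl S c))"

definition total_image :: "('f, 'm::ab_group_add, 'z) dspace_scheme \<Rightarrow> nat \<Rightarrow> 'm lpoly set" where
  "total_image S n =
     (\<lambda>P. Poly_Mapping.map (der S) P + (\<Sum>i<n. lam i P)) ` carrier (lpoly_space S n)"

abbreviation lquot :: "('f, 'm::ab_group_add, 'z) dspace_scheme \<Rightarrow> nat \<Rightarrow> ('f, 'm lpoly set) module" where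
  "lquot S n \<equiv> quotient_space (lpoly_space S n) (total_image S n)"

definition lclass :: "('f, 'm::ab_group_add, 'z) dspace_scheme \<Rightarrow> nat \<Rightarrow> 'm lpoly \<Rightarrow> 'm lpoly set" where
  "lclass S n P = total_image S n +>\<^bsub>lpoly_space S n\<^esub> P"

text \<open>
  Operators that descend to \<open>M[\<lambda>\<^sub>0, \<dots>, \<lambda>\<^sub>n\<^sub>-\<^sub>1]/\<langle>\<partial> + \<lambda>\<^sub>0 + \<dots> + \<lambda>\<^sub>n\<^sub>-\<^sub>1\<rangle>\<close> are applied to a representative.
\<close>

definition rep :: "'a set \<Rightarrow> 'a" where
  "rep X = (SOME P. P \<in> X)"

text \<open>
  Linear maps on \<open>V\<^sup>\<otimes>\<^sup>n\<close> are multilinear maps on lists of length \<open>n\<close>, made \<open>undefined\<close> on all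
  other lists so that equality of cochains is equality of functions.
\<close>

abbreviation lists_of :: "nat \<Rightarrow> 'v list set" where
  "lists_of n \<equiv> {xs. length xs = n}"

definition multilinear ::
  "('f, 'v::ring_1) pva \<Rightarrow> ('v, 'f, 'm::ab_group_add) pva_mod \<Rightarrow> nat \<Rightarrow>
   ('v list \<Rightarrow> 'm lpoly set) \<Rightarrow> bool" where
  "multilinear V M n Y \<longleftrightarrow>
     Y \<in> lists_of n \<rightarrow>\<^sub>E carrier (lquot M n) \<and>
     (\<forall>xs\<in>lists_of n. \<forall>i<n. \<forall>c a b.
        Y (xs[i := scl V c a + b]) =
          c \<odot>\<^bsub>lquot M n\<^esub> Y (xs[i := a]) \<oplus>\<^bsub>lquot M n\<^esub> Y (xs[i := b]))"

text \<open>
  The cochains \<open>Y\<close> with opposite parity \<open>\<pi>\<close>. A value whose opposite parity is \<open>\<rho>\<close> is represented by a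
  polynomial with coefficients of parity \<open>1 + \<rho>\<close>.
\<close>

definition homogeneous_cochains ::
  "('f::field_char_0, 'v::ring_1) pva \<Rightarrow> ('v, 'f, 'm::ab_group_add) pva_mod \<Rightarrow> nat \<Rightarrow> bit \<Rightarrow>
   ('v list \<Rightarrow> 'm lpoly set) set" where
  "homogeneous_cochains V M n \<pi> =
     {Y. multilinear V M n Y \<and>
       (\<forall>xs\<in>lists_of n. \<forall>ps\<in>lists_of n. (\<forall>j<n. xs ! j \<in> par V (ps ! j)) \<longrightarrow>
          Y xs \<in> lclass M n ` {P \<in> carrier (lpoly_space M n).
            \<forall>e. Poly_Mapping.lookup P e \<in> par M (1 + (\<pi> + (\<Sum>j<n. 1 + ps ! j)))}) \<and>
       (\<forall>xs\<in>lists_of n. \<forall>i<n.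
          Y (xs[i := der V (xs ! i)]) = lclass M n (- lam i (rep (Y xs)))) \<and>
       (\<forall>xs\<in>lists_of n. \<forall>i \<alpha> \<beta>. Suc i < n \<and> xs ! i \<in> par V \<alpha> \<and> xs ! Suc i \<in> par V \<beta> \<longrightarrow>
          lclass M n (lsubst (map lam ([0..<n][i := Suc i, Suc i := i]))
            (rep (Y (xs[i := xs ! Suc i, Suc i := xs ! i]))))
          = sg ((1 + \<alpha>) * (1 + \<beta>)) \<odot>\<^bsub>lquot M n\<^esub> Y xs) \<and>
       (\<forall>xs\<in>lists_of n. \<forall>ps\<in>lists_of n. \<forall>i<n. \<forall>\<beta> \<gamma>. \<forall>b\<in>par V \<beta>. \<forall>c\<in>par V \<gamma>.
          (\<forall>j<i. xs ! j \<in> par V (ps ! j)) \<longrightarrow>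
          (let s = \<pi> + (\<Sum>j<i. 1 + ps ! j) in
           Y (xs[i := b * c]) = lclass M n
             (Poly_Mapping.map (scl M (sg (\<beta> * s))) (exp_der V M i b (rep (Y (xs[i := c]))))
              + Poly_Mapping.map (scl M (sg (\<gamma> * (\<beta> + s))))
                  (exp_der V M i c (rep (Y (xs[i := b])))))))}"

definition map_space ::
  "('v, 'f, 'm::ab_group_add) pva_mod \<Rightarrow> nat \<Rightarrow> ('v list \<Rightarrow> 'm lpoly set) set \<Rightarrow>
   ('f, 'v list \<Rightarrow> 'm lpoly set) module" where
  "map_space M n C =
     vspace C (\<lambda>xs\<in>lists_of n. \<zero>\<^bsub>lquot M n\<^esub>)
       (\<lambda>Y Z. \<lambda>xs\<in>lists_of n. Y xs \<oplus>\<^bsub>lquot M n\<^esub> Z xs)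
       (\<lambda>c Y. \<lambda>xs\<in>lists_of n. c \<odot>\<^bsub>lquot M n\<^esub> Y xs)"

definition cochains ::
  "('f::field_char_0, 'v::ring_1) pva \<Rightarrow> ('v, 'f, 'm::ab_group_add) pva_mod \<Rightarrow> nat \<Rightarrow>
   ('f, 'v list \<Rightarrow> 'm lpoly set) module" where
  "cochains V M n =
     map_space M n {Y \<oplus>\<^bsub>map_space M n UNIV\<^esub> Z | Y Z.
       Y \<in> homogeneous_cochains V M n 0 \<and> Z \<in> homogeneous_cochains V M n 1}"

definition cochain_part ::
  "('f::field_char_0, 'v::ring_1) pva \<Rightarrow> ('v, 'f, 'm::ab_group_add) pva_mod \<Rightarrow> nat \<Rightarrow> bit \<Rightarrow>
   ('v list \<Rightarrow> 'm lpoly set) \<Rightarrow> 'v list \<Rightarrow> 'm lpoly set" where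
  "cochain_part V M n \<pi> Y =
     (THE Z. Z \<in> homogeneous_cochains V M n \<pi> \<and>
        (\<exists>W\<in>homogeneous_cochains V M n (1 + \<pi>). Y = Z \<oplus>\<^bsub>cochains V M n\<^esub> W))"

definition omit :: "nat \<Rightarrow> 'a list \<Rightarrow> 'a list" where
  "omit i xs = take i xs @ drop (Suc i) xs"

text \<open>
  The value (as a polynomial) of the differential of \<open>Y\<close>, of opposite parity \<open>\<pi>\<close>, on a list
  \<open>xs = [a\<^sub>0, \<dots>, a\<^sub>n]\<close> of homogeneous elements of opposite parities \<open>q 0, \<dots>, q n\<close>.
\<close>

definition differential_value ::
  "('f::field_char_0, 'v::ring_1) pva \<Rightarrow> ('v, 'f, 'm::ab_group_add) pva_mod \<Rightarrow> nat \<Rightarrow> bit \<Rightarrow>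
   ('v list \<Rightarrow> 'm lpoly set) \<Rightarrow> (nat \<Rightarrow> bit) \<Rightarrow> 'v list \<Rightarrow> 'm lpoly" where
  "differential_value V M n \<pi> Y q xs =
     (\<Sum>i\<le>n. Poly_Mapping.map (scl M (sg (q i * (\<pi> + (\<Sum>l<i. q l) + 1) + 1)))
        (lact (vact M) (lam i) (xs ! i)
          (lsubst (map lam (omit i [0..<Suc n])) (rep (Y (omit i xs))))))
     + (\<Sum>j\<le>n. \<Sum>i<j.
        Poly_Mapping.map
          (scl M (sg (\<pi> + q i * ((\<Sum>l<i. q l) + 1) + q j * (\<Sum>l\<in>{..<j} - {i}. q l))))
          (\<Sum>k\<le>degree (lbr V (xs ! i) (xs ! j)).
            (lam i ^^ k)
              (lsubst ((\<lambda>P. lam i P + lam j P) # map lam (omit i (omit j [0..<Suc n])))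
                (rep (Y (coeff (lbr V (xs ! i) (xs ! j)) k # omit i (omit j xs)))))))"

text \<open>On arbitrary arguments the differential is extended multilinearly from homogeneous ones.\<close>

definition homogeneous_differential ::
  "('f::field_char_0, 'v::ring_1) pva \<Rightarrow> ('v, 'f, 'm::ab_group_add) pva_mod \<Rightarrow> nat \<Rightarrow> bit \<Rightarrow>
   ('v list \<Rightarrow> 'm lpoly set) \<Rightarrow> 'v list \<Rightarrow> 'm lpoly set" where
  "homogeneous_differential V M n \<pi> Y =
     (\<lambda>xs\<in>lists_of (Suc n). lclass M (Suc n)
       (\<Sum>ps\<in>lists_of (Suc n).
          differential_value V M n \<pi> Y (\<lambda>i. 1 + ps ! i) (map2 (hcomp V) ps xs)))"

definition differential ::
  "('f::field_char_0, 'v::ring_1) pva \<Rightarrow> ('v, 'f, 'm::ab_group_add) pva_mod \<Rightarrow> nat \<Rightarrow>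
   ('v list \<Rightarrow> 'm lpoly set) \<Rightarrow> 'v list \<Rightarrow> 'm lpoly set" where
  "differential V M n Y =
     homogeneous_differential V M n 0 (cochain_part V M n 0 Y)
     \<oplus>\<^bsub>cochains V M (Suc n)\<^esub> homogeneous_differential V M n 1 (cochain_part V M n 1 Y)"

definition cocycles ::
  "('f::field_char_0, 'v::ring_1) pva \<Rightarrow> ('v, 'f, 'm::ab_group_add) pva_mod \<Rightarrow> nat \<Rightarrow>
   ('f, 'v list \<Rightarrow> 'm lpoly set) module" where
  "cocycles V M n =
     map_space M n {Y \<in> carrier (cochains V M n).
       differential V M n Y = \<zero>\<^bsub>cochains V M (Suc n)\<^esub>}"

fun coboundaries ::
  "('f::field_char_0, 'v::ring_1) pva \<Rightarrow> ('v, 'f, 'm::ab_group_add) pva_mod \<Rightarrow> nat \<Rightarrow>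
   ('v list \<Rightarrow> 'm lpoly set) set" where
  "coboundaries V M 0 = {\<zero>\<^bsub>cochains V M 0\<^esub>}"
| "coboundaries V M (Suc n) = differential V M n ` carrier (cochains V M n)"

definition cohomology ::
  "('f::field_char_0, 'v::ring_1) pva \<Rightarrow> ('v, 'f, 'm::ab_group_add) pva_mod \<Rightarrow> nat \<Rightarrow>
   ('f, ('v list \<Rightarrow> 'm lpoly set) set) module" where
  "cohomology V M n = quotient_space (cocycles V M n) (coboundaries V M n)"

definition total_cohomology ::
  "('f::field_char_0, 'v::ring_1) pva \<Rightarrow> ('v, 'f, 'm::ab_group_add) pva_mod \<Rightarrow>
   ('f, nat \<Rightarrow> ('v list \<Rightarrow> 'm lpoly set) set) module" where
  "total_cohomology V M = direct_sum (cohomology V M)"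


section \<open>The energy operator\<close>

definition poly_energy ::
  "'v \<Rightarrow> ('v, 'f::field_char_0, 'm::ab_group_add) pva_mod \<Rightarrow> nat \<Rightarrow> 'm lpoly \<Rightarrow> 'm lpoly" where
  "poly_energy L M n P =
     Poly_Mapping.map (\<lambda>m. coeff (vact M L m) 1) P + (\<Sum>i<n. lam i (lder M i P))"

definition cochain_energy ::
  "('f::field_char_0, 'v::ring_1) pva \<Rightarrow> 'v \<Rightarrow> ('v, 'f, 'm::ab_group_add) pva_mod \<Rightarrow> nat \<Rightarrow>
   ('v list \<Rightarrow> 'm lpoly set) \<Rightarrow> 'v list \<Rightarrow> 'm lpoly set" where
  "cochain_energy V L M n Y =
     (\<lambda>xs\<in>lists_of n. lclass M n
       (poly_energy L M n (rep (Y xs)) + Poly_Mapping.map (scl M (of_nat n)) (rep (Y xs))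
        - (\<Sum>i<n. rep (Y (xs[i := coeff (lbr V L (xs ! i)) 1])))))"

definition energy ::
  "('f::field_char_0, 'v::ring_1) pva \<Rightarrow> 'v \<Rightarrow> ('v, 'f, 'm::ab_group_add) pva_mod \<Rightarrow>
   (nat \<Rightarrow> ('v list \<Rightarrow> 'm lpoly set) set) \<Rightarrow> nat \<Rightarrow> ('v list \<Rightarrow> 'm lpoly set) set" where
  "energy V L M h =
     (\<lambda>n. induced_map (cocycles V M n) (coboundaries V M n) (cochain_energy V L M n) (h n))"

end

theory Submission
 imports Defs
begin

text \<open>
  Since \<open>V\<close> is free as a differential superalgebra, every cochain lifts to one with values in
  \<open>M[\<lambda>\<^sub>1, \<dots>, \<lambda>\<^sub>n]\<close>, before reduction modulo \<open>\<partial> + \<lambda>\<^sub>1 + \<dots> + \<lambda>\<^sub>n\<close>. On such cochains the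
  operators \<open>i0\<close>, \<open>i1\<close> of inserting \<open>L\<close> as the first argument and taking the coefficient of \<open>\<lambda>\<^sup>0\<close>,
  \<open>\<lambda>\<^sup>1\<close> in its variable satisfy the Cartan formulas \<open>[i1, d] = E\<close> and
  \<open>[i0, d] = \<partial> + \<lambda>\<^sub>1 + \<dots> + \<lambda>\<^sub>n\<close>. A cocycle of the reduced complex is represented by some \<open>y\<close> with
  \<open>d y = (\<partial> + \<lambda>\<^sub>0 + \<dots> + \<lambda>\<^sub>n) z\<close>; the first formula makes \<open>E y\<close> cohomologous to \<open>\<plusminus> i0 z\<close>, and \<open>E\<close>
  acts on this class as the identity. Hence \<open>E\<close> is idempotent on the reduced cohomology.
\<close>

text \<open>Polynomials are treated as functions of scalar values of their variables; the field is
  infinite, so nothing is lost. An argument paired with the value of its variable then behaves like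
  an element of an ordinary Lie superalgebra, the Cartan formula can serve as the recursive
  definition of the differential, and the closed formula with its signs is only met when the given
  complex is compared with it. Two obstacles shape the proof. Representatives of the values on
  generators are symmetric only modulo the image of \<partial> plus the sum of the variables;
  averaging over permutations repairs this and uses characteristic 0. And z has to be a closed
  cochain itself: \<partial> plus the sum of the variables is injective as soon as there is one
  variable, so z inherits every identity from d y, and d z = 0 follows from d d y = 0. The
  eigenvalue 1 comes from L_(1) L = 2 L: in the energy of \<open>i0\<close> z the inserted slot
  contributes 2 from L_(1) and -1 from the count of arguments, so that E \<open>i0\<close> =
  \<open>i0\<close> E + \<open>i0\<close>; moreover E z is exact because z is closed.\<close>

abbreviation "lookup \<equiv> Poly_Mapping.lookup"
abbreviation "keys \<equiv> Poly_Mapping.keys"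
abbreviation "single \<equiv> Poly_Mapping.single"

text \<open>These simp rules would turn sums and products of bits into bit operations; parities are
  kept in ring form so that \<open>add_ac\<close> and case splits settle the signs.\<close>

declare add_bit_eq_xor [simp del] mult_bit_eq_and [simp del]

lemma bit_arith [simp]:
 fixes a b :: bit
 shows "a + a = 0" "a + (a + b) = b" "a * a = a" "a * (a * b) = a * b"
 by (cases a; cases b; simp only: Z2.bit_eq_iff even_add even_mult_iff; auto)+

text \<open>The sign (-1)^b as an operator. It does not mention the scalars, so that it serves
  \<open>V\<close> and \<open>M\<close> alike and unfolds by a case split on the bit.\<close>

definition sm :: "bit => 'm::ab_group_add => 'm" where
 "sm b m = (if b = 0 then m else - m)"

lemma sm_simps [simp]:
 "sm 0 m = m" "sm 1 m = - m" "sm b 0 = 0"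
 by (auto simp: sm_def)

lemma sm_add: "sm b (m + n) = sm b m + sm b n"
 and sm_diff: "sm b (m - n) = sm b m - sm b n"
 and sm_minus: "sm b (- m) = - sm b m"
 and sm_sm: "sm a (sm b m) = sm (a + b) m"
 by (cases a; cases b; auto simp: sm_def)+

lemma sm_sum: "sm b (sum f A) = (SUM x:A. sm b (f x))"
 by (cases b) (auto simp: sum_negf)

section \<open>Polynomial functions of one scalar with values in a superspace\<close>

definition pev :: "('f::field_char_0, 'm::ab_group_add, 'z) dspace_scheme => 'm poly => 'f => 'm" where
 "pev S p t = (SUM k<=degree p. scl S (t ^ k) (coeff p k))"

text \<open>Evaluation is injective on polynomials over an infinite field (\<open>pev_inj\<close>),
  so the description is unique whenever the function is polynomial.\<close>

definition cof :: "('f::field_char_0, 'm::ab_group_add, 'z) dspace_scheme => ('f => 'm) => nat => 'm" where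
 "cof S p k = coeff (THE P. pev S P = p) k"

definition pf :: "('f::field_char_0, 'm::ab_group_add, 'z) dspace_scheme => ('f => 'm) => bool" where
 "pf S p \<longleftrightarrow> (EX P. pev S P = p)"

definition lin :: "('f, 'm::ab_group_add, 'z) dspace_scheme => ('f, 'n::ab_group_add, 'y) dspace_scheme => ('m => 'n) => bool" where
 "lin S S' T \<longleftrightarrow> (ALL x y. T (x + y) = T x + T y) & (ALL c x. T (scl S c x) = scl S' c (T x))"

lemma linI: "(!!x y. T (x + y) = T x + T y) ==> (!!c x. T (scl S c x) = scl S' c (T x)) ==> lin S S' T"
 by (auto simp: lin_def)

lemma lin_linear: "Vector_Spaces.linear (scl S) (scl S') T ==> lin S S' T"
 by (auto simp: lin_def Vector_Spaces.linear_def module_hom_def module_hom_axioms_def)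

lemma lin_add: "lin S S' T ==> T (x + y) = T x + T y"
 and lin_scl: "lin S S' T ==> T (scl S c x) = scl S' c (T x)"
 by (auto simp: lin_def)

lemma lin_0: "lin S S' T ==> T 0 = 0"
 using lin_add[of S S' T 0 0] by simp

lemma lin_minus: "lin S S' T ==> T (- x) = - T x"
 using lin_add[of S S' T x "- x"] lin_0[of S S' T] by (metis add_eq_0_iff add.right_inverse)

lemma lin_diff: "lin S S' T ==> T (x - y) = T x - T y"
 using lin_add[of S S' T x "- y"] lin_minus[of S S' T y] by simp

lemma lin_sm: "lin S S' T ==> T (sm b x) = sm b (T x)"
 by (cases b) (auto simp: lin_minus)

lemma lin_sum: "lin S S' T ==> T (sum f A) = (SUM x:A. T (f x))"
 by (induction A rule: infinite_finite_induct) (auto simp: lin_0 lin_add)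

locale superspace =
 fixes S :: "('f::field_char_0, 'm::ab_group_add, 'z) dspace_scheme"
 assumes diff_superspace: "diff_superspace S"
begin

sublocale vector_space "scl S"
 using diff_superspace by (simp add: diff_superspace_def)

lemma lin_der: "lin S S (der S)"
 using diff_superspace by (simp add: diff_superspace_def lin_linear)

lemma der_par: "a : par S \<alpha> ==> der S a : par S \<alpha>"
 using diff_superspace by (simp add: diff_superspace_def)

lemma par_subspace: "subspace (par S \<alpha>)"
 using diff_superspace by (simp add: diff_superspace_def)

lemmas par_0 [simp] = subspace_0[OF par_subspace]
lemmas par_add = subspace_add[OF par_subspace]
lemmas par_scl = subspace_scale[OF par_subspace]
lemmas par_neg = subspace_neg[OF par_subspace]
lemmas par_diff = subspace_diff[OF par_subspace]
lemmas par_sum = subspace_sum[OF par_subspace]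

lemma par_sm: "m : par S \<alpha> ==> sm b m : par S \<alpha>"
 by (cases b) (auto intro: par_neg)

lemma sg_sm: "scl S (sg b) m = sm b m"
 by (cases b) (auto simp: sg_def)

lemma scl_sm: "scl S c (sm b m) = sm b (scl S c m)"
 by (cases b) auto

lemma scl_lin: "lin S S (scl S c)"
 by (auto simp: lin_def scale_right_distrib mult.commute)

lemma par_disjoint: "m : par S \<alpha> ==> m : par S (1 + \<alpha>) ==> m = 0"
 using diff_superspace by (cases \<alpha>) (auto simp: diff_superspace_def)

lemma hcomp_eqI:
 assumes "a : par S \<alpha>" "v - a : par S (1 + \<alpha>)" shows "hcomp S \<alpha> v = a"
 unfolding hcomp_def
proof (rule the_equality)
 fix b assume b: "b : par S \<alpha> & v - b : par S (1 + \<alpha>)"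
 have "b - a : par S \<alpha>" using b assms(1) by (simp add: par_diff)
 moreover have "b - a = (v - a) - (v - b)" by simp
 hence "b - a : par S (1 + \<alpha>)" using b assms(2) by (metis par_diff)
 ultimately show "b = a" using par_disjoint[of "b - a" \<alpha>] by simp
qed (use assms in auto)

lemma hcomp_ex: "EX a. a : par S \<alpha> & v - a : par S (1 + \<alpha>)"
proof -
 obtain a b where "a : par S 0" "b : par S 1" "v = a + b"
  using diff_superspace unfolding diff_superspace_def by blast
 thus ?thesis
  by (cases \<alpha>) (auto intro: exI[of _ a] exI[of _ b])
qed

lemma hcomp_par [simp]: "hcomp S \<alpha> v : par S \<alpha>"
 and hcomp_diff: "v - hcomp S \<alpha> v : par S (1 + \<alpha>)"
 using hcomp_ex[of \<alpha> v] hcomp_eqI by fastforce+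

lemma hcomp_sum: "hcomp S 0 v + hcomp S 1 v = v"
proof -
 have "hcomp S 1 v = v - hcomp S 0 v"
  using hcomp_diff[of v 0] by (intro hcomp_eqI) auto
 thus ?thesis by simp
qed

lemma hcomp_hom: "a : par S \<alpha> ==> hcomp S \<beta> a = (if \<beta> = \<alpha> then a else 0)"
 by (cases \<alpha>; cases \<beta>) (auto intro!: hcomp_eqI)

lemma hcomp_lin: "lin S S (hcomp S \<alpha>)"
proof (rule linI)
 fix x y c
 have "x + y - (hcomp S \<alpha> x + hcomp S \<alpha> y) = (x - hcomp S \<alpha> x) + (y - hcomp S \<alpha> y)" by simp
 thus "hcomp S \<alpha> (x + y) = hcomp S \<alpha> x + hcomp S \<alpha> y"
  by (intro hcomp_eqI) (metis par_add hcomp_par hcomp_diff)+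
 have "scl S c x - scl S c (hcomp S \<alpha> x) = scl S c (x - hcomp S \<alpha> x)"
  by (simp add: scale_right_diff_distrib)
 thus "hcomp S \<alpha> (scl S c x) = scl S c (hcomp S \<alpha> x)"
  by (intro hcomp_eqI) (metis par_scl hcomp_par hcomp_diff)+
qed

lemma hcomp_der: "hcomp S \<alpha> (der S x) = der S (hcomp S \<alpha> x)"
 by (intro hcomp_eqI) (metis der_par hcomp_par hcomp_diff lin_diff[OF lin_der])+

text \<open>Parity becomes the vanishing of a linear projection, a condition that passes to
  coefficients and through every operator commuting with the projection.\<close>

lemma par_iff: "m : par S \<alpha> \<longleftrightarrow> hcomp S (1 + \<alpha>) m = 0"
proof
 assume "m : par S \<alpha>" thus "hcomp S (1 + \<alpha>) m = 0" by (cases \<alpha>) (auto simp: hcomp_hom)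
next
 assume h: "hcomp S (1 + \<alpha>) m = 0"
 hence "hcomp S \<alpha> m = m" using hcomp_sum[of m] by (cases \<alpha>) auto
 thus "m : par S \<alpha>" by (metis hcomp_par)
qed

lemma pev_bound: "degree p \<le> N ==> pev S p t = (SUM k<=N. scl S (t ^ k) (coeff p k))"
 unfolding pev_def by (rule sum.mono_neutral_left) (auto simp: coeff_eq_0)

lemma pev_add: "pev S (p + q) t = pev S p t + pev S q t"
proof -
 let ?N = "max (degree p) (degree q)"
 show ?thesis
  by (simp add: pev_bound[of "p + q" ?N] pev_bound[of p ?N] pev_bound[of q ?N] degree_add_le
    scale_right_distrib sum.distrib)
qed

lemma pev_0 [simp]: "pev S 0 t = 0"
 by (simp add: pev_def)

lemma pev_pCons: "pev S (pCons m p) t = m + scl S t (pev S p t)"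
proof -
 have "pev S (pCons m p) t = (SUM k<=Suc (degree p). scl S (t ^ k) (coeff (pCons m p) k))"
  by (rule pev_bound) (simp add: degree_pCons_le)
 also have "... = m + (SUM k<=degree p. scl S (t ^ Suc k) (coeff p k))"
  by (subst sum.atMost_Suc_shift) simp
 finally show ?thesis by (simp add: pev_def scale_sum_right)
qed

lemma pev_map:
 assumes "lin S S' T" "superspace S'"
 shows "pev S' (map_poly T p) t = T (pev S p t)"
proof -
 interpret S': superspace S' by fact
 have "degree (map_poly T p) \<le> degree p" by (rule degree_le) (auto simp: coeff_map_poly lin_0[OF assms(1)] coeff_eq_0)
 thus ?thesis
  by (subst S'.pev_bound) (auto simp: pev_def lin_sum[OF assms(1)] lin_scl[OF assms(1)]
    coeff_map_poly lin_0[OF assms(1)])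
qed

lemma pev_minus: "pev S (- p) t = - pev S p t"
 using pev_add[of p "- p" t] by (simp add: eq_neg_iff_add_eq_0 add.commute)

text \<open>Reduces statements about vector-valued polynomials to scalar ones.\<close>

lemma functional_exists:
 assumes "m ~= 0"
 shows "EX \<phi>::'m => 'f. (ALL x y. \<phi> (x + y) = \<phi> x + \<phi> y) & (ALL c x. \<phi> (scl S c x) = c * \<phi> x) & \<phi> m = 1"
proof -
 interpret F: vector_space "(*) :: 'f => 'f => 'f"
  by unfold_locales (auto simp: algebra_simps)
 interpret P: vector_space_pair "scl S" "(*) :: 'f => 'f => 'f" ..
 have "independent {m}" using assms by simp
 from P.linear_independent_extend[OF this, of "%_. 1"]
 obtain g where "Vector_Spaces.linear (scl S) (*) g" "g m = 1" by auto
 thus ?thesis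
  by (auto simp: Vector_Spaces.linear_def module_hom_def module_hom_axioms_def)
qed

text \<open>A functional with value 1 on the leading coefficient yields a nonzero scalar polynomial
  with infinitely many roots.\<close>

lemma pev_eq_0:
 assumes "!!t. pev S p t = 0" shows "p = 0"
proof (rule ccontr)
 assume "p ~= 0"
 then obtain \<phi> :: "'m => 'f" where \<phi>: "!!x y. \<phi> (x + y) = \<phi> x + \<phi> y" "!!c x. \<phi> (scl S c x) = c * \<phi> x"
   "\<phi> (lead_coeff p) = 1"
  using functional_exists[of "lead_coeff p"] by auto
 have \<phi>0: "\<phi> 0 = 0" using \<phi>(1)[of 0 0] by simp
 have s: "\<phi> (sum f A) = (SUM x:A. \<phi> (f x))" for f and A :: "nat set"
  by (induction A rule: infinite_finite_induct) (auto simp: \<phi> \<phi>0)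
 let ?q = "map_poly \<phi> p"
 have "poly ?q t = 0" for t
 proof -
  have "degree ?q \<le> degree p" by (rule degree_le) (auto simp: coeff_map_poly \<phi>0 coeff_eq_0)
  hence "poly ?q t = (SUM k<=degree p. coeff ?q k * t ^ k)"
   unfolding poly_altdef by (intro sum.mono_neutral_left) (auto simp: coeff_eq_0)
  also have "... = \<phi> (pev S p t)"
   by (simp add: pev_def s \<phi> coeff_map_poly \<phi>0 mult.commute)
  finally show ?thesis by (simp add: assms \<phi>0)
 qed
 hence "?q = 0" using poly_all_0_iff_0 by blast
 hence "\<phi> (lead_coeff p) = 0" by (metis coeff_0 coeff_map_poly \<phi>0)
 thus False using \<phi>(3) by simp
qed

lemma pev_inj: "pev S p = pev S q ==> p = q"
 using pev_eq_0[of "p - q"] pev_add[of p "- q"] by (simp add: pev_minus)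

lemma cof_pev [simp]: "cof S (pev S P) k = coeff P k"
proof -
 have "(THE Q. pev S Q = pev S P) = P" by (rule the_equality) (auto dest: pev_inj)
 thus ?thesis by (simp add: cof_def)
qed

lemma pf_pev [simp]: "pf S (pev S P)"
 by (auto simp: pf_def)

lemma pf_step_eq: "(%t. m + scl S t (pev S P t)) = pev S (pCons m P)"
 by (auto simp: pev_pCons)

lemma pf_step: "pf S p ==> pf S (%t. m + scl S t (p t))"
 unfolding pf_def using pf_step_eq by metis

lemma pf_0 [simp]: "pf S (%_. 0)"
 unfolding pf_def by (rule exI[of _ 0]) auto

text \<open>Horner's scheme as an induction rule: an operator on polynomial functions is controlled
  by its values on constants and its behaviour under multiplication by the variable.\<close>

lemma pf_induct [consumes 1, case_names zero step]:
 assumes "pf S p" "Q (%_. 0)" "!!m p. pf S p ==> Q p ==> Q (%t. m + scl S t (p t))"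
 shows "Q p"
proof -
 have "Q (pev S P)" for P
 proof (induction P)
  case 0
  have "pev S 0 = (%_. 0)" by auto
  thus ?case using assms(2) by simp
 next
  case (pCons a p)
  show ?case unfolding pf_step_eq[symmetric] by (rule assms(3)) (use pCons in auto)
 qed
 thus ?thesis using assms(1) by (auto simp: pf_def)
qed

lemma pf_const [simp]: "pf S (%_. m)"
 using pf_step[OF pf_0, of m] by simp

lemma pf_add: assumes "pf S p" "pf S q" shows "pf S (%t. p t + q t)"
proof -
 obtain P Q where "pev S P = p" "pev S Q = q" using assms by (auto simp: pf_def)
 hence "pev S (P + Q) = (%t. p t + q t)" by (auto simp: pev_add)
 thus ?thesis by (metis pf_pev)
qed

lemma pf_lin: assumes "pf S p" "lin S S' T" "superspace S'" shows "pf S' (%t. T (p t))"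
proof -
 obtain P where "pev S P = p" using assms by (auto simp: pf_def)
 hence "pev S' (map_poly T P) = (%t. T (p t))" using pev_map[OF assms(2,3)] by auto
 thus ?thesis unfolding pf_def by metis
qed

lemma pf_lin': "pf S p ==> lin S S T ==> pf S (%t. T (p t))"
 using pf_lin superspace_axioms by blast

lemma pf_scl: "pf S p ==> pf S (%t. scl S c (p t))"
 using pf_lin'[OF _ scl_lin] by blast

lemma pf_neg: "pf S p ==> pf S (%t. - p t)"
 using pf_scl[of p "- 1"] by simp

lemma pf_diff: "pf S p ==> pf S q ==> pf S (%t. p t - q t)"
 using pf_add[OF _ pf_neg] by simp

lemma pf_sm: "pf S p ==> pf S (%t. sm b (p t))"
 by (cases b) (auto intro: pf_neg)

lemma pf_var: "pf S p ==> pf S (%t. scl S t (p t))"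
 using pf_step[of p 0] by simp

lemma pf_sum: "(!!x. x : A ==> pf S (p x)) ==> pf S (%t. SUM x:A. p x t)"
 by (induction A rule: infinite_finite_induct) (auto intro: pf_add)

lemma pf_shift: assumes "pf S p" shows "pf S (%t. p (s + t))"
 using assms
proof (induction rule: pf_induct)
 case (step m p)
 have "(%t. m + scl S (s + t) (p (s + t))) = (%t. m + scl S s (p (s + t)) + scl S t (p (s + t)))"
  by (auto simp: scale_left_distrib)
 thus ?case using step by (auto intro!: pf_add pf_scl pf_var)
qed simp

lemma cof_0 [simp]: "cof S (%_. 0) k = 0"
proof -
 have "(%_. 0) = pev S 0" by auto
 thus ?thesis by (metis cof_pev coeff_0)
qed

lemma cof_step: "pf S p ==> cof S (%t. m + scl S t (p t)) k = (case k of 0 => m | Suc j => cof S p j)"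
 by (auto simp: pf_def pf_step_eq coeff_pCons split: nat.split)

lemma cof_const: "cof S (%_. m) k = (if k = 0 then m else 0)"
 using cof_step[OF pf_0, of m k] by (auto split: nat.split)

lemma cof_add: assumes "pf S p" "pf S q" shows "cof S (%t. p t + q t) k = cof S p k + cof S q k"
proof -
 obtain P Q where PQ: "pev S P = p" "pev S Q = q" using assms by (auto simp: pf_def)
 hence "pev S (P + Q) = (%t. p t + q t)" by (auto simp: pev_add)
 thus ?thesis by (metis PQ cof_pev coeff_add)
qed

lemma cof_lin:
 assumes "pf S p" "lin S S' T" "superspace S'" shows "cof S' (%t. T (p t)) k = T (cof S p k)"
proof -
 interpret S': superspace S' by fact
 obtain P where P: "pev S P = p" using assms by (auto simp: pf_def)
 hence "pev S' (map_poly T P) = (%t. T (p t))" using pev_map[OF assms(2,3)] by auto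
 hence "cof S' (%t. T (p t)) k = coeff (map_poly T P) k" by (metis S'.cof_pev)
 thus ?thesis using P lin_0[OF assms(2)] by (metis coeff_map_poly cof_pev)
qed

lemma cof_lin': "pf S p ==> lin S S T ==> cof S (%t. T (p t)) k = T (cof S p k)"
 using cof_lin superspace_axioms by blast

lemma cof_scl: "pf S p ==> cof S (%t. scl S c (p t)) k = scl S c (cof S p k)"
 using cof_lin'[OF _ scl_lin] by blast

lemma sm_lin: "lin S S (sm b)"
 by (rule linI) (auto simp: sm_add scl_sm)

lemma cof_sm: "pf S p ==> cof S (%t. sm b (p t)) k = sm b (cof S p k)"
 using cof_lin'[OF _ sm_lin] by blast

lemma cof_neg: "pf S p ==> cof S (%t. - p t) k = - cof S p k"
 using cof_sm[of p 1] by simp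

lemma cof_diff: "pf S p ==> pf S q ==> cof S (%t. p t - q t) k = cof S p k - cof S q k"
 using cof_add[OF _ pf_neg] by (simp add: cof_neg)

lemma cof_var: "pf S p ==> cof S (%t. scl S t (p t)) k = (case k of 0 => 0 | Suc j => cof S p j)"
 using cof_step[of p 0 k] by (simp split: nat.split)

lemma cof_sum:
 "(!!x. x : A ==> pf S (p x)) ==> cof S (%t. SUM x:A. p x t) k = (SUM x:A. cof S (p x) k)"
 by (induction A rule: infinite_finite_induct) (auto simp: cof_add pf_sum)

lemma cof_at_0: "pf S p ==> cof S p 0 = p 0"
 by (induction rule: pf_induct) (auto simp: cof_step)

lemma cof_par: assumes "pf S p" "!!t. p t : par S \<alpha>" shows "cof S p k : par S \<alpha>"
proof -
 have "(%t. hcomp S (1 + \<alpha>) (p t)) = (%_. 0)" using assms(2) by (auto simp: par_iff)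
 hence "hcomp S (1 + \<alpha>) (cof S p k) = 0"
  using cof_lin'[OF assms(1) hcomp_lin, of "1 + \<alpha>" k] by simp
 thus ?thesis by (simp add: par_iff)
qed

text \<open>Multiplication by t raises the degree, whereas \<partial> and c do not, so nothing can
  cancel the leading term. This injectivity later lets preimages inherit identities.\<close>

lemma shifted_der_injective:
 assumes "pf S p" "!!t. der S (p t) + scl S (t + c) (p t) = 0"
 shows "p t = 0"
proof -
 obtain P where P: "pev S P = p" using assms by (auto simp: pf_def)
 have "cof S (%t. der S (p t) + (scl S c (p t) + scl S t (p t))) (Suc k)
   = der S (cof S p (Suc k)) + (scl S c (cof S p (Suc k)) + cof S p k)" for k
  using assms(1) by (simp add: cof_add pf_add pf_scl pf_var pf_lin' lin_der cof_scl cof_lin' cof_var)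
 moreover have "(%t. der S (p t) + (scl S c (p t) + scl S t (p t))) = (%_. 0)"
  using assms(2) by (auto simp: scale_left_distrib add.commute)
 ultimately have "der S (cof S p (Suc k)) + (scl S c (cof S p (Suc k)) + cof S p k) = 0" for k
  by simp
 hence *: "coeff P (Suc k) = 0 ==> coeff P k = 0" for k
  using P lin_0[OF lin_der] by (metis cof_pev add_0 scale_zero_right)
 \<comment> \<open>The implication \<open>*\<close> is used at the degree itself: the coefficient
   just above it is zero.\<close>
 have "lead_coeff P = 0" by (rule *) (simp add: coeff_eq_0)
 thus ?thesis using P by auto
qed

end

section \<open>Cartan calculus for an abstract Lie superalgebra acting on a module\<close>

locale leibniz_calculus =
 fixes X :: "'x set" and p :: "'x => bit" and br :: "'x => 'x => 'x"
  and act :: "'x => 'm::ab_group_add => 'm"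
 assumes br_X: "x : X ==> z : X ==> br x z : X"
  and p_br: "x : X ==> z : X ==> p (br x z) = p x + p z"
  and act_add: "act x (m + n) = act x m + act x n"
  and act_br: "x : X ==> z : X ==>
   act x (act z m) - sm (p x * p z) (act z (act x m)) = act (br x z) m"
begin

text \<open>The opposite parity: it governs the signs of permuting arguments of a cochain, while
  \<open>p\<close> governs those of brackets.\<close>

definition q :: "'x => bit" where "q x = 1 + p x"

abbreviation ins :: "('x list => 'm) => 'x => 'x list => 'm" where
 "ins y x \<equiv> %w. y (x # w)"

text \<open>The Lie derivative, with \<pi> the opposite parity of \<open>y\<close>. The recursion is
  the rule that the commutator of a Lie derivative and an insertion is the insertion of the
  bracket.\<close>

fun Lie :: "bit => 'x => ('x list => 'm) => 'x list => 'm" where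
 "Lie \<pi> x y [] = act x (y [])"
| "Lie \<pi> x y (z # zs) = Lie (\<pi> + q z) x (ins y z) zs - sm (p x * \<pi>) (y (br x z # zs))"

text \<open>The Chevalley-Eilenberg differential. Its recursion is the Cartan formula: inserting x
  into d y gives, up to sign, the Lie derivative along x plus d of the insertion of x. Agreement
  with the double sum over pairs is shown in \<open>dd_explicit\<close>.\<close>

fun dd :: "bit => ('x list => 'm) => 'x list => 'm" where
 "dd \<pi> y [] = 0"
| "dd \<pi> y (x # xs) = sm (q x * (\<pi> + 1) + 1) (Lie \<pi> x y xs) + dd (\<pi> + q x) (ins y x) xs"

text \<open>The only part of multilinearity that the calculus needs.\<close>

definition jac :: "('x list => 'm) => bool" where
 "jac y \<longleftrightarrow> (ALL us:lists X. ALL vs:lists X. ALL x:X. ALL z:X. ALL w:X.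
   y (us @ br x (br z w) # vs) = y (us @ br (br x z) w # vs) + sm (p x * p z) (y (us @ br z (br x w) # vs)))"

lemma jac_ins: "jac y ==> x : X ==> jac (ins y x)"
 unfolding jac_def by (metis append_Cons lists.Cons)

lemma jacD: "jac y ==> vs : lists X ==> x : X ==> z : X ==> w : X ==>
   y (br x (br z w) # vs) = y (br (br x z) w # vs) + sm (p x * p z) (y (br z (br x w) # vs))"
 unfolding jac_def by (metis append_Nil lists.Nil)

lemma act_0: "act x 0 = 0"
 using act_add[of x 0 0] by simp

lemma act_minus: "act x (- m) = - act x m"
 using act_add[of x m "- m"] act_0 by (metis add_eq_0_iff add.right_inverse)

lemma act_sm: "act x (sm b m) = sm b (act x m)"
 by (cases b) (auto simp: act_minus)

lemma Lie_cong:
 "xs : lists X ==> x : X ==> (!!zs. zs : lists X ==> length zs = length xs ==> y zs = y' zs) ==>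
  Lie \<pi> x y xs = Lie \<pi> x y' xs"
proof (induction xs arbitrary: \<pi> y y')
 case (Cons z zs)
 have "Lie (\<pi> + q z) x (ins y z) zs = Lie (\<pi> + q z) x (ins y' z) zs"
  using Cons.prems by (intro Cons.IH) auto
 thus ?case using Cons.prems br_X by auto
qed auto

lemma dd_cong:
 "xs : lists X ==> (!!zs. zs : lists X ==> Suc (length zs) = length xs ==> y zs = y' zs) ==>
  dd \<pi> y xs = dd \<pi> y' xs"
proof (induction xs arbitrary: \<pi> y y')
 case (Cons z zs)
 have "dd (\<pi> + q z) (ins y z) zs = dd (\<pi> + q z) (ins y' z) zs"
  using Cons.prems by (intro Cons.IH) auto
 moreover have "Lie \<pi> z y zs = Lie \<pi> z y' zs"
  using Cons.prems by (intro Lie_cong) auto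
 ultimately show ?case by simp
qed auto

lemma Lie_add: "Lie \<pi> x (%w. y w + y' w) xs = Lie \<pi> x y xs + Lie \<pi> x y' xs"
 by (induction xs arbitrary: \<pi> y y') (auto simp: act_add sm_add)

lemma Lie_sm: "Lie \<pi> x (%w. sm b (y w)) xs = sm b (Lie \<pi> x y xs)"
 by (induction xs arbitrary: \<pi> y) (auto simp: act_sm sm_diff sm_sm add.commute)

lemma Lie_minus: "Lie \<pi> x (%w. - y w) xs = - Lie \<pi> x y xs"
 using Lie_sm[of \<pi> x 1 y xs] by simp

lemma Lie_diff: "Lie \<pi> x (%w. y w - y' w) xs = Lie \<pi> x y xs - Lie \<pi> x y' xs"
 using Lie_add[of \<pi> x y "%w. - y' w"] by (simp add: Lie_minus)

lemma dd_add: "dd \<pi> (%w. y w + y' w) xs = dd \<pi> y xs + dd \<pi> y' xs"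
 by (induction xs arbitrary: \<pi> y y') (auto simp: Lie_add sm_add)

lemma dd_sm: "dd \<pi> (%w. sm b (y w)) xs = sm b (dd \<pi> y xs)"
 by (induction xs arbitrary: \<pi> y) (auto simp: Lie_sm sm_add sm_sm add.commute)

lemma dd_minus: "dd \<pi> (%w. - y w) xs = - dd \<pi> y xs"
 using dd_sm[of \<pi> 1 y xs] by simp

lemma dd_diff: "dd \<pi> (%w. y w - y' w) xs = dd \<pi> y xs - dd \<pi> y' xs"
 using dd_add[of \<pi> y "%w. - y' w"] by (simp add: dd_minus)

lemma dd_0: "dd \<pi> (%w. 0) xs = 0"
 using dd_add[of \<pi> "%_. 0" "%_. 0" xs] by simp

text \<open>Lie derivatives represent the bracket. Without arguments this is \<open>act_br\<close>;
  peeling off an argument leaves nested brackets, which \<open>jac\<close> combines.\<close>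

lemma Lie_Lie:
 "jac y ==> zs : lists X ==> x : X ==> u : X ==>
  Lie (\<pi> + p u) x (Lie \<pi> u y) zs - sm (p x * p u) (Lie (\<pi> + p x) u (Lie \<pi> x y) zs) = Lie \<pi> (br x u) y zs"
proof (induction zs arbitrary: y \<pi>)
 case Nil
 thus ?case by (simp add: act_br)
next
 case (Cons z zs)
 have zs: "zs : lists X" "z : X" using Cons.prems by auto
 have IH: "Lie (\<pi> + q z + p u) x (Lie (\<pi> + q z) u (ins y z)) zs
   = sm (p x * p u) (Lie (\<pi> + q z + p x) u (Lie (\<pi> + q z) x (ins y z)) zs) + Lie (\<pi> + q z) (br x u) (ins y z) zs"
  using Cons.IH[of "ins y z" "\<pi> + q z"] Cons.prems zs jac_ins by (simp add: algebra_simps)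
 have J: "y (br x (br u z) # zs) = y (br (br x u) z # zs) + sm (p x * p u) (y (br u (br x z) # zs))"
  by (rule jacD) (use Cons.prems zs in auto)
 have "q (br x z) = p x + q z" "q (br u z) = p u + q z" "p (br x u) = p x + p u"
  using Cons.prems zs by (auto simp: q_def p_br)
 with IH J show ?case
  by (cases "p x"; cases "p u"; cases \<pi>; cases "p z"; simp add: Lie_diff Lie_add Lie_minus q_def)
qed

text \<open>Peeling off an argument z turns the defect into a commutator of the Lie derivatives
  along x and z, which \<open>Lie_Lie\<close> evaluates.\<close>

lemma dd_Lie:
 "jac y ==> zs : lists X ==> x : X ==>
  dd (\<pi> + p x) (Lie \<pi> x y) zs = sm (p x) (Lie (\<pi> + 1) x (dd \<pi> y) zs)"
proof (induction zs arbitrary: y \<pi>)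
 case Nil
 thus ?case by (simp add: act_0)
next
 case (Cons z zs)
 have zs: "zs : lists X" "z : X" using Cons.prems by auto
 have IH: "dd (\<pi> + q z + p x) (Lie (\<pi> + q z) x (ins y z)) zs = sm (p x) (Lie (\<pi> + q z + 1) x (dd (\<pi> + q z) (ins y z)) zs)"
  using Cons.IH[of "ins y z" "\<pi> + q z"] Cons.prems zs jac_ins by simp
 have LL: "Lie (\<pi> + p z) x (Lie \<pi> z y) zs = Lie \<pi> (br x z) y zs + sm (p x * p z) (Lie (\<pi> + p x) z (Lie \<pi> x y) zs)"
  using Lie_Lie[OF Cons.prems(1) zs(1) Cons.prems(3) zs(2), of \<pi>] by (simp add: algebra_simps)
 have "q (br x z) = p x + q z"
  using Cons.prems zs by (auto simp: q_def p_br)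
 with IH LL show ?case
  by (cases "p x"; cases "p z"; cases \<pi>; simp add: dd_diff dd_add dd_minus Lie_add Lie_diff Lie_minus q_def algebra_simps)
qed

text \<open>Inserting z into d d y and applying the Cartan formula twice leaves two copies of the
  Lie derivative of d y, which cancel by \<open>dd_Lie\<close>, and d d of the shorter
  cochain.\<close>

lemma dd_dd: "jac y ==> zs : lists X ==> dd (\<pi> + 1) (dd \<pi> y) zs = 0"
proof (induction zs arbitrary: y \<pi>)
 case (Cons z zs)
 have zs: "zs : lists X" "z : X" using Cons.prems by auto
 have IH: "dd (\<pi> + q z + 1) (dd (\<pi> + q z) (ins y z)) zs = 0"
  using Cons.IH[of "ins y z" "\<pi> + q z"] Cons.prems zs jac_ins by simp
 have "dd (\<pi> + p z) (Lie \<pi> z y) zs = sm (p z) (Lie (\<pi> + 1) z (dd \<pi> y) zs)"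
  using dd_Lie Cons.prems zs by blast
 with IH show ?case
  by (cases "p z"; cases \<pi>; simp add: dd_diff dd_add dd_minus q_def)
qed auto

end

section \<open>Evaluation of polynomials in several variables\<close>

definition monval :: "(nat \<Rightarrow>\<^sub>0 nat) => (nat => 'f::comm_semiring_1) => 'f" where
 "monval e l = (\<Prod>i\<in>keys e. l i ^ lookup e i)"

lemma monval_bound:
 "finite A ==> keys e \<subseteq> A ==> monval e l = (\<Prod>i\<in>A. l i ^ lookup e i)"
 unfolding monval_def by (rule prod.mono_neutral_left) (auto simp: in_keys_iff)

lemma monval_add: "monval (e + f) l = monval e l * monval f l"
proof -
 let ?A = "keys e \<union> keys f"
 show ?thesis
  by (simp add: monval_bound[of ?A e] monval_bound[of ?A f] monval_bound[of ?A "e + f"]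
    Poly_Mapping.keys_add prod.distrib lookup_add power_add)
qed

lemma monval_0 [simp]: "monval 0 l = 1"
 by (simp add: monval_def)

lemma monval_single: "monval (single i k) l = l i ^ k"
 by (simp add: monval_bound[of "{i}"])

lemma monval_split:
 "monval e l = l i ^ lookup e i * (\<Prod>j\<in>keys e - {i}. l j ^ lookup e j)"
 by (subst monval_bound[of "insert i (keys e)"])
  (auto simp: prod.insert_remove)

lemma monval_minus_single:
 "monval (e - single i 1) l
  = l i ^ (lookup e i - 1) * (\<Prod>j\<in>keys e - {i}. l j ^ lookup e j)"
proof -
 have "keys (e - single i 1) \<subseteq> insert i (keys e)"
  by (auto simp: in_keys_iff lookup_minus)
 hence "monval (e - single i 1) l
   = (\<Prod>j\<in>insert i (keys e). l j ^ lookup (e - single i 1) j)"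
  by (intro monval_bound) auto
 also have "... = l i ^ (lookup e i - 1)
   * (\<Prod>j\<in>keys e - {i}. l j ^ lookup (e - single i 1) j)"
  by (simp add: prod.insert_remove lookup_minus)
 also have "(\<Prod>j\<in>keys e - {i}. l j ^ lookup (e - single i 1) j)
   = (\<Prod>j\<in>keys e - {i}. l j ^ lookup e j)"
  by (rule prod.cong) (auto simp: lookup_minus lookup_single_not_eq)
 finally show ?thesis .
qed

definition evl :: "('f::field_char_0, 'm::ab_group_add, 'z) dspace_scheme => 'm lpoly => (nat => 'f) => 'm" where
 "evl S P l = (SUM e:keys P. scl S (monval e l) (lookup P e))"

text \<open>The derivative at s as the first Taylor coefficient, since only values of the function
  are at hand.\<close>

definition Dv :: "('f::field_char_0, 'm::ab_group_add, 'z) dspace_scheme => ('f => 'm) => 'f => 'm" where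
 "Dv S p s = cof S (%t. p (s + t)) 1"

text \<open>The expressions that occur as values of variables: brackets add variables, and constants
  let fixed values be treated in the same way.\<close>

inductive afn :: "nat set => ((nat => 'f::field_char_0) => 'f) => bool" for J where
 afn_const: "afn J (%_. c)"
| afn_var: "i : J ==> afn J (%l. l i)"
| afn_add: "afn J f ==> afn J g ==> afn J (%l. f l + g l)"

lemma afn_sum: "(!!i. i : A ==> afn J (f i)) ==> afn J (%l. SUM i:A. f i l)"
 by (induction A rule: infinite_finite_induct) (auto intro: afn.intros)

lemma afn_subst: "afn J f ==> (!!i. i : J ==> afn K (\<phi> i)) ==> afn K (%l. f (%i. \<phi> i l))"
 by (induction rule: afn.induct) (auto intro: afn.intros)

context superspace begin

text \<open>\<open>J\<close> limits the variables that may occur. The inductive form makes every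
  closure property an induction; \<open>polyfun_ex_evl\<close> shows that these are the functions of
  actual polynomials.\<close>

inductive polyfun :: "nat set => ((nat => 'f) => 'm) => bool" for J where
 polyfun_const: "polyfun J (%_. m)"
| polyfun_add: "polyfun J f ==> polyfun J g ==> polyfun J (%l. f l + g l)"
| polyfun_var: "i : J ==> polyfun J f ==> polyfun J (%l. scl S (l i) (f l))"

lemma polyfun_lin: assumes "polyfun J f" "lin S S T" shows "polyfun J (%l. T (f l))"
 using assms(1) by induction (auto simp: lin_add[OF assms(2)] lin_scl[OF assms(2)] intro: polyfun.intros)

lemmas polyfun_scl = polyfun_lin[OF _ scl_lin]
lemmas polyfun_sm = polyfun_lin[OF _ sm_lin]

lemma polyfun_neg: "polyfun J f ==> polyfun J (%l. - f l)"
 using polyfun_sm[of J f 1] by simp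

lemma polyfun_diff: "polyfun J f ==> polyfun J g ==> polyfun J (%l. f l - g l)"
 using polyfun_add[OF _ polyfun_neg] by simp

lemma polyfun_sum: "(!!x. x : A ==> polyfun J (f x)) ==> polyfun J (%l. SUM x:A. f x l)"
 by (induction A rule: infinite_finite_induct) (auto intro: polyfun.intros)

lemma polyfun_afn: "afn J \<phi> ==> polyfun J f ==> polyfun J (%l. scl S (\<phi> l) (f l))"
 by (induction rule: afn.induct) (auto simp: scale_left_distrib intro: polyfun_scl polyfun.intros)

lemma polyfun_afn_pow: "afn J \<phi> ==> polyfun J f ==> polyfun J (%l. scl S (\<phi> l ^ k) (f l))"
proof (induction k)
 case (Suc k)
 from polyfun_afn[OF Suc.prems(1) Suc.IH[OF Suc.prems]] show ?case by simp
qed simp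

lemma polyfun_subst:
 assumes "polyfun J f" "!!i. i : J ==> afn K (\<phi> i)" shows "polyfun K (%l. f (%i. \<phi> i l))"
 using assms(1) by induction (auto intro: polyfun.intros polyfun_afn assms(2))

lemma polyfun_cong: "polyfun J f ==> (!!i. i : J ==> l i = l' i) ==> f l = f l'"
 by (induction rule: polyfun.induct) auto

lemma pf_polyfun: assumes "polyfun J f" shows "pf S (%t. f (%i. c i + d i * t))"
 using assms
proof induction
 case (polyfun_var i f)
 have eq: "(%t. scl S (c i + d i * t) (f (%i. c i + d i * t)))
   = (%t. scl S (c i) (f (%i. c i + d i * t)) + scl S (d i) (scl S t (f (%i. c i + d i * t))))"
  by (simp add: scale_left_distrib)
 show ?case unfolding eq by (intro pf_add pf_scl pf_var polyfun_var.IH)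
qed (auto intro: pf_add)

lemma pf_polyfun_upd: assumes "polyfun J f" shows "pf S (%t. f (l(i := t)))"
proof -
 have "l(i := t) = (%j. (if j = i then 0 else l j) + (if j = i then 1 else 0) * t)" for t
  by auto
 thus ?thesis using pf_polyfun[OF assms] by simp
qed

lemma pf_polyfun_case: assumes "polyfun J f" shows "pf S (%t. f (case_nat t l))"
proof -
 have "(%t. f (case_nat t l)) = (%t. f (%j. (case j of 0 => 0 | Suc k => l k) + (case j of 0 => 1 | _ => 0) * t))"
  by (intro ext arg_cong[where f = f]) (auto split: nat.split)
 thus ?thesis using pf_polyfun[OF assms] by (simp only:)
qed

lemma polyfun_pf: "afn J \<phi> ==> pf S p ==> polyfun J (%l. p (\<phi> l))"
proof (rotate_tac, induction rule: pf_induct)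
 case (step m p)
 thus ?case by (auto intro!: polyfun.intros polyfun_afn)
qed (rule polyfun_const)

text \<open>\<open>case_nat t l\<close> places t in variable 0 and shifts the others up, so that
  after extracting a coefficient the remaining variables are numbered from 0 again.\<close>

lemma polyfun_cof:
 assumes "polyfun UNIV f" shows "polyfun UNIV (%l. cof S (%t. f (case_nat t l)) k)"
 using assms
proof (induction arbitrary: k)
 case (polyfun_add f g)
 thus ?case by (simp add: cof_add pf_polyfun_case polyfun.polyfun_add)
next
 case (polyfun_var i f)
 show ?case
 proof (cases i)
  case 0
  thus ?thesis using polyfun_var
   by (cases k) (auto simp: cof_var pf_polyfun_case intro: polyfun.intros)
 next
  case (Suc j)
  thus ?thesis using polyfun_var
   by (auto simp: cof_scl pf_polyfun_case intro: polyfun.intros)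
 qed
qed (simp add: polyfun_const)

lemma evl_bound:
 "finite A ==> keys P \<subseteq> A ==> evl S P l = (SUM e:A. scl S (monval e l) (lookup P e))"
 unfolding evl_def by (rule sum.mono_neutral_left) (auto simp: in_keys_iff)

lemma evl_add: "evl S (P + Q) l = evl S P l + evl S Q l"
proof -
 let ?A = "keys P \<union> keys Q"
 show ?thesis
  by (simp add: evl_bound[of ?A P] evl_bound[of ?A Q] evl_bound[of ?A "P + Q"]
    Poly_Mapping.keys_add sum.distrib lookup_add scale_right_distrib)
qed

lemma evl_0 [simp]: "evl S 0 l = 0"
 by (simp add: evl_def)

lemma evl_sum: "evl S (sum f A) l = (SUM x:A. evl S (f x) l)"
 by (induction A rule: infinite_finite_induct) (auto simp: evl_add)

lemma evl_minus: "evl S (- P) l = - evl S P l"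
 using evl_add[of P "- P" l] by (simp add: eq_neg_iff_add_eq_0 add.commute)

lemma evl_diff: "evl S (P - Q) l = evl S P l - evl S Q l"
 using evl_add[of P "- Q" l] by (simp add: evl_minus)

lemma evl_single: "evl S (single e m) l = scl S (monval e l) m"
 by (simp add: evl_bound[of "{e}"])

lemma evl_const [simp]: "evl S (const m) l = m"
 by (simp add: const_def evl_single)

lemma evl_map: assumes "lin S S T" shows "evl S (Poly_Mapping.map T P) l = T (evl S P l)"
proof -
 have lk: "lookup (Poly_Mapping.map T P) e = T (lookup P e)" for e
  using lin_0[OF assms] by (simp add: Poly_Mapping.map.rep_eq when_def)
 hence "keys (Poly_Mapping.map T P) \<subseteq> keys P"
  using lin_0[OF assms] by (auto simp: in_keys_iff)
 thus ?thesis
  by (subst evl_bound[of "keys P"])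
   (auto simp: lk evl_def lin_sum[OF assms] lin_scl[OF assms])
qed

lemma evl_lmonom: "evl S (lmonom e P) l = scl S (monval e l) (evl S P l)"
 by (simp add: lmonom_def evl_sum evl_single monval_add) (simp add: evl_def scale_sum_right)

lemma evl_lam: "evl S (lam i P) l = scl S (l i) (evl S P l)"
 by (simp add: lam_def evl_lmonom monval_single)

lemma evl_funpow:
 "(!!Q. evl S (T Q) l = scl S c (evl S Q l)) ==> evl S ((T ^^ k) Q) l = scl S (c ^ k) (evl S Q l)"
 by (induction k) auto

lemma evl_psubst:
 assumes "!!Q. evl S (T Q) l = scl S c (evl S Q l)"
 shows "evl S (psubst T p) l = pev S p c"
 by (simp add: psubst_def evl_sum evl_funpow[OF assms] pev_def)

lemma evl_lact:
 assumes "!!Q. evl S (T Q) l = scl S c (evl S Q l)" "lin S S (%m. pev S (A a m) c)"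
 shows "evl S (lact A T a P) l = pev S (A a (evl S P l)) c"
 by (simp add: lact_def evl_sum evl_lmonom evl_psubst[OF assms(1)])
  (simp add: evl_def lin_sum[OF assms(2)] lin_scl[OF assms(2)])

lemma evl_lsubst:
 assumes "!!j Q. j < length Ts ==> evl S ((Ts ! j) Q) l = scl S (c j) (evl S Q l)"
  "!!e. e : keys P ==> keys e \<subseteq> {..<length Ts}"
 shows "evl S (lsubst Ts P) l = evl S P c"
proof -
 have *: "set js \<subseteq> {..<length Ts} ==> distinct js ==>
   evl S (foldr (%j. (Ts ! j) ^^ lookup e j) js Q) l
    = scl S (\<Prod>j\<in>set js. c j ^ lookup e j) (evl S Q l)" for js e Q
  by (induction js) (auto simp: evl_funpow[OF assms(1)])
 have "evl S (lsubst Ts P) l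
   = (SUM e:keys P. scl S (\<Prod>j\<in>{..<length Ts}. c j ^ lookup e j) (lookup P e))"
  by (simp add: lsubst_def evl_sum * atLeast0LessThan)
 thus ?thesis
  using assms(2) by (simp add: evl_def monval_bound[of "{..<length Ts}"])
qed

lemma evl_upd:
 "evl S P (l(i := t)) = (SUM e:keys P. scl S (t ^ lookup e i)
   (scl S (\<Prod>j\<in>keys e - {i}. l j ^ lookup e j) (lookup P e)))"
 unfolding evl_def by (rule sum.cong) (auto simp: monval_split[of _ _ i])

lemma pf_pow: "pf S (%t. scl S (t ^ k) m)"
proof (induction k)
 case (Suc k)
 thus ?case using pf_var[OF Suc.IH] by simp
qed simp

lemma Dv_0 [simp]: "Dv S (%_. 0) s = 0"
 by (simp add: Dv_def)

lemma Dv_step: "pf S p ==> Dv S (%t. m + scl S t (p t)) s = p s + scl S s (Dv S p s)"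
proof -
 assume p: "pf S p"
 have "(%t. m + scl S (s + t) (p (s + t))) = (%t. (m + scl S s (p (s + t))) + scl S t (p (s + t)))"
  by (simp add: scale_left_distrib add.assoc)
 thus ?thesis
  unfolding Dv_def using pf_shift[OF p, of s]
  by (simp add: cof_add cof_scl cof_var pf_add pf_scl pf_var cof_const cof_at_0)
qed

lemma Dv_add: "pf S p ==> pf S p' ==> Dv S (%t. p t + p' t) s = Dv S p s + Dv S p' s"
 by (simp add: Dv_def cof_add pf_shift)

lemma Dv_sum: "(!!x. x : A ==> pf S (p x)) ==> Dv S (%t. SUM x:A. p x t) s = (SUM x:A. Dv S (p x) s)"
 by (simp add: Dv_def cof_sum pf_shift)

lemma Dv_pow: "Dv S (%t. scl S (t ^ k) m) s = scl S (of_nat k * s ^ (k - 1)) m"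
proof (induction k)
 case 0
 show ?case by (simp add: Dv_def cof_const)
next
 case (Suc k)
 have "Dv S (%t. scl S (t ^ Suc k) m) s = Dv S (%t. 0 + scl S t (scl S (t ^ k) m)) s"
  by simp
 also have "... = scl S (s ^ k) m + scl S s (scl S (of_nat k * s ^ (k - 1)) m)"
  by (subst Dv_step[OF pf_pow]) (simp only: Suc.IH)
 also have "... = scl S (of_nat (Suc k) * s ^ (Suc k - 1)) m"
  by (cases k) (simp_all add: algebra_simps flip: scale_left_distrib)
 finally show ?case .
qed

lemma pf_Dv: "pf S p ==> pf S (Dv S p)"
proof (induction rule: pf_induct)
 case zero
 have "Dv S (%_. 0) = (%_. 0)" by auto
 thus ?case by simp
next
 case (step m p)
 have "Dv S (%t. m + scl S t (p t)) = (%s. p s + scl S s (Dv S p s))" using step Dv_step by auto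
 thus ?case using step by (auto intro: pf_add pf_var)
qed

lemma evl_lder: "evl S (lder S i P) l = Dv S (%t. evl S P (l(i := t))) (l i)"
 by (simp add: lder_def evl_upd Dv_sum pf_pow Dv_pow evl_sum evl_single monval_minus_single mult_ac del: One_nat_def scale_scale)
  (simp add: mult_ac)

lemma pf_evl: "pf S (%t. evl S P (l(i := t)))"
 by (simp add: evl_upd pf_sum pf_pow del: scale_scale)

lemma evl_lder_pow: "evl S ((lder S i ^^ k) P) l = (Dv S ^^ k) (%t. evl S P (l(i := t))) (l i)"
proof (induction k arbitrary: l)
 case (Suc k)
 have "(%t. evl S ((lder S i ^^ k) P) (l(i := t))) = (Dv S ^^ k) (%t. evl S P (l(i := t)))"
  by (rule ext, subst Suc.IH, simp only: fun_upd_upd fun_upd_same)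
 thus ?case unfolding funpow.simps o_apply evl_lder by simp
qed simp

text \<open>Each derivative lowers the exponent of variable i. This is what makes the sum over all k
  in \<open>exp_der\<close> finite.\<close>

lemma lder_pow_eq_0: "EX N. ALL k>=N. (lder S i ^^ k) P = 0"
proof -
 define B where "B n P \<longleftrightarrow> (ALL e:keys P. lookup e i < n)" for n and P :: "'m lpoly"
 have keys: "e : keys (lder S i P) ==>
   EX e':keys P. e = e' - single i 1 & lookup e' i ~= 0" for e P
 proof -
  assume "e : keys (lder S i P)"
  hence "e : (\<Union>e'\<in>keys P. keys (single (e' - single i 1)
    (scl S (of_nat (lookup e' i)) (lookup P e'))))"
   unfolding lder_def by (rule subsetD[OF Poly_Mapping.keys_sum])
  thus ?thesis by (auto split: if_splits)
 qed
 have step: "B n (lder S i P)" if "B (Suc n) P" for n P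
  unfolding B_def
 proof
  fix e assume "e : keys (lder S i P)"
  from keys[OF this] obtain e' where "e' : keys P" "e = e' - single i 1"
   "lookup e' i ~= 0" by blast
  thus "lookup e i < n" using that by (auto simp: B_def lookup_minus)
 qed
 have B: "B n P ==> (lder S i ^^ n) P = 0" for n P
 proof (induction n arbitrary: P)
  case 0
  thus ?case by (auto simp: B_def)
 next
  case (Suc n)
  thus ?case using step by (simp only: funpow_Suc_right o_apply)
 qed
 have "B (Suc (Max ((%e. lookup e i) ` keys P))) P"
  unfolding B_def by (auto simp: less_Suc_eq_le intro: Max_ge)
 moreover have "B n P ==> n \<le> k ==> B k P" for n k unfolding B_def by fastforce
 ultimately show ?thesis using B by blast
qed

text \<open>One variable of \<open>J\<close> is split off at a time by comparing coefficients. Since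
  exponents may differ outside \<open>J\<close>, the conclusion is about the sum of all terms that
  agree with \<kappa> on \<open>J\<close>.\<close>

lemma evl_coeff_eq_0:
 assumes "finite J" "finite A" "!!l. (SUM e:A. scl S (\<Prod>i\<in>J. l i ^ lookup e i) (c e)) = 0"
 shows "(SUM e:{e\<in>A. ALL i:J. lookup e i = \<kappa> i}. c e) = 0"
 using assms
proof (induction J arbitrary: A)
 case empty
 thus ?case by simp
next
 case (insert j J)
 define h where "h l e = scl S (\<Prod>i\<in>J. l i ^ lookup e i) (c e)" for l e
 have cong: "h (l(j := t)) e = h l e" for l t e
  unfolding h_def by (intro arg_cong2[where f = "scl S"] prod.cong) (use insert.hyps in auto)
 \<comment> \<open>The factors \<open>h l e\<close> do not involve variable j, so this is a
   polynomial identity in t alone.\<close>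
 have z: "(SUM e:A. scl S (t ^ lookup e j) (h l e)) = 0" for l t
 proof -
  have "(SUM e:A. scl S (t ^ lookup e j) (h (l(j := t)) e)) = 0"
   using insert.prems(2)[of "l(j := t)"] insert.hyps by (simp add: h_def)
  thus ?thesis by (simp add: cong)
 qed
 define N where "N = Max ((%e. lookup e j) ` A)"
 have N: "e : A ==> lookup e j \<le> N" for e
  unfolding N_def using insert.prems(1) by (intro Max_ge) auto
 have "(SUM e:{e\<in>A. lookup e j = k}. h l e) = 0" for l k
 proof -
  have ck: "cof S (%t. scl S (t ^ n) m) k = (if k = n then m else 0)" for n m
  proof (induction n arbitrary: k)
   case (Suc n)
   thus ?case using cof_var[OF pf_pow, of n m k] by (auto split: nat.split)
  qed (simp add: cof_const)
  have "0 = cof S (%t. SUM e:A. scl S (t ^ lookup e j) (h l e)) k"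
   by (simp add: z)
  also have "... = (SUM e:A. if k = lookup e j then h l e else 0)"
   by (simp add: cof_sum pf_pow ck)
  also have "... = (SUM e:{e\<in>A. lookup e j = k}. h l e)"
   using insert.prems(1) by (subst sum.inter_filter) (auto intro: sum.cong)
  finally show ?thesis by simp
 qed
 hence "(SUM e:{e\<in>{e\<in>A. lookup e j = \<kappa> j}. ALL i:J. lookup e i = \<kappa> i}. c e) = 0"
  using insert.prems(1) by (intro insert.IH) (auto simp: h_def)
 moreover have "{e\<in>{e\<in>A. lookup e j = \<kappa> j}. ALL i:J. lookup e i = \<kappa> i}
   = {e\<in>A. ALL i:insert j J. lookup e i = \<kappa> i}" by auto
 ultimately show ?case by simp
qed

text \<open>When \<open>J\<close> contains all variables that occur, an exponent is determined by
  its restriction to \<open>J\<close>, and the sum in \<open>evl_coeff_eq_0\<close> has the single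
  term at \<open>e0\<close>.\<close>

lemma evl_eq_0: assumes "!!l. evl S P l = 0" shows "P = 0"
proof (rule poly_mapping_eqI)
 fix e0
 let ?A = "insert e0 (keys P)"
 let ?J = "\<Union>e\<in>?A. keys e"
 have "(SUM e:{e\<in>?A. ALL i:?J. lookup e i = lookup e0 i}. lookup P e) = 0"
 proof (rule evl_coeff_eq_0)
  fix l
  have "(SUM e:?A. scl S (\<Prod>i\<in>?J. l i ^ lookup e i) (lookup P e)) = evl S P l"
  proof -
   have "monval e l = (\<Prod>i\<in>?J. l i ^ lookup e i)" if "e : ?A" for e
    using that by (intro monval_bound) auto
   thus ?thesis by (subst evl_bound[of ?A]) (auto intro!: sum.cong)
  qed
  thus "(SUM e:?A. scl S (\<Prod>i\<in>?J. l i ^ lookup e i) (lookup P e)) = 0"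
   using assms by simp
 qed auto
 moreover have "{e\<in>?A. ALL i:?J. lookup e i = lookup e0 i} = {e0}"
 proof -
  have "e = e0" if "e : ?A" "ALL i:?J. lookup e i = lookup e0 i" for e
  proof (rule poly_mapping_eqI)
   fix i show "lookup e i = lookup e0 i"
    using that by (cases "i : ?J") (auto simp: in_keys_iff)
  qed
  thus ?thesis by blast
 qed
 ultimately show "lookup P e0 = lookup 0 e0" by simp
qed

lemma evl_inj: "evl S P = evl S Q ==> P = Q"
 using evl_eq_0[of "P - Q"] by (simp add: evl_diff)

abbreviation lcar :: "nat => 'm lpoly set" where
 "lcar n \<equiv> {P. ALL e:keys P. keys e \<subseteq> {..<n}}"

lemma polyfun_evl: assumes "P : lcar n" shows "polyfun {..<n} (evl S P)"
proof -
 have pw: "polyfun {..<n} (%l. scl S (\<Prod>i\<in>A. l i ^ k i) m)" if "A \<subseteq> {..<n}" for A and k :: "nat => nat" and m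
  using finite_subset[OF that finite_lessThan] that
 proof (induction A rule: finite_induct)
  case (insert i A)
  hence "polyfun {..<n} (%l. scl S (l i ^ k i) (scl S (\<Prod>i\<in>A. l i ^ k i) m))"
   by (intro polyfun_afn_pow) (auto intro: afn_var)
  thus ?case using insert by simp
 qed (auto intro: polyfun.intros)
 have "polyfun {..<n} (%l. SUM e:keys P. scl S (monval e l) (lookup P e))"
  unfolding monval_def using assms by (intro polyfun_sum pw) auto
 thus ?thesis unfolding evl_def .
qed

lemma lcar_add: "P : lcar n ==> Q : lcar n ==> P + Q : lcar n"
 using Poly_Mapping.keys_add[of P Q] by blast

lemma lcar_lam: "P : lcar n ==> i < n ==> lam i P : lcar n"
proof (intro CollectI ballI)
 fix e assume P: "P : lcar n" "i < n" and "e : keys (lam i P)"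
 hence "e : (\<Union>f\<in>keys P. keys (single (single i 1 + f) (lookup P f)))"
  unfolding lam_def lmonom_def by (intro subsetD[OF Poly_Mapping.keys_sum]) simp
 then obtain f where "f : keys P" "e = single i 1 + f"
  by (auto split: if_splits)
 thus "keys e \<subseteq> {..<n}"
  using P Poly_Mapping.keys_add[of "single i 1" f] by fastforce
qed

lemma polyfun_ex_evl: "polyfun {..<n} f ==> EX P:lcar n. evl S P = f"
proof (induction rule: polyfun.induct)
 case (polyfun_const m)
 show ?case by (rule bexI[of _ "const m"]) (auto simp: const_def evl_single split: if_splits)
next
 case (polyfun_add f g)
 then obtain P Q where "P : lcar n" "Q : lcar n" "evl S P = f" "evl S Q = g" by blast
 moreover from this have "evl S (P + Q) = (%l. f l + g l)" by (auto simp: evl_add)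
 ultimately show ?case using lcar_add by blast
next
 case (polyfun_var i f)
 then obtain P where "P : lcar n" "evl S P = f" by blast
 moreover from this have "evl S (lam i P) = (%l. scl S (l i) (f l))" by (auto simp: evl_lam)
 ultimately show ?case using polyfun_var.hyps(1) lcar_lam by blast
qed

end

section \<open>The axioms of a Poisson vertex superalgebra and its module at scalar values of the
  variables\<close>

lemma lca_action_facts:
 fixes R :: "('f::field_char_0, 'v::ab_group_add) pva" and S :: "('f, 'm::ab_group_add, 'z) dspace_scheme"
 assumes "superspace R" "superspace S" "lca_action R S A"
 shows lca_lin1: "lin R S (%a. pev S (A a m) t)"
  and lca_lin2: "lin S S (%m. pev S (A a m) t)"
  and lca_par: "a : par R \<alpha> ==> m : par S \<beta> ==> pev S (A a m) t : par S (\<alpha> + \<beta>)"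
  and lca_sesq1: "pev S (A (der R a) m) t = - scl S t (pev S (A a m) t)"
  and lca_sesq2: "pev S (A a (der S m)) t = scl S t (pev S (A a m) t) + der S (pev S (A a m) t)"
  and lca_jacobi: "a : par R \<alpha> ==> b : par R \<beta> ==>
   pev S (A a (pev S (A b m) t)) s - sm (\<alpha> * \<beta>) (pev S (A b (pev S (A a m) s)) t)
    = pev S (A (pev R (lbr R a b) s) m) (s + t)"
proof -
 interpret R: superspace R by fact
 interpret S: superspace S by fact
 have l1: "lin R S (%a. coeff (A a m) k)" and l2: "lin S S (%m. coeff (A a m) k)" for a m k
  using assms(3) by (auto simp: lca_action_def lin_linear)
 have A1: "A (a + b) m = A a m + A b m" "A (scl R c a) m = map_poly (scl S c) (A a m)" for a b c m
  by (auto simp: poly_eq_iff lin_add[OF l1] lin_scl[OF l1] coeff_map_poly)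
 have A2: "A a (m + n) = A a m + A a n" "A a (scl S c m) = map_poly (scl S c) (A a m)" for a m n c
  by (auto simp: poly_eq_iff lin_add[OF l2] lin_scl[OF l2] coeff_map_poly)
 show lin1: "lin R S (%a. pev S (A a m) t)" for m t
  by (rule linI) (auto simp: A1 S.pev_add S.pev_map[OF S.scl_lin assms(2)])
 show lin2: "lin S S (%m. pev S (A a m) t)" for a t
  by (rule linI) (auto simp: A2 S.pev_add S.pev_map[OF S.scl_lin assms(2)])
 show "a : par R \<alpha> ==> m : par S \<beta> ==> pev S (A a m) t : par S (\<alpha> + \<beta>)"
  using assms(3) by (auto simp: lca_action_def pev_def intro!: S.par_sum S.par_scl)
 show "pev S (A (der R a) m) t = - scl S t (pev S (A a m) t)"
  using assms(3) by (auto simp: lca_action_def S.pev_minus S.pev_pCons)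
 show "pev S (A a (der S m)) t = scl S t (pev S (A a m) t) + der S (pev S (A a m) t)"
  using assms(3) by (auto simp: lca_action_def S.pev_add S.pev_pCons S.pev_map[OF S.lin_der assms(2)])
 assume ab: "a : par R \<alpha>" "b : par R \<beta>"
 \<comment> \<open>The Jacobi identity is stated for \<lambda>_0 and \<lambda>_1; they receive the
   values s and t.\<close>
 let ?l = "%i::nat. if i = 0 then s else t"
 have v0: "evl S (lam 0 Q) ?l = scl S s (evl S Q ?l)" and v1: "evl S (lam 1 Q) ?l = scl S t (evl S Q ?l)" for Q
  by (auto simp: S.evl_lam)
 have v01: "evl S (lam 0 Q + lam 1 Q) ?l = scl S (s + t) (evl S Q ?l)" for Q
  by (simp only: S.evl_add v0 v1 S.scale_left_distrib)
 have "lact A (lam 0) a (psubst (lam 1) (A b m))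
    - Poly_Mapping.map (scl S (sg (\<alpha> * \<beta>))) (lact A (lam 1) b (psubst (lam 0) (A a m)))
    = (SUM k<=degree (lbr R a b).
       (lam 0 ^^ k) (psubst (%P. lam 0 P + lam 1 P) (A (coeff (lbr R a b) k) m)))"
  using assms(3) ab unfolding lca_action_def by blast
 from arg_cong[OF this, of "%P. evl S P ?l"]
 have "pev S (A a (pev S (A b m) t)) s - sm (\<alpha> * \<beta>) (pev S (A b (pev S (A a m) s)) t)
   = (SUM k<=degree (lbr R a b). scl S (s ^ k) (pev S (A (coeff (lbr R a b) k) m) (s + t)))"
  by (simp only: S.evl_diff S.evl_map[OF S.scl_lin] S.sg_sm S.evl_lact[where T = "lam 0" and c = s, OF v0 lin2] S.evl_lact[where T = "lam 1" and c = t, OF v1 lin2]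
    S.evl_psubst[where T = "lam 0" and c = s, OF v0] S.evl_psubst[where T = "lam 1" and c = t, OF v1] S.evl_sum S.evl_funpow[OF v0] S.evl_psubst[where c = "s + t", OF v01])
 also have "... = pev S (A (pev R (lbr R a b) s) m) (s + t)"
  by (simp add: pev_def[of R] lin_sum[OF lin1] lin_scl[OF lin1])
 finally show "pev S (A a (pev S (A b m) t)) s - sm (\<alpha> * \<beta>) (pev S (A b (pev S (A a m) s)) t)
    = pev S (A (pev R (lbr R a b) s) m) (s + t)" .
qed

locale pvm =
 fixes V :: "('f::field_char_0, 'v::ring_1) pva" and L :: 'v
  and M :: "('v, 'f, 'm::ab_group_add) pva_mod"
 assumes conformal_pva: "conformal_pva V L" and conformal_module: "conformal_module V L M"
begin

lemma poisson: "poisson_vertex V" and pva_module: "pva_module V M"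
 using conformal_pva conformal_module by (auto simp: conformal_pva_def conformal_module_def)

lemma superalgebra: "diff_superalgebra V" and lie_conformal: "lie_conformal V"
 using poisson by (auto simp: poisson_vertex_def)

sublocale V: superspace V
proof
 show "diff_superspace V" using lie_conformal unfolding lie_conformal_def by blast
qed

sublocale M: superspace M
proof
 show "diff_superspace M" using pva_module unfolding pva_module_def by blast
qed

definition ac :: "'v => 'f => 'm => 'm" where "ac a t m = pev M (vact M a m) t"
definition bk :: "'v => 'f => 'v => 'v" where "bk a t b = pev V (lbr V a b) t"

lemma lcaM: "lca_action V M (vact M)" and lcaV: "lca_action V V (lbr V)"
proof -
 show "lca_action V M (vact M)" using pva_module unfolding pva_module_def by blast
 show "lca_action V V (lbr V)" using lie_conformal unfolding lie_conformal_def by blast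
qed

lemma ac_lin1: "lin V M (%a. ac a t m)" and ac_lin2: "lin M M (ac a t)"
 and ac_par: "a : par V \<alpha> ==> m : par M \<beta> ==> ac a t m : par M (\<alpha> + \<beta>)"
 and ac_sesq1: "ac (der V a) t m = - scl M t (ac a t m)"
 and ac_sesq2: "ac a t (der M m) = scl M t (ac a t m) + der M (ac a t m)"
 and ac_bk: "a : par V \<alpha> ==> b : par V \<beta> ==>
  ac a s (ac b t m) - sm (\<alpha> * \<beta>) (ac b t (ac a s m)) = ac (bk a s b) (s + t) m"
 unfolding ac_def[abs_def] bk_def
 by (fact lca_action_facts[OF V.superspace_axioms M.superspace_axioms lcaM])+

lemma bk_lin1: "lin V V (%a. bk a t b)" and bk_lin2: "lin V V (bk a t)"
 and bk_par: "a : par V \<alpha> ==> b : par V \<beta> ==> bk a t b : par V (\<alpha> + \<beta>)"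
 and bk_sesq1: "bk (der V a) t b = - scl V t (bk a t b)"
 and bk_sesq2: "bk a t (der V b) = scl V t (bk a t b) + der V (bk a t b)"
 and bk_bk: "a : par V \<alpha> ==> b : par V \<beta> ==>
  bk a s (bk b t c) - sm (\<alpha> * \<beta>) (bk b t (bk a s c)) = bk (bk a s b) (s + t) c"
 unfolding bk_def[abs_def]
 by (fact lca_action_facts[OF V.superspace_axioms V.superspace_axioms lcaV])+

lemma mult_scl: "scl V c a * b = scl V c (a * b)" "a * scl V c b = scl V c (a * b)"
 and mult_par: "a : par V \<alpha> ==> b : par V \<beta> ==> a * b : par V (\<alpha> + \<beta>)"
 and mult_comm: "a : par V \<alpha> ==> b : par V \<beta> ==> a * b = sm (\<alpha> * \<beta>) (b * a)"
 and der_mult: "der V (a * b) = der V a * b + a * der V b"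
 and one_par: "1 : par V 0"
proof -
 note sa = superalgebra[unfolded diff_superalgebra_def]
 have "ALL c a b. scl V c (a * b) = scl V c a * b & scl V c (a * b) = a * scl V c b" using sa by blast
 thus "scl V c a * b = scl V c (a * b)" "a * scl V c b = scl V c (a * b)" by metis+
 show "a : par V \<alpha> ==> b : par V \<beta> ==> a * b : par V (\<alpha> + \<beta>)" using sa by blast
 have "ALL \<alpha> \<beta>. ALL a:par V \<alpha>. ALL b:par V \<beta>. a * b = scl V (sg (\<alpha> * \<beta>)) (b * a)" using sa by blast
 thus "a : par V \<alpha> ==> b : par V \<beta> ==> a * b = sm (\<alpha> * \<beta>) (b * a)" unfolding V.sg_sm by blast
 show "der V (a * b) = der V a * b + a * der V b" "1 : par V 0" using sa by blast+
qed

lemma mult_linl: "lin V V (%a. a * b)" and mult_linr: "lin V V (%b. a * b)"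
 by (auto intro!: linI simp: algebra_simps mult_scl)

lemma bk_mult:
 assumes "b : par V \<beta>" "c : par V \<gamma>"
 shows "bk a t (b * c) = bk a t b * c + sm (\<beta> * \<gamma>) (bk a t c * b)"
proof -
 have "lbr V a (b * c) = map_poly (%x. x * c) (lbr V a b)
     + map_poly (%x. scl V (sg (\<beta> * \<gamma>)) (x * b)) (lbr V a c)"
  using poisson assms unfolding poisson_vertex_def by blast
 moreover have "lin V V (%x. scl V (sg (\<beta> * \<gamma>)) (x * b))"
  using V.sm_lin mult_linl by (auto simp: lin_def V.sg_sm)
 ultimately show ?thesis
  by (simp add: bk_def V.pev_add V.pev_map[OF mult_linl V.superspace_axioms] V.pev_map[OF _ V.superspace_axioms] V.sg_sm)
qed

lemma vm_lin1: "lin V M (%a. vmul M a m)" and vm_lin2: "lin M M (vmul M a)"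
 and vm_par: "a : par V \<alpha> ==> m : par M \<beta> ==> vmul M a m : par M (\<alpha> + \<beta>)"
 and vm_mult: "vmul M (a * b) m = vmul M a (vmul M b m)"
 and vm_one: "vmul M 1 m = m"
 and vm_der: "der M (vmul M a m) = vmul M (der V a) m + vmul M a (der M m)"
proof -
 note pm = pva_module[unfolded pva_module_def]
 show "lin V M (%a. vmul M a m)" by (rule lin_linear[OF spec[OF conjunct1[OF conjunct2[OF pm]]]])
 show "lin M M (vmul M a)" by (rule lin_linear[OF spec[OF conjunct1[OF conjunct2[OF conjunct2[OF pm]]]]])
 show "a : par V \<alpha> ==> m : par M \<beta> ==> vmul M a m : par M (\<alpha> + \<beta>)" using pm by blast
 show "vmul M (a * b) m = vmul M a (vmul M b m)" "vmul M 1 m = m"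
  "der M (vmul M a m) = vmul M (der V a) m + vmul M a (der M m)" using pm by blast+
qed

lemma ac_vmul:
 assumes "a : par V \<alpha>" "b : par V \<beta>"
 shows "ac a t (vmul M b m) = vmul M (bk a t b) m + sm (\<alpha> * \<beta>) (vmul M b (ac a t m))"
proof -
 have "vact M a (vmul M b m) = map_poly (%x. vmul M x m) (lbr V a b)
     + map_poly (%x. scl M (sg (\<alpha> * \<beta>)) (vmul M b x)) (vact M a m)"
  using pva_module assms unfolding pva_module_def by blast
 moreover have "lin M M (%x. scl M (sg (\<alpha> * \<beta>)) (vmul M b x))"
  using vm_lin2[of b] by (auto simp: lin_def M.sg_sm sm_add M.scl_sm)
 ultimately show ?thesis
  by (simp add: ac_def bk_def M.pev_add V.pev_map[OF vm_lin1 M.superspace_axioms] M.pev_map[OF _ M.superspace_axioms] M.sg_sm)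
qed

text \<open>Skew-symmetry substitutes - \<lambda> - \<partial> for the variable, which is not a
  scalar. Under a map on which \<partial> acts as -(s + t), it becomes -s + (s + t) = t. This is the
  situation in a sesquilinear slot holding a bracket.\<close>

lemma skew_through:
 assumes "lin V M \<Phi>" "!!a. \<Phi> (der V a) = - scl M (s + t) (\<Phi> a)" "a : par V \<alpha>" "b : par V \<beta>"
 shows "\<Phi> (bk a s b) = - sm (\<alpha> * \<beta>) (\<Phi> (bk b t a))"
proof -
 let ?op = "%p. - pCons 0 p - map_poly (der V) p"
 have op: "\<Phi> (pev V (?op p) s) = scl M t (\<Phi> (pev V p s))" for p
  using V.pev_add[of "- pCons 0 p" "- map_poly (der V) p" s]
  by (simp add: V.pev_minus V.pev_pCons V.pev_map[OF V.lin_der V.superspace_axioms]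
    lin_diff[OF assms(1)] lin_minus[OF assms(1)] lin_scl[OF assms(1)] assms(2) M.scale_left_distrib)
 have opk: "\<Phi> (pev V ((?op ^^ k) p) s) = scl M (t ^ k) (\<Phi> (pev V p s))" for k p
 proof (induction k)
  case (Suc k)
  have "\<Phi> (pev V ((?op ^^ Suc k) p) s) = \<Phi> (pev V (?op ((?op ^^ k) p)) s)" by simp
  thus ?case by (simp only: op Suc.IH M.scale_scale power_Suc)
 qed simp
 have "lbr V a b = - map_poly (scl V (sg (\<alpha> * \<beta>)))
     (SUM k<=degree (lbr V b a). (?op ^^ k) [:coeff (lbr V b a) k:])"
  using lie_conformal assms(3,4) unfolding lie_conformal_def by blast
 hence e: "bk a s b = - sm (\<alpha> * \<beta>) (pev V (SUM k<=degree (lbr V b a). (?op ^^ k) [:coeff (lbr V b a) k:]) s)"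
  by (simp only: bk_def V.pev_minus V.pev_map[OF V.scl_lin V.superspace_axioms] V.sg_sm)
 have "pev V (sum f A) s = (SUM x:A. pev V (f x) s)" for f and A :: "nat set"
  by (induction A rule: infinite_finite_induct) (auto simp: V.pev_add)
 hence "\<Phi> (bk a s b) = - sm (\<alpha> * \<beta>) (SUM k<=degree (lbr V b a). \<Phi> (pev V ((?op ^^ k) [:coeff (lbr V b a) k:]) s))"
  by (simp only: e lin_minus[OF assms(1)] lin_sm[OF assms(1)] lin_sum[OF assms(1)])
 also have "... = - sm (\<alpha> * \<beta>) (SUM k<=degree (lbr V b a). scl M (t ^ k) (\<Phi> (coeff (lbr V b a) k)))"
  by (simp only: opk V.pev_pCons) simp
 also have "... = - sm (\<alpha> * \<beta>) (\<Phi> (bk b t a))"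
  by (simp add: bk_def pev_def lin_sum[OF assms(1)] lin_scl[OF assms(1)])
 finally show ?thesis .
qed

section \<open>The exponential operator of the Leibniz rules; Horner's scheme avoids its
  factorials\<close>

fun emul :: "'v => (nat => 'm) => nat => 'f => 'm" where
 "emul b c 0 t = 0"
| "emul b c (Suc N) t = vmul M b (c 0) + scl M t (emul b (%k. c (Suc k)) N t) + emul (der V b) (%k. c (Suc k)) N t"

text \<open>\<open>exm b p\<close> is \<open>(e\<^bsup>\<partial>\<partial>\<^sub>\<lambda>\<^esup> b) p(\<lambda>)\<close> for a polynomial function \<open>p\<close>. It is determined by additivity in \<open>p\<close>,
  \<open>exm b m = b m\<close> and \<open>exm b (\<lambda> p) = \<lambda> exm b p + exm (\<partial> b) p\<close>.\<close>

definition exm :: "'v => ('f => 'm) => 'f => 'm" where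
 "exm b p t = (let P = (THE P. pev M P = p) in emul b (coeff P) (Suc (degree P)) t)"

lemma emul_bound: "(!!k. N \<le> k ==> c k = 0) ==> N \<le> N' ==> emul b c N' t = emul b c N t"
proof (induction N' arbitrary: b c N)
 case (Suc N')
 show ?case
 proof (cases N)
  case 0
  hence "emul b' (%k. c (Suc k)) N' t = 0" for b' using Suc.IH[of 0 "%k. c (Suc k)" b'] Suc.prems by simp
  thus ?thesis using 0 Suc.prems by (simp add: lin_0[OF vm_lin2])
 next
  case (Suc n)
  hence "emul b' (%k. c (Suc k)) N' t = emul b' (%k. c (Suc k)) n t" for b'
   using Suc.IH[of n "%k. c (Suc k)" b'] Suc.prems by simp
  thus ?thesis using Suc by simp
 qed
qed auto

lemma exm_pev: "degree P < N ==> exm b (pev M P) t = emul b (coeff P) N t"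
proof -
 assume N: "degree P < N"
 have "(THE Q. pev M Q = pev M P) = P" by (rule the_equality) (auto dest: M.pev_inj)
 thus ?thesis
  using emul_bound[of "Suc (degree P)" "coeff P" N b t] N by (simp add: exm_def coeff_eq_0)
qed

lemma exm_step: "pf M p ==> exm b (%t. m + scl M t (p t)) t = vmul M b m + scl M t (exm b p t) + exm (der V b) p t"
proof -
 assume "pf M p"
 then obtain P where p: "p = pev M P" by (auto simp: pf_def)
 have "degree (pCons m P) < Suc (Suc (degree P))" using degree_pCons_le[of m P] by simp
 hence "exm b (pev M (pCons m P)) t = emul b (coeff (pCons m P)) (Suc (Suc (degree P))) t"
  by (rule exm_pev)
 also have "... = vmul M b m + scl M t (emul b (coeff P) (Suc (degree P)) t) + emul (der V b) (coeff P) (Suc (degree P)) t"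
  by (simp only: emul.simps(2)[of b "coeff (pCons m P)"] coeff_pCons_0 coeff_pCons_Suc)
 finally show ?thesis by (simp add: p M.pf_step_eq exm_pev[OF lessI] del: emul.simps)
qed

lemma exm_0 [simp]: "exm b (%_. 0) t = 0"
proof -
 have "(%_. 0) = pev M 0" by auto
 thus ?thesis using exm_pev[of 0 1 b t] by (simp add: lin_0[OF vm_lin2])
qed

lemma exm_const: "exm b (%_. m) t = vmul M b m"
 using exm_step[OF M.pf_0, of b m t] by simp

lemma emul_add: "emul b (%k. c k + c' k) N t = emul b c N t + emul b c' N t"
 by (induction N arbitrary: b c c') (auto simp: lin_add[OF vm_lin2] M.scale_right_distrib)

lemma exm_add: assumes "pf M p" "pf M p'" shows "exm b (%t. p t + p' t) t = exm b p t + exm b p' t"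
proof -
 obtain P P' where P: "p = pev M P" "p' = pev M P'" using assms by (auto simp: pf_def)
 let ?N = "Suc (max (degree P) (degree P'))"
 have "(%t. p t + p' t) = pev M (P + P')" by (auto simp: P M.pev_add)
 moreover have "coeff (P + P') = (%k. coeff P k + coeff P' k)" by auto
 ultimately show ?thesis
  by (simp add: P exm_pev[of _ ?N] degree_add_le less_Suc_eq_le emul_add del: emul.simps)
qed

lemma exm_var: "pf M p ==> exm b (%t. scl M t (p t)) t = scl M t (exm b p t) + exm (der V b) p t"
 using exm_step[of p b 0 t] by (simp add: lin_0[OF vm_lin2])

lemma exm_lin: "pf M p ==> lin V M (%b. exm b p t)"
proof (induction rule: M.pf_induct)
 case (step m p)
 show ?case
 proof (rule linI)
  fix x y c
  show "exm (x + y) (%t. m + scl M t (p t)) t = exm x (%t. m + scl M t (p t)) t + exm y (%t. m + scl M t (p t)) t"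
   using step.hyps by (simp only: exm_step lin_add[OF vm_lin1] lin_add[OF V.lin_der] lin_add[OF step.IH] M.scale_right_distrib) (simp add: add_ac)
  show "exm (scl V c x) (%t. m + scl M t (p t)) t = scl M c (exm x (%t. m + scl M t (p t)) t)"
   using step.hyps by (simp only: exm_step lin_scl[OF vm_lin1] lin_scl[OF V.lin_der] lin_scl[OF step.IH] M.scale_right_distrib) (simp add: mult.commute)
 qed
qed (simp add: lin_def)

lemma exm_scl: "pf M p ==> exm b (%t. scl M c (p t)) t = scl M c (exm b p t)"
proof (induction arbitrary: b rule: M.pf_induct)
 case (step m p)
 have "exm b (%t. scl M c (m + scl M t (p t))) t = exm b (%t. scl M c m + scl M t (scl M c (p t))) t"
  by (simp add: M.scale_right_distrib mult.commute)
 also have "... = scl M c (exm b (%t. m + scl M t (p t)) t)" using step.IH step.hyps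
  by (simp add: exm_step M.pf_scl lin_scl[OF vm_lin2] M.scale_right_distrib mult.commute del: M.scale_scale)
   (simp add: mult.commute)
 finally show ?case .
qed simp

lemma exm_sm: "pf M p ==> exm b (%t. sm c (p t)) t = sm c (exm b p t)"
 using exm_scl[of p b "sg c" t] by (simp add: M.sg_sm)

lemma exm_neg: "pf M p ==> exm b (%t. - p t) t = - exm b p t"
 using exm_sm[of p b 1 t] by simp

lemma exm_diff: "pf M p ==> pf M p' ==> exm b (%t. p t - p' t) t = exm b p t - exm b p' t"
 using exm_add[OF _ M.pf_neg, of p p' b t] by (simp add: exm_neg)

lemma exm_sum: "(!!x. x : A ==> pf M (p x)) ==> exm b (%t. SUM x:A. p x t) t = (SUM x:A. exm b (p x) t)"
 by (induction A rule: infinite_finite_induct) (auto simp: exm_add M.pf_sum)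

lemma pf_exm: "pf M p ==> pf M (exm b p)"
proof (induction arbitrary: b rule: M.pf_induct)
 case zero
 have "exm b (%_. 0) = (%_. 0)" by auto
 thus ?case by simp
next
 case (step m p)
 have "exm b (%t. m + scl M t (p t)) = (%t. vmul M b m + scl M t (exm b p t) + exm (der V b) p t)"
  using step exm_step by auto
 thus ?case using step by (auto intro!: M.pf_add M.pf_var)
qed

text \<open>In the Horner step both sides produce the same terms because \<partial> is a derivation
  of the product.\<close>

lemma exm_exm: "pf M p ==> exm b (exm c p) t = exm (b * c) p t"
proof (induction arbitrary: b c t rule: M.pf_induct)
 case zero
 have "exm c (%_. 0) = (%_. 0)" by auto
 thus ?case by simp
next
 case (step m p)
 have e: "exm c (%t. m + scl M t (p t)) = (%t. (vmul M c m + scl M t (exm c p t)) + exm (der V c) p t)"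
  using step exm_step by auto
 show ?case unfolding e using step
  by (simp add: exm_add exm_step M.pf_step pf_exm der_mult lin_add[OF exm_lin] vm_mult)
qed

text \<open>The term with \<partial> b coming from \<partial>(b m) equals the one created by
  multiplying with the variable. Hence the operator commutes with \<partial> + \<lambda> and
  descends to the quotients of the complex.\<close>

lemma exm_der:
 "pf M p ==> der M (exm b p t) + scl M t (exm b p t) = exm b (%t. der M (p t) + scl M t (p t)) t"
proof (induction arbitrary: b rule: M.pf_induct)
 case zero
 thus ?case by (simp add: lin_0[OF M.lin_der])
next
 case (step m p)
 have e: "(%t. der M (m + scl M t (p t)) + scl M t (m + scl M t (p t)))
   = (%t. der M m + scl M t (m + (der M (p t) + scl M t (p t))))"
  by (simp add: lin_add[OF M.lin_der] lin_scl[OF M.lin_der] M.scale_right_distrib add_ac)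
 have pf: "pf M (%t. der M (p t) + scl M t (p t))"
  by (intro M.pf_add M.pf_var M.pf_lin'[OF _ M.lin_der] step.hyps)
 have "exm b (%t. der M m + scl M t (m + (der M (p t) + scl M t (p t)))) t
   = vmul M b (der M m) + scl M t (vmul M b m + (der M (exm b p t) + scl M t (exm b p t)))
    + (vmul M (der V b) m + (der M (exm (der V b) p t) + scl M t (exm (der V b) p t)))"
  using pf by (simp only: exm_step exm_add exm_const M.pf_add M.pf_const step.IH)
 thus ?case unfolding e using step.hyps
  by (simp only: exm_step vm_der lin_add[OF M.lin_der] lin_scl[OF M.lin_der] M.scale_right_distrib) (simp add: add_ac)
qed

lemma exm_shift: "pf M p ==> exm b (%t. p (s + t)) t = exm b p (s + t)"
proof (induction arbitrary: b rule: M.pf_induct)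
 case (step m p)
 have e: "(%t. m + scl M (s + t) (p (s + t))) = (%t. (m + scl M t (p (s + t))) + scl M s (p (s + t)))"
  by (simp add: M.scale_left_distrib add_ac)
 show ?case unfolding e using step M.pf_shift[OF step.hyps, of s]
  by (simp only: exm_add exm_step exm_scl M.pf_step M.pf_scl M.scale_left_distrib) (simp add: add_ac)
qed simp

text \<open>The module axiom for a acting on b m, carried through Horner's scheme. The bracket term
  moves to the value s + t because [a_s \<partial> b] = (s + \<partial>)[a_s b].\<close>

lemma ac_exm:
 assumes "a : par V \<alpha>"
 shows "pf M p ==> b : par V \<beta> ==> ac a s (exm b p t) = exm (bk a s b) p (s + t) + sm (\<alpha> * \<beta>) (exm b (%t. ac a s (p t)) t)"
proof (induction arbitrary: b rule: M.pf_induct)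
 case zero
 thus ?case by (simp add: lin_0[OF ac_lin2])
next
 case (step m p)
 have e: "(%t. ac a s (m + scl M t (p t))) = (%t. ac a s m + scl M t (ac a s (p t)))"
  by (simp add: lin_add[OF ac_lin2] lin_scl[OF ac_lin2])
 have pf: "pf M (%t. ac a s (p t))" using step by (auto intro: M.pf_lin' ac_lin2)
 show ?case unfolding e using step pf V.der_par[OF step.prems]
  by (simp add: exm_step lin_add[OF ac_lin2] lin_scl[OF ac_lin2] ac_vmul[OF assms step.prems] bk_sesq2 lin_add[OF exm_lin] lin_scl[OF exm_lin]
    M.scale_right_distrib M.scale_left_distrib sm_add M.scl_sm add_ac)
qed

lemma exm_par: "pf M p ==> b : par V \<beta> ==> (!!t. p t : par M \<alpha>) ==> exm b p t : par M (\<beta> + \<alpha>)"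
proof -
 have "pf M p ==> b : par V \<beta> ==> (ALL k. cof M p k : par M \<alpha>) ==> exm b p t : par M (\<beta> + \<alpha>)"
 proof (induction arbitrary: b rule: M.pf_induct)
  case (step m p)
  have "m : par M \<alpha>" "ALL k. cof M p k : par M \<alpha>"
   using step.prems(2) step.hyps by (auto simp: M.cof_step split: nat.splits)
  thus ?case using step V.der_par[OF step.prems(1)]
   by (auto simp: exm_step intro!: M.par_add M.par_scl vm_par)
 qed simp
 thus "pf M p ==> b : par V \<beta> ==> (!!t. p t : par M \<alpha>) ==> exm b p t : par M (\<beta> + \<alpha>)"
  using M.cof_par by blast
qed

lemma polyfun_ac: "afn J \<phi> ==> M.polyfun J f ==> M.polyfun J (%l. ac a (\<phi> l) (f l))"
proof (rotate_tac, induction rule: M.polyfun.induct)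
 case (polyfun_const m)
 have "pf M (pev M (vact M a m))" by simp
 thus ?case unfolding ac_def using polyfun_const by (intro M.polyfun_pf) auto
qed (auto simp: lin_add[OF ac_lin2] lin_scl[OF ac_lin2] intro: M.polyfun.intros)

lemma polyfun_exm:
 "M.polyfun UNIV f ==> afn UNIV \<phi> ==> M.polyfun UNIV (%l. exm b (%r. f (case_nat r l)) (\<phi> l))"
proof (induction arbitrary: b rule: M.polyfun.induct)
 case (polyfun_const m)
 thus ?case by (simp add: exm_const M.polyfun_const)
next
 case (polyfun_add f g)
 thus ?case by (auto simp: exm_add M.pf_polyfun_case intro: M.polyfun_add)
next
 case (polyfun_var i f)
 thus ?case
  by (cases i rule: nat.exhaust) (auto simp: exm_var exm_scl M.pf_polyfun_case intro!: M.polyfun_add M.polyfun_afn M.polyfun_var)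
qed

lemma exm_affine:
 "pf M p ==> exm b (%t. scl M (k + e * t) (p t)) t = scl M (k + e * t) (exm b p t) + scl M e (exm (der V b) p t)"
proof -
 assume p: "pf M p"
 have "(%t. scl M (k + e * t) (p t)) = (%t. scl M k (p t) + scl M e (scl M t (p t)))"
  by (simp add: M.scale_left_distrib)
 hence "exm b (%t. scl M (k + e * t) (p t)) t = scl M k (exm b p t) + scl M e (scl M t (exm b p t) + exm (der V b) p t)"
  using p by (simp only: exm_add exm_scl exm_var M.pf_scl M.pf_var)
 thus ?thesis by (simp add: M.scale_left_distrib M.scale_right_distrib add_ac)
qed

lemma pf_affine: "pf M p ==> pf M (%t. scl M (k + e * t) (p t))"
proof -
 assume p: "pf M p"
 have "(%t. scl M (k + e * t) (p t)) = (%t. scl M k (p t) + scl M e (scl M t (p t)))"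
  by (simp add: M.scale_left_distrib)
 thus ?thesis using p by (simp only: M.pf_add M.pf_scl M.pf_var)
qed

text \<open>A polynomial function restricted to an affine plane; the two parameters allow operators
  in two different variables to be interchanged.\<close>

definition pf2 :: "('f => 'f => 'm) => bool" where
 "pf2 F \<longleftrightarrow> (EX f k d e. M.polyfun UNIV f & F = (%r t. f (%i. k i + d i * r + e i * t)))"

lemma pf2_flip: "pf2 F ==> pf2 (%t r. F r t)"
proof -
 assume "pf2 F"
 then obtain f k d e where "M.polyfun UNIV f" "F = (%r t. f (%i. k i + d i * r + e i * t))"
  unfolding pf2_def by blast
 thus ?thesis unfolding pf2_def
  by (intro exI[of _ f] exI[of _ k] exI[of _ e] exI[of _ d]) (auto simp: add_ac)
qed

lemma pf2_induct [consumes 1, case_names const add aff]: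
 assumes "pf2 F" "!!m. Q (%r t. m)" "!!F G. pf2 F ==> Q F ==> pf2 G ==> Q G ==> Q (%r t. F r t + G r t)"
  "!!F k d e. pf2 F ==> Q F ==> Q (%r t. scl M (k + d * r + e * t) (F r t))"
 shows "Q F"
proof -
 obtain f k d e where f: "M.polyfun UNIV f" and F: "F = (%r t. f (%i. k i + d i * r + e i * t))"
  using assms(1) unfolding pf2_def by blast
 show ?thesis unfolding F using f
 proof induction
  case (polyfun_add f g)
  thus ?case by (intro assms(3)) (auto simp: pf2_def)
 next
  case (polyfun_var i f)
  have "pf2 (%r t. f (%i. k i + d i * r + e i * t))" unfolding pf2_def using polyfun_var by blast
  thus ?case using assms(4) polyfun_var by blast
 qed (rule assms(2))
qed

lemma pf2_pf: "pf2 F ==> pf M (F r)"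
proof (induction rule: pf2_induct)
 case (aff F k d e)
 thus ?case by (intro pf_affine)
qed (auto intro: M.pf_add)

lemma pf2_exm: "pf2 F ==> pf M (%r. exm b (F r) t)"
proof (induction arbitrary: b rule: pf2_induct)
 case (add F G)
 thus ?case by (auto simp: exm_add pf2_pf intro!: M.pf_add)
next
 case (aff F k d e)
 have "exm b (%t. scl M (k + d * r + e * t) (F r t)) t
   = scl M (k + d * r + e * t) (exm b (F r) t) + scl M e (exm (der V b) (F r) t)" for r
  by (rule exm_affine[OF pf2_pf[OF aff.hyps]])
 moreover have "k + d * r + e * t = (k + e * t) + d * r" for r by simp
 ultimately have "(%r. exm b (%t. scl M (k + d * r + e * t) (F r t)) t)
   = (%r. scl M ((k + e * t) + d * r) (exm b (F r) t) + scl M e (exm (der V b) (F r) t))"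
  by presburger
 thus ?case using aff by (simp only: M.pf_add pf_affine M.pf_scl)
qed simp

text \<open>Operators in different variables interact only through the elements b and c, which
  supercommute; on constants this is the whole statement.\<close>

lemma exm_commute:
 "pf2 F ==> b : par V \<beta> ==> c : par V \<gamma> ==>
  exm b (%r. exm c (%t. F r t) t) r = sm (\<beta> * \<gamma>) (exm c (%t. exm b (%r. F r t) r) t)"
proof (induction arbitrary: b c rule: pf2_induct)
 case (const m)
 thus ?case by (simp add: exm_const lin_sm[OF vm_lin1] mult_comm[of b \<beta> c \<gamma>] flip: vm_mult)
next
 case (add F G)
 note fl = pf2_pf[OF pf2_flip[OF add.hyps(1)]] pf2_pf[OF pf2_flip[OF add.hyps(2)]]
  pf2_exm[OF pf2_flip[OF add.hyps(1)]] pf2_exm[OF pf2_flip[OF add.hyps(2)]]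
 show ?case using add by (simp add: exm_add pf2_pf pf2_exm fl sm_add)
next
 case (aff F k d e)
 have 1: "exm c (%t. scl M (k + d * r + e * t) (F r t)) t
   = scl M ((k + e * t) + d * r) (exm c (F r) t) + scl M e (exm (der V c) (F r) t)" for r
 proof -
  have "(k + e * t) + d * r = k + d * r + e * t" by simp
  thus ?thesis using exm_affine[OF pf2_pf[OF aff.hyps], of c "k + d * r" e r t] by (simp only:)
 qed
 have 2: "exm b (%r. scl M (k + d * r + e * t) (F r t)) r
   = scl M ((k + d * r) + e * t) (exm b (%r. F r t) r) + scl M d (exm (der V b) (%r. F r t) r)" for t
 proof -
  have "k + d * r + e * t = (k + e * t) + d * r" for r by simp
  thus ?thesis using exm_affine[OF pf2_pf[OF pf2_flip[OF aff.hyps]], of b "k + e * t" d t r] by (simp only:)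
 qed
 have d: "der V b : par V \<beta>" "der V c : par V \<gamma>" using aff.prems V.der_par by auto
 note pe = pf2_exm[OF pf2_flip[OF aff.hyps]] pf2_exm[OF aff.hyps]
 have "exm b (%r. exm c (%t. scl M (k + d * r + e * t) (F r t)) t) r
   = scl M ((k + e * t) + d * r) (exm b (%r. exm c (F r) t) r) + scl M d (exm (der V b) (%r. exm c (F r) t) r)
    + scl M e (exm b (%r. exm (der V c) (F r) t) r)"
  unfolding 1 by (simp only: exm_add exm_scl exm_affine pf_affine M.pf_scl pe)
 moreover have "exm c (%t. exm b (%r. scl M (k + d * r + e * t) (F r t)) r) t
   = scl M ((k + d * r) + e * t) (exm c (%t. exm b (%r. F r t) r) t) + scl M e (exm (der V c) (%t. exm b (%r. F r t) r) t)
    + scl M d (exm c (%t. exm (der V b) (%r. F r t) r) t)"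
  unfolding 2 by (simp only: exm_add exm_scl exm_affine pf_affine M.pf_scl pe)
 moreover have "(k + e * t) + d * r = (k + d * r) + e * t" by simp
 ultimately show ?case
  using aff.prems d by (simp only: aff.IH sm_add M.scl_sm) (simp add: add_ac)
qed

end

context superspace begin

lemma Dv_scl: "pf S p ==> Dv S (%t. scl S c (p t)) s = scl S c (Dv S p s)"
 by (simp add: Dv_def cof_scl pf_shift)

lemma pf_Dv_pow: "pf S p ==> pf S ((Dv S ^^ k) p)"
 by (induction k) (auto intro: pf_Dv)

text \<open>The Leibniz formula for a higher derivative of t p(t); the constant m is killed by the
  first derivative.\<close>

lemma Dv_pow_step:
 assumes "pf S p"
 shows "(Dv S ^^ Suc k) (%t. m + scl S t (p t))
  = (%s. scl S (of_nat (Suc k)) ((Dv S ^^ k) p s) + scl S s ((Dv S ^^ Suc k) p s))"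
proof (induction k)
 case 0
 show ?case using assms by (auto simp: Dv_step)
next
 case (Suc k)
 note p = pf_Dv_pow[OF assms]
 have "(Dv S ^^ Suc (Suc k)) (%t. m + scl S t (p t))
  = Dv S (%s. scl S (of_nat (Suc k)) ((Dv S ^^ k) p s) + scl S s ((Dv S ^^ Suc k) p s))"
  unfolding funpow.simps(2)[of "Suc k"] o_apply Suc.IH ..
 also have "... = (%s. scl S (of_nat (Suc k)) ((Dv S ^^ Suc k) p s) + ((Dv S ^^ Suc k) p s + scl S s ((Dv S ^^ Suc (Suc k)) p s)))"
 proof
  fix s
  have "Dv S (%s. scl S s ((Dv S ^^ Suc k) p s)) s = (Dv S ^^ Suc k) p s + scl S s (Dv S ((Dv S ^^ Suc k) p) s)"
   using Dv_step[OF p[of "Suc k"], of 0 s] by simp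
  moreover have "Dv S (%s. scl S (of_nat (Suc k)) ((Dv S ^^ k) p s)) s = scl S (of_nat (Suc k)) (Dv S ((Dv S ^^ k) p) s)"
   by (rule Dv_scl[OF p])
  ultimately show "Dv S (%s. scl S (of_nat (Suc k)) ((Dv S ^^ k) p s) + scl S s ((Dv S ^^ Suc k) p s)) s =
   scl S (of_nat (Suc k)) ((Dv S ^^ Suc k) p s) + ((Dv S ^^ Suc k) p s + scl S s ((Dv S ^^ Suc (Suc k)) p s))"
   by (subst Dv_add[OF pf_scl[OF p] pf_var[OF p]]) simp
 qed
 finally show ?case by (simp only: of_nat_Suc[of "Suc k"] scale_left_distrib scale_one add_ac)
qed

end

context pvm begin

text \<open>Confirms that the Horner recursion is the exponential series of the definitions. The
  cutoff is left free so that the two series in the step can be compared at a common length.\<close>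

lemma exm_eq_sum:
 "pf M p ==> EX N0. ALL N>=N0. exm b p s
   = (SUM k<N. scl M (1 / fact k) (vmul M ((der V ^^ k) b) ((Dv M ^^ k) p s)))"
proof (induction arbitrary: b rule: M.pf_induct)
 case zero
 have "(Dv M ^^ k) (%_. 0) = (%_. 0)" for k
 proof (induction k)
  case (Suc k)
  thus ?case by (simp only: funpow.simps o_apply) auto
 qed simp
 thus ?case by (auto simp: lin_0[OF vm_lin2])
next
 case (step m p)
 define T where "T b k x = scl M (1 / fact k) (vmul M ((der V ^^ k) b) x)" for b k x
 have T: "T b k (x + y) = T b k x + T b k y" "T b k (scl M c x) = scl M c (T b k x)" for b k x y c
  by (auto simp: T_def lin_add[OF vm_lin2] lin_scl[OF vm_lin2] M.scale_right_distrib mult.commute)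
 have T0: "T b 0 x = vmul M b x" for b x by (simp add: T_def)
 \<comment> \<open>The factor k + 1 from differentiating a product with t cancels one factor of (k +
   1)!, and the leftover \<partial> moves to b.\<close>
 have TS: "T b (Suc k) (scl M (of_nat (Suc k)) x) = T (der V b) k x" for b k x
 proof -
  have "(of_nat (Suc k) :: 'f) ~= 0" by (rule of_nat_neq_0)
  hence "of_nat (Suc k) / fact (Suc k) = (1 / fact k :: 'f)"
   by (simp add: field_simps del: of_nat_Suc)
  moreover have "T b (Suc k) (scl M (of_nat (Suc k)) x)
    = scl M (of_nat (Suc k) / fact (Suc k)) (vmul M ((der V ^^ Suc k) b) x)"
   by (simp add: T_def lin_scl[OF vm_lin2])
  ultimately show ?thesis by (simp add: T_def funpow_swap1 del: of_nat_Suc fact_Suc)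
 qed
 obtain N1 where N1: "!!N. N \<ge> N1 ==> exm b p s = (SUM k<N. T b k ((Dv M ^^ k) p s))"
  using step.IH[of b] unfolding T_def by blast
 obtain N2 where N2: "!!N. N \<ge> N2 ==> exm (der V b) p s = (SUM k<N. T (der V b) k ((Dv M ^^ k) p s))"
  using step.IH[of "der V b"] unfolding T_def by blast
 let ?p = "%t. m + scl M t (p t)"
 have "exm b ?p s = (SUM k<N. T b k ((Dv M ^^ k) ?p s))" if N: "N \<ge> Suc (max N1 N2)" for N
 proof -
  obtain n where n: "N = Suc n" "n \<ge> N2" "N \<ge> N1" using N by (cases N) auto
  have "(SUM k<N. T b k ((Dv M ^^ k) ?p s)) = T b 0 (?p s) + (SUM k<n. T b (Suc k) ((Dv M ^^ Suc k) ?p s))"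
   unfolding n(1) by (subst sum.lessThan_Suc_shift) simp
  also have "... = T b 0 (?p s) + (SUM k<n. T (der V b) k ((Dv M ^^ k) p s) + scl M s (T b (Suc k) ((Dv M ^^ Suc k) p s)))"
   unfolding M.Dv_pow_step[OF step.hyps] T(1) unfolding TS unfolding T(2) ..
  also have "... = vmul M b m + scl M s (T b 0 (p s) + (SUM k<n. T b (Suc k) ((Dv M ^^ Suc k) p s))) + (SUM k<n. T (der V b) k ((Dv M ^^ k) p s))"
   by (simp only: T T0 M.scale_right_distrib M.scale_sum_right sum.distrib) (simp add: add_ac)
  also have "T b 0 (p s) + (SUM k<n. T b (Suc k) ((Dv M ^^ Suc k) p s)) = (SUM k<N. T b k ((Dv M ^^ k) p s))"
   unfolding n(1) by (subst sum.lessThan_Suc_shift) simp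
  finally show ?thesis using N1[OF n(3)] N2[OF n(2)] exm_step[OF step.hyps] by simp
 qed
 thus ?case unfolding T_def by blast
qed

lemma evl_exp_der: "evl M (exp_der V M i b P) l = exm b (%t. evl M P (l(i := t))) (l i)"
proof -
 let ?T = "%k m. scl M (1 / fact k) (vmul M ((der V ^^ k) b) m)"
 let ?g = "%k. Poly_Mapping.map (?T k) ((lder M i ^^ k) P)"
 have T: "lin M M (?T k)" for k
  by (rule linI) (auto simp: lin_add[OF vm_lin2] lin_scl[OF vm_lin2] M.scale_right_distrib mult.commute)
 obtain N1 where N1: "!!k. k \<ge> N1 ==> (lder M i ^^ k) P = 0" using M.lder_pow_eq_0 by blast
 obtain N2 where N2: "!!N. N \<ge> N2 ==> exm b (%t. evl M P (l(i := t))) (l i)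
   = (SUM k<N. ?T k ((Dv M ^^ k) (%t. evl M P (l(i := t))) (l i)))"
  using exm_eq_sum[OF M.pf_evl, of b P l i "l i"] by blast
 let ?N = "max N1 N2"
 have "{k. ?g k ~= 0} \<subseteq> {..<?N}"
 proof
  fix k assume "k : {k. ?g k ~= 0}"
  hence "(lder M i ^^ k) P ~= 0" by (auto simp: Poly_Mapping.map_eq_zero_iff)
  thus "k : {..<?N}" using N1[of k] by (meson lessThan_iff less_max_iff_disj not_le)
 qed
 hence "exp_der V M i b P = sum ?g {..<?N}"
  unfolding exp_der_def by (intro Sum_any.expand_superset) auto
 hence "evl M (exp_der V M i b P) l = (SUM k<?N. ?T k ((Dv M ^^ k) (%t. evl M P (l(i := t))) (l i)))"
  by (simp only: M.evl_sum M.evl_map[OF T] M.evl_lder_pow)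
 thus ?thesis using N2[of ?N] by simp
qed

lemma ac_mult:
 assumes "a : par V \<alpha>" "b : par V \<beta>"
 shows "ac (a * b) t m = exm a (%t. ac b t m) t + sm (\<alpha> * \<beta>) (exm b (%t. ac a t m) t)"
proof -
 have v: "evl M (psubst (lam 0) p) l = pev M p (l 0)" for p l
  by (rule M.evl_psubst) (simp add: M.evl_lam)
 have "psubst (lam 0) (vact M (a * b) m) =
     exp_der V M 0 a (psubst (lam 0) (vact M b m))
     + Poly_Mapping.map (scl M (sg (\<alpha> * \<beta>))) (exp_der V M 0 b (psubst (lam 0) (vact M a m)))"
  using pva_module assms unfolding pva_module_def by blast
 from arg_cong[OF this, of "%P. evl M P (%_. t)"] show ?thesis
  by (simp add: M.evl_add M.evl_map[OF M.scl_lin] evl_exp_der v M.sg_sm ac_def)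
qed

section \<open>Cochains with unreduced values, evaluated at scalars\<close>

definition X :: "('v \<times> bit \<times> 'f) set" where "X = {(a, \<alpha>, t). a : par V \<alpha>}"
definition xp :: "'v \<times> bit \<times> 'f => bit" where "xp = (%(a, \<alpha>, t). \<alpha>)"
text \<open>The bracket of arguments with values s and t sits at the value s + t. With this
  convention the Jacobi identity of \<lambda>-brackets is that of an ordinary Lie superalgebra. The
  parity is carried along because 0 has both parities.\<close>

definition xbr :: "'v \<times> bit \<times> 'f => 'v \<times> bit \<times> 'f => 'v \<times> bit \<times> 'f" where
 "xbr = (%(a, \<alpha>, s) (b, \<beta>, t). (bk a s b, \<alpha> + \<beta>, s + t))"
definition xact :: "'v \<times> bit \<times> 'f => 'm => 'm" where "xact = (%(a, \<alpha>, s). ac a s)"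

lemma X_iff [simp]: "(a, \<alpha>, t) : X \<longleftrightarrow> a : par V \<alpha>"
 and xp_simp [simp]: "xp (a, \<alpha>, t) = \<alpha>"
 and xbr_simp: "xbr (a, \<alpha>, s) (b, \<beta>, t) = (bk a s b, \<alpha> + \<beta>, s + t)"
 and xact_simp: "xact (a, \<alpha>, s) m = ac a s m"
 by (auto simp: X_def xp_def xbr_def xact_def)

sublocale leibniz_calculus X xp xbr xact
proof
 fix x z :: "'v \<times> bit \<times> 'f" and m n
 obtain a \<alpha> s b \<beta> t where xz: "x = (a, \<alpha>, s)" "z = (b, \<beta>, t)" by (metis prod_cases3)
 show "x : X ==> z : X ==> xbr x z : X" "x : X ==> z : X ==> xp (xbr x z) = xp x + xp z"
  by (auto simp: xz xbr_simp bk_par)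
 show "xact x (m + n) = xact x m + xact x n" by (simp add: xz xact_simp lin_add[OF ac_lin2])
 show "x : X ==> z : X ==> xact x (xact z m) - sm (xp x * xp z) (xact z (xact x m)) = xact (xbr x z) m"
  by (simp add: xz xact_simp xbr_simp ac_bk)
qed

lemma q_simp [simp]: "q (a, \<alpha>, t) = 1 + \<alpha>"
 by (simp add: q_def)

lemma q_br: "x : X ==> z : X ==> q (xbr x z) = xp x + q z"
 by (simp add: q_def p_br)

definition qs :: "('v \<times> bit \<times> 'f) list => bit" where "qs xs = sum_list (map q xs)"

lemma qs_simps [simp]: "qs [] = 0" "qs (x # xs) = q x + qs xs" "qs (xs @ ys) = qs xs + qs ys"
 by (auto simp: qs_def)

text \<open>Linearity and sesquilinearity of one slot, between the fixed arguments \<open>us\<close>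
  and \<open>vs\<close>; slotwise statements permit induction on \<open>us\<close>.\<close>

definition LinAt :: "(('v \<times> bit \<times> 'f) list => 'm) => ('v \<times> bit \<times> 'f) list => ('v \<times> bit \<times> 'f) list => bool" where
 "LinAt y us vs \<longleftrightarrow> (ALL \<alpha> t. ALL a:par V \<alpha>.
   (ALL b:par V \<alpha>. y (us @ (a + b, \<alpha>, t) # vs) = y (us @ (a, \<alpha>, t) # vs) + y (us @ (b, \<alpha>, t) # vs)) \<and>
   (ALL c. y (us @ (scl V c a, \<alpha>, t) # vs) = scl M c (y (us @ (a, \<alpha>, t) # vs))) \<and>
   y (us @ (der V a, \<alpha>, t) # vs) = - scl M t (y (us @ (a, \<alpha>, t) # vs)))"

definition SymAt :: "(('v \<times> bit \<times> 'f) list => 'm) => ('v \<times> bit \<times> 'f) list => ('v \<times> bit \<times> 'f) list => bool" where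
 "SymAt y us vs \<longleftrightarrow> (ALL x:X. ALL z:X. y (us @ x # z # vs) = sm (q x * q z) (y (us @ z # x # vs)))"

definition LeibAt :: "bit => (('v \<times> bit \<times> 'f) list => 'm) => ('v \<times> bit \<times> 'f) list => ('v \<times> bit \<times> 'f) list => bool" where
 "LeibAt \<pi> y us vs \<longleftrightarrow> (ALL \<beta> \<gamma> t. ALL b:par V \<beta>. ALL c:par V \<gamma>.
   y (us @ (b * c, \<beta> + \<gamma>, t) # vs)
    = sm (\<beta> * (\<pi> + qs us)) (exm b (%r. y (us @ (c, \<gamma>, r) # vs)) t)
     + sm (\<gamma> * (\<beta> + (\<pi> + qs us))) (exm c (%r. y (us @ (b, \<beta>, r) # vs)) t))"

abbreviation inst :: "('v \<times> bit \<times> ((nat => 'f) => 'f)) list => (nat => 'f) => ('v \<times> bit \<times> 'f) list" where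
 "inst ws l \<equiv> map (%(a, \<alpha>, \<phi>). (a, \<alpha>, \<phi> l)) ws"

definition XF :: "('v \<times> bit \<times> ((nat => 'f) => 'f)) set" where
 "XF = {(a, \<alpha>, \<phi>). a : par V \<alpha> & afn UNIV \<phi>}"

text \<open>Polynomial dependence on the values, tested on arguments whose values are affine in
  arbitrarily many variables, a class stable under brackets. \<open>Y\<close> may itself depend on
  the variables, which is what remains after such an argument has been inserted.\<close>

definition PF :: "((nat => 'f) => ('v \<times> bit \<times> 'f) list => 'm) => bool" where
 "PF Y \<longleftrightarrow> (ALL ws:lists XF. M.polyfun UNIV (%l. Y l (inst ws l)))"

definition slin where "slin y \<longleftrightarrow> (ALL us:lists X. ALL vs:lists X. LinAt y us vs)"
definition ssym where "ssym y \<longleftrightarrow> (ALL us:lists X. ALL vs:lists X. SymAt y us vs)"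
definition sleib where "sleib \<pi> y \<longleftrightarrow> (ALL us:lists X. ALL vs:lists X. LeibAt \<pi> y us vs)"
definition spar where "spar \<pi> y \<longleftrightarrow> (ALL xs:lists X. y xs : par M (1 + \<pi> + qs xs))"

text \<open>The cochains of opposite parity \<open>\<pi>\<close> with values in polynomials that are not reduced modulo
  \<open>\<partial> + \<lambda>\<^sub>1 + \<dots> + \<lambda>\<^sub>n\<close>, evaluated at scalars: an argument \<open>(a, \<alpha>, t)\<close> is an element \<open>a\<close> of parity
  \<open>\<alpha>\<close> together with the value \<open>t\<close> of its variable.\<close>

definition BC :: "bit => (('v \<times> bit \<times> 'f) list => 'm) => bool" where
 "BC \<pi> y \<longleftrightarrow> slin y & spar \<pi> y & ssym y & sleib \<pi> y & PF (%_. y)"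

lemma LinAt_D:
 assumes "LinAt y us vs" "a : par V \<alpha>"
 shows "b : par V \<alpha> ==> y (us @ (a + b, \<alpha>, t) # vs) = y (us @ (a, \<alpha>, t) # vs) + y (us @ (b, \<alpha>, t) # vs)"
  "y (us @ (scl V c a, \<alpha>, t) # vs) = scl M c (y (us @ (a, \<alpha>, t) # vs))"
  "y (us @ (der V a, \<alpha>, t) # vs) = - scl M t (y (us @ (a, \<alpha>, t) # vs))"
  "y (us @ (- a, \<alpha>, t) # vs) = - y (us @ (a, \<alpha>, t) # vs)"
  "y (us @ (sm d a, \<alpha>, t) # vs) = sm d (y (us @ (a, \<alpha>, t) # vs))"
  "y (us @ (0, \<alpha>, t) # vs) = 0"
proof -
 have s: "y (us @ (scl V c a, \<alpha>, t) # vs) = scl M c (y (us @ (a, \<alpha>, t) # vs))" for c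
  using assms by (auto simp: LinAt_def)
 thus "y (us @ (scl V c a, \<alpha>, t) # vs) = scl M c (y (us @ (a, \<alpha>, t) # vs))" .
 show "y (us @ (- a, \<alpha>, t) # vs) = - y (us @ (a, \<alpha>, t) # vs)" "y (us @ (0, \<alpha>, t) # vs) = 0"
  using s[of "-1"] s[of 0] by simp_all
 thus "y (us @ (sm d a, \<alpha>, t) # vs) = sm d (y (us @ (a, \<alpha>, t) # vs))" by (cases d) auto
qed (use assms in \<open>auto simp: LinAt_def\<close>)

lemma LinAt_sum:
 assumes "LinAt y us vs" "!!i. i : A ==> f i : par V \<alpha>"
 shows "y (us @ (sum f A, \<alpha>, t) # vs) = (SUM i:A. y (us @ (f i, \<alpha>, t) # vs))"
 using assms(2)
proof (induction A rule: infinite_finite_induct)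
 case (insert i A)
 thus ?case using LinAt_D(1)[OF assms(1), of "f i" \<alpha> "sum f A"] by (simp add: V.par_sum)
qed (use LinAt_D(6)[OF assms(1) V.par_0] in auto)

lemma slinD: "slin y ==> us : lists X ==> vs : lists X ==> LinAt y us vs"
 and ssymD: "ssym y ==> us : lists X ==> vs : lists X ==> SymAt y us vs"
 and sleibD: "sleib \<pi> y ==> us : lists X ==> vs : lists X ==> LeibAt \<pi> y us vs"
 by (auto simp: slin_def ssym_def sleib_def)

lemma LinAt_Cons: "LinAt y (u # us) vs \<longleftrightarrow> LinAt (ins y u) us vs"
 and SymAt_Cons: "SymAt y (u # us) vs \<longleftrightarrow> SymAt (ins y u) us vs"
 and LeibAt_Cons: "LeibAt \<pi> y (u # us) vs \<longleftrightarrow> LeibAt (\<pi> + q u) (ins y u) us vs"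
 by (auto simp: LinAt_def SymAt_def LeibAt_def add_ac)

lemma slin_ins: "slin y ==> x : X ==> slin (ins y x)"
 and ssym_ins: "ssym y ==> x : X ==> ssym (ins y x)"
 and sleib_ins: "sleib \<pi> y ==> x : X ==> sleib (\<pi> + q x) (ins y x)"
 by (auto simp: slin_def ssym_def sleib_def LinAt_Cons[symmetric] SymAt_Cons[symmetric] LeibAt_Cons[symmetric])

lemma spar_ins: "spar \<pi> y ==> x : X ==> spar (\<pi> + q x) (ins y x)"
 unfolding spar_def
proof
 fix xs assume *: "ALL xs:lists X. y xs : par M (1 + \<pi> + qs xs)" "x : X" "xs : lists X"
 hence "x # xs : lists X" by simp
 from bspec[OF *(1) this] show "y (x # xs) : par M (1 + (\<pi> + q x) + qs xs)" by (simp add: add_ac)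
qed

lemma PF_ins: "PF Y ==> a : par V \<alpha> ==> afn UNIV \<phi> ==> PF (%l. ins (Y l) (a, \<alpha>, \<phi> l))"
 unfolding PF_def
proof
 fix ws assume "ALL ws:lists XF. M.polyfun UNIV (%l. Y l (inst ws l))" "a : par V \<alpha>" "afn UNIV \<phi>" "ws : lists XF"
 thus "M.polyfun UNIV (%l. Y l ((a, \<alpha>, \<phi> l) # inst ws l))"
  using bspec[of "lists XF" "%ws. M.polyfun UNIV (%l. Y l (inst ws l))" "(a, \<alpha>, \<phi>) # ws"]
  by (simp add: XF_def)
qed

lemma BC_ins: "BC \<pi> y ==> x : X ==> BC (\<pi> + q x) (ins y x)"
 using PF_ins[of "%_. y" "fst x" "fst (snd x)" "%_. snd (snd x)"]
 by (cases x) (auto simp: BC_def slin_ins ssym_ins afn_const simp del: q_simp intro!: sleib_ins spar_ins)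

lemma PF_const_inst:
 assumes "xs : lists X" shows "EX ws:lists XF. ALL l. inst ws l = xs"
 using assms
proof (induction xs)
 case (Cons x xs)
 then obtain ws where "ws : lists XF" "!!l. inst ws l = xs" by auto
 thus ?case using Cons.hyps
  by (cases x) (auto simp: XF_def afn_const intro!: bexI[of _ "(fst x, fst (snd x), %_. snd (snd x)) # ws"])
qed auto

lemma PF_pf:
 assumes "PF (%_. y)" "us : lists X" "vs : lists X" "a : par V \<alpha>"
 shows "pf M (%t. y (us @ (a, \<alpha>, t) # vs))"
proof -
 obtain uw vw where w: "uw : lists XF" "vw : lists XF" "!!l. inst uw l = us" "!!l. inst vw l = vs"
  using PF_const_inst assms by metis
 hence "uw @ (a, \<alpha>, %l. l 0) # vw : lists XF" using assms(4) by (auto simp: XF_def afn_var)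
 from assms(1)[unfolded PF_def, rule_format, OF this] w
 have "M.polyfun UNIV (%l. y (us @ (a, \<alpha>, l 0) # vs))" by simp
 from M.pf_polyfun_upd[OF this, of undefined 0] show ?thesis by simp
qed

lemma BC_jac: "slin y ==> jac y"
 unfolding jac_def
proof (intro ballI)
 fix us vs x z w assume y: "slin y" and uv: "us : lists X" "vs : lists X" and X: "x : X" "z : X" "w : X"
 obtain a \<alpha> s b \<beta> t c \<gamma> r where e: "x = (a, \<alpha>, s)" "z = (b, \<beta>, t)" "w = (c, \<gamma>, r)" by (metis prod_cases3)
 have p: "bk (bk a s b) (s + t) c : par V (\<alpha> + \<beta> + \<gamma>)" "bk b t (bk a s c) : par V (\<alpha> + \<beta> + \<gamma>)"
  using X bk_par[OF bk_par, of a \<alpha> b \<beta> c \<gamma>] bk_par[OF _ bk_par, of b \<beta> a \<alpha> c \<gamma>] by (auto simp: e add_ac)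
 have "bk a s (bk b t c) = bk (bk a s b) (s + t) c + sm (\<alpha> * \<beta>) (bk b t (bk a s c))"
  using bk_bk[of a \<alpha> b \<beta> s t c] X by (simp add: e algebra_simps)
 thus "y (us @ xbr x (xbr z w) # vs) = y (us @ xbr (xbr x z) w # vs) + sm (xp x * xp z) (y (us @ xbr z (xbr x w) # vs))"
  using LinAt_D[OF slinD[OF y uv]] p V.par_sm[OF p(2)] by (simp add: e xbr_simp add_ac)
qed

text \<open>The slot holds a bracket at the value s + t, on which \<partial> acts as -(s + t) by
  sesquilinearity, so \<open>skew_through\<close> applies.\<close>

lemma skew_slot:
 assumes "LinAt y us vs" "x : X" "z : X"
 shows "y (us @ xbr x z # vs) = - sm (xp x * xp z) (y (us @ xbr z x # vs))"
proof -
 obtain a \<alpha> s b \<beta> t where e: "x = (a, \<alpha>, s)" "z = (b, \<beta>, t)" by (metis prod_cases3)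
 \<comment> \<open>Taking the homogeneous component makes the slot a linear map on all of
   \<open>V\<close>.\<close>
 define \<Phi> where "\<Phi> v = y (us @ (hcomp V (\<alpha> + \<beta>) v, \<alpha> + \<beta>, s + t) # vs)" for v
 have "lin V M \<Phi>"
  by (rule linI) (simp_all add: \<Phi>_def lin_add[OF V.hcomp_lin] lin_scl[OF V.hcomp_lin] LinAt_D[OF assms(1) V.hcomp_par])
 moreover have "\<Phi> (der V v) = - scl M (s + t) (\<Phi> v)" for v
  by (simp add: \<Phi>_def V.hcomp_der LinAt_D[OF assms(1) V.hcomp_par])
 ultimately have "\<Phi> (bk a s b) = - sm (\<alpha> * \<beta>) (\<Phi> (bk b t a))"
  using skew_through assms(2,3) by (simp add: e)
 moreover have "hcomp V (\<alpha> + \<beta>) (bk a s b) = bk a s b" "hcomp V (\<alpha> + \<beta>) (bk b t a) = bk b t a"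
  using assms(2,3) bk_par[of a \<alpha> b \<beta> s] bk_par[of b \<beta> a \<alpha> t] by (auto simp: e V.hcomp_hom add.commute)
 ultimately show ?thesis by (simp add: e xbr_simp \<Phi>_def add.commute)
qed

end

section \<open>Lie derivatives of unreduced cochains\<close>

context pvm begin

lemma Lie_scl: "Lie \<pi> x (%w. scl M c (y w)) xs = scl M c (Lie \<pi> x y xs)"
 by (induction xs arbitrary: \<pi> y)
  (cases x, auto simp: xact_simp lin_scl[OF ac_lin2] M.scl_sm M.scale_right_diff_distrib)

lemma dd_scl: "dd \<pi> (%w. scl M c (y w)) xs = scl M c (dd \<pi> y xs)"
 by (induction xs arbitrary: \<pi> y) (auto simp: Lie_scl M.scl_sm M.scale_right_distrib)

lemma xact_lin: "lin M M (xact x)"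
 by (cases x) (auto intro!: linI simp: xact_simp lin_add[OF ac_lin2] lin_scl[OF ac_lin2])

lemma pf_Lie: "zs : lists X ==> x : X ==> (!!w. w : lists X ==> pf M (%r. Y r w)) ==> pf M (%r. Lie \<pi> x (Y r) zs)"
proof (induction zs arbitrary: Y \<pi>)
 case Nil
 thus ?case by (auto intro: M.pf_lin' xact_lin)
next
 case (Cons z zs)
 have "pf M (%r. Lie (\<pi> + q z) x (ins (Y r) z) zs)"
  using Cons.prems(1,2) by (auto intro!: Cons.IH Cons.prems(3))
 moreover have "pf M (%r. Y r (xbr x z # zs))" using Cons.prems(1,2) br_X[of x z] by (intro Cons.prems(3)) simp
 ultimately show ?case by (simp add: M.pf_diff M.pf_sm)
qed

lemma pf_dd: "zs : lists X ==> (!!w. w : lists X ==> pf M (%r. Y r w)) ==> pf M (%r. dd \<pi> (Y r) zs)"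
proof (induction zs arbitrary: Y \<pi>)
 case (Cons z zs)
 hence "pf M (%r. dd (\<pi> + q z) (ins (Y r) z) zs)" "pf M (%r. Lie \<pi> z (Y r) zs)"
  by (auto intro!: Cons.IH pf_Lie Cons.prems(2))
 thus ?case by (simp add: M.pf_add M.pf_sm)
qed auto

lemma cof_Lie: "zs : lists X ==> x : X ==> (!!w. w : lists X ==> pf M (%r. Y r w)) ==>
  cof M (%r. Lie \<pi> x (Y r) zs) k = Lie \<pi> x (%w. cof M (%r. Y r w) k) zs"
proof (induction zs arbitrary: Y \<pi>)
 case Nil
 thus ?case by (auto intro: M.cof_lin' xact_lin)
next
 case (Cons z zs)
 have "pf M (%r. Lie (\<pi> + q z) x (ins (Y r) z) zs)"
  using Cons.prems(1,2) by (auto intro!: pf_Lie Cons.prems(3))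
 moreover have "cof M (%r. Lie (\<pi> + q z) x (ins (Y r) z) zs) k = Lie (\<pi> + q z) x (%w. cof M (%r. ins (Y r) z w) k) zs"
  using Cons.prems(1,2) by (auto intro!: Cons.IH Cons.prems(3))
 moreover have "pf M (%r. Y r (xbr x z # zs))" using Cons.prems(1,2) br_X[of x z] by (intro Cons.prems(3)) simp
 ultimately show ?case by (simp add: M.cof_diff M.cof_sm M.pf_sm)
qed

lemma cof_dd: "zs : lists X ==> (!!w. w : lists X ==> pf M (%r. Y r w)) ==>
  cof M (%r. dd \<pi> (Y r) zs) k = dd \<pi> (%w. cof M (%r. Y r w) k) zs"
proof (induction zs arbitrary: Y \<pi>)
 case (Cons z zs)
 hence "pf M (%r. dd (\<pi> + q z) (ins (Y r) z) zs)" "pf M (%r. Lie \<pi> z (Y r) zs)"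
  by (auto intro!: pf_dd pf_Lie Cons.prems(2))
 moreover have "cof M (%r. dd (\<pi> + q z) (ins (Y r) z) zs) k = dd (\<pi> + q z) (%w. cof M (%r. ins (Y r) z w) k) zs"
  using Cons.prems(1) by (auto intro!: Cons.IH Cons.prems(2))
 moreover have "cof M (%r. Lie \<pi> z (Y r) zs) k = Lie \<pi> z (%w. cof M (%r. Y r w) k) zs"
  using Cons.prems(1) by (auto intro!: cof_Lie Cons.prems(2))
 ultimately show ?case by (simp add: M.cof_add M.cof_sm M.pf_sm)
qed auto

lemma LinAt_Lie: "slin y ==> x : X ==> us : lists X ==> vs : lists X ==> LinAt (Lie \<pi> x y) us vs"
proof (induction us arbitrary: y \<pi>)
 case Nil
 obtain b \<beta> s where x: "x = (b, \<beta>, s)" by (metis prod_cases3)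
 have b: "b : par V \<beta>" using Nil x by simp
 have L: "LinAt y [] w" if "w : lists X" for w using slinD[OF Nil.prems(1) _ that] by simp
 note D = LinAt_D[OF L, simplified]
 show ?case unfolding LinAt_def
 proof (intro allI ballI conjI)
  fix \<alpha> t a assume a: "a : par V \<alpha>"
  have ba: "bk b s a : par V (\<beta> + \<alpha>)" using bk_par[OF b a] .
  show "Lie \<pi> x y ([] @ (a + a', \<alpha>, t) # vs) = Lie \<pi> x y ([] @ (a, \<alpha>, t) # vs) + Lie \<pi> x y ([] @ (a', \<alpha>, t) # vs)"
   if a': "a' : par V \<alpha>" for a'
  proof -
   have "Lie (\<pi> + (1 + \<alpha>)) x (ins y (a + a', \<alpha>, t)) vs = Lie (\<pi> + (1 + \<alpha>)) x (%w. ins y (a, \<alpha>, t) w + ins y (a', \<alpha>, t) w) vs"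
    using Nil.prems D(1) a a' by (intro Lie_cong) auto
   thus ?thesis
    using D(1)[OF Nil.prems(4) ba bk_par[OF b a']]
    by (simp add: Lie_add x xbr_simp lin_add[OF bk_lin2] sm_add)
  qed
  show "Lie \<pi> x y ([] @ (scl V c a, \<alpha>, t) # vs) = scl M c (Lie \<pi> x y ([] @ (a, \<alpha>, t) # vs))" for c
  proof -
   have "Lie (\<pi> + (1 + \<alpha>)) x (ins y (scl V c a, \<alpha>, t)) vs = Lie (\<pi> + (1 + \<alpha>)) x (%w. scl M c (ins y (a, \<alpha>, t) w)) vs"
    using Nil.prems D(2) a by (intro Lie_cong) auto
   thus ?thesis
    using D(2)[OF Nil.prems(4) ba]
    by (simp add: Lie_scl x xbr_simp lin_scl[OF bk_lin2] M.scl_sm M.scale_right_diff_distrib)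
  qed
  have "Lie (\<pi> + (1 + \<alpha>)) x (ins y (der V a, \<alpha>, t)) vs = Lie (\<pi> + (1 + \<alpha>)) x (%w. scl M (- t) (ins y (a, \<alpha>, t) w)) vs"
   using Nil.prems D(3) a by (intro Lie_cong) auto
  \<comment> \<open>The bracket with \<partial> a is (s + \<partial>) times the bracket with a, and
    \<partial> acts as -(s + t) in this slot; what remains is -t.\<close>
  moreover have "y (xbr x (der V a, \<alpha>, t) # vs) = scl M (- t) (y (xbr x (a, \<alpha>, t) # vs))"
   using D(1)[OF Nil.prems(4) V.par_scl[OF ba] V.der_par[OF ba]] D(2)[OF Nil.prems(4) ba] D(3)[OF Nil.prems(4) ba]
   by (simp add: x xbr_simp bk_sesq2 M.scale_left_distrib)
  ultimately show "Lie \<pi> x y ([] @ (der V a, \<alpha>, t) # vs) = - scl M t (Lie \<pi> x y ([] @ (a, \<alpha>, t) # vs))"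
   by (simp add: Lie_scl Lie_minus M.scale_right_diff_distrib M.scl_sm sm_minus)
 qed
next
 case (Cons u us)
 have "LinAt (Lie (\<pi> + q u) x (ins y u)) us vs" using Cons by (auto intro!: Cons.IH slin_ins)
 moreover have "LinAt y (xbr x u # us) vs" using Cons.prems br_X by (intro slinD) auto
 ultimately show ?case
  by (auto simp: LinAt_def sm_add M.scl_sm M.scale_right_diff_distrib sm_minus)
qed

lemma SymAt_Lie: "ssym y ==> x : X ==> us : lists X ==> vs : lists X ==> SymAt (Lie \<pi> x y) us vs"
proof (induction us arbitrary: y \<pi>)
 case Nil
 have S: "y (z # w # v) = sm (q z * q w) (y (w # z # v))" if "z : X" "w : X" "v : lists X" for z w v
  using ssymD[OF Nil.prems(1) lists.Nil that(3)] that(1,2) unfolding SymAt_def append_Nil by blast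
 show ?case unfolding SymAt_def
 proof (intro ballI)
  fix z w assume zw: "z : X" "w : X"
  have L: "Lie (\<pi> + q z + q w) x (%v. y (z # w # v)) vs = sm (q z * q w) (Lie (\<pi> + q w + q z) x (%v. y (w # z # v)) vs)"
  proof -
   have "Lie (\<pi> + q z + q w) x (%v. y (z # w # v)) vs = Lie (\<pi> + q z + q w) x (%v. sm (q z * q w) (y (w # z # v))) vs"
    by (rule Lie_cong[OF Nil.prems(4,2)]) (rule S[OF zw])
   moreover have "\<pi> + q w + q z = \<pi> + q z + q w" by simp
   ultimately show ?thesis by (simp only: Lie_sm)
  qed
  have "y (z # xbr x w # vs) = sm (q z * (xp x + q w)) (y (xbr x w # z # vs))"
   "y (xbr x z # w # vs) = sm ((xp x + q z) * q w) (y (w # xbr x z # vs))"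
   using S[OF zw(1) br_X[OF Nil.prems(2) zw(2)] Nil.prems(4)] S[OF br_X[OF Nil.prems(2) zw(1)] zw(2) Nil.prems(4)]
   by (simp_all only: q_br[OF Nil.prems(2) zw(1)] q_br[OF Nil.prems(2) zw(2)])
  thus "Lie \<pi> x y ([] @ z # w # vs) = sm (q z * q w) (Lie \<pi> x y ([] @ w # z # vs))"
   unfolding append_Nil Lie.simps L
   by (simp only: ) (cases "q z"; cases "q w"; cases "xp x"; cases \<pi>; simp)
 qed
next
 case (Cons u us)
 have "SymAt (Lie (\<pi> + q u) x (ins y u)) us vs" using Cons by (auto intro!: Cons.IH ssym_ins)
 moreover have "SymAt y (xbr x u # us) vs" using Cons.prems br_X by (intro ssymD) auto
 ultimately show ?case
  unfolding SymAt_def append_Cons Lie.simps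
 proof (intro ballI)
  fix z w assume zw: "z : X" "w : X"
   and "ALL z:X. ALL w:X. Lie (\<pi> + q u) x (ins y u) (us @ z # w # vs) = sm (q z * q w) (Lie (\<pi> + q u) x (ins y u) (us @ w # z # vs))"
   "ALL z:X. ALL w:X. y (xbr x u # us @ z # w # vs) = sm (q z * q w) (y (xbr x u # us @ w # z # vs))"
  hence "Lie (\<pi> + q u) x (ins y u) (us @ z # w # vs) = sm (q z * q w) (Lie (\<pi> + q u) x (ins y u) (us @ w # z # vs))"
   "y (xbr x u # us @ z # w # vs) = sm (q z * q w) (y (xbr x u # us @ w # z # vs))" by blast+
  thus "Lie (\<pi> + q u) x (ins y u) (us @ z # w # vs) - sm (xp x * \<pi>) (y (xbr x u # us @ z # w # vs))
    = sm (q z * q w) (Lie (\<pi> + q u) x (ins y u) (us @ w # z # vs) - sm (xp x * \<pi>) (y (xbr x u # us @ w # z # vs)))"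
   by (simp only: sm_diff sm_sm add.commute)
 qed
qed

text \<open>A Lie derivative acts as a derivation on a product with b. Only the module action sees
  the factor b (\<open>ac_exm\<close>); the bracket terms in the other slots pass through the
  operator.\<close>

lemma Lie_exm:
 assumes "x = (a, \<alpha>, s)" "x : X" "b : par V \<beta>"
 shows "zs : lists X ==> (!!w. w : lists X ==> pf M (%r. Y r w)) ==>
  Lie \<pi> x (%w. exm b (%r. Y r w) t) zs
   = exm (bk a s b) (%r. Y r zs) (s + t) + sm (\<alpha> * \<beta>) (exm b (%r. Lie (\<pi> + \<beta>) x (Y r) zs) t)"
proof (induction zs arbitrary: Y \<pi>)
 case Nil
 have "a : par V \<alpha>" using assms by simp
 from ac_exm[OF this Nil(2)[of "[]"] assms(3), of s t] show ?case by (simp add: assms(1) xact_simp)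
next
 case (Cons z zs)
 have IH: "Lie (\<pi> + q z) x (%w. exm b (%r. ins (Y r) z w) t) zs
   = exm (bk a s b) (%r. ins (Y r) z zs) (s + t) + sm (\<alpha> * \<beta>) (exm b (%r. Lie (\<pi> + q z + \<beta>) x (ins (Y r) z) zs) t)"
  using Cons.prems(1) by (auto intro!: Cons.IH Cons.prems(2))
 have "pf M (%r. Lie (\<pi> + \<beta> + q z) x (ins (Y r) z) zs)" "pf M (%r. Y r (xbr x z # zs))"
  using Cons.prems(1) assms(2) br_X[of x z] by (auto intro!: pf_Lie Cons.prems(2))
 moreover have "\<pi> + q z + \<beta> = \<pi> + \<beta> + q z" "xp x = \<alpha>" using assms(1) by (auto simp: add_ac)
 ultimately show ?case
  using IH by (simp add: exm_diff exm_sm M.pf_sm sm_diff sm_sm) (cases \<alpha>; cases \<beta>; cases \<pi>; simp add: add.commute)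
qed

text \<open>The bracket slot holds an element that varies with the variables, which
  \<open>PF\<close> does not allow; it is first expanded into fixed elements with polynomial
  factors.\<close>

lemma PF_Lie:
 assumes "a : par V \<alpha>" "afn UNIV \<phi>" "PF Y" "!!l. slin (Y l)"
 shows "PF (%l. Lie \<pi> (a, \<alpha>, \<phi> l) (Y l))"
proof -
 have "ws : lists XF ==> PF Y ==> ALL l. slin (Y l) ==> M.polyfun UNIV (%l. Lie \<pi> (a, \<alpha>, \<phi> l) (Y l) (inst ws l))" for ws
 proof (induction ws arbitrary: Y \<pi>)
  case Nil
  thus ?case by (auto simp: PF_def xact_simp dest: bspec[of _ _ "[]"] intro!: polyfun_ac[OF assms(2)])
 next
  case (Cons w ws)
  obtain b \<beta> \<psi> where w: "w = (b, \<beta>, \<psi>)" by (metis prod_cases3)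
  have b: "b : par V \<beta>" "afn UNIV \<psi>" "ws : lists XF" using Cons w by (auto simp: XF_def)
  have 1: "M.polyfun UNIV (%l. Lie (\<pi> + (1 + \<beta>)) (a, \<alpha>, \<phi> l) (ins (Y l) (b, \<beta>, \<psi> l)) (inst ws l))"
   using Cons.prems b by (intro Cons.IH PF_ins slin_ins allI) auto
  let ?c = "coeff (lbr V a b)"
  have c: "?c k : par V (\<alpha> + \<beta>)" for k
   using lcaV assms(1) b(1) unfolding lca_action_def by blast
  \<comment> \<open>The coefficients of the bracket are fixed homogeneous elements; the dependence
    on \<open>l\<close> is left in the powers and in the value of the slot.\<close>
  have "Y l ((bk a (\<phi> l) b, \<alpha> + \<beta>, \<phi> l + \<psi> l) # inst ws l)
    = (SUM k<=degree (lbr V a b). scl M (\<phi> l ^ k) (Y l ((?c k, \<alpha> + \<beta>, \<phi> l + \<psi> l) # inst ws l)))" for l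
  proof -
   have "inst ws l : lists X" using b(3) by (auto simp: XF_def in_lists_conv_set)
   note L = slinD[OF Cons.prems(3)[rule_format, of l] lists.Nil this]
   show ?thesis
    using LinAt_sum[OF L, of "{..degree (lbr V a b)}" "%k. scl V (\<phi> l ^ k) (?c k)" "\<alpha> + \<beta>" "\<phi> l + \<psi> l"]
     LinAt_D(2)[OF L c]
    by (simp add: bk_def pev_def V.par_scl c)
  qed
  moreover have "M.polyfun UNIV (%l. SUM k<=degree (lbr V a b). scl M (\<phi> l ^ k) (Y l ((?c k, \<alpha> + \<beta>, \<phi> l + \<psi> l) # inst ws l)))"
  proof (intro M.polyfun_sum M.polyfun_afn_pow assms(2))
   fix k
   have "(?c k, \<alpha> + \<beta>, %l. \<phi> l + \<psi> l) # ws : lists XF" using b c afn_add[OF assms(2) b(2)] by (auto simp: XF_def)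
   from Cons.prems(2)[unfolded PF_def, rule_format, OF this]
   show "M.polyfun UNIV (%l. Y l ((?c k, \<alpha> + \<beta>, \<phi> l + \<psi> l) # inst ws l))" by simp
  qed
  ultimately have 2: "M.polyfun UNIV (%l. Y l ((bk a (\<phi> l) b, \<alpha> + \<beta>, \<phi> l + \<psi> l) # inst ws l))" by simp
  show ?case using M.polyfun_diff[OF 1 M.polyfun_sm[OF 2, of "\<alpha> * \<pi>"]] by (simp add: w xbr_simp)
 qed
 thus ?thesis using assms(3,4) by (simp add: PF_def)
qed

lemma PF_Lie_const: "x : X ==> PF (%_. y) ==> slin y ==> PF (%_. Lie \<pi> x y)"
 using PF_Lie[of "fst x" "fst (snd x)" "%_. snd (snd x)" "%_. y"] by (cases x) (simp add: afn_const)

text \<open>In the first slot, the Lie derivative of the product and the bracket with the product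
  each give four terms. Those in which a bracket acts as the outer factor cancel, and the others
  regroup to the Leibniz rule for \<open>Lie\<close>.\<close>

lemma LeibAt_Lie:
 "BC \<pi> y ==> x : X ==> us : lists X ==> vs : lists X ==> LeibAt (\<pi> + xp x) (Lie \<pi> x y) us vs"
proof (induction us arbitrary: y \<pi>)
 case Nil
 obtain a \<alpha> s where x: "x = (a, \<alpha>, s)" by (metis prod_cases3)
 have a: "a : par V \<alpha>" using Nil x by simp
 have y: "slin y" "sleib \<pi> y" "PF (%_. y)" using Nil.prems by (auto simp: BC_def)
 note D = LinAt_D[OF slinD[OF y(1) lists.Nil Nil.prems(4)], simplified]
 have LB: "y ((b * c, \<beta> + \<gamma>, t) # w)
    = sm (\<beta> * \<pi>) (exm b (%r. y ((c, \<gamma>, r) # w)) t) + sm (\<gamma> * (\<beta> + \<pi>)) (exm c (%r. y ((b, \<beta>, r) # w)) t)"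
  if "b : par V \<beta>" "c : par V \<gamma>" "w : lists X" for b c \<beta> \<gamma> t w
  using sleibD[OF y(2) lists.Nil that(3)] that by (simp add: LeibAt_def)
 have pf: "pf M (%r. y ((b, \<beta>, r) # w))" if "b : par V \<beta>" "w : lists X" for b \<beta> w
  using PF_pf[OF y(3) lists.Nil that(2,1)] by simp
 show ?case unfolding LeibAt_def
 proof (intro allI ballI)
  fix \<beta> \<gamma> t b c assume bc: "b : par V \<beta>" "c : par V \<gamma>"
  define \<rho> where "\<rho> = \<pi> + (1 + (\<beta> + \<gamma>))"
  have "Lie \<rho> x (ins y (b * c, \<beta> + \<gamma>, t)) vs
   = Lie \<rho> x (%w. sm (\<beta> * \<pi>) (exm b (%r. ins y (c, \<gamma>, r) w) t)
     + sm (\<gamma> * (\<beta> + \<pi>)) (exm c (%r. ins y (b, \<beta>, r) w) t)) vs"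
   using Nil.prems LB[OF bc] by (intro Lie_cong) auto
  also have "... = sm (\<beta> * \<pi>) (exm (bk a s b) (%r. ins y (c, \<gamma>, r) vs) (s + t)
      + sm (\<alpha> * \<beta>) (exm b (%r. Lie (\<rho> + \<beta>) x (ins y (c, \<gamma>, r)) vs) t))
    + sm (\<gamma> * (\<beta> + \<pi>)) (exm (bk a s c) (%r. ins y (b, \<beta>, r) vs) (s + t)
      + sm (\<alpha> * \<gamma>) (exm c (%r. Lie (\<rho> + \<gamma>) x (ins y (b, \<beta>, r)) vs) t))"
   using Nil.prems bc pf
   by (simp only: Lie_add Lie_sm Lie_exm[OF x Nil.prems(2) bc(1) Nil.prems(4)] Lie_exm[OF x Nil.prems(2) bc(2) Nil.prems(4)])
  finally have 1: "Lie \<rho> x (ins y (b * c, \<beta> + \<gamma>, t)) vs = ..." .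
  have ab: "bk a s b : par V (\<alpha> + \<beta>)" "bk a s c : par V (\<alpha> + \<gamma>)" using bk_par a bc by auto
  have mp: "bk a s b * c : par V (\<alpha> + (\<beta> + \<gamma>))" "bk a s c * b : par V (\<alpha> + (\<beta> + \<gamma>))"
   using mult_par[OF ab(1) bc(2)] mult_par[OF ab(2) bc(1)] by (simp_all add: add_ac)
  \<comment> \<open>The slot with the bracket has the value s + r; translation invariance lets the
    operator act in r.\<close>
  have sh: "exm c (%r. y ((bk a s b, \<alpha> + \<beta>, s + r) # vs)) t = exm c (%r. y ((bk a s b, \<alpha> + \<beta>, r) # vs)) (s + t)"
    "exm b (%r. y ((bk a s c, \<alpha> + \<gamma>, s + r) # vs)) t = exm b (%r. y ((bk a s c, \<alpha> + \<gamma>, r) # vs)) (s + t)"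
   using exm_shift[OF pf[OF ab(1) Nil.prems(4)]] exm_shift[OF pf[OF ab(2) Nil.prems(4)]] by simp_all
  have "y (xbr x (b * c, \<beta> + \<gamma>, t) # vs)
    = y ((bk a s b * c, \<alpha> + \<beta> + \<gamma>, s + t) # vs) + sm (\<beta> * \<gamma>) (y ((bk a s c * b, \<alpha> + \<gamma> + \<beta>, s + t) # vs))"
   using D(1)[OF mp(1) V.par_sm[OF mp(2)]] D(5)[OF mp(2)] by (simp add: x xbr_simp bk_mult[OF bc] add_ac)
  hence 2: "y (xbr x (b * c, \<beta> + \<gamma>, t) # vs) =
    sm ((\<alpha> + \<beta>) * \<pi>) (exm (bk a s b) (%r. y ((c, \<gamma>, r) # vs)) (s + t))
    + sm (\<gamma> * (\<alpha> + \<beta> + \<pi>)) (exm c (%r. y ((bk a s b, \<alpha> + \<beta>, s + r) # vs)) t)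
    + sm (\<beta> * \<gamma>) (sm ((\<alpha> + \<gamma>) * \<pi>) (exm (bk a s c) (%r. y ((b, \<beta>, r) # vs)) (s + t))
    + sm (\<beta> * (\<alpha> + \<gamma> + \<pi>)) (exm b (%r. y ((bk a s c, \<alpha> + \<gamma>, s + r) # vs)) t))"
   by (simp only: LB[OF ab(1) bc(2) Nil.prems(4)] LB[OF ab(2) bc(1) Nil.prems(4)] sh)
  have \<rho>: "\<rho> + \<beta> = \<pi> + (1 + \<gamma>)" "\<rho> + \<gamma> = \<pi> + (1 + \<beta>)"
   by (cases \<beta>; cases \<gamma>; cases \<pi>; simp add: \<rho>_def)+
  have pfL: "pf M (%r. Lie \<pi>' x (ins y (b', \<beta>', r)) vs)" if "b' : par V \<beta>'" for \<pi>' b' \<beta>'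
   using Nil.prems pf that by (intro pf_Lie) auto
  have pfs: "pf M (%r. y ((bk a s b, \<alpha> + \<beta>, s + r) # vs))" "pf M (%r. y ((bk a s c, \<alpha> + \<gamma>, s + r) # vs))"
   using M.pf_shift[OF pf[OF ab(1) Nil.prems(4)]] M.pf_shift[OF pf[OF ab(2) Nil.prems(4)]] by auto
  have 3: "exm c (%r. Lie \<pi> x y ((b, \<beta>, r) # vs)) t
    = exm c (%r. Lie (\<rho> + \<gamma>) x (ins y (b, \<beta>, r)) vs) t - sm (\<alpha> * \<pi>) (exm c (%r. y ((bk a s b, \<alpha> + \<beta>, s + r) # vs)) t)"
   using pfL[OF bc(1)] pfs by (simp add: \<rho> x xbr_simp exm_diff M.pf_sm exm_sm)
  have 4: "exm b (%r. Lie \<pi> x y ((c, \<gamma>, r) # vs)) t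
    = exm b (%r. Lie (\<rho> + \<beta>) x (ins y (c, \<gamma>, r)) vs) t - sm (\<alpha> * \<pi>) (exm b (%r. y ((bk a s c, \<alpha> + \<gamma>, s + r) # vs)) t)"
   using pfL[OF bc(2)] pfs by (simp add: \<rho> x xbr_simp exm_diff M.pf_sm exm_sm)
  have "Lie \<pi> x y ((b * c, \<beta> + \<gamma>, t) # vs) = Lie \<rho> x (ins y (b * c, \<beta> + \<gamma>, t)) vs - sm (\<alpha> * \<pi>) (y (xbr x (b * c, \<beta> + \<gamma>, t) # vs))"
   by (simp add: \<rho>_def x)
  thus "Lie \<pi> x y ([] @ (b * c, \<beta> + \<gamma>, t) # vs) =
    sm (\<beta> * (\<pi> + xp x + qs [])) (exm b (%r. Lie \<pi> x y ([] @ (c, \<gamma>, r) # vs)) t) +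
    sm (\<gamma> * (\<beta> + (\<pi> + xp x + qs []))) (exm c (%r. Lie \<pi> x y ([] @ (b, \<beta>, r) # vs)) t)"
   unfolding append_Nil 1 2 3 4
   by (simp add: x del: Lie.simps) (cases \<alpha>; cases \<beta>; cases \<gamma>; cases \<pi>; simp add: algebra_simps del: Lie.simps)
 qed
next
 case (Cons u us)
 have y: "sleib \<pi> y" "PF (%_. y)" using Cons.prems by (auto simp: BC_def)
 have "LeibAt (\<pi> + q u + xp x) (Lie (\<pi> + q u) x (ins y u)) us vs" using Cons by (auto intro!: Cons.IH BC_ins)
 moreover have "LeibAt \<pi> y (xbr x u # us) vs" using Cons.prems br_X by (intro sleibD[OF y(1)]) auto
 moreover have "pf M (%r. y ((xbr x u # us) @ (b, \<beta>, r) # vs))" if "b : par V \<beta>" for b \<beta>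
  using Cons.prems br_X by (intro PF_pf[OF y(2) _ _ that]) auto
 moreover have "pf M (%r. Lie (\<pi> + q u) x (ins y u) (us @ (b, \<beta>, r) # vs))" if "b : par V \<beta>" for b \<beta>
 proof -
  have "BC (\<pi> + q u) (ins y u)" using BC_ins[OF Cons.prems(1)] Cons.prems(3) by auto
  thus ?thesis using Cons.prems that by (intro PF_pf PF_Lie_const) (auto simp: BC_def)
 qed
 moreover have "\<pi> + q u + xp x + qs us = \<pi> + xp x + (q u + qs us)" "\<pi> + qs (xbr x u # us) = \<pi> + xp x + (q u + qs us)"
  using Cons.prems q_br[of x u] by (auto simp: add_ac)
 ultimately show ?case
  unfolding LeibAt_def append_Cons Lie.simps
  by (simp add: exm_diff exm_sm M.pf_sm sm_diff sm_sm) (simp add: add_ac sm_add sm_sm)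
qed

end

section \<open>The differential of unreduced cochains\<close>

context pvm begin

lemma spar_Lie: "spar \<pi> y ==> x : X ==> spar (\<pi> + xp x) (Lie \<pi> x y)"
 unfolding spar_def[of "\<pi> + xp x"]
proof
 fix zs assume "spar \<pi> y" "x : X" "zs : lists X"
 thus "Lie \<pi> x y zs : par M (1 + (\<pi> + xp x) + qs zs)"
 proof (induction zs arbitrary: y \<pi>)
  case Nil
  obtain a \<alpha> s where x: "x = (a, \<alpha>, s)" by (metis prod_cases3)
  have "y [] : par M (1 + \<pi>)" using bspec[OF Nil.prems(1)[unfolded spar_def], of "[]"] by simp
  thus ?case using ac_par[of a \<alpha> "y []" "1 + \<pi>" s] Nil.prems by (simp add: x xact_simp add_ac)
 next
  case (Cons z zs)
  have 1: "Lie (\<pi> + q z) x (ins y z) zs : par M (1 + (\<pi> + q z + xp x) + qs zs)"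
   using Cons.prems by (intro Cons.IH spar_ins) auto
  have "xbr x z # zs : lists X" using Cons.prems br_X by auto
  from bspec[OF Cons.prems(1)[unfolded spar_def] this]
  have "y (xbr x z # zs) : par M (1 + (\<pi> + q z + xp x) + qs zs)"
   using Cons.prems q_br[of x z] by (simp add: add_ac)
  with 1 have "Lie \<pi> x y (z # zs) : par M (1 + (\<pi> + q z + xp x) + qs zs)"
   by (simp add: M.par_diff M.par_sm)
  moreover have "1 + (\<pi> + q z + xp x) + qs zs = 1 + (\<pi> + xp x) + qs (z # zs)" by (simp add: add_ac)
  ultimately show ?case by (simp only:)
 qed
qed

lemma spar_dd: "spar \<pi> y ==> spar (\<pi> + 1) (dd \<pi> y)"
 unfolding spar_def[of "\<pi> + 1"]
proof
 fix zs assume "spar \<pi> y" "zs : lists X"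
 thus "dd \<pi> y zs : par M (1 + (\<pi> + 1) + qs zs)"
 proof (induction zs arbitrary: y \<pi>)
  case (Cons z zs)
  have z: "z : X" "zs : lists X" using Cons.prems by auto
  have "dd (\<pi> + q z) (ins y z) zs : par M (1 + (\<pi> + q z + 1) + qs zs)"
   using Cons.prems z by (intro Cons.IH spar_ins) auto
  moreover have "Lie \<pi> z y zs : par M (1 + (\<pi> + xp z) + qs zs)"
   using spar_Lie[OF Cons.prems(1) z(1)] z(2) unfolding spar_def by blast
  moreover have "1 + (\<pi> + q z + 1) + qs zs = 1 + (\<pi> + 1) + qs (z # zs)" "1 + (\<pi> + xp z) + qs zs = 1 + (\<pi> + 1) + qs (z # zs)"
   by (simp_all add: q_def add_ac)
  ultimately show ?case by (simp only: dd.simps M.par_add M.par_sm)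
 qed simp
qed

lemma BC_Lie: assumes "BC \<pi> y" "x : X" shows "BC (\<pi> + xp x) (Lie \<pi> x y)"
proof -
 have y: "slin y" "spar \<pi> y" "ssym y" "sleib \<pi> y" "PF (%_. y)" using assms by (auto simp: BC_def)
 show ?thesis unfolding BC_def
 proof (intro conjI)
  show "slin (Lie \<pi> x y)" unfolding slin_def using LinAt_Lie[OF y(1) assms(2)] by blast
  show "ssym (Lie \<pi> x y)" unfolding ssym_def using SymAt_Lie[OF y(3) assms(2)] by blast
  show "sleib (\<pi> + xp x) (Lie \<pi> x y)" unfolding sleib_def using LeibAt_Lie[OF assms] by blast
  show "spar (\<pi> + xp x) (Lie \<pi> x y)" using spar_Lie[OF y(2) assms(2)] .
  show "PF (%_. Lie \<pi> x y)" using PF_Lie_const[OF assms(2) y(5,1)] .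
 qed
qed

lemma LinAt_comb: "LinAt y us vs ==> LinAt y' us vs ==> LinAt (%w. sm c (y w) + y' w) us vs"
 by (auto simp: LinAt_def sm_add M.scl_sm M.scale_right_distrib sm_minus)

lemma SymAt_comb: "SymAt y us vs ==> SymAt y' us vs ==> SymAt (%w. sm c (y w) + y' w) us vs"
 unfolding SymAt_def
proof (intro ballI)
 fix x z assume "ALL x:X. ALL z:X. y (us @ x # z # vs) = sm (q x * q z) (y (us @ z # x # vs))"
  "ALL x:X. ALL z:X. y' (us @ x # z # vs) = sm (q x * q z) (y' (us @ z # x # vs))" "x : X" "z : X"
 hence "y (us @ x # z # vs) = sm (q x * q z) (y (us @ z # x # vs))"
  "y' (us @ x # z # vs) = sm (q x * q z) (y' (us @ z # x # vs))" by blast+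
 thus "sm c (y (us @ x # z # vs)) + y' (us @ x # z # vs) = sm (q x * q z) (sm c (y (us @ z # x # vs)) + y' (us @ z # x # vs))"
  by (simp only: sm_add sm_sm add.commute)
qed

lemma LeibAt_comb:
 assumes "LeibAt \<pi> y us vs" "LeibAt \<pi> y' us vs"
  "!!b \<beta>. b : par V \<beta> ==> pf M (%r. y (us @ (b, \<beta>, r) # vs))" "!!b \<beta>. b : par V \<beta> ==> pf M (%r. y' (us @ (b, \<beta>, r) # vs))"
 shows "LeibAt \<pi> (%w. sm c (y w) + y' w) us vs"
 using assms unfolding LeibAt_def by (simp add: exm_add exm_sm M.pf_sm sm_add sm_sm add_ac)


text \<open>Each property of a slot of \<open>dd y\<close> follows by induction on the number of arguments: for slots other than
  the first one from the corresponding property of \<open>Lie\<close>, and for the first slot by symmetry.\<close>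

lemma SymAt_dd: "BC \<pi> y ==> us : lists X ==> vs : lists X ==> SymAt (dd \<pi> y) us vs"
proof (induction us arbitrary: y \<pi>)
 case Nil
 have y: "slin y" "ssym y" using Nil.prems by (auto simp: BC_def)
 have S: "y (z # w # v) = sm (q z * q w) (y (w # z # v))" if "z : X" "w : X" "v : lists X" for z w v
  using ssymD[OF y(2) lists.Nil that(3)] that(1,2) unfolding SymAt_def append_Nil by blast
 show ?case unfolding SymAt_def append_Nil
 proof (intro ballI)
  fix x z assume xz: "x : X" "z : X"
  have "dd (\<pi> + q x + q z) (%w. y (x # z # w)) vs = sm (q x * q z) (dd (\<pi> + q z + q x) (%w. y (z # x # w)) vs)"
  proof -
   have "dd (\<pi> + q x + q z) (%w. y (x # z # w)) vs = dd (\<pi> + q x + q z) (%w. sm (q x * q z) (y (z # x # w))) vs"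
    by (rule dd_cong[OF Nil.prems(3)]) (rule S[OF xz])
   moreover have "\<pi> + q x + q z = \<pi> + q z + q x" by simp
   ultimately show ?thesis by (simp only: dd_sm)
  qed
  \<comment> \<open>Exchanging x and z exchanges the two Lie derivatives in the expansion; the
    bracket terms match by skew-symmetry, and the rest by the symmetry of \<open>y\<close>.\<close>
  moreover have "y (xbr x z # vs) = - sm (xp x * xp z) (y (xbr z x # vs))"
   using skew_slot[OF slinD[OF y(1) lists.Nil Nil.prems(3)] xz] by simp
  ultimately show "dd \<pi> y (x # z # vs) = sm (q x * q z) (dd \<pi> y (z # x # vs))"
   unfolding dd.simps Lie.simps
   by (cases "xp x"; cases "xp z"; cases \<pi>; simp add: q_def)
 qed
next
 case (Cons u us)
 have "SymAt (Lie \<pi> u y) us vs" using Cons.prems by (intro SymAt_Lie) (auto simp: BC_def)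
 moreover have "SymAt (dd (\<pi> + q u) (ins y u)) us vs" using Cons by (auto intro!: Cons.IH BC_ins)
 ultimately show ?case using SymAt_comb by (auto simp: SymAt_Cons)
qed

lemma PF_dd:
 assumes "PF Y" "ALL l. slin (Y l)" shows "PF (%l. dd \<pi> (Y l))"
proof -
 have "ws : lists XF ==> PF Y ==> ALL l. slin (Y l) ==> M.polyfun UNIV (%l. dd \<pi> (Y l) (inst ws l))" for ws
 proof (induction ws arbitrary: Y \<pi>)
  case (Cons w ws)
  obtain b \<beta> \<psi> where w: "w = (b, \<beta>, \<psi>)" by (metis prod_cases3)
  have b: "b : par V \<beta>" "afn UNIV \<psi>" "ws : lists XF" using Cons w by (auto simp: XF_def)
  have "M.polyfun UNIV (%l. dd (\<pi> + (1 + \<beta>)) (ins (Y l) (b, \<beta>, \<psi> l)) (inst ws l))"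
   using Cons.prems b by (intro Cons.IH PF_ins slin_ins allI) auto
  moreover have "M.polyfun UNIV (%l. Lie \<pi> (b, \<beta>, \<psi> l) (Y l) (inst ws l))"
   using PF_Lie[OF b(1,2) Cons.prems(2)] Cons.prems(3) b(3) unfolding PF_def by blast
  ultimately show ?case by (simp add: w M.polyfun_add M.polyfun_sm)
 qed (simp add: M.polyfun_const)
 thus ?thesis using assms by (simp add: PF_def)
qed

text \<open>If other arguments precede the slot, the first of them is peeled off. If the slot is
  first and another argument follows, symmetry moves the slot to second place. Only a single
  argument remains as the base case.\<close>

lemma slot_induct:
 assumes base: "!!\<pi> y. BC \<pi> y ==> Q (\<pi> + 1) (dd \<pi> y) [] []"
  and sym: "!!\<pi> y v vs. ssym y ==> v : X ==> vs : lists X ==> Q \<pi> y [v] vs ==> Q \<pi> y [] (v # vs)"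
  and cons: "!!\<pi> y u us vs. BC \<pi> y ==> u : X ==> us : lists X ==> vs : lists X ==>
   Q (\<pi> + q u + 1) (dd (\<pi> + q u) (ins y u)) us vs ==> Q (\<pi> + 1) (dd \<pi> y) (u # us) vs"
 shows "BC \<pi> y ==> us : lists X ==> vs : lists X ==> Q (\<pi> + 1) (dd \<pi> y) us vs"
proof (induction "length us + length vs" arbitrary: \<pi> y us vs)
 case 0
 thus ?case using base by simp
next
 case (Suc n)
 have step: "Q (\<pi> + 1) (dd \<pi> y) (u # us') vs'" if "u : X" "us' : lists X" "vs' : lists X" "n = length us' + length vs'" for u us' vs'
  using that Suc.hyps(1)[OF that(4) BC_ins[OF Suc.prems(1) that(1)] that(2,3)] by (intro cons Suc.prems)
 show ?case
 proof (cases us)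
  case Nil
  then obtain v vs' where v: "vs = v # vs'" using Suc.hyps(2) by (cases vs) auto
  have "ssym (dd \<pi> y)" unfolding ssym_def using SymAt_dd Suc.prems by blast
  thus ?thesis using sym step[of v "[]" vs'] Suc v Nil by auto
 next
  case (Cons u us')
  thus ?thesis using step Suc by auto
 qed
qed

lemma sym_head:
 assumes "ssym y" "v : X" "vs : lists X" "x : X"
 shows "y (x # v # vs) = sm (q x * q v) (y (v # x # vs))"
 using ssymD[OF assms(1) lists.Nil assms(3)] assms unfolding SymAt_def append_Nil by blast

lemma LinAt_dd: "BC \<pi> y ==> us : lists X ==> vs : lists X ==> LinAt (dd \<pi> y) us vs"
proof (rule slot_induct[where Q = "%_. LinAt"])
 fix \<pi> y assume "BC \<pi> y"
 show "LinAt (dd \<pi> y) [] []"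
  by (auto simp: LinAt_def xact_simp lin_add[OF ac_lin1] lin_scl[OF ac_lin1] ac_sesq1 sm_add M.scl_sm sm_minus)
next
 fix y v vs assume *: "ssym y" "v : X" "vs : lists X" "LinAt y [v] vs"
 have H: "y ((a, \<alpha>, t) # v # vs) = sm ((1 + \<alpha>) * q v) (y (v # (a, \<alpha>, t) # vs))" if "a : par V \<alpha>" for a \<alpha> t
  using sym_head[OF *(1-3), of "(a, \<alpha>, t)"] that by simp
 show "LinAt y [] (v # vs)"
  using *(4) by (auto simp: LinAt_def H V.par_add V.par_scl V.der_par sm_add M.scl_sm sm_minus)
next
 fix \<pi> y u us vs assume *: "BC \<pi> y" "u : X" "us : lists X" "vs : lists X" "LinAt (dd (\<pi> + q u) (ins y u)) us vs"
 have "LinAt (Lie \<pi> u y) us vs" using * by (intro LinAt_Lie) (auto simp: BC_def)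
 from LinAt_comb[OF this *(5)] show "LinAt (dd \<pi> y) (u # us) vs" by (simp add: LinAt_Cons)
qed

text \<open>For a single argument d y is, up to sign, the action on an element of \<open>M\<close>,
  and the claim is the module axiom for a product acting.\<close>

lemma LeibAt_dd: "BC \<pi> y ==> us : lists X ==> vs : lists X ==> LeibAt (\<pi> + 1) (dd \<pi> y) us vs"
proof -
 have pfc: "pf M (%t. dd \<pi> y (us @ (a, \<alpha>, t) # vs))" if "BC \<pi> y" "us : lists X" "vs : lists X" "a : par V \<alpha>" for \<pi> y us vs a \<alpha>
  using that PF_dd[of "%_. y" \<pi>] by (intro PF_pf) (auto simp: BC_def)
 \<comment> \<open>Polynomiality in the slot is carried along: the symmetry step moves a sign
   through the exponential operator, which needs it.\<close>
 define Q where "Q \<pi> y us vs \<longleftrightarrow> LeibAt \<pi> y us vs & (ALL b \<beta>. b : par V \<beta> --> pf M (%r. y (us @ (b, \<beta>, r) # vs)))" for \<pi> y us vs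
 have "BC \<pi> y ==> us : lists X ==> vs : lists X ==> Q (\<pi> + 1) (dd \<pi> y) us vs"
 proof (rule slot_induct[where Q = Q])
  fix \<pi> y assume y: "BC \<pi> y"
  have pa: "pf M (%r. ac c r m)" for c m unfolding ac_def by simp
  have "LeibAt (\<pi> + 1) (dd \<pi> y) [] []"
   unfolding LeibAt_def
  proof (intro allI ballI)
   fix \<beta> \<gamma> t b c assume bc: "b : par V \<beta>" "c : par V \<gamma>"
   show "dd \<pi> y ([] @ [(b * c, \<beta> + \<gamma>, t)]) =
    sm (\<beta> * (\<pi> + 1 + qs [])) (exm b (%r. dd \<pi> y ([] @ [(c, \<gamma>, r)])) t) +
    sm (\<gamma> * (\<beta> + (\<pi> + 1 + qs []))) (exm c (%r. dd \<pi> y ([] @ [(b, \<beta>, r)])) t)"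
    by (simp add: xact_simp ac_mult[OF bc] exm_sm[OF pa] exm_neg[OF pa])
     (cases \<beta>; cases \<gamma>; cases \<pi>; simp add: exm_sm[OF pa] exm_neg[OF pa])
  qed
  thus "Q (\<pi> + 1) (dd \<pi> y) [] []" unfolding Q_def using pfc[OF y, of "[]" "[]"] by auto
 next
  fix \<pi> y v vs assume *: "ssym y" "v : X" "vs : lists X" "Q \<pi> y [v] vs"
  have H: "y ((a, \<alpha>, t) # v # vs) = sm ((1 + \<alpha>) * q v) (y (v # (a, \<alpha>, t) # vs))" if "a : par V \<alpha>" for a \<alpha> t
   using sym_head[OF *(1-3), of "(a, \<alpha>, t)"] that by simp
  have pf: "pf M (%r. y (v # (b, \<beta>, r) # vs))" if "b : par V \<beta>" for b \<beta> using *(4) that by (simp add: Q_def)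
  have "LeibAt \<pi> y [] (v # vs)" unfolding LeibAt_def
  proof (intro allI ballI)
   fix \<beta> \<gamma> t b c assume bc: "b : par V \<beta>" "c : par V \<gamma>"
   have "y (v # (b * c, \<beta> + \<gamma>, t) # vs) =
      sm (\<beta> * (\<pi> + q v)) (exm b (%r. y (v # (c, \<gamma>, r) # vs)) t) +
      sm (\<gamma> * (\<beta> + (\<pi> + q v))) (exm c (%r. y (v # (b, \<beta>, r) # vs)) t)"
    using *(4) bc by (simp add: Q_def LeibAt_def)
   thus "y ([] @ (b * c, \<beta> + \<gamma>, t) # v # vs) = sm (\<beta> * (\<pi> + qs [])) (exm b (%r. y ([] @ (c, \<gamma>, r) # v # vs)) t) +
      sm (\<gamma> * (\<beta> + (\<pi> + qs []))) (exm c (%r. y ([] @ (b, \<beta>, r) # v # vs)) t)"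
    using H[OF mult_par[OF bc]] H[OF bc(1)] H[OF bc(2)] pf[OF bc(1)] pf[OF bc(2)]
    by (simp add: exm_sm) (cases \<beta>; cases \<gamma>; cases \<pi>; cases "q v"; simp)
  qed
  moreover have "pf M (%r. y ((b, \<beta>, r) # v # vs))" if "b : par V \<beta>" for b \<beta>
   using H[OF that] pf[OF that] by (simp add: M.pf_sm)
  ultimately show "Q \<pi> y [] (v # vs)" unfolding Q_def by simp
 next
  fix \<pi> y u us vs assume *: "BC \<pi> y" "u : X" "us : lists X" "vs : lists X" "Q (\<pi> + q u + 1) (dd (\<pi> + q u) (ins y u)) us vs"
  have "LeibAt (\<pi> + xp u) (Lie \<pi> u y) us vs" by (rule LeibAt_Lie[OF *(1-4)])
  moreover have e: "\<pi> + q u + 1 = \<pi> + xp u" "\<pi> + 1 + q u = \<pi> + xp u" by (simp_all add: q_def add_ac)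
  moreover have "LeibAt (\<pi> + xp u) (dd (\<pi> + q u) (ins y u)) us vs" using *(5) unfolding Q_def e by blast
  moreover have "pf M (%t. Lie \<pi> u y (us @ (a, \<alpha>, t) # vs))" if "a : par V \<alpha>" for a \<alpha>
   using * that by (intro PF_pf PF_Lie_const) (auto simp: BC_def)
  ultimately have "LeibAt (\<pi> + xp u) (ins (dd \<pi> y) u) us vs"
   using *(5) unfolding Q_def dd.simps by (intro LeibAt_comb) auto
  hence "LeibAt (\<pi> + 1) (dd \<pi> y) (u # us) vs" unfolding LeibAt_Cons e .
  moreover have "pf M (%t. dd \<pi> y ((u # us) @ (a, \<alpha>, t) # vs))" if "a : par V \<alpha>" for a \<alpha>
   using * by (intro pfc that) auto
  ultimately show "Q (\<pi> + 1) (dd \<pi> y) (u # us) vs" unfolding Q_def by blast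
 qed
 thus "BC \<pi> y ==> us : lists X ==> vs : lists X ==> LeibAt (\<pi> + 1) (dd \<pi> y) us vs" unfolding Q_def by blast
qed

lemma BC_dd: assumes "BC \<pi> y" shows "BC (\<pi> + 1) (dd \<pi> y)"
proof -
 have y: "slin y" "spar \<pi> y" "PF (%_. y)" using assms by (auto simp: BC_def)
 show ?thesis unfolding BC_def
 proof (intro conjI)
  show "slin (dd \<pi> y)" unfolding slin_def using LinAt_dd[OF assms] by blast
  show "ssym (dd \<pi> y)" unfolding ssym_def using SymAt_dd[OF assms] by blast
  show "sleib (\<pi> + 1) (dd \<pi> y)" unfolding sleib_def using LeibAt_dd[OF assms] by blast
  show "spar (\<pi> + 1) (dd \<pi> y)" using spar_dd[OF y(2)] .
  show "PF (%_. dd \<pi> y)" using PF_dd[of "%_. y"] y by simp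
 qed
qed

end

section \<open>Contractions with the Virasoro element and the energy operator\<close>

context superspace begin

lemma cof_affine: "pf S p ==> cof S (%t. scl S (k + d * t) (p t)) n
  = scl S k (cof S p n) + scl S d (case n of 0 => 0 | Suc j => cof S p j)"
proof -
 assume p: "pf S p"
 have "(%t. scl S (k + d * t) (p t)) = (%t. scl S k (p t) + scl S d (scl S t (p t)))"
  by (simp add: scale_left_distrib)
 thus ?thesis using p by (simp only: cof_add cof_scl pf_scl pf_var cof_var)
qed

lemma pev_at_0: "pev S p 0 = coeff p 0"
 by (cases p) (simp add: pev_pCons)

lemma cof_pow_1: "pf S p ==> cof S (%t. scl S (t ^ k) (p t)) 1 = (if k = 0 then cof S p 1 else 0) + (if k = 1 then p 0 else 0)"
proof -
 assume p: "pf S p"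
 have pk: "pf S (%t. scl S (t ^ j) (p t))" for j
 proof (induction j)
  case (Suc j)
  thus ?case using pf_var[OF Suc.IH] by simp
 qed (use p in simp)
 show ?thesis
 proof (cases k)
  case (Suc j)
  have "cof S (%t. scl S t (scl S (t ^ j) (p t))) 1 = cof S (%t. scl S (t ^ j) (p t)) 0"
   using cof_var[OF pk, of j 1] by simp
  thus ?thesis using Suc p by (simp add: cof_at_0[OF pk] power_0_left)
 qed simp
qed

end

context pvm begin

lemma BC_cong:
 assumes "BC \<pi> y" "!!xs. xs : lists X ==> y xs = y' xs" shows "BC \<pi> y'"
proof -
 have e: "y (us @ (a, \<alpha>, t) # vs) = y' (us @ (a, \<alpha>, t) # vs)" if "us : lists X" "vs : lists X" "a : par V \<alpha>" for us vs a \<alpha> t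
  using assms(2)[of "us @ (a, \<alpha>, t) # vs"] that by simp
 have LA: "LinAt y us vs ==> LinAt y' us vs" if "us : lists X" "vs : lists X" for us vs
  unfolding LinAt_def by (simp add: e[symmetric] that V.par_add V.par_scl V.der_par)
 have SA: "SymAt y us vs ==> SymAt y' us vs" if "us : lists X" "vs : lists X" for us vs
  unfolding SymAt_def
 proof (intro ballI)
  fix x z assume *: "ALL x:X. ALL z:X. y (us @ x # z # vs) = sm (q x * q z) (y (us @ z # x # vs))" "x : X" "z : X"
  have "y (us @ x # z # vs) = y' (us @ x # z # vs)" "y (us @ z # x # vs) = y' (us @ z # x # vs)"
   using assms(2) that *(2,3) by auto
  thus "y' (us @ x # z # vs) = sm (q x * q z) (y' (us @ z # x # vs))" using * by metis
 qed
 have BA: "LeibAt \<pi> y us vs ==> LeibAt \<pi> y' us vs" if "us : lists X" "vs : lists X" for us vs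
  unfolding LeibAt_def by (simp add: e[symmetric] that mult_par)
 have "PF (%_. y) ==> PF (%_. y')"
  unfolding PF_def
 proof
  fix ws assume *: "ALL ws:lists XF. M.polyfun UNIV (%l. y (inst ws l))" "ws : lists XF"
  have "inst ws l : lists X" for l using *(2) by (auto simp: XF_def in_lists_conv_set)
  hence "(%l. y (inst ws l)) = (%l. y' (inst ws l))" using assms(2) by auto
  thus "M.polyfun UNIV (%l. y' (inst ws l))" using * by metis
 qed
 thus ?thesis
  using assms LA SA BA by (simp add: BC_def slin_def ssym_def sleib_def spar_def)
qed

text \<open>The sign on one summand makes the rule cover differences as well as sums.\<close>

lemma BC_add: assumes "BC \<pi> y" "BC \<pi> y'" shows "BC \<pi> (%w. sm c (y w) + y' w)"
proof -
 have pf: "pf M (%r. y (us @ (b, \<beta>, r) # vs))" "pf M (%r. y' (us @ (b, \<beta>, r) # vs))"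
  if "us : lists X" "vs : lists X" "b : par V \<beta>" for us vs b \<beta>
  using assms that by (auto simp: BC_def intro!: PF_pf)
 show ?thesis
  using assms LinAt_comb SymAt_comb LeibAt_comb[OF _ _ pf]
  by (auto simp: BC_def slin_def ssym_def sleib_def spar_def PF_def intro!: M.par_add M.par_sm M.polyfun_add M.polyfun_sm)
qed

lemma BC_0: "BC \<pi> (%_. 0)"
 by (auto simp: BC_def slin_def ssym_def sleib_def spar_def PF_def LinAt_def SymAt_def LeibAt_def M.polyfun_const)

lemma BC_sm: "BC \<pi> y ==> BC \<pi> (%w. sm c (y w))"
 using BC_add[OF _ BC_0] by simp

lemma BC_scl: assumes "BC \<pi> y" shows "BC \<pi> (%w. scl M c (y w))"
proof -
 have pf: "pf M (%r. y (us @ (b, \<beta>, r) # vs))" if "us : lists X" "vs : lists X" "b : par V \<beta>" for us vs b \<beta>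
  using assms that by (auto simp: BC_def intro!: PF_pf)
 have S: "SymAt y us vs ==> SymAt (%w. scl M c (y w)) us vs" for us vs
  unfolding SymAt_def by (metis M.scl_sm)
 have LL: "LeibAt \<pi> y us vs ==> LeibAt \<pi> (%w. scl M c (y w)) us vs" if "us : lists X" "vs : lists X" for us vs
  unfolding LeibAt_def by (simp add: exm_scl pf[OF that] M.scl_sm M.scale_right_distrib)
 have A: "LinAt y us vs ==> LinAt (%w. scl M c (y w)) us vs" for us vs
  by (auto simp: LinAt_def M.scale_right_distrib mult.commute)
 show ?thesis
  using assms S LL A
  by (auto simp: BC_def slin_def ssym_def sleib_def spar_def PF_def intro!: M.par_scl M.polyfun_scl)
qed

text \<open>All conditions relate arguments of one fixed length, except the passage through zero, so
  a cochain can be cut down to a single degree.\<close>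

lemma BC_restrict:
 assumes "BC \<pi> y" shows "BC \<pi> (%w. if length w = n then y w else 0)"
proof -
 have "LinAt y us vs ==> LinAt (%w. if length w = n then y w else 0) us vs" for us vs
  by (auto simp: LinAt_def)
 moreover have "SymAt y us vs ==> SymAt (%w. if length w = n then y w else 0) us vs" for us vs
  unfolding SymAt_def
 proof (intro ballI)
  fix x z assume "ALL x:X. ALL z:X. y (us @ x # z # vs) = sm (q x * q z) (y (us @ z # x # vs))" "x : X" "z : X"
  hence "y (us @ x # z # vs) = sm (q x * q z) (y (us @ z # x # vs))" by blast
  thus "(if length (us @ x # z # vs) = n then y (us @ x # z # vs) else 0)
   = sm (q x * q z) (if length (us @ z # x # vs) = n then y (us @ z # x # vs) else 0)" by simp
 qed
 moreover have "LeibAt \<pi> y us vs ==> LeibAt \<pi> (%w. if length w = n then y w else 0) us vs" for us vs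
  by (cases "length us + length vs + 1 = n") (auto simp: LeibAt_def)
 moreover have "M.polyfun UNIV (%l. y (inst ws l)) ==> M.polyfun UNIV (%l. if length (inst ws l) = n then y (inst ws l) else 0)" for ws
  by (cases "length ws = n") (auto simp: M.polyfun_const)
 ultimately show ?thesis
  using assms by (simp add: BC_def slin_def ssym_def sleib_def spar_def PF_def)
qed

lemma L_par [simp]: "L : par V 0" and L_0: "coeff (lbr V L a) 0 = der V a" and LM_0: "coeff (vact M L m) 0 = der M m"
 and L_L: "coeff (lbr V L L) 1 = scl V 2 L"
 using conformal_pva conformal_module unfolding conformal_pva_def conformal_module_def by (blast, blast, blast, auto)

definition xL :: "'f => 'v \<times> bit \<times> 'f" where "xL t = (L, 0, t)"

lemma xL_simps [simp]: "xL t : X" "xp (xL t) = 0" "q (xL t) = 1"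
 by (auto simp: xL_def)

definition i0 :: "(('v \<times> bit \<times> 'f) list => 'm) => ('v \<times> bit \<times> 'f) list => 'm" where
 "i0 y = ins y (xL 0)"

definition i1 :: "(('v \<times> bit \<times> 'f) list => 'm) => ('v \<times> bit \<times> 'f) list => 'm" where
 "i1 y w = cof M (%t. y (xL t # w)) 1"

definition lsum :: "('v \<times> bit \<times> 'f) list => 'f" where "lsum xs = (\<Sum>(a, \<alpha>, t)\<leftarrow>xs. t)"

lemma lsum_simps [simp]: "lsum [] = 0" "lsum ((a, \<alpha>, t) # xs) = t + lsum xs" "lsum (xs @ ys) = lsum xs + lsum ys"
 by (auto simp: lsum_def)

definition TT :: "(('v \<times> bit \<times> 'f) list => 'm) => ('v \<times> bit \<times> 'f) list => 'm" where
 "TT y xs = der M (y xs) + scl M (lsum xs) (y xs)"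

text \<open>Each argument contributes its share 1 of the summand n, the term with L_(1) on the
  element, and \<lambda> d/d\<lambda> in its variable.\<close>

fun En :: "(('v \<times> bit \<times> 'f) list => 'm) => ('v \<times> bit \<times> 'f) list => 'm" where
 "En y [] = coeff (vact M L (y [])) 1"
| "En y ((a, \<alpha>, t) # zs) = En (ins y (a, \<alpha>, t)) zs - y ((coeff (lbr V L a) 1, \<alpha>, t) # zs)
   + y ((a, \<alpha>, t) # zs) + scl M t (Dv M (%r. y ((a, \<alpha>, r) # zs)) t)"

lemma ac_L_0: "ac L 0 m = der M m" and bk_L_0: "bk L 0 b = der V b"
 by (simp_all add: ac_def bk_def L_0 LM_0 M.pev_at_0 V.pev_at_0)

text \<open>At \<lambda> = 0 the Virasoro element acts as \<partial> on both \<open>V\<close> and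
  \<open>M\<close>; in a slot \<partial> is minus the value of the variable, so the slots together
  contribute the sum of the variables.\<close>

lemma Lie_L0: "slin y ==> xs : lists X ==> Lie \<pi> (xL 0) y xs = TT y xs"
proof (induction xs arbitrary: y \<pi>)
 case Nil
 thus ?case by (simp add: xL_def xact_simp ac_L_0 TT_def)
next
 case (Cons z zs)
 obtain b \<beta> t where z: "z = (b, \<beta>, t)" by (metis prod_cases3)
 have b: "b : par V \<beta>" "zs : lists X" using Cons.prems z by auto
 have "Lie (\<pi> + (1 + \<beta>)) (xL 0) (ins y z) zs = TT (ins y z) zs" using Cons.prems by (intro Cons.IH slin_ins) auto
 moreover have "y ((der V b, \<beta>, t) # zs) = - scl M t (y ((b, \<beta>, t) # zs))"
  using LinAt_D(3)[OF slinD[OF Cons.prems(1) lists.Nil b(2)] b(1)] by simp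
 ultimately show ?case
  by (simp add: z xL_def xbr_simp bk_L_0 TT_def M.scale_left_distrib)
qed

text \<open>By \<open>Lie_L0\<close> this operator is a Lie derivative, so nothing has to be checked
  anew.\<close>

lemma BC_TT: "BC \<pi> y ==> BC \<pi> (TT y)"
 using BC_cong[OF BC_Lie[of \<pi> y "xL 0"]] Lie_L0[of y] by (simp add: BC_def)

lemma TT_dd: "BC \<pi> y ==> xs : lists X ==> dd \<pi> (TT y) xs = TT (dd \<pi> y) xs"
proof -
 assume y: "BC \<pi> y" and xs: "xs : lists X"
 have s: "slin y" "slin (dd \<pi> y)" using y BC_dd[OF y] by (auto simp: BC_def)
 have "dd \<pi> (TT y) xs = dd \<pi> (Lie \<pi> (xL 0) y) xs" by (rule dd_cong[OF xs]) (simp add: Lie_L0[OF s(1)])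
 also have "... = Lie (\<pi> + 1) (xL 0) (dd \<pi> y) xs"
  using dd_Lie[OF BC_jac[OF s(1)] xs, of "xL 0" \<pi>] by simp
 finally show ?thesis by (simp add: Lie_L0[OF s(2) xs])
qed

lemma BC_i0: "BC \<pi> y ==> BC (\<pi> + 1) (i0 y)"
 using BC_ins[of \<pi> y "xL 0"] by (simp add: i0_def)

lemma pf2_cof: "pf2 F ==> pf M (%r. cof M (%t. F t r) k)"
proof (induction arbitrary: k rule: pf2_induct)
 case (const m)
 thus ?case by simp
next
 case (add F G)
 thus ?case using pf2_pf[OF pf2_flip[OF add.hyps(1)]] pf2_pf[OF pf2_flip[OF add.hyps(2)]]
  by (simp add: M.cof_add M.pf_add)
next
 case (aff F k' d e)
 have "k' + d * t + e * r = (k' + e * r) + d * t" for t r by simp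
 hence "(%r. cof M (%t. scl M (k' + d * t + e * r) (F t r)) k)
  = (%r. scl M (k' + e * r) (cof M (%t. F t r) k) + scl M d (case k of 0 => 0 | Suc j => cof M (%t. F t r) j))"
  using pf2_pf[OF pf2_flip[OF aff.hyps]] by (simp only: M.cof_affine)
 thus ?case using aff.IH by (cases k) (simp_all add: pf_affine M.pf_add M.pf_scl)
qed

text \<open>Extracting a coefficient in one variable does not interfere with the operator in another
  one. This is why \<open>i1\<close> preserves the Leibniz rules.\<close>

lemma cof_exm: "pf2 F ==> cof M (%t. exm b (F t) r) k = exm b (%r. cof M (%t. F t r) k) r"
proof (induction arbitrary: k b rule: pf2_induct)
 case (const m)
 thus ?case by (simp add: exm_const M.cof_const lin_0[OF vm_lin2])
next
 case (add F G)
 have "cof M (%t. F t r + G t r) k = cof M (%t. F t r) k + cof M (%t. G t r) k" for r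
  using pf2_pf[OF pf2_flip[OF add.hyps(1)]] pf2_pf[OF pf2_flip[OF add.hyps(2)]] by (simp add: M.cof_add)
 thus ?case using add by (simp add: exm_add pf2_pf pf2_exm M.cof_add pf2_cof)
next
 case (aff F k' d e)
 have c: "k' + d * t + e * r = (k' + e * r) + d * t" for t r by simp
 have "exm b (%r. scl M (k' + d * t + e * r) (F t r)) r = scl M ((k' + e * r) + d * t) (exm b (F t) r) + scl M e (exm (der V b) (F t) r)" for t
  using exm_affine[OF pf2_pf[OF aff.hyps], of b "k' + d * t" e t r] unfolding c .
 hence "cof M (%t. exm b (%r. scl M (k' + d * t + e * r) (F t r)) r) k
   = scl M (k' + e * r) (cof M (%t. exm b (F t) r) k) + scl M d (case k of 0 => 0 | Suc j => cof M (%t. exm b (F t) r) j)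
    + scl M e (cof M (%t. exm (der V b) (F t) r) k)"
  using pf2_exm[OF aff.hyps] by (simp only: M.cof_add M.cof_scl M.cof_affine pf_affine M.pf_scl)
 moreover have "cof M (%t. scl M (k' + d * t + e * r) (F t r)) k
  = scl M (k' + e * r) (cof M (%t. F t r) k) + scl M d (case k of 0 => 0 | Suc j => cof M (%t. F t r) j)" for r
  using pf2_pf[OF pf2_flip[OF aff.hyps]] unfolding c by (simp only: M.cof_affine)
 ultimately show ?case
  using pf2_cof[OF aff.hyps]
  by (cases k) (simp_all add: aff.IH exm_affine exm_add exm_scl pf_affine M.pf_scl add_ac)
qed

lemma PF_pf2':
 assumes "PF (%_. y)" "x1 : lists X" "x2 : lists X" "x3 : lists X" "a : par V \<alpha>" "b : par V \<beta>"
 shows "pf2 (%r t. y (x1 @ (a, \<alpha>, r) # x2 @ (b, \<beta>, t) # x3))"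
proof -
 obtain w1 w2 w3 where w: "w1 : lists XF" "!!l. inst w1 l = x1" "w2 : lists XF" "!!l. inst w2 l = x2" "w3 : lists XF" "!!l. inst w3 l = x3"
  using PF_const_inst assms by metis
 hence "w1 @ (a, \<alpha>, %l. l 0) # w2 @ (b, \<beta>, %l. l 1) # w3 : lists XF" using assms by (auto simp: XF_def afn_var)
 from assms(1)[unfolded PF_def, rule_format, OF this] w
 have "M.polyfun UNIV (%l. y (x1 @ (a, \<alpha>, l 0) # x2 @ (b, \<beta>, l 1) # x3))" by simp
 thus ?thesis unfolding pf2_def
  by (intro exI[of _ "%l. y (x1 @ (a, \<alpha>, l 0) # x2 @ (b, \<beta>, l 1) # x3)"] exI[of _ "%_. 0"] exI[of _ "%i. if i = 0 then 1 else 0"] exI[of _ "%i. if i = 0 then 0 else 1"]) auto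
qed

text \<open>Renumbers the variables from 1, so that variable 0 is free for the inserted Virasoro
  element.\<close>

definition shiftw :: "('v \<times> bit \<times> ((nat => 'f) => 'f)) list => ('v \<times> bit \<times> ((nat => 'f) => 'f)) list" where
 "shiftw ws = map (%(a, \<alpha>, \<phi>). (a, \<alpha>, %l. \<phi> (%i. l (Suc i)))) ws"

lemma shiftw: "ws : lists XF ==> shiftw ws : lists XF" "inst (shiftw ws) l = inst ws (%i. l (Suc i))"
 by (auto simp: shiftw_def XF_def in_lists_conv_set intro!: afn_subst[where \<phi> = "%i l. l (Suc i)"] afn_var)

lemma BC_i1: assumes "BC \<pi> y" shows "BC (\<pi> + 1) (i1 y)"
proof -
 have y: "slin y" "spar \<pi> y" "ssym y" "sleib \<pi> y" "PF (%_. y)" using assms by (auto simp: BC_def)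
 have pf: "pf M (%t. y (xL t # w))" if "w : lists X" for w
  using PF_pf[OF y(5) lists.Nil that L_par] by (simp add: xL_def)
 have A: "LinAt (i1 y) us vs" if uv: "us : lists X" "vs : lists X" for us vs
 proof -
  have p: "pf M (%t. y (xL t # us @ (a, \<alpha>, r) # vs))" if "a : par V \<alpha>" for a \<alpha> r using pf that uv by simp
  have "LinAt y (xL t # us) vs" for t using uv by (intro slinD y) auto
  note D = LinAt_D[OF this, simplified]
  show ?thesis unfolding LinAt_def
   by (auto simp: i1_def D M.cof_add M.cof_scl M.cof_neg M.pf_scl p)
 qed
 have B: "SymAt (i1 y) us vs" if uv: "us : lists X" "vs : lists X" for us vs
  unfolding SymAt_def
 proof (intro ballI)
  fix x z assume xz: "x : X" "z : X"
  have "y (xL t # us @ x # z # vs) = sm (q x * q z) (y (xL t # us @ z # x # vs))" for t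
  proof -
   have "SymAt y (xL t # us) vs" using uv by (intro ssymD[OF y(3)]) auto
   thus ?thesis using xz unfolding SymAt_def append_Cons by blast
  qed
  moreover have "pf M (%t. y (xL t # us @ z # x # vs))" using pf uv xz by auto
  ultimately show "i1 y (us @ x # z # vs) = sm (q x * q z) (i1 y (us @ z # x # vs))"
   unfolding i1_def by (simp only: M.cof_sm)
 qed
 have C: "LeibAt (\<pi> + 1) (i1 y) us vs" if uv: "us : lists X" "vs : lists X" for us vs
  unfolding LeibAt_def
 proof (intro allI ballI)
  fix \<beta> \<gamma> t b c assume bc: "b : par V \<beta>" "c : par V \<gamma>"
  have e: "y (xL r # us @ (b * c, \<beta> + \<gamma>, t) # vs) =
    sm (\<beta> * (\<pi> + 1 + qs us)) (exm b (%t. y (xL r # us @ (c, \<gamma>, t) # vs)) t)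
     + sm (\<gamma> * (\<beta> + (\<pi> + 1 + qs us))) (exm c (%t. y (xL r # us @ (b, \<beta>, t) # vs)) t)" for r
  proof -
   have "LeibAt \<pi> y (xL r # us) vs" using uv by (intro sleibD[OF y(4)]) auto
   thus ?thesis using bc unfolding LeibAt_def by (simp add: add.assoc)
  qed
  have p2: "pf2 (%r t. y (xL r # us @ (b, \<beta>, t) # vs))" if "b : par V \<beta>" for b \<beta>
   using PF_pf2'[OF y(5) lists.Nil uv L_par that] by (simp add: xL_def)
  show "i1 y (us @ (b * c, \<beta> + \<gamma>, t) # vs) =
    sm (\<beta> * (\<pi> + 1 + qs us)) (exm b (%r. i1 y (us @ (c, \<gamma>, r) # vs)) t) +
    sm (\<gamma> * (\<beta> + (\<pi> + 1 + qs us))) (exm c (%r. i1 y (us @ (b, \<beta>, r) # vs)) t)"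
   unfolding i1_def e
   using pf2_exm[OF p2[OF bc(1)]] pf2_exm[OF p2[OF bc(2)]]
   by (simp only: M.cof_add M.cof_sm M.pf_sm cof_exm[OF p2[OF bc(1)]] cof_exm[OF p2[OF bc(2)]])
 qed
 have D: "i1 y xs : par M (1 + (\<pi> + 1) + qs xs)" if "xs : lists X" for xs
  unfolding i1_def
 proof (rule M.cof_par[OF pf[OF that]])
  fix t
  have "xL t # xs : lists X" using that by simp
  from bspec[OF y(2)[unfolded spar_def] this] show "y (xL t # xs) : par M (1 + (\<pi> + 1) + qs xs)"
   by (simp add: add_ac)
 qed
 have "M.polyfun UNIV (%l. i1 y (inst ws l))" if "ws : lists XF" for ws
 proof -
  have "(L, 0, %l. l 0) # shiftw ws : lists XF" using shiftw(1)[OF that] by (auto simp: XF_def afn_var)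
  from y(5)[unfolded PF_def, rule_format, OF this]
  have "M.polyfun UNIV (%l. y (xL (l 0) # inst ws (%i. l (Suc i))))" by (simp add: shiftw(2) xL_def)
  from M.polyfun_cof[OF this, of 1] show ?thesis by (simp add: i1_def)
 qed
 thus ?thesis using A B C D
  by (simp add: BC_def slin_def ssym_def sleib_def spar_def PF_def)
qed

lemma coeff_L_par: assumes "a : par V \<alpha>" shows "coeff (lbr V L a) k : par V \<alpha>"
proof -
 have "coeff (lbr V L a) k : par V (0 + \<alpha>)" using lcaV L_par assms unfolding lca_action_def by blast
 thus ?thesis by simp
qed

lemma pf_Lie_L: assumes "BC \<pi> y" "xs : lists X" shows "pf M (%t. Lie \<pi>' (xL t) y xs)"
proof -
 have P: "PF (%l. Lie \<pi>' (L, 0, l 0) y)" using assms by (intro PF_Lie) (auto simp: BC_def afn_var)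
 obtain ws where w: "ws : lists XF" "!!l. inst ws l = xs" using PF_const_inst[OF assms(2)] by blast
 from bspec[OF P[unfolded PF_def] w(1)] have "M.polyfun UNIV (%l. Lie \<pi>' (L, 0, l 0) y xs)" by (simp only: w)
 from M.pf_polyfun_upd[OF this, of undefined 0] show ?thesis by (simp add: xL_def)
qed

text \<open>The linear term in t of the Lie derivative along L at the value t. L is even, so the
  sign parameter \<pi> has no effect on the result.\<close>

lemma cof_Lie_L: "BC \<rho> y ==> xs : lists X ==> cof M (%t. Lie \<pi> (xL t) y xs) 1 = En y xs"
proof (induction xs arbitrary: y \<pi> \<rho>)
 case Nil
 have "(%t. ac L t (y [])) = pev M (vact M L (y []))" by (auto simp: ac_def)
 thus ?case by (simp add: xL_def xact_simp)
next
 case (Cons z zs)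
 obtain a \<alpha> r where z: "z = (a, \<alpha>, r)" by (metis prod_cases3)
 have a: "a : par V \<alpha>" and zs: "zs : lists X" using Cons.prems z by auto
 have y: "slin y" "PF (%_. y)" using Cons.prems(1) by (auto simp: BC_def)
 note D = LinAt_D[OF slinD[OF y(1) lists.Nil zs], simplified]
 have pf: "pf M (%t. y ((b, \<alpha>, t) # zs))" if "b : par V \<alpha>" for b
  using PF_pf[OF y(2) lists.Nil zs that] by simp
 let ?c = "coeff (lbr V L a)"
 have c: "?c k : par V \<alpha>" for k
  by (rule coeff_L_par[OF a])
 \<comment> \<open>One more than the degree, so that the term with index 1 is in the range even for
   a constant bracket.\<close>
 let ?N = "Suc (degree (lbr V L a))"
 have e: "y ((bk L t a, \<alpha>, t + r) # zs) = (SUM k<=?N. scl M (t ^ k) (y ((?c k, \<alpha>, r + t) # zs)))" for t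
  using LinAt_sum[OF slinD[OF y(1) lists.Nil zs], of "{..?N}" "%k. scl V (t ^ k) (?c k)" \<alpha> "r + t"] D(2)[OF c]
  by (simp add: bk_def V.pev_bound[of "lbr V L a" ?N] V.par_scl c add.commute)
 have ps: "pf M (%t. y ((?c k, \<alpha>, r + t) # zs))" for k using M.pf_shift[OF pf[OF c]] .
 have pk: "pf M (%t. scl M (t ^ j) (p t))" if "pf M p" for j p
 proof (induction j)
  case (Suc j)
  thus ?case using M.pf_var[OF Suc.IH] by simp
 qed (use that in simp)
 have "cof M (%t. y ((bk L t a, \<alpha>, t + r) # zs)) 1 =
   (SUM k<=?N. (if k = 0 then cof M (%t. y ((?c k, \<alpha>, r + t) # zs)) 1 else 0) + (if k = 1 then y ((?c k, \<alpha>, r) # zs) else 0))"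
 proof -
  have cp: "cof M (%t. scl M (t ^ k) (y ((?c k', \<alpha>, r + t) # zs))) 1
    = (if k = 0 then cof M (%t. y ((?c k', \<alpha>, r + t) # zs)) 1 else 0) + (if k = 1 then y ((?c k', \<alpha>, r) # zs) else 0)" for k k'
   using M.cof_pow_1[OF ps[of k'], of k] by simp
  show ?thesis unfolding e by (simp add: M.cof_sum pk ps cp del: sum.atMost_Suc One_nat_def)
 qed
 also have "... = cof M (%t. y ((?c 0, \<alpha>, r + t) # zs)) 1 + y ((?c 1, \<alpha>, r) # zs)"
  by (simp add: sum.distrib del: sum.atMost_Suc)
 \<comment> \<open>The slot with the bracket has the value r + t, so the constant term \<partial> a
   of the bracket contributes too: by sesquilinearity it is minus the derivative of r y, which
   yields the count 1 and \<lambda> d/d\<lambda>.\<close>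
 also have "cof M (%t. y ((?c 0, \<alpha>, r + t) # zs)) 1 = Dv M (%t. - scl M t (y ((a, \<alpha>, t) # zs))) r"
  by (simp add: Dv_def L_0 D(3)[OF a])
 also have "... = - (y ((a, \<alpha>, r) # zs) + scl M r (Dv M (%t. y ((a, \<alpha>, t) # zs)) r))"
  using M.Dv_scl[OF M.pf_var[OF pf[OF a]], of "-1" r] M.Dv_step[OF pf[OF a], of 0 r] by simp
 finally have B: "cof M (%t. y ((bk L t a, \<alpha>, t + r) # zs)) 1 =
   y ((?c 1, \<alpha>, r) # zs) - (y ((a, \<alpha>, r) # zs) + scl M r (Dv M (%t. y ((a, \<alpha>, t) # zs)) r))" by simp
 have Z: "BC (\<rho> + q z) (ins y z)" using BC_ins[OF Cons.prems(1)] Cons.prems(2) by auto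
 have IH: "cof M (%t. Lie (\<pi> + q z) (xL t) (ins y z) zs) 1 = En (ins y z) zs"
  by (rule Cons.IH[OF Z zs])
 have "pf M (%t. y ((bk L t a, \<alpha>, t + r) # zs))" unfolding e by (intro M.pf_sum pk ps)
 moreover have "pf M (%t. Lie (\<pi> + q z) (xL t) (ins y z) zs)" by (rule pf_Lie_L[OF Z zs])
 ultimately show ?case
  using IH B by (simp add: z xL_def xbr_simp M.cof_diff)
qed

lemma i1_dd:
 assumes "BC \<pi> y" "xs : lists X"
 shows "i1 (dd \<pi> y) xs = sm \<pi> (En y xs) + dd (\<pi> + 1) (i1 y) xs"
proof -
 have p: "pf M (%t. y (xL t # w))" if "w : lists X" for w
  using PF_pf[OF _ lists.Nil that L_par, of y] assms(1) by (simp add: xL_def BC_def)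
 have "cof M (%t. dd (\<pi> + 1) (ins y (xL t)) xs) 1 = dd (\<pi> + 1) (i1 y) xs"
  unfolding i1_def[abs_def] by (rule cof_dd[OF assms(2) p])
 moreover have "pf M (%t. dd (\<pi> + 1) (ins y (xL t)) xs)" by (rule pf_dd[OF assms(2) p])
 ultimately show ?thesis
  using pf_Lie_L[OF assms] cof_Lie_L[OF assms]
  by (simp add: i1_def[of "dd \<pi> y"] M.cof_add M.cof_sm M.pf_sm add_ac)
qed

lemma i0_dd:
 assumes "BC \<pi> y" "xs : lists X"
 shows "i0 (dd \<pi> y) xs = sm \<pi> (TT y xs) + dd (\<pi> + 1) (i0 y) xs"
 using Lie_L0[of y xs \<pi>] assms by (simp add: i0_def BC_def add_ac)

text \<open>The inserted variable is part of the sum of the variables; multiplying by it turns the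
  constant term \<open>i0\<close> into a linear one.\<close>

lemma i1_TT:
 assumes "BC \<pi> y" "xs : lists X"
 shows "i1 (TT y) xs = TT (i1 y) xs + i0 y xs"
proof -
 have p: "pf M (%t. y (xL t # xs))"
  using PF_pf[OF _ lists.Nil assms(2) L_par, of y] assms(1) by (simp add: xL_def BC_def)
 have "(%t. TT y (xL t # xs)) = (%t. der M (y (xL t # xs)) + scl M (lsum xs + 1 * t) (y (xL t # xs)))"
  by (auto simp: TT_def xL_def add.commute)
 hence "i1 (TT y) xs = cof M (%t. der M (y (xL t # xs)) + scl M (lsum xs + 1 * t) (y (xL t # xs))) 1"
  by (simp only: i1_def)
 also have "... = der M (i1 y xs) + scl M (lsum xs) (i1 y xs) + cof M (%t. y (xL t # xs)) 0"
  unfolding i1_def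
  by (subst M.cof_add[OF M.pf_lin'[OF p M.lin_der] pf_affine[OF p]]) (simp add: M.cof_affine[OF p] M.cof_lin'[OF p M.lin_der] add_ac del: mult_1)
 finally show ?thesis using M.cof_at_0[OF p] by (simp add: TT_def i0_def)
qed

text \<open>The slot of L contributes -2 from L_(1) L = 2 L, 1 from the count of arguments, and
  nothing from \<lambda> d/d\<lambda> at the value 0. This shift by one is the origin of the
  eigenvalue 1.\<close>

lemma En_i0: "slin y ==> xs : lists X ==> En (i0 y) xs = i0 y xs + i0 (En y) xs"
proof -
 assume y: "slin y" and xs: "xs : lists X"
 have "y ((scl V 2 L, 0, 0) # xs) = scl M 2 (y ((L, 0, 0) # xs))"
  using LinAt_D(2)[OF slinD[OF y lists.Nil xs] L_par] by simp
 thus ?thesis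
  using M.scale_left_distrib[of 1 1 "y ((L, 0, 0) # xs)"] by (simp add: i0_def xL_def L_L[simplified])
qed

text \<open>The Cartan formula \<open>i1_dd\<close> expresses the energy through \<open>i1\<close>
  and the differential, both of which preserve the cochain conditions.\<close>

lemma BC_En: "BC \<pi> y ==> BC \<pi> (En y)"
proof -
 assume y: "BC \<pi> y"
 have "BC \<pi> (%w. sm \<pi> (sm 1 (dd (\<pi> + 1) (i1 y) w) + i1 (dd \<pi> y) w))"
  using BC_dd[OF BC_i1[OF y]] BC_i1[OF BC_dd[OF y]] by (intro BC_sm BC_add) simp_all
 thus ?thesis by (rule BC_cong) (simp add: i1_dd[OF y] sm_sm sm_add)
qed

lemma dd_dd_0: "BC \<pi> y ==> xs : lists X ==> dd (\<pi> + 1) (dd \<pi> y) xs = 0"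
 using dd_dd[OF BC_jac] by (simp add: BC_def)

text \<open>In the Cartan formula \<open>i1_dd\<close> only the exact term survives when
  \<open>y\<close> is closed.\<close>

lemma En_closed:
 assumes "BC \<pi> y" "!!xs. xs : lists X ==> dd \<pi> y xs = 0" "xs : lists X"
 shows "En y xs = sm (\<pi> + 1) (dd (\<pi> + 1) (i1 y) xs)"
proof -
 have "i1 (dd \<pi> y) xs = 0" using assms(2,3) by (simp add: i1_def del: dd.simps)
 hence "sm \<pi> (sm \<pi> (En y xs) + dd (\<pi> + 1) (i1 y) xs) = 0" using i1_dd[OF assms(1,3)] by simp
 hence "En y xs + sm \<pi> (dd (\<pi> + 1) (i1 y) xs) = 0" by (simp add: sm_add sm_sm)
 thus ?thesis by (cases \<pi>) (auto simp: eq_neg_iff_add_eq_0)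
qed

lemma En_dd:
 assumes "BC \<pi> y" "xs : lists X"
 shows "En (dd \<pi> y) xs = sm \<pi> (dd \<pi> (i1 (dd \<pi> y)) xs)"
 using En_closed[OF BC_dd[OF assms(1)] dd_dd_0[OF assms(1)] assms(2)] by (simp add: add.commute)

text \<open>The three facts come from \<open>i0\<close> applied to d z = 0, from \<open>i1\<close>
  applied to d y = \<open>TT\<close> z, and from the shift \<open>En_i0\<close> together with the
  exactness of the energy of z. They say that \<open>i0\<close> z is a reduced cocycle, cohomologous
  up to sign to the energy of y and fixed by the energy in cohomology.\<close>

lemma reduced_cocycle:
 assumes y: "BC \<pi> y" and z: "BC (\<pi> + 1) z"
  and yz: "!!xs. xs : lists X ==> dd \<pi> y xs = TT z xs" and dz: "!!xs. xs : lists X ==> dd (\<pi> + 1) z xs = 0"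
  and xs: "xs : lists X"
 shows "dd \<pi> (i0 z) xs = sm \<pi> (TT z xs)"
  and "En y xs = sm \<pi> (i0 z xs) + sm \<pi> (TT (i1 z) xs) - sm \<pi> (dd (\<pi> + 1) (i1 y) xs)"
  and "En (i0 z) xs = i0 z xs + TT (i1 z) xs + sm \<pi> (dd (\<pi> + 1) (i0 (i1 z)) xs)"
proof -
 have "sm (\<pi> + 1) (sm (\<pi> + 1) (TT z xs) + dd \<pi> (i0 z) xs) = 0"
  using i0_dd[OF z xs] dz[of "xL 0 # xs"] xs by (simp add: i0_def[of "dd _ _"] add_ac)
 hence "TT z xs + sm (\<pi> + 1) (dd \<pi> (i0 z) xs) = 0" by (simp add: sm_add sm_sm)
 thus "dd \<pi> (i0 z) xs = sm \<pi> (TT z xs)" by (cases \<pi>) (auto simp: eq_neg_iff_add_eq_0 add.commute)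
 have "i1 (dd \<pi> y) xs = i1 (TT z) xs" using yz xs by (simp add: i1_def del: dd.simps)
 hence "sm \<pi> (sm \<pi> (En y xs) + dd (\<pi> + 1) (i1 y) xs) = sm \<pi> (TT (i1 z) xs + i0 z xs)"
  by (simp add: i1_dd[OF y xs] i1_TT[OF z xs])
 hence "En y xs + sm \<pi> (dd (\<pi> + 1) (i1 y) xs) = sm \<pi> (TT (i1 z) xs) + sm \<pi> (i0 z xs)"
  by (simp add: sm_add sm_sm)
 thus "En y xs = sm \<pi> (i0 z xs) + sm \<pi> (TT (i1 z) xs) - sm \<pi> (dd (\<pi> + 1) (i1 y) xs)"
  by (simp add: algebra_simps)
 have i1z: "BC \<pi> (i1 z)" using BC_i1[OF z] by (simp add: add.commute)
 \<comment> \<open>z is closed before reduction, so its energy is exact; \<open>i0_dd\<close> then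
   moves \<open>i0\<close> past the differential at the cost of a term in the image of
   \<open>TT\<close>.\<close>
 have "En z w = sm \<pi> (dd \<pi> (i1 z) w)" if "w : lists X" for w
  using En_closed[OF z dz that] by (simp add: add_ac)
 hence "i0 (En z) xs = sm \<pi> (i0 (dd \<pi> (i1 z)) xs)" using xs by (simp add: i0_def)
 thus "En (i0 z) xs = i0 z xs + TT (i1 z) xs + sm \<pi> (dd (\<pi> + 1) (i0 (i1 z)) xs)"
  using En_i0[of z xs] z xs i0_dd[OF i1z xs] by (simp add: BC_def sm_add sm_sm add_ac)
qed

end

section \<open>Partial derivatives of differential polynomials\<close>

locale pvm_poly = pvm V L M
 for V :: "('f::field_char_0, 'v::ring_1) pva" and L and M :: "('v, 'f, 'm::ab_group_add) pva_mod" +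
 fixes I :: "'i set" and u :: "'i => 'v" and qu :: "'i => bit"
 assumes u_par: "i : I ==> u i : par V (qu i)"
  and word_surj: "word_eval V u ` {f. keys f \<subseteq> lists (I \<times> UNIV)} = UNIV"
  and word_ker: "{f. keys f \<subseteq> lists (I \<times> UNIV) & word_eval V u f = 0} = supercommutator_ideal I qu"
begin

abbreviation "J \<equiv> I \<times> (UNIV :: nat set)"

definition ev :: "'i \<times> nat => 'v" where "ev = (%(i, k). (der V ^^ k) (u i))"
definition qq :: "'i \<times> nat => bit" where "qq x = qu (fst x)"
definition wv :: "('i \<times> nat) list => 'v" where "wv w = prod_list (map ev w)"
definition wp :: "('i \<times> nat) list => bit" where "wp w = sum_list (map qq w)"

lemma wv_simps [simp]: "wv [] = 1" "wv (x # w) = ev x * wv w" "wv (v @ w) = wv v * wv w"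
 and wp_simps [simp]: "wp [] = 0" "wp (x # w) = qq x + wp w" "wp (v @ w) = wp v + wp w"
 by (auto simp: wv_def wp_def)

lemma ev_par: "x : J ==> ev x : par V (qq x)"
proof -
 have "a : par V \<alpha> ==> (der V ^^ k) a : par V \<alpha>" for a \<alpha> k
  by (induction k) (auto intro: V.der_par)
 thus "x : J ==> ev x : par V (qq x)" using u_par by (auto simp: ev_def qq_def)
qed

lemma wv_par: "w : lists J ==> wv w : par V (wp w)"
 by (induction w) (auto simp: one_par simp del: mem_Sigma_iff intro!: mult_par ev_par)

definition wlin :: "(('i \<times> nat) list => 'v) => (('i \<times> nat) list \<Rightarrow>\<^sub>0 'f) => 'v" where
 "wlin g f = (SUM w:keys f. scl V (lookup f w) (g w))"

lemma word_eval_wlin: "word_eval V u f = wlin wv f"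
 by (simp add: word_eval_def wlin_def wv_def ev_def)

lemma wlin_bound: "finite A ==> keys f \<subseteq> A ==> wlin g f = (SUM w:A. scl V (lookup f w) (g w))"
 unfolding wlin_def by (rule sum.mono_neutral_left) (auto simp: in_keys_iff)

lemma wlin_add: "wlin g (f + h) = wlin g f + wlin g h"
proof -
 let ?A = "keys f \<union> keys h"
 show ?thesis
  by (simp add: wlin_bound[of ?A f] wlin_bound[of ?A h] wlin_bound[of ?A "f + h"]
    Poly_Mapping.keys_add sum.distrib lookup_add V.scale_left_distrib)
qed

lemma wlin_0 [simp]: "wlin g 0 = 0"
 by (simp add: wlin_def)

lemma wlin_diff: "wlin g (f - h) = wlin g f - wlin g h"
 using wlin_add[of g "f - h" h] by simp

lemma lookup_scale: "lookup (Poly_Mapping.map ((*) (c::'f)) f) w = c * lookup f w"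
 by (simp add: Poly_Mapping.map.rep_eq when_def)

lemma keys_scale: "keys (Poly_Mapping.map ((*) (c::'f)) f) \<subseteq> keys f"
 by (auto simp: in_keys_iff lookup_scale)

lemma wlin_scale: "wlin g (Poly_Mapping.map ((*) c) f) = scl V c (wlin g f)"
 by (simp add: wlin_bound[OF _ keys_scale] lookup_scale wlin_def[of g f] V.scale_sum_right)

lemma wlin_single: "wlin g (single w c) = scl V c (g w)"
 by (simp add: wlin_bound[of "{w}"])

text \<open>The right derivative of a word, with the sign for moving the removed letter past the
  word behind it. The value is already taken in \<open>V\<close>, as only invariance under the
  relations of \<open>V\<close> is needed.\<close>

fun del :: "'i \<times> nat => ('i \<times> nat) list => 'v" where
 "del x [] = 0"
| "del x (z # w) = ev z * del x w + (if z = x then sm (qq x * wp w) (wv w) else 0)"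

lemma sm_mult: "sm b a * c = sm b (a * c)" "a * sm b c = sm b (a * (c::'v))"
 by (cases b; simp)+

lemma del_append: "del x (v @ w) = wv v * del x w + sm (qq x * wp w) (del x v * wv w)"
proof (induction v)
 case (Cons z v)
 show ?case
  by (simp add: Cons.IH distrib_left distrib_right mult.assoc sm_mult sm_add sm_sm add_ac)
qed simp

text \<open>By \<open>del_append\<close> only the values of the two-letter word and of its
  derivative matter, and both obey the supercommutation rule.\<close>

lemma del_relation:
 assumes "y : J" "z : J"
 shows "del x (v @ [y, z] @ w) = sm (qq y * qq z) (del x (v @ [z, y] @ w))"
proof -
 have c: "ev y * ev z = sm (qq y * qq z) (ev z * ev y)" using mult_comm ev_par assms by blast
 have 1: "wv [y, z] = sm (qq y * qq z) (wv [z, y])" using c by simp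
 have 2: "del x [y, z] = sm (qq y * qq z) (del x [z, y])"
  by (cases "qq y"; cases "qq z") auto
 have 3: "wp [y, z] = wp [z, y]" by simp
 have e: "del x (v @ yz @ w) = wv v * (wv yz * del x w + sm (qq x * wp w) (del x yz * wv w))
   + sm (qq x * (wp yz + wp w)) (del x v * (wv yz * wv w))" for yz
  by (simp add: del_append)
 show ?thesis unfolding e 1 2 3
  by (simp only: sm_mult sm_add sm_sm distrib_left add_ac mult.assoc)
qed

text \<open>Generators of the ideal are killed by \<open>del_relation\<close>; hence the derivative
  descends from words to \<open>V\<close>.\<close>

lemma wlin_ideal:
 assumes "f : supercommutator_ideal I qu" shows "wlin (del x) f = 0"
proof -
 interpret W: Modules.module "%c::'f. Poly_Mapping.map ((*) c) :: (('i \<times> nat) list \<Rightarrow>\<^sub>0 'f) => _"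
  by unfold_locales (rule poly_mapping_eqI, simp add: lookup_scale lookup_add algebra_simps)+
 from assms[unfolded supercommutator_ideal_def] show ?thesis
 proof (induction rule: W.span_induct_alt)
  case base
  show ?case by simp
 next
  case (step c f g)
  then obtain v w y z where f: "f = single (v @ [y, z] @ w) 1
     - single (v @ [z, y] @ w) (sg (qu (fst y) * qu (fst z)))" and yz: "y : J" "z : J" by blast
  have "wlin (del x) f = 0"
   unfolding f wlin_diff wlin_single V.sg_sm using del_relation[OF yz, of x v w] by (simp add: qq_def)
  thus ?case using step by (simp add: wlin_add wlin_scale)
 qed
qed

text \<open>Right partial derivatives: \<open>D x\<close> removes a factor \<open>x\<close> after moving it to the right end.\<close>

definition D :: "'i \<times> nat => 'v => 'v" where
 "D x a = wlin (del x) (SOME f. keys f \<subseteq> lists J & wlin wv f = a)"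

lemma D_wlin: assumes "keys f \<subseteq> lists J" shows "D x (wlin wv f) = wlin (del x) f"
proof -
 define g where "g = (SOME g. keys g \<subseteq> lists J & wlin wv g = wlin wv f)"
 have g: "keys g \<subseteq> lists J & wlin wv g = wlin wv f"
  unfolding g_def by (rule someI[of _ f]) (use assms in simp)
 have "keys (g - f) \<subseteq> lists J"
 proof
  fix w assume "w : keys (g - f)"
  hence "w : keys g | w : keys f" by (auto simp: in_keys_iff lookup_minus)
  thus "w : lists J" using g assms by blast
 qed
 \<comment> \<open>This is where freeness enters: two representations of the same element differ by
   the supercommutator ideal and nothing more.\<close>
 hence "g - f : supercommutator_ideal I qu"
  using g word_ker by (auto simp: word_eval_wlin wlin_diff)
 hence "wlin (del x) g = wlin (del x) f" using wlin_ideal[of "g - f" x] by (simp add: wlin_diff)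
 thus ?thesis by (simp add: D_def g_def)
qed

lemma words_span: "EX f. keys f \<subseteq> lists J & wlin wv f = a"
 using word_surj by (auto simp: word_eval_wlin) (metis (mono_tags, lifting) UNIV_I image_iff mem_Collect_eq)

lemma word_induct:
 assumes "P 0" "!!a b. P a ==> P b ==> P (a + b)" "!!c a. P a ==> P (scl V c a)" "!!w. w : lists J ==> P (wv w)"
 shows "P a"
proof -
 obtain f where f: "keys f \<subseteq> lists J" "wlin wv f = a" using words_span by blast
 have "A \<subseteq> lists J ==> P (SUM w:A. scl V (lookup f w) (wv w))" if "finite A" for A
  using that
 proof (induction A)
  case empty
  thus ?case using assms(1) by simp
 next
  case (insert w A)
  thus ?case using assms(2-4) by auto
 qed
 thus ?thesis using f by (auto simp: wlin_def)
qed

text \<open>Applies \<open>word_induct\<close> to the claim for the homogeneous component, which is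
  a word of parity \<alpha> or zero on each word.\<close>

lemma hom_word_induct:
 assumes "a : par V \<alpha>" "P 0" "!!a b. a : par V \<alpha> ==> b : par V \<alpha> ==> P a ==> P b ==> P (a + b)"
  "!!c a. a : par V \<alpha> ==> P a ==> P (scl V c a)"
  "!!w. w : lists J ==> wp w = \<alpha> ==> P (wv w)"
 shows "P a"
proof -
 have "P (hcomp V \<alpha> a)"
 proof (induction a rule: word_induct)
  case 1
  thus ?case using assms(2) lin_0[OF V.hcomp_lin] by simp
 next
  case (2 a b)
  thus ?case using assms(3) by (simp add: lin_add[OF V.hcomp_lin])
 next
  case (3 c a)
  thus ?case using assms(4) by (simp add: lin_scl[OF V.hcomp_lin])
 next
  case (4 w)
  thus ?case using assms(2,5) V.hcomp_hom[OF wv_par[OF 4], of \<alpha>] by auto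
 qed
 thus ?thesis using V.hcomp_hom[OF assms(1)] by simp
qed

lemma D_lin: "lin V V (D x)"
proof (rule linI)
 fix a b c
 obtain f g where f: "keys f \<subseteq> lists J" "a = wlin wv f" and g: "keys g \<subseteq> lists J" "b = wlin wv g"
  using words_span by metis
 have "keys (f + g) \<subseteq> lists J" using f g Poly_Mapping.keys_add[of f g] by blast
 from D_wlin[OF this] show "D x (a + b) = D x a + D x b" using f g by (simp add: D_wlin wlin_add)
 have "keys (Poly_Mapping.map ((*) c) f) \<subseteq> lists J" by (rule order_trans[OF keys_scale f(1)])
 from D_wlin[OF this] show "D x (scl V c a) = scl V c (D x a)" using f by (simp add: D_wlin wlin_scale)
qed

lemma D_wv: "w : lists J ==> D x (wv w) = del x w"
 using D_wlin[of "single w 1" x] by (simp add: wlin_single)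

lemma del_par: "x : J ==> w : lists J ==> del x w : par V (wp w + qq x)"
proof (induction w)
 case (Cons z w)
 have "ev z * del x w : par V (qq z + (wp w + qq x))" using Cons by (intro mult_par ev_par) auto
 moreover have "wv w : par V (wp w)" using wv_par Cons by auto
 moreover have "z = x ==> wp (z # w) + qq x = wp w" by (simp add: add_ac)
 ultimately show ?case by (auto simp: add_ac intro!: V.par_add V.par_sm)
qed simp

lemma D_par: "x : J ==> a : par V \<alpha> ==> D x a : par V (\<alpha> + qq x)"
proof -
 assume x: "x : J" and a: "a : par V \<alpha>"
 from a show ?thesis
 proof (rule hom_word_induct)
  fix w assume "w : lists J" "wp w = \<alpha>"
  thus "D x (wv w) : par V (\<alpha> + qq x)" using del_par[OF x, of w] by (simp add: D_wv)
 qed (simp_all add: lin_0[OF D_lin] lin_add[OF D_lin] lin_scl[OF D_lin] V.par_add V.par_scl)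
qed

lemma D_mult:
 assumes "c : par V \<gamma>" shows "D x (b * c) = b * D x c + sm (qq x * \<gamma>) (D x b * c)"
proof -
 have *: "D x (b * c) = b * D x c + sm (qq x * \<gamma>) (D x b * c)" if w: "w : lists J" "wp w = \<gamma>" and c: "c = wv w" for b c w
 proof (induction b rule: word_induct)
  case 1
  show ?case by (simp add: lin_0[OF D_lin])
 next
  case (2 a b)
  thus ?case by (simp add: algebra_simps lin_add[OF D_lin] sm_add)
 next
  case (3 d a)
  thus ?case by (simp add: mult_scl lin_scl[OF D_lin] V.scl_sm V.scale_right_distrib)
 next
  case (4 v)
  thus ?case using w D_wv[of "v @ w" x] by (simp add: c del_append D_wv)
 qed
 show ?thesis
  using assms
 proof (rule hom_word_induct)
  show "D x (b * 0) = b * D x 0 + sm (qq x * \<gamma>) (D x b * 0)" by (simp add: lin_0[OF D_lin])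
 next
  fix c d assume "D x (b * c) = b * D x c + sm (qq x * \<gamma>) (D x b * c)" "D x (b * d) = b * D x d + sm (qq x * \<gamma>) (D x b * d)"
  thus "D x (b * (c + d)) = b * D x (c + d) + sm (qq x * \<gamma>) (D x b * (c + d))"
   by (simp add: algebra_simps lin_add[OF D_lin] sm_add)
 next
  fix d a assume "D x (b * a) = b * D x a + sm (qq x * \<gamma>) (D x b * a)"
  thus "D x (b * scl V d a) = b * D x (scl V d a) + sm (qq x * \<gamma>) (D x b * scl V d a)"
   by (simp add: mult_scl lin_scl[OF D_lin] V.scl_sm V.scale_right_distrib)
 qed (use * in blast)
qed

definition supp :: "'v => ('i \<times> nat) set" where "supp a = {x : J. D x a ~= 0}"

text \<open>A word has nonzero derivatives only in its own letters; thus the sum over variables in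
  \<open>dext\<close> is finite.\<close>

lemma finite_supp: "finite (supp a)"
proof (induction a rule: word_induct)
 case 1
 show ?case by (simp add: supp_def lin_0[OF D_lin])
next
 case (2 a b)
 have "supp (a + b) \<subseteq> supp a \<union> supp b" by (auto simp: supp_def lin_add[OF D_lin])
 thus ?case using 2 by (meson finite_UnI finite_subset)
next
 case (3 c a)
 have "supp (scl V c a) \<subseteq> supp a" by (auto simp: supp_def lin_scl[OF D_lin])
 thus ?case using 3 finite_subset by blast
next
 case (4 w)
 have "x \<notin> set w ==> del x w = 0" for x by (induction w) auto
 hence "supp (wv w) \<subseteq> set w" using 4 by (auto simp: supp_def D_wv)
 thus ?case using finite_subset by blast
qed

lemma D_one: "D x 1 = 0"
 using D_wv[of "[]" x] by simp

lemma D_ev: "z : J ==> D x (ev z) = (if z = x then 1 else 0)"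
 using D_wv[of "[z]" x] by simp

lemma der_ev: "der V (ev (i, k)) = ev (i, Suc k)"
 by (simp add: ev_def)

lemma der_one: "der V 1 = 0"
 using der_mult[of 1 1] by simp

text \<open>The commutation rule of \<partial>/\<partial>u^(k) with the total derivative; the extra
  term arises because \<partial> creates u^(k) from u^(k-1).\<close>

lemma D_der: "D (i, k) (der V a) = der V (D (i, k) a) + (case k of 0 => 0 | Suc l => D (i, l) a)"
proof (induction a rule: word_induct)
 case 1
 show ?case by (simp add: lin_0[OF D_lin] lin_0[OF V.lin_der] split: nat.split)
next
 case (2 a b)
 thus ?case by (simp add: lin_add[OF D_lin] lin_add[OF V.lin_der] split: nat.split)
next
 case (3 c a)
 thus ?case by (simp add: lin_scl[OF D_lin] lin_scl[OF V.lin_der] V.scale_right_distrib split: nat.split)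
next
 case (4 w)
 thus ?case
 proof (induction w)
  case Nil
  show ?case by (simp add: D_one der_one lin_0[OF D_lin] lin_0[OF V.lin_der] split: nat.split)
 next
  case (Cons z w)
  obtain j l where z: "z = (j, l)" by force
  have zJ: "z : J" "(j, Suc l) : J" and w: "w : lists J" using Cons.hyps z by auto
  have b: "wv w : par V (wp w)" "der V (wv w) : par V (wp w)" using wv_par[OF w] V.der_par by auto
  have der_if: "der V (if P then 1 else 0) = 0" for P using der_one lin_0[OF V.lin_der] by simp
  have 1: "D (i, k) (der V (wv (z # w))) = ev (j, Suc l) * D (i, k) (wv w) + sm (qu i * wp w) ((if (j, Suc l) = (i, k) then 1 else 0) * wv w)
    + (ev z * D (i, k) (der V (wv w)) + sm (qu i * wp w) ((if z = (i, k) then 1 else 0) * der V (wv w)))"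
   using D_mult[OF b(1), of "(i, k)" "ev (j, Suc l)"] D_mult[OF b(2), of "(i, k)" "ev z"] D_ev[OF zJ(1)] D_ev[OF zJ(2)]
   by (simp add: der_mult z der_ev lin_add[OF D_lin] qq_def)
  have 2: "D (i, k') (wv (z # w)) = ev z * D (i, k') (wv w) + sm (qu i * wp w) ((if z = (i, k') then 1 else 0) * wv w)" for k'
   using D_mult[OF b(1), of "(i, k')" "ev z"] D_ev[OF zJ(1)] by (simp add: qq_def)
  have 3: "der V (D (i, k) (wv (z # w))) = ev (j, Suc l) * D (i, k) (wv w) + ev z * der V (D (i, k) (wv w))
    + sm (qu i * wp w) ((if z = (i, k) then 1 else 0) * der V (wv w))"
   unfolding 2 by (simp add: lin_add[OF V.lin_der] der_mult z der_ev lin_sm[OF V.lin_der] der_if lin_0[OF V.lin_der])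
  show ?case
   unfolding 3 unfolding 1 using Cons.IH
   by (cases k) (auto simp: 2[unfolded z wv_simps(2)] algebra_simps z)
 qed
qed

end

section \<open>Extension of functions of generators to multiderivations\<close>

context pvm_poly begin

definition qx :: "'i \<times> 'f => bit" where "qx = (%(i, t). 1 + qu i)"

lemma qx_simp [simp]: "qx (i, t) = 1 + qu i"
 by (simp add: qx_def)

definition GX :: "('i \<times> 'f) set" where "GX = I \<times> UNIV"

lemma GX_iff [simp]: "(i, t) : GX \<longleftrightarrow> i : I"
 by (simp add: GX_def)

text \<open>The extension of a function of generators to a multiderivation.\<close>

definition dext :: "bit => bit => ('i \<times> nat => 'f => 'm) => 'v => 'f => 'm" where
 "dext \<pi> \<alpha> g a t = (SUM x:supp a. sm ((\<alpha> + qq x) * \<pi>) (exm (D x a) (%r. scl M ((- r) ^ snd x) (g x r)) t))"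

text \<open>The first argument is replaced by generators, then the others by recursion, where \<pi>
  has absorbed the opposite parity of the generator. The factor (-r)^k in \<open>dext\<close> is
  forced by sesquilinearity, as the k-th derivative of a generator stands in the slot.\<close>

fun ext :: "bit => (('i \<times> 'f) list => 'm) => ('v \<times> bit \<times> 'f) list => 'm" where
 "ext \<pi> G [] = G []"
| "ext \<pi> G ((a, \<alpha>, t) # xs) = dext \<pi> \<alpha> (%x r. ext (\<pi> + 1 + qq x) (%zs. G ((fst x, r) # zs)) xs) a t"

lemma pf_npow: "pf M p ==> pf M (%r. scl M ((- r) ^ k) (p r))"
proof (induction k)
 case (Suc k)
 have "pf M (%r. scl M (0 + (-1) * r) (scl M ((- r) ^ k) (p r)))" by (rule pf_affine, rule Suc.IH, rule Suc.prems)
 thus ?case by simp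
qed simp

lemma exm_zero_arg: "pf M p ==> exm 0 p t = 0"
 using lin_0[OF exm_lin] by blast

definition wpf :: "('i \<times> nat => 'f => 'm) => bool" where "wpf g \<longleftrightarrow> (ALL x:J. pf M (g x))"

lemma dext_bound:
 assumes "wpf g" "finite A" "supp a \<subseteq> A" "A \<subseteq> J"
 shows "dext \<pi> \<alpha> g a t = (SUM x:A. sm ((\<alpha> + qq x) * \<pi>) (exm (D x a) (%r. scl M ((- r) ^ snd x) (g x r)) t))"
 unfolding dext_def
proof (rule sum.mono_neutral_left[OF assms(2,3)], rule ballI)
 fix x assume "x : A - supp a"
 hence "D x a = 0" "x : J" using assms by (auto simp: supp_def)
 moreover from this have "pf M (%r. scl M ((- r) ^ snd x) (g x r))" using assms(1) by (auto simp: wpf_def intro!: pf_npow)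
 ultimately show "sm ((\<alpha> + qq x) * \<pi>) (exm (D x a) (%r. scl M ((- r) ^ snd x) (g x r)) t) = 0"
  by (simp add: exm_zero_arg)
qed

lemma supp_J: "supp a \<subseteq> J"
 by (auto simp: supp_def)

lemma wpf_pf: "wpf g ==> x : J ==> pf M (%r. scl M ((- r) ^ snd x) (g x r))"
 by (auto simp: wpf_def intro!: pf_npow)

lemma dext_lin: assumes "wpf g" shows "lin V M (%a. dext \<pi> \<alpha> g a t)"
proof (rule linI)
 fix a b c
 let ?A = "supp a \<union> supp b \<union> supp (a + b) \<union> supp (scl V c a)"
 have A: "finite ?A" "?A \<subseteq> J" using finite_supp supp_J by auto
 note e = lin_add[OF exm_lin[OF wpf_pf[OF assms]]] lin_scl[OF exm_lin[OF wpf_pf[OF assms]]]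
 note d = dext_bound[OF assms A(1) _ A(2)]
 have "dext \<pi> \<alpha> g (a + b) t = (SUM x:?A. sm ((\<alpha> + qq x) * \<pi>) (exm (D x (a + b)) (%r. scl M ((- r) ^ snd x) (g x r)) t))"
  by (rule d) auto
 also have "... = dext \<pi> \<alpha> g a t + dext \<pi> \<alpha> g b t"
 proof -
  have "dext \<pi> \<alpha> g a t = (SUM x:?A. sm ((\<alpha> + qq x) * \<pi>) (exm (D x a) (%r. scl M ((- r) ^ snd x) (g x r)) t))"
   "dext \<pi> \<alpha> g b t = (SUM x:?A. sm ((\<alpha> + qq x) * \<pi>) (exm (D x b) (%r. scl M ((- r) ^ snd x) (g x r)) t))"
   by (rule d; blast)+
  moreover have "sm ((\<alpha> + qq x) * \<pi>) (exm (D x (a + b)) (%r. scl M ((- r) ^ snd x) (g x r)) t)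
    = sm ((\<alpha> + qq x) * \<pi>) (exm (D x a) (%r. scl M ((- r) ^ snd x) (g x r)) t)
     + sm ((\<alpha> + qq x) * \<pi>) (exm (D x b) (%r. scl M ((- r) ^ snd x) (g x r)) t)" if "x : ?A" for x
  proof -
   have "x : J" using that A(2) by blast
   thus ?thesis by (simp only: lin_add[OF D_lin] e(1) sm_add)
  qed
  ultimately show ?thesis by (simp only: sum.distrib[symmetric] cong: sum.cong)
 qed
 finally show "dext \<pi> \<alpha> g (a + b) t = dext \<pi> \<alpha> g a t + dext \<pi> \<alpha> g b t" .
 have "dext \<pi> \<alpha> g (scl V c a) t = (SUM x:?A. sm ((\<alpha> + qq x) * \<pi>) (exm (D x (scl V c a)) (%r. scl M ((- r) ^ snd x) (g x r)) t))"
  by (rule d) auto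
 also have "... = scl M c (dext \<pi> \<alpha> g a t)"
 proof -
  have "dext \<pi> \<alpha> g a t = (SUM x:?A. sm ((\<alpha> + qq x) * \<pi>) (exm (D x a) (%r. scl M ((- r) ^ snd x) (g x r)) t))"
   by (rule d; blast)
  moreover have "sm ((\<alpha> + qq x) * \<pi>) (exm (D x (scl V c a)) (%r. scl M ((- r) ^ snd x) (g x r)) t)
    = scl M c (sm ((\<alpha> + qq x) * \<pi>) (exm (D x a) (%r. scl M ((- r) ^ snd x) (g x r)) t))" if "x : ?A" for x
  proof -
   have "x : J" using that A(2) by blast
   thus ?thesis by (simp only: lin_scl[OF D_lin] e(2) M.scl_sm)
  qed
  ultimately show ?thesis by (simp only: M.scale_sum_right cong: sum.cong)
 qed
 finally show "dext \<pi> \<alpha> g (scl V c a) t = scl M c (dext \<pi> \<alpha> g a t)" .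
qed

text \<open>The extra term in \<open>D_der\<close> shifts k by one, and multiplication by -r in the
  shifted summand yields -t together with a term in \<partial> of the derivative, which cancels the
  other half of \<open>D_der\<close>.\<close>

lemma dext_der:
 assumes "wpf g" "!!i k l r. g (i, k) r = g (i, l) r"
 shows "dext \<pi> \<alpha> g (der V a) t = - scl M t (dext \<pi> \<alpha> g a t)"
proof -
 let ?S = "%(i, k). (i, Suc k)"
 let ?A = "supp a \<union> ?S ` supp a"
 let ?A' = "?A \<union> supp (der V a)"
 define h where "h x b = sm ((\<alpha> + qq x) * \<pi>) (exm b (%r. scl M ((- r) ^ snd x) (g x r)) t)" for x b
 have hl: "h x (b + c) = h x b + h x c" "h x 0 = 0" if "x : J" for x b c
  using lin_add[OF exm_lin[OF wpf_pf[OF assms(1) that]]] lin_0[OF exm_lin[OF wpf_pf[OF assms(1) that]]]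
  by (simp_all add: h_def sm_add)
 have A: "finite ?A'" "?A' \<subseteq> J" using finite_supp supp_J by auto
 have hS: "h (i, Suc k) b = - scl M t (h (i, k) b) - h (i, k) (der V b)" if "i : I" for i k b
 proof -
  have p: "pf M (%r. scl M ((- r) ^ k) (g (i, k) r))" using wpf_pf[OF assms(1), of "(i, k)"] that by simp
  have "(%r. scl M ((- r) ^ Suc k) (g (i, Suc k) r)) = (%r. - scl M r (scl M ((- r) ^ k) (g (i, k) r)))"
   using assms(2)[of i "Suc k" _ k] by simp
  hence "exm b (%r. scl M ((- r) ^ Suc k) (g (i, Suc k) r)) t
    = - (scl M t (exm b (%r. scl M ((- r) ^ k) (g (i, k) r)) t) + exm (der V b) (%r. scl M ((- r) ^ k) (g (i, k) r)) t)"
   using exm_neg[OF M.pf_var[OF p]] exm_var[OF p] by (simp only:)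
  thus ?thesis by (simp add: h_def qq_def sm_add sm_minus sm_diff M.scl_sm)
 qed
 have "dext \<pi> \<alpha> g (der V a) t = (SUM x:?A'. h x (D x (der V a)))"
  unfolding h_def using A by (intro dext_bound[OF assms(1)]) auto
 also have "... = (SUM x:?A'. h x (der V (D x a)) + h x (case snd x of 0 => 0 | Suc l => D (fst x, l) a))"
 proof (rule sum.cong)
  fix x assume "x : ?A'"
  hence "x : J" using A by blast
  thus "h x (D x (der V a)) = h x (der V (D x a)) + h x (case snd x of 0 => 0 | Suc l => D (fst x, l) a)"
   using D_der[of "fst x" "snd x" a] hl(1) by simp
 qed simp
 also have "... = (SUM x:?A'. h x (der V (D x a))) + (SUM x:?A'. h x (case snd x of 0 => 0 | Suc l => D (fst x, l) a))"
  by (rule sum.distrib)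
 also have "(SUM x:?A'. h x (der V (D x a))) = (SUM x:supp a. h x (der V (D x a)))"
 proof (rule sum.mono_neutral_right)
  show "ALL x:?A' - supp a. h x (der V (D x a)) = 0"
  proof
   fix x assume "x : ?A' - supp a"
   hence "x : J" "D x a = 0" using A(2) by (auto simp: supp_def)
   thus "h x (der V (D x a)) = 0" using hl(2) by (simp add: lin_0[OF V.lin_der])
  qed
 qed (use A in auto)
 also have "(SUM x:?A'. h x (case snd x of 0 => 0 | Suc l => D (fst x, l) a)) = (SUM x:?S ` supp a. h x (case snd x of 0 => 0 | Suc l => D (fst x, l) a))"
 proof (rule sum.mono_neutral_right)
  show "ALL x:?A' - ?S ` supp a. h x (case snd x of 0 => 0 | Suc l => D (fst x, l) a) = 0"
  proof
   fix x assume x: "x : ?A' - ?S ` supp a"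
   obtain i k where ik: "x = (i, k)" by force
   have "x : J" using x A(2) by blast
   have "(case k of 0 => 0 | Suc l => D (i, l) a) = 0"
   proof (cases k)
    case (Suc l)
    have "(i, l) \<notin> supp a" using x unfolding ik Suc by (auto simp: image_iff)
    thus ?thesis using \<open>x : J\<close> Suc ik by (auto simp: supp_def)
   qed simp
   thus "h x (case snd x of 0 => 0 | Suc l => D (fst x, l) a) = 0" using hl(2)[OF \<open>x : J\<close>] by (simp only: ik fst_conv snd_conv)
  qed
 qed (use A in auto)
 \<comment> \<open>Reindexing by the shift undoes the predecessor in the second term of
   \<open>D_der\<close>.\<close>
 also have "... = (SUM x:supp a. h (?S x) (D x a))"
  by (subst sum.reindex) (auto simp: inj_on_def intro!: sum.cong)
 also have "... = (SUM x:supp a. - scl M t (h x (D x a)) - h x (der V (D x a)))"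
  by (rule sum.cong) (auto simp: hS supp_def)
 also have "(SUM x:supp a. h x (der V (D x a))) + ... = - scl M t (SUM x:supp a. h x (D x a))"
  by (simp add: sum_subtractf M.scale_sum_right sum_negf)
 finally show ?thesis by (simp add: dext_def h_def)
qed

text \<open>The Leibniz rule of each partial derivative, with \<open>exm_exm\<close> pulling the
  remaining factor out of the operator.\<close>

lemma dext_mult:
 assumes "wpf g" "b : par V \<beta>" "c : par V \<gamma>"
 shows "dext \<pi> (\<beta> + \<gamma>) g (b * c) t = sm (\<beta> * \<pi>) (exm b (dext \<pi> \<gamma> g c) t) + sm (\<gamma> * (\<beta> + \<pi>)) (exm c (dext \<pi> \<beta> g b) t)"
proof -
 let ?A = "supp b \<union> supp c \<union> supp (b * c)"
 have A: "finite ?A" "?A \<subseteq> J" using finite_supp supp_J by auto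
 define p where "p x = (%r. scl M ((- r) ^ snd x) (g x r))" for x
 have pf: "pf M (p x)" if "x : J" for x using wpf_pf[OF assms(1) that] by (simp add: p_def)
 have d: "dext \<pi> \<alpha> g a = (%t. SUM x:?A. sm ((\<alpha> + qq x) * \<pi>) (exm (D x a) (p x) t))" if "supp a \<subseteq> ?A" for \<alpha> a
  using dext_bound[OF assms(1) A(1) that A(2)] by (auto simp: p_def)
 have s: "exm (b' + c') (p x) t = exm b' (p x) t + exm c' (p x) t" "exm (sm e b') (p x) t = sm e (exm b' (p x) t)" if "x : J" for b' c' e x t
  using lin_add[OF exm_lin[OF pf[OF that]]] lin_sm[OF exm_lin[OF pf[OF that]]] by simp_all
 have E: "exm b (%t. SUM x:?A. sm (e x) (exm (D x c') (p x) t)) t = (SUM x:?A. sm (e x) (exm (b * D x c') (p x) t))" for b c' e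
 proof -
  have "exm b (%t. SUM x:?A. sm (e x) (exm (D x c') (p x) t)) t = (SUM x:?A. exm b (%t. sm (e x) (exm (D x c') (p x) t)) t)"
   using A(2) by (intro exm_sum M.pf_sm pf_exm pf) auto
  also have "... = (SUM x:?A. sm (e x) (exm (b * D x c') (p x) t))"
  proof (rule sum.cong)
   fix x assume "x : ?A"
   hence "x : J" using A(2) by blast
   thus "exm b (%t. sm (e x) (exm (D x c') (p x) t)) t = sm (e x) (exm (b * D x c') (p x) t)"
    using pf by (simp only: exm_sm pf_exm exm_exm)
  qed simp
  finally show ?thesis .
 qed
 have "dext \<pi> (\<beta> + \<gamma>) g (b * c) t = (SUM x:?A. sm ((\<beta> + \<gamma> + qq x) * \<pi>) (exm (D x (b * c)) (p x) t))"
  by (simp add: d)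
 also have "... = (SUM x:?A. sm (\<beta> * \<pi>) (sm ((\<gamma> + qq x) * \<pi>) (exm (b * D x c) (p x) t))
   + sm (\<gamma> * (\<beta> + \<pi>)) (sm ((\<beta> + qq x) * \<pi>) (exm (c * D x b) (p x) t)))"
 proof (rule sum.cong)
  fix x assume "x : ?A"
  hence x: "x : J" using A(2) by blast
  have "D x (b * c) = b * D x c + sm (qq x * \<gamma> + (\<beta> + qq x) * \<gamma>) (c * D x b)"
   using D_mult[OF assms(3)] mult_comm[OF D_par[OF x assms(2)] assms(3)] by (simp add: sm_sm)
  thus "sm ((\<beta> + \<gamma> + qq x) * \<pi>) (exm (D x (b * c)) (p x) t) =
     sm (\<beta> * \<pi>) (sm ((\<gamma> + qq x) * \<pi>) (exm (b * D x c) (p x) t)) +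
     sm (\<gamma> * (\<beta> + \<pi>)) (sm ((\<beta> + qq x) * \<pi>) (exm (c * D x b) (p x) t))"
   by (simp add: s[OF x]) (cases \<beta>; cases \<gamma>; cases \<pi>; cases "qq x"; simp)
 qed simp
 finally have "dext \<pi> (\<beta> + \<gamma>) g (b * c) t = (SUM x:?A. sm (\<beta> * \<pi>) (sm ((\<gamma> + qq x) * \<pi>) (exm (b * D x c) (p x) t))
   + sm (\<gamma> * (\<beta> + \<pi>)) (sm ((\<beta> + qq x) * \<pi>) (exm (c * D x b) (p x) t)))" .
 moreover have "dext \<pi> \<gamma> g c = (%t. SUM x:?A. sm ((\<gamma> + qq x) * \<pi>) (exm (D x c) (p x) t))"
  "dext \<pi> \<beta> g b = (%t. SUM x:?A. sm ((\<beta> + qq x) * \<pi>) (exm (D x b) (p x) t))"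
  by (rule d; blast)+
 ultimately show ?thesis by (simp only: E sum.distrib sm_sum)
qed

definition GPoly :: "(('i \<times> 'f) list => 'm) => bool" where
 "GPoly G \<longleftrightarrow> (ALL ws. (ALL (i, \<phi>):set ws. i : I & afn UNIV \<phi>) --> M.polyfun UNIV (%l. G (map (%(i, \<phi>). (i, \<phi> l)) ws)))"

definition GSym :: "(('i \<times> 'f) list => 'm) => bool" where
 "GSym G \<longleftrightarrow> (ALL us:lists GX. ALL vs:lists GX. ALL x:GX. ALL z:GX. G (us @ x # z # vs) = sm (qx x * qx z) (G (us @ z # x # vs)))"

definition GPar :: "bit => (('i \<times> 'f) list => 'm) => bool" where
 "GPar \<pi> G \<longleftrightarrow> (ALL zs:lists GX. G zs : par M (1 + \<pi> + sum_list (map qx zs)))"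

abbreviation ginst :: "('i \<times> ((nat => 'f) => 'f)) list => (nat => 'f) => ('i \<times> 'f) list" where
 "ginst ws l \<equiv> map (%(i, \<phi>). (i, \<phi> l)) ws"

definition GXF :: "('i \<times> ((nat => 'f) => 'f)) set" where "GXF = {(i, \<phi>). i : I & afn UNIV \<phi>}"

lemma polyfun_npow: "afn UNIV \<phi> ==> M.polyfun UNIV f ==> M.polyfun UNIV (%l. scl M ((- \<phi> l) ^ k) (f l))"
proof (induction k)
 case (Suc k)
 have "M.polyfun UNIV (%l. - scl M (\<phi> l) (scl M ((- \<phi> l) ^ k) (f l)))"
  by (rule M.polyfun_neg[OF M.polyfun_afn[OF Suc.prems(1) Suc.IH[OF Suc.prems]]])
 thus ?case by simp
qed simp

text \<open>\<open>pre\<close> holds the generators already substituted, whose values may vary as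
  well; without it the induction would only cover fixed values.\<close>

lemma PF_ext_aux:
 assumes G: "GPoly G"
 shows "ws : lists XF ==> pre : lists GXF ==> M.polyfun UNIV (%l. ext \<pi> (%zs. G (ginst pre l @ zs)) (inst ws l))"
proof (induction "length ws" arbitrary: \<pi> pre ws)
 case 0
 hence "M.polyfun UNIV (%l. G (ginst pre l))" using G by (auto simp: GPoly_def GXF_def in_lists_conv_set)
 thus ?case using 0 by simp
next
 case (Suc n)
 then obtain w ws' where ws: "ws = w # ws'" by (cases ws) auto
 obtain a \<alpha> \<phi> where w: "w = (a, \<alpha>, \<phi>)" by (metis prod_cases3)
 have a: "a : par V \<alpha>" "afn UNIV \<phi>" "ws' : lists XF" using Suc.prems w ws by (auto simp: XF_def)
 have len: "n = length (shiftw ws')" using Suc.hyps(2) ws by (simp add: shiftw_def)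
 let ?sh = "map (%(i, \<phi>). (i, %l. \<phi> (%i. l (Suc i)))) pre"
 have "M.polyfun UNIV (%l. exm (D x a) (%r. scl M ((- r) ^ snd x) (ext (\<pi> + 1 + qq x) (%zs. G (ginst pre l @ (fst x, r) # zs)) (inst ws' l))) (\<phi> l))"
  if "x : supp a" for x
 proof -
  \<comment> \<open>All variables move up by one, which frees variable 0 for the value of the new
    generator, in the form that \<open>polyfun_exm\<close> requires.\<close>
  have sh: "?sh : lists GXF" "!!l. ginst ?sh l = ginst pre (%i. l (Suc i))"
   using Suc.prems(2) by (auto simp: GXF_def in_lists_conv_set intro!: afn_subst[where \<phi> = "%i l. l (Suc i)"] afn_var)
  have "?sh @ [(fst x, %l. l 0)] : lists GXF" using sh(1) that by (auto simp: GXF_def supp_def afn_var)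
  from Suc.hyps(1)[OF len shiftw(1)[OF a(3)] this, of "\<pi> + 1 + qq x"]
  have "M.polyfun UNIV (%l. ext (\<pi> + 1 + qq x) (%zs. G (ginst pre (%i. l (Suc i)) @ (fst x, l 0) # zs)) (inst ws' (%i. l (Suc i))))"
   unfolding map_append sh(2) shiftw(2) by simp
  from polyfun_exm[OF polyfun_npow[OF afn_var[of 0] this] a(2), of "D x a" "snd x"]
  show ?thesis by simp
 qed
 thus ?case by (auto simp: w ws dext_def intro!: M.polyfun_sum M.polyfun_sm)
qed

lemma GPoly_ins: "GPoly G ==> i : I ==> GPoly (%zs. G ((i, t) # zs))"
 unfolding GPoly_def
proof (intro allI impI)
 fix ws :: "('i \<times> ((nat => 'f) => 'f)) list"
 assume *: "ALL ws. (ALL (i, \<phi>):set ws. i : I & afn UNIV \<phi>) --> M.polyfun UNIV (%l. G (ginst ws l))" "i : I"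
  "ALL (i, \<phi>):set ws. i : I & afn UNIV \<phi>"
 show "M.polyfun UNIV (%l. G ((i, t) # ginst ws l))"
 proof -
  have "ALL (i, \<phi>):set ((i, %_. t) # ws). i : I & afn UNIV \<phi>" using * by (auto simp: afn_const)
  with *(1) have "M.polyfun UNIV (%l. G (ginst ((i, %_. t) # ws) l))" by blast
  thus ?thesis by simp
 qed
qed

lemma wpf_ext:
 assumes "GPoly G" "xs : lists X"
 shows "wpf (%x r. ext (\<pi> + 1 + qq x) (%zs. G ((fst x, r) # zs)) xs)"
 unfolding wpf_def
proof
 fix x assume x: "x : J"
 obtain ws where w: "ws : lists XF" "!!l. inst ws l = xs" using PF_const_inst[OF assms(2)] by blast
 have "[(fst x, %l. l 0)] : lists GXF" using x by (auto simp: GXF_def afn_var)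
 from PF_ext_aux[OF assms(1) w(1) this, of "\<pi> + 1 + qq x"]
 have "M.polyfun UNIV (%l. ext (\<pi> + 1 + qq x) (%zs. G ((fst x, l 0) # zs)) xs)" by (simp add: w(2))
 from M.pf_polyfun_upd[OF this, of undefined 0]
 show "pf M (%r. ext (\<pi> + 1 + qq x) (%zs. G ((fst x, r) # zs)) xs)" by simp
qed

lemma PF_ext: "GPoly G ==> PF (%_. ext \<pi> G)"
 using PF_ext_aux[of G _ "[]" \<pi>] by (simp add: PF_def)

lemma dext_cong:
 "(!!x r. x : supp a ==> g x r = g' x r) ==> dext \<pi> \<alpha> g a t = dext \<pi> \<alpha> g' a t"
 by (auto simp: dext_def intro!: sum.cong)

lemma dext_add: "wpf g ==> wpf g' ==> dext \<pi> \<alpha> (%x r. g x r + g' x r) a t = dext \<pi> \<alpha> g a t + dext \<pi> \<alpha> g' a t"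
proof -
 assume g: "wpf g" "wpf g'"
 have "exm (D x a) (%r. scl M ((- r) ^ snd x) (g x r + g' x r)) t
   = exm (D x a) (%r. scl M ((- r) ^ snd x) (g x r)) t + exm (D x a) (%r. scl M ((- r) ^ snd x) (g' x r)) t" if "x : supp a" for x
 proof -
  have "x : J" using that supp_J by blast
  from exm_add[OF wpf_pf[OF g(1) this] wpf_pf[OF g(2) this]] show ?thesis by (simp add: M.scale_right_distrib)
 qed
 thus ?thesis by (simp add: dext_def sm_add sum.distrib)
qed

lemma dext_scl: "wpf g ==> dext \<pi> \<alpha> (%x r. scl M c (g x r)) a t = scl M c (dext \<pi> \<alpha> g a t)"
proof -
 assume g: "wpf g"
 have "exm (D x a) (%r. scl M ((- r) ^ snd x) (scl M c (g x r))) t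
   = scl M c (exm (D x a) (%r. scl M ((- r) ^ snd x) (g x r)) t)" if "x : supp a" for x
 proof -
  have "x : J" using that supp_J by blast
  from exm_scl[OF wpf_pf[OF g this]] show ?thesis by (simp add: mult.commute)
 qed
 thus ?thesis by (simp add: dext_def M.scl_sm M.scale_sum_right)
qed

lemma dext_sm: "wpf g ==> dext \<pi> \<alpha> (%x r. sm e (g x r)) a t = sm e (dext \<pi> \<alpha> g a t)"
 using dext_scl[of g \<pi> \<alpha> "sg e" a t] by (simp add: M.sg_sm)

lemma LinAt_ext: "GPoly G ==> us : lists X ==> vs : lists X ==> LinAt (ext \<pi> G) us vs"
proof (induction us arbitrary: \<pi> G)
 case Nil
 note w = wpf_ext[OF Nil.prems(1,3)]
 show ?case
  unfolding LinAt_def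
  by (auto simp: lin_add[OF dext_lin[OF w]] lin_scl[OF dext_lin[OF w]] intro!: dext_der[OF w]) (simp add: qq_def)
next
 case (Cons x us)
 obtain a \<alpha> t where x: "x = (a, \<alpha>, t)" by (metis prod_cases3)
 have us: "us : lists X" using Cons.prems by simp
 have IH: "LinAt (ext \<pi>' (%zs. G ((i, r) # zs))) us vs" if "i : I" for i r \<pi>'
  using Cons.IH[OF GPoly_ins[OF Cons.prems(1) that] us Cons.prems(3)] .
 have w: "wpf (%x r. ext (\<pi> + 1 + qq x) (%zs. G ((fst x, r) # zs)) (us @ (b, \<beta>, s) # vs))" if "b : par V \<beta>" for b \<beta> s
  using Cons.prems us that by (intro wpf_ext) auto
 have sI: "x : supp a ==> fst x : I" for x using supp_J by fastforce
 show ?case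
  unfolding LinAt_def
 proof (intro allI ballI conjI)
  fix \<beta> s b c
  assume b: "b : par V \<beta>"
  have "ext \<pi> G ((x # us) @ (scl V c b, \<beta>, s) # vs) = dext \<pi> \<alpha> (%x r. scl M c (ext (\<pi> + 1 + qq x) (%zs. G ((fst x, r) # zs)) (us @ (b, \<beta>, s) # vs))) a t"
   unfolding x append_Cons ext.simps by (rule dext_cong) (rule LinAt_D(2)[OF IH[OF sI] b])
  thus "ext \<pi> G ((x # us) @ (scl V c b, \<beta>, s) # vs) = scl M c (ext \<pi> G ((x # us) @ (b, \<beta>, s) # vs))"
   by (simp add: dext_scl[OF w[OF b]] x)
  have "ext \<pi> G ((x # us) @ (der V b, \<beta>, s) # vs) = dext \<pi> \<alpha> (%x r. scl M (- s) (ext (\<pi> + 1 + qq x) (%zs. G ((fst x, r) # zs)) (us @ (b, \<beta>, s) # vs))) a t"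
   unfolding x append_Cons ext.simps
   by (rule dext_cong) (use LinAt_D(3)[OF IH[OF sI] b] in simp)
  thus "ext \<pi> G ((x # us) @ (der V b, \<beta>, s) # vs) = - scl M s (ext \<pi> G ((x # us) @ (b, \<beta>, s) # vs))"
   unfolding dext_scl[OF w[OF b]] by (simp add: x)
  fix b' assume b': "b' : par V \<beta>"
  have "ext \<pi> G ((x # us) @ (b + b', \<beta>, s) # vs) = dext \<pi> \<alpha> (%x r. ext (\<pi> + 1 + qq x) (%zs. G ((fst x, r) # zs)) (us @ (b, \<beta>, s) # vs)
    + ext (\<pi> + 1 + qq x) (%zs. G ((fst x, r) # zs)) (us @ (b', \<beta>, s) # vs)) a t"
   unfolding x append_Cons ext.simps by (rule dext_cong) (rule LinAt_D(1)[OF IH[OF sI] b b'])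
  thus "ext \<pi> G ((x # us) @ (b + b', \<beta>, s) # vs) = ext \<pi> G ((x # us) @ (b, \<beta>, s) # vs) + ext \<pi> G ((x # us) @ (b', \<beta>, s) # vs)"
   by (simp add: dext_add[OF w[OF b] w[OF b']] x)
 qed
qed

lemma spar_ext: "GPoly G ==> GPar \<pi> G ==> xs : lists X ==> ext \<pi> G xs : par M (1 + \<pi> + qs xs)"
proof (induction xs arbitrary: \<pi> G)
 case Nil
 from bspec[OF Nil.prems(2)[unfolded GPar_def], of "[]"] show ?case by simp
next
 case (Cons x xs)
 obtain a \<alpha> t where x: "x = (a, \<alpha>, t)" by (metis prod_cases3)
 have xs: "xs : lists X" "a : par V \<alpha>" using Cons.prems x by auto
 note w = wpf_ext[OF Cons.prems(1) xs(1)]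
 show ?case unfolding x ext.simps dext_def
 proof (intro M.par_sum M.par_sm)
  fix z assume z: "z : supp a"
  hence zJ: "z : J" "fst z : I" using supp_J by fastforce+
  have gp: "GPar (\<pi> + 1 + qq z) (%zs. G ((fst z, r) # zs))" for r
   unfolding GPar_def
  proof
   fix zs assume "zs : lists GX"
   hence "(fst z, r) # zs : lists GX" using zJ by simp
   from bspec[OF Cons.prems(2)[unfolded GPar_def] this]
   show "G ((fst z, r) # zs) : par M (1 + (\<pi> + 1 + qq z) + sum_list (map qx zs))" by (simp add: qq_def add_ac)
  qed
  have "ext (\<pi> + 1 + qq z) (%zs. G ((fst z, r) # zs)) xs : par M (1 + (\<pi> + 1 + qq z) + qs xs)" for r
   using Cons.IH[OF GPoly_ins[OF Cons.prems(1) zJ(2)] gp xs(1)] .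
  hence "exm (D z a) (%r. scl M ((- r) ^ snd z) (ext (\<pi> + 1 + qq z) (%zs. G ((fst z, r) # zs)) xs)) t
    : par M ((\<alpha> + qq z) + (1 + (\<pi> + 1 + qq z) + qs xs))"
   using xs zJ by (intro exm_par wpf_pf[OF w] D_par M.par_scl) auto
  moreover have "(\<alpha> + qq z) + (1 + (\<pi> + 1 + qq z) + qs xs) = 1 + \<pi> + qs ((a, \<alpha>, t) # xs)"
   by (cases "qq z") (simp_all add: add_ac)
  ultimately show "exm (D z a) (%r. scl M ((- r) ^ snd z) (ext (\<pi> + 1 + qq z) (%zs. G ((fst z, r) # zs)) xs)) t : par M (1 + \<pi> + qs ((a, \<alpha>, t) # xs))"
   by (simp only:)
 qed
qed

lemma pf2_ext:
 assumes "GPoly G" "us : lists X" "vs : lists X" "i : I" "b : par V \<beta>"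
 shows "pf2 (%r t. scl M ((- r) ^ k) (ext \<pi> (%zs. G ((i, r) # zs)) (us @ (b, \<beta>, t) # vs)))"
proof -
 obtain w1 w2 where w: "w1 : lists XF" "!!l. inst w1 l = us" "w2 : lists XF" "!!l. inst w2 l = vs"
  using PF_const_inst assms by metis
 hence "w1 @ (b, \<beta>, %l. l 1) # w2 : lists XF" using assms(5) by (auto simp: XF_def afn_var)
 moreover have "[(i, %l. l 0)] : lists GXF" using assms(4) by (auto simp: GXF_def afn_var)
 ultimately have "M.polyfun UNIV (%l. ext \<pi> (%zs. G ((i, l 0) # zs)) (us @ (b, \<beta>, l 1) # vs))"
  using PF_ext_aux[OF assms(1), of "w1 @ (b, \<beta>, %l. l 1) # w2" "[(i, %l. l 0)]" \<pi>] by (simp add: w)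
 from polyfun_npow[OF afn_var[of 0] this, of k] show ?thesis unfolding pf2_def
  by (intro exI[of _ "%l. scl M ((- l 0) ^ k) (ext \<pi> (%zs. G ((i, l 0) # zs)) (us @ (b, \<beta>, l 1) # vs))"]
    exI[of _ "%_. 0"] exI[of _ "%i. if i = 0 then 1 else 0"] exI[of _ "%i. if i = 0 then 0 else 1"]) auto
qed

text \<open>Operators in different slots commute up to the sign of b passing the partial derivatives
  of a; that sign is absorbed by replacing \<pi> with \<pi> + \<beta>.\<close>

lemma exm_dext:
 assumes "b : par V \<beta>" "a : par V \<alpha>" "!!x. x : J ==> pf2 (%r t. scl M ((- r) ^ snd x) (g x r t))"
  "!!x r. x : J ==> pf M (g x r)"
 shows "dext \<pi> \<alpha> (%x r. exm b (g x r) t) a t0 = exm b (%t. dext (\<pi> + \<beta>) \<alpha> (%x r. g x r t) a t0) t"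
proof -
 have J: "x : J" "D x a : par V (\<alpha> + qq x)" if "x : supp a" for x using that supp_J D_par[OF _ assms(2)] by blast+
 have "exm b (%t. dext (\<pi> + \<beta>) \<alpha> (%x r. g x r t) a t0) t
   = (SUM x:supp a. exm b (%t. sm ((\<alpha> + qq x) * (\<pi> + \<beta>)) (exm (D x a) (%r. scl M ((- r) ^ snd x) (g x r t)) t0)) t)"
  unfolding dext_def by (rule exm_sum, rule M.pf_sm, rule pf2_exm[OF pf2_flip[OF assms(3)[OF J(1)]]])
 also have "... = (SUM x:supp a. sm ((\<alpha> + qq x) * \<pi>) (exm (D x a) (%r. scl M ((- r) ^ snd x) (exm b (g x r) t)) t0))"
 proof (rule sum.cong[OF refl])
  fix x assume x: "x : supp a"
  note p2 = assms(3)[OF J(1)[OF x]]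
  have "exm b (%t. exm (D x a) (%r. scl M ((- r) ^ snd x) (g x r t)) t0) t
    = sm (\<beta> * (\<alpha> + qq x)) (exm (D x a) (%r. exm b (%t. scl M ((- r) ^ snd x) (g x r t)) t) t0)"
   by (rule exm_commute[OF pf2_flip[OF p2] assms(1) J(2)[OF x]])
  also have "(%r. exm b (%t. scl M ((- r) ^ snd x) (g x r t)) t) = (%r. scl M ((- r) ^ snd x) (exm b (g x r) t))"
   using assms(4)[OF J(1)[OF x]] by (simp add: exm_scl)
  finally show "exm b (%t. sm ((\<alpha> + qq x) * (\<pi> + \<beta>)) (exm (D x a) (%r. scl M ((- r) ^ snd x) (g x r t)) t0)) t
    = sm ((\<alpha> + qq x) * \<pi>) (exm (D x a) (%r. scl M ((- r) ^ snd x) (exm b (g x r) t)) t0)"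
   using exm_sm[OF pf2_exm[OF pf2_flip[OF p2]]] by (simp add: sm_sm) (simp add: algebra_simps)
 qed
 finally show ?thesis by (simp add: dext_def)
qed

text \<open>The converse bookkeeping: a sign depending on the generator is the same as a change of
  \<pi>.\<close>

lemma dext_shift: "wpf g ==> dext \<pi> \<alpha> (%x r. sm (\<beta> * (\<alpha> + qq x)) (g x r)) a t = dext (\<pi> + \<beta>) \<alpha> g a t"
 unfolding dext_def
proof (rule sum.cong[OF refl])
 fix x assume g: "wpf g" "x : supp a"
 have "x : J" using g supp_J by blast
 from exm_sm[OF wpf_pf[OF g(1) this]]
 show "sm ((\<alpha> + qq x) * \<pi>) (exm (D x a) (%r. scl M ((- r) ^ snd x) (sm (\<beta> * (\<alpha> + qq x)) (g x r))) t)
   = sm ((\<alpha> + qq x) * (\<pi> + \<beta>)) (exm (D x a) (%r. scl M ((- r) ^ snd x) (g x r)) t)"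
  by (simp add: M.scl_sm sm_sm) (simp add: algebra_simps)
qed

lemma LeibAt_ext: "GPoly G ==> us : lists X ==> vs : lists X ==> LeibAt \<pi> (ext \<pi> G) us vs"
proof (induction us arbitrary: \<pi> G)
 case Nil
 note w = wpf_ext[OF Nil.prems(1,3)]
 show ?case unfolding LeibAt_def by (simp add: dext_mult[OF w])
next
 case (Cons x us)
 obtain a \<alpha> t0 where x: "x = (a, \<alpha>, t0)" by (metis prod_cases3)
 have us: "us : lists X" and a: "a : par V \<alpha>" using Cons.prems x by auto
 have sI: "x : supp a ==> fst x : I" for x using supp_J by fastforce
 let ?e = "%x r. ext (\<pi> + 1 + qq x) (%zs. G ((fst x, r) # zs))"
 have w: "wpf (%x r. ?e x r (us @ (b, \<beta>, s) # vs))" if "b : par V \<beta>" for b \<beta> s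
  using Cons.prems us that by (intro wpf_ext) auto
 have p2: "pf2 (%r t. scl M ((- r) ^ snd x) (?e x r (us @ (b, \<beta>, t) # vs)))" if "b : par V \<beta>" "x : J" for b \<beta> x
  using that by (intro pf2_ext Cons.prems us) auto
 have p1: "pf M (%t. ?e x r (us @ (b, \<beta>, t) # vs))" if "b : par V \<beta>" "x : J" for b \<beta> x r
  using that by (intro PF_pf PF_ext GPoly_ins Cons.prems us) auto
 have P1: "exm c (%t. dext \<pi> \<alpha> (%x r. ?e x r (us @ (b, \<beta>, t) # vs)) a t0) t
   = dext (\<pi> + \<gamma>) \<alpha> (%x r. exm c (%t. ?e x r (us @ (b, \<beta>, t) # vs)) t) a t0" if "b : par V \<beta>" "c : par V \<gamma>" for b \<beta> c \<gamma> t
  using exm_dext[OF that(2) a, of "%x r t. ?e x r (us @ (b, \<beta>, t) # vs)" "\<pi> + \<gamma>"] p2[OF that(1)] p1[OF that(1)] by simp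
 have wE: "wpf (%x r. exm c (%t. ?e x r (us @ (b, \<beta>, t) # vs)) t)" if "b : par V \<beta>" "c : par V \<gamma>" for b \<beta> c \<gamma> t
  unfolding wpf_def
 proof
  fix x assume "x : J"
  hence "pf2 (%r t. scl M ((- r) ^ 0) (?e x r (us @ (b, \<beta>, t) # vs)))" using that by (intro pf2_ext Cons.prems us) auto
  thus "pf M (%r. exm c (%t. ?e x r (us @ (b, \<beta>, t) # vs)) t)" using pf2_exm by simp
 qed
 show ?case
  unfolding LeibAt_def
 proof (intro allI ballI)
  fix \<beta> \<gamma> t b c assume bc: "b : par V \<beta>" "c : par V \<gamma>"
  \<comment> \<open>The sign parameter that the Leibniz rule prescribes for this slot. The inner
    rule has the parity of the generator x instead of that of a; the difference \<alpha> +
    \<open>qq x\<close> is handled by \<open>dext_shift\<close>.\<close>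
  define \<sigma> where "\<sigma> = \<pi> + (1 + \<alpha> + qs us)"
  have "ext \<pi> G ((x # us) @ (b * c, \<beta> + \<gamma>, t) # vs) = dext \<pi> \<alpha> (%x r.
    sm (\<beta> * \<sigma>) (sm (\<beta> * (\<alpha> + qq x)) (exm b (%t. ?e x r (us @ (c, \<gamma>, t) # vs)) t))
    + sm (\<gamma> * (\<beta> + \<sigma>)) (sm (\<gamma> * (\<alpha> + qq x)) (exm c (%t. ?e x r (us @ (b, \<beta>, t) # vs)) t))) a t0"
   unfolding x append_Cons ext.simps
  proof (rule dext_cong)
   fix x r assume xa: "x : supp a"
   have "LeibAt (\<pi> + 1 + qq x) (?e x r) us vs"
    by (rule Cons.IH[OF GPoly_ins[OF Cons.prems(1) sI[OF xa]] us Cons.prems(3)])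
   hence "?e x r (us @ (b * c, \<beta> + \<gamma>, t) # vs) = sm (\<beta> * (\<pi> + 1 + qq x + qs us)) (exm b (%t. ?e x r (us @ (c, \<gamma>, t) # vs)) t)
    + sm (\<gamma> * (\<beta> + (\<pi> + 1 + qq x + qs us))) (exm c (%t. ?e x r (us @ (b, \<beta>, t) # vs)) t)"
    using bc unfolding LeibAt_def by blast
   thus "?e x r (us @ (b * c, \<beta> + \<gamma>, t) # vs) = sm (\<beta> * \<sigma>) (sm (\<beta> * (\<alpha> + qq x)) (exm b (%t. ?e x r (us @ (c, \<gamma>, t) # vs)) t))
    + sm (\<gamma> * (\<beta> + \<sigma>)) (sm (\<gamma> * (\<alpha> + qq x)) (exm c (%t. ?e x r (us @ (b, \<beta>, t) # vs)) t))"
    by (cases \<alpha>; cases \<beta>; cases \<gamma>; cases \<pi>; cases "qs us"; cases "qq x"; simp add: \<sigma>_def)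
  qed
  also have "... = sm (\<beta> * \<sigma>) (dext (\<pi> + \<beta>) \<alpha> (%x r. exm b (%t. ?e x r (us @ (c, \<gamma>, t) # vs)) t) a t0)
    + sm (\<gamma> * (\<beta> + \<sigma>)) (dext (\<pi> + \<gamma>) \<alpha> (%x r. exm c (%t. ?e x r (us @ (b, \<beta>, t) # vs)) t) a t0)"
  proof -
   have ws: "wpf (%x r. sm (e x) (g x r))" if "wpf g" for g :: "'i \<times> nat => 'f => 'm" and e
    using that by (auto simp: wpf_def intro: M.pf_sm)
   note W = wE[OF bc(2,1)] wE[OF bc]
   show ?thesis
    by (simp only: dext_add[OF ws[OF ws[OF W(1)]] ws[OF ws[OF W(2)]]] dext_sm[OF ws[OF W(1)]] dext_sm[OF ws[OF W(2)]]
      dext_shift[OF W(1)] dext_shift[OF W(2)])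
  qed
  finally show "ext \<pi> G ((x # us) @ (b * c, \<beta> + \<gamma>, t) # vs) =
    sm (\<beta> * (\<pi> + qs (x # us))) (exm b (%r. ext \<pi> G ((x # us) @ (c, \<gamma>, r) # vs)) t) +
    sm (\<gamma> * (\<beta> + (\<pi> + qs (x # us)))) (exm c (%r. ext \<pi> G ((x # us) @ (b, \<beta>, r) # vs)) t)"
   using P1[OF bc(2) bc(1)] P1[OF bc] by (simp add: x \<sigma>_def add.assoc)
 qed
qed

lemma ext_cong: "(!!zs. zs : lists GX ==> G zs = G' zs) ==> ext \<pi> G xs = ext \<pi> G' xs"
proof (induction xs arbitrary: \<pi> G G')
 case (Cons x xs)
 obtain a \<alpha> t0 where x: "x = (a, \<alpha>, t0)" by (metis prod_cases3)
 show ?case unfolding x ext.simps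
 proof (rule dext_cong)
  fix x r assume "x : supp a"
  hence "fst x : I" using supp_J by fastforce
  thus "ext (\<pi> + 1 + qq x) (%zs. G ((fst x, r) # zs)) xs = ext (\<pi> + 1 + qq x) (%zs. G' ((fst x, r) # zs)) xs"
   by (intro Cons.IH Cons.prems) simp
 qed
qed simp

lemma ext_sm: "GPoly G ==> xs : lists X ==> ext \<pi> (%zs. sm e (G zs)) xs = sm e (ext \<pi> G xs)"
proof (induction xs arbitrary: \<pi> G)
 case (Cons x xs)
 obtain a \<alpha> t0 where x: "x = (a, \<alpha>, t0)" by (metis prod_cases3)
 have xs: "xs : lists X" using Cons.prems by simp
 have "ext \<pi> (%zs. sm e (G zs)) (x # xs) = dext \<pi> \<alpha> (%x r. sm e (ext (\<pi> + 1 + qq x) (%zs. G ((fst x, r) # zs)) xs)) a t0"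
  unfolding x ext.simps
 proof (rule dext_cong)
  fix x r assume "x : supp a"
  hence "fst x : I" using supp_J by fastforce
  thus "ext (\<pi> + 1 + qq x) (%zs. sm e (G ((fst x, r) # zs))) xs = sm e (ext (\<pi> + 1 + qq x) (%zs. G ((fst x, r) # zs)) xs)"
   by (intro Cons.IH GPoly_ins Cons.prems xs)
 qed
 thus ?case by (simp add: dext_sm[OF wpf_ext[OF Cons.prems(1) xs]] x)
qed simp

text \<open>Brings two nested expansions into a form in which the two slots appear alike, ready to
  be exchanged.\<close>

lemma dext_dext:
 assumes "!!x y. x : J ==> y : J ==> pf2 (%r s. scl M ((- r) ^ snd x) (scl M ((- s) ^ snd y) (F x y r s)))"
  "!!x y r. x : J ==> y : J ==> pf M (F x y r)"
 shows "dext \<pi> \<alpha> (%x r. dext (\<rho> x) \<beta> (%y s. F x y r s) b s) a t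
  = (SUM x:supp a. SUM y:supp b. sm ((\<alpha> + qq x) * \<pi> + (\<beta> + qq y) * \<rho> x)
    (exm (D x a) (%r. exm (D y b) (%s. scl M ((- r) ^ snd x) (scl M ((- s) ^ snd y) (F x y r s))) s) t))"
 unfolding dext_def[of \<pi>]
proof (rule sum.cong[OF refl])
 let ?E = "%x y r. exm (D y b) (%s. scl M ((- r) ^ snd x) (scl M ((- s) ^ snd y) (F x y r s))) s"
 fix x assume x: "x : supp a"
 hence xJ: "x : J" using supp_J by blast
 have "(%r. scl M ((- r) ^ snd x) (dext (\<rho> x) \<beta> (%y s. F x y r s) b s))
   = (%r. SUM y:supp b. sm ((\<beta> + qq y) * \<rho> x) (?E x y r))"
 proof
  fix r
  have "scl M c (sm e (exm (D y b) (%s. scl M ((- s) ^ snd y) (F x y r s)) s))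
    = sm e (exm (D y b) (%s. scl M c (scl M ((- s) ^ snd y) (F x y r s))) s)" if "y : supp b" for y c e
  proof -
   have "y : J" using that supp_J by blast
   from exm_scl[OF pf_npow[OF assms(2)[OF xJ this]]] show ?thesis by (simp add: M.scl_sm)
  qed
  thus "scl M ((- r) ^ snd x) (dext (\<rho> x) \<beta> (%y s. F x y r s) b s)
   = (SUM y:supp b. sm ((\<beta> + qq y) * \<rho> x) (?E x y r))"
   unfolding dext_def M.scale_sum_right by (intro sum.cong) auto
 qed
 hence "exm (D x a) (%r. scl M ((- r) ^ snd x) (dext (\<rho> x) \<beta> (%y s. F x y r s) b s)) t
   = exm (D x a) (%r. SUM y:supp b. sm ((\<beta> + qq y) * \<rho> x) (?E x y r)) t"
  by (simp only:)
 also have "... = (SUM y:supp b. exm (D x a) (%r. sm ((\<beta> + qq y) * \<rho> x) (?E x y r)) t)"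
  using supp_J[of b] by (intro exm_sum M.pf_sm pf2_exm assms(1) xJ) blast
 also have "... = (SUM y:supp b. sm ((\<beta> + qq y) * \<rho> x) (exm (D x a) (?E x y) t))"
  using supp_J[of b] by (intro sum.cong exm_sm pf2_exm assms(1) xJ) blast+
 finally show "sm ((\<alpha> + qq x) * \<pi>) (exm (D x a) (%r. scl M ((- r) ^ snd x) (dext (\<rho> x) \<beta> (%y s. F x y r s) b s)) t)
   = (SUM y:supp b. sm ((\<alpha> + qq x) * \<pi> + (\<beta> + qq y) * \<rho> x)
    (exm (D x a) (?E x y) t))"
  by (simp add: sm_sum sm_sm)
qed

lemma pf2_ext2:
 assumes "GPoly G" "vs : lists X" "i : I" "j : I"
 shows "pf2 (%r s. scl M ((- r) ^ k) (scl M ((- s) ^ n) (ext \<pi> (%zs. G ((i, r) # (j, s) # zs)) vs)))"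
proof -
 obtain w where w: "w : lists XF" "!!l. inst w l = vs" using PF_const_inst[OF assms(2)] by blast
 have "[(i, %l. l 0), (j, %l. l 1)] : lists GXF" using assms(3,4) by (auto simp: GXF_def afn_var)
 from PF_ext_aux[OF assms(1) w(1) this, of \<pi>]
 have "M.polyfun UNIV (%l. ext \<pi> (%zs. G ((i, l 0) # (j, l 1) # zs)) vs)" by (simp add: w(2))
 from polyfun_npow[OF afn_var[of 0] polyfun_npow[OF afn_var[of 1] this, of n], of k] show ?thesis unfolding pf2_def
  by (intro exI[of _ "%l. scl M ((- l 0) ^ k) (scl M ((- l 1) ^ n) (ext \<pi> (%zs. G ((i, l 0) # (j, l 1) # zs)) vs))"]
    exI[of _ "%_. 0"] exI[of _ "%i. if i = 0 then 1 else 0"] exI[of _ "%i. if i = 0 then 0 else 1"]) auto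
qed

text \<open>For the first two slots the double sum is exchanged, using the symmetry of
  \<open>G\<close> on generators and the commutation of the two exponential operators.\<close>

lemma SymAt_ext: "GPoly G ==> GSym G ==> us : lists X ==> vs : lists X ==> SymAt (ext \<pi> G) us vs"
proof (induction us arbitrary: \<pi> G)
 case Nil
 note G = Nil.prems(1)
 let ?g = "%x y r s zs. G ((fst x, r) # (fst y, s) # zs)" and ?n = "%x (r :: 'f). scl M ((- r) ^ snd x)" and ?\<tau> = "%x y. \<pi> + 1 + qq x + 1 + qq y"
 have p2: "pf2 (%r s. ?n x r (?n y s (ext \<rho> (?g x y r s) vs)))"
  if "x : J" "y : J" for x y \<rho>
  using that by (intro pf2_ext2 G Nil.prems) auto
 have p1: "pf M (%s. ext \<rho> (?g x y r s) vs)" if "x : J" "y : J" for x y \<rho> r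
  using pf2_pf[OF pf2_ext2[OF G Nil.prems(4), of "fst x" "fst y" 0 0 \<rho>], of r] that by auto
 show ?case unfolding SymAt_def
 proof (intro ballI)
  fix x z assume "x : X" "z : X"
  moreover obtain a \<alpha> t b \<beta> s where x: "x = (a, \<alpha>, t)" "z = (b, \<beta>, s)" by (metis prod_cases3)
  ultimately have ab: "a : par V \<alpha>" "b : par V \<beta>" by auto
  have E: "ext \<pi> G ((a, \<alpha>, t) # (b, \<beta>, s) # vs)
    = (SUM x:supp a. SUM y:supp b. sm ((\<alpha> + qq x) * \<pi> + (\<beta> + qq y) * (\<pi> + 1 + qq x))
    (exm (D x a) (%r. exm (D y b) (%s. ?n x r (?n y s
     (ext (?\<tau> x y) (?g x y r s) vs))) s) t))" for a \<alpha> t b \<beta> s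
   unfolding ext.simps by (rule dext_dext[OF p2 p1])
  have "ext \<pi> G ((a, \<alpha>, t) # (b, \<beta>, s) # vs) = (SUM x:supp a. SUM y:supp b. sm ((1 + \<alpha>) * (1 + \<beta>)) (sm ((\<beta> + qq y) * \<pi> + (\<alpha> + qq x) * (\<pi> + 1 + qq y))
    (exm (D y b) (%s. exm (D x a) (%r. ?n y s (?n x r
     (ext (?\<tau> y x) (?g y x s r) vs))) t) s)))"
   unfolding E
  proof (intro sum.cong refl)
   fix x y assume "x : supp a" "y : supp b"
   hence xy: "x : J" "y : J" "fst x : I" "fst y : I" using supp_J by fastforce+
   let ?\<rho> = "?\<tau> y x" and ?\<kappa> = "(1 + qq x) * (1 + qq y)"
   have "ext ?\<rho> (?g x y r s) vs = sm ?\<kappa> (ext ?\<rho> (?g y x s r) vs)" for r s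
   proof -
    have g: "G ((fst x, r) # (fst y, s) # zs) = sm ?\<kappa> (G ((fst y, s) # (fst x, r) # zs))" if "zs : lists GX" for zs
    proof -
     have "G ([] @ (fst x, r) # (fst y, s) # zs) = sm (qx (fst x, r) * qx (fst y, s)) (G ([] @ (fst y, s) # (fst x, r) # zs))"
      by (rule Nil.prems(2)[unfolded GSym_def, rule_format]) (use that xy in auto)
     thus ?thesis by (simp add: qq_def)
    qed
    have "ext ?\<rho> (?g x y r s) vs = ext ?\<rho> (%zs. sm ?\<kappa> (G ((fst y, s) # (fst x, r) # zs))) vs"
     by (rule ext_cong) (rule g)
    thus ?thesis using ext_sm[OF GPoly_ins[OF GPoly_ins[OF G xy(4)] xy(3)] Nil.prems(4)] by simp
   qed
   moreover have "\<pi> + 1 + qq x + 1 + qq y = ?\<rho>" by (simp add: add_ac)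
   ultimately have e: "ext (?\<tau> x y) (?g x y r s) vs
     = sm ?\<kappa> (ext ?\<rho> (?g y x s r) vs)" for r s
    by (simp only:)
   have 1: "(%r s. ?n x r (?n y s (ext (?\<tau> x y) (?g x y r s) vs)))
    = (%r s. sm ?\<kappa> (?n y s (?n x r (ext ?\<rho> (?g y x s r) vs))))"
    unfolding e M.scl_sm by (intro ext arg_cong[where f = "sm _"] M.scale_left_commute)
   let ?F = "%r s. ?n y s (?n x r (ext ?\<rho> (?g y x s r) vs))"
   have F: "pf2 ?F" using pf2_flip[OF p2[OF xy(2,1), of ?\<rho>]] .
   have "exm (D x a) (%r. exm (D y b) (%s. sm ?\<kappa> (?F r s)) s) t
     = sm ?\<kappa> (exm (D x a) (%r. exm (D y b) (?F r) s) t)"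
    by (simp only: exm_sm[OF pf2_pf[OF F]] exm_sm[OF pf2_exm[OF F]])
   also have "exm (D x a) (%r. exm (D y b) (?F r) s) t = sm ((\<alpha> + qq x) * (\<beta> + qq y)) (exm (D y b) (%s. exm (D x a) (%r. ?F r s) t) s)"
    by (rule exm_commute[OF F D_par[OF xy(1) ab(1)] D_par[OF xy(2) ab(2)]])
   finally have 2: "exm (D x a) (%r. exm (D y b) (%s. sm ?\<kappa> (?F r s)) s) t
     = sm ?\<kappa> (sm ((\<alpha> + qq x) * (\<beta> + qq y)) (exm (D y b) (%s. exm (D x a) (%r. ?F r s) t) s))" .
   have 3: "exm (D x a) (%r. exm (D y b) (%s. ?n x r (?n y s (ext (?\<tau> x y) (?g x y r s) vs))) s) t
    = exm (D x a) (%r. exm (D y b) (%s. sm ?\<kappa> (?F r s)) s) t"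
    by (rule arg_cong[OF 1, of "%F. exm (D x a) (%r. exm (D y b) (%s. F r s) s) t"])
   show "sm ((\<alpha> + qq x) * \<pi> + (\<beta> + qq y) * (\<pi> + 1 + qq x))
      (exm (D x a) (%r. exm (D y b) (%s. ?n x r (?n y s (ext (?\<tau> x y) (?g x y r s) vs))) s) t)
     = sm ((1 + \<alpha>) * (1 + \<beta>)) (sm ((\<beta> + qq y) * \<pi> + (\<alpha> + qq x) * (\<pi> + 1 + qq y)) (exm (D y b) (%s. exm (D x a) (%r. ?F r s) t) s))"
   proof -
    \<comment> \<open>With c and d the parities of the two generators: the signs of exchanging
      generators and of exchanging coefficients combine to the sign for exchanging the
      arguments.\<close>
    have "(\<alpha> + c) * \<pi> + (\<beta> + d) * (\<pi> + 1 + c) + ((1 + c) * (1 + d) + (\<alpha> + c) * (\<beta> + d))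
      = (1 + \<alpha>) * (1 + \<beta>) + ((\<beta> + d) * \<pi> + (\<alpha> + c) * (\<pi> + 1 + d))" for c d
     by (cases \<alpha>; cases \<beta>; cases c; cases d; cases \<pi>; simp)
    thus ?thesis unfolding 3 2 sm_sm by (simp only:)
   qed
  qed
  also have "... = sm ((1 + \<alpha>) * (1 + \<beta>)) (ext \<pi> G ((b, \<beta>, s) # (a, \<alpha>, t) # vs))"
   unfolding E by (subst sum.swap) (simp only: sm_sum)
  finally show "ext \<pi> G ([] @ x # z # vs) = sm (q x * q z) (ext \<pi> G ([] @ z # x # vs))"
   by (simp add: x del: ext.simps)
 qed
next
 case (Cons u us)
 obtain a \<alpha> t where u: "u = (a, \<alpha>, t)" by (metis prod_cases3)
 show ?case unfolding SymAt_def
 proof (intro ballI)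
  fix x z assume xz: "x : X" "z : X"
  have "us @ z # x # vs : lists X" using Cons.prems xz by auto
  note w = wpf_ext[OF Cons.prems(1) this]
  have "ext \<pi> G ((u # us) @ x # z # vs) = dext \<pi> \<alpha> (%y r. sm (q x * q z) (ext (\<pi> + 1 + qq y) (%zs. G ((fst y, r) # zs)) (us @ z # x # vs))) a t"
   unfolding u append_Cons ext.simps
  proof (rule dext_cong)
   fix y r assume "y : supp a"
   hence y: "fst y : I" using supp_J by fastforce
   have "GSym (%zs. G ((fst y, r) # zs))" unfolding GSym_def
   proof (intro ballI)
    fix us vs x z assume *: "us : lists GX" "vs : lists GX" "x : GX" "z : GX"
    have "G (((fst y, r) # us) @ x # z # vs) = sm (qx x * qx z) (G (((fst y, r) # us) @ z # x # vs))"
     by (rule Cons.prems(2)[unfolded GSym_def, rule_format]) (use * y in auto)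
    thus "G ((fst y, r) # us @ x # z # vs) = sm (qx x * qx z) (G ((fst y, r) # us @ z # x # vs))" by simp
   qed
   hence "SymAt (ext (\<pi> + 1 + qq y) (%zs. G ((fst y, r) # zs))) us vs"
    using Cons.prems y by (intro Cons.IH GPoly_ins) auto
   thus "ext (\<pi> + 1 + qq y) (%zs. G ((fst y, r) # zs)) (us @ x # z # vs) = sm (q x * q z) (ext (\<pi> + 1 + qq y) (%zs. G ((fst y, r) # zs)) (us @ z # x # vs))"
    using xz unfolding SymAt_def by blast
  qed
  thus "ext \<pi> G ((u # us) @ x # z # vs) = sm (q x * q z) (ext \<pi> G ((u # us) @ z # x # vs))"
   by (simp add: dext_sm[OF w] u)
 qed
qed

lemma BC_ext:
 assumes "GPoly G" "GSym G" "GPar \<pi> G" shows "BC \<pi> (ext \<pi> G)"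
 unfolding BC_def slin_def ssym_def sleib_def spar_def
 using LinAt_ext[OF assms(1)] SymAt_ext[OF assms(1,2)] LeibAt_ext[OF assms(1)] spar_ext[OF assms(1,3)] PF_ext[OF assms(1)] by blast

end

section \<open>Graded symmetrization\<close>

fun choose_front :: "('e => bit) => ('e => 'e list => 'm::ab_group_add) => 'e list => 'm" where
 "choose_front qf H [] = 0"
| "choose_front qf H (y # ys) = H y ys + choose_front qf (%w r. sm (qf w * qf y) (H w (y # r))) ys"

text \<open>The sum over all permutations with signs, generated by choosing the first entry, then
  the second, and so on, instead of by permutations.\<close>

fun symmetrize :: "('e => bit) => nat => ('e list => 'm::ab_group_add) => 'e list => 'm" where
 "symmetrize qf 0 G ys = G ys"
| "symmetrize qf (Suc n) G ys = choose_front qf (%w r. symmetrize qf n (%zs. G (w # zs)) r) ys"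

definition symm :: "('e => bit) => nat => ('e list => 'm::ab_group_add) => bool" where
 "symm qf n G \<longleftrightarrow> (ALL us x z vs. length us + length vs + 2 = n --> G (us @ x # z # vs) = sm (qf x * qf z) (G (us @ z # x # vs)))"

lemma choose_front_sm: "choose_front qf (%w r. sm e (H w r)) ys = sm e (choose_front qf H ys)"
proof (induction ys arbitrary: H)
 case (Cons y ys)
 have "(%w r. sm (qf w * qf y) (sm e (H w (y # r)))) = (%w r. sm e (sm (qf w * qf y) (H w (y # r))))"
  by (simp add: sm_sm add.commute)
 thus ?case by (simp only: choose_front.simps Cons.IH sm_add)
qed simp

lemma choose_front_cong:
 "(!!w r. Suc (length r) = length ys ==> H w r = H' w r) ==> choose_front qf H ys = choose_front qf H' ys"
proof (induction ys arbitrary: H H')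
 case (Cons y ys)
 have "choose_front qf (%w r. sm (qf w * qf y) (H w (y # r))) ys = choose_front qf (%w r. sm (qf w * qf y) (H' w (y # r))) ys"
  by (rule Cons.IH) (simp add: Cons.prems)
 thus ?case by (simp add: Cons.prems)
qed simp

text \<open>Exchanging neighbours x and z swaps the two summands in which one of them is chosen; in
  every other summand they remain neighbours and the symmetry of \<open>H\<close> applies.\<close>

lemma symm_choose_front:
 fixes H :: "'e => 'e list => 'm::ab_group_add"
 shows "(!!w. symm qf n (H w)) ==> symm qf (Suc n) (choose_front qf H)"
proof -
 have "length us + length vs + 2 = Suc n ==> (ALL w. symm qf n (H w)) ==>
   choose_front qf H (us @ x # z # vs) = sm (qf x * qf z) (choose_front qf H (us @ z # x # vs))" for us x z vs n and H :: "'e => 'e list => 'm"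
 proof (induction us arbitrary: n H)
  case Nil
  have E: "choose_front qf (%w r. sm (qf w * qf z) (sm (qf w * qf x) (H w (x # z # r)))) vs
   = sm (qf x * qf z) (choose_front qf (%w r. sm (qf w * qf x) (sm (qf w * qf z) (H w (z # x # r)))) vs)"
   unfolding choose_front_sm[symmetric]
  proof (rule choose_front_cong)
   fix w and r :: "'e list" assume "Suc (length r) = length vs"
   hence "length ([] :: 'e list) + length r + 2 = n" using Nil(1) by simp
   hence "H w ([] @ x # z # r) = sm (qf x * qf z) (H w ([] @ z # x # r))"
    using Nil(2) unfolding symm_def by blast
   hence "H w (x # z # r) = sm (qf x * qf z) (H w (z # x # r))" by simp
   thus "sm (qf w * qf z) (sm (qf w * qf x) (H w (x # z # r))) = sm (qf x * qf z) (sm (qf w * qf x) (sm (qf w * qf z) (H w (z # x # r))))"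
    by (simp only: sm_sm add_ac)
  qed
  show ?case
   unfolding append_Nil choose_front.simps E
   by (simp only: sm_add sm_sm mult.commute[of "qf z" "qf x"] bit_arith sm_simps) (simp add: add_ac)
 next
  case (Cons u us)
  have 1: "symm qf (length us + length vs + 1) (%r. sm (qf w * qf u) (H w (u # r)))" for w
   unfolding symm_def
  proof (intro allI impI)
   fix us' vs' :: "'e list" and x z assume "length us' + length vs' + 2 = length us + length vs + 1"
   hence "length (u # us') + length vs' + 2 = n" using Cons.prems(1) by simp
   hence "H w ((u # us') @ x # z # vs') = sm (qf x * qf z) (H w ((u # us') @ z # x # vs'))"
    using Cons.prems(2) unfolding symm_def by blast
   thus "sm (qf w * qf u) (H w (u # us' @ x # z # vs')) = sm (qf x * qf z) (sm (qf w * qf u) (H w (u # us' @ z # x # vs')))"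
    by (simp only: append_Cons sm_sm add_ac)
  qed
  have "choose_front qf (%w r. sm (qf w * qf u) (H w (u # r))) (us @ x # z # vs) =
    sm (qf x * qf z) (choose_front qf (%w r. sm (qf w * qf u) (H w (u # r))) (us @ z # x # vs))"
   by (rule Cons.IH[of "length us + length vs + 1"]) (use 1 in auto)
  moreover have "H u (us @ x # z # vs) = sm (qf x * qf z) (H u (us @ z # x # vs))"
  proof -
   have "length us + length vs + 2 = n" using Cons.prems(1) by simp
   thus ?thesis using Cons.prems(2) unfolding symm_def by blast
  qed
  ultimately show ?case by (simp add: sm_add)
 qed
 thus "(!!w. symm qf n (H w)) ==> symm qf (Suc n) (choose_front qf H)"
  unfolding symm_def[of _ "Suc n"] by blast
qed

lemma symm_symmetrize: "symm qf n (symmetrize qf n G)"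
proof (induction n arbitrary: G)
 case (Suc n)
 have "symmetrize qf (Suc n) G = choose_front qf (%w. symmetrize qf n (%zs. G (w # zs)))" by auto
 thus ?case using symm_choose_front[of qf n "%w. symmetrize qf n (%zs. G (w # zs))"] Suc by simp
qed (simp add: symm_def)

lemma choose_front_map: "choose_front qf H (map f ys) = choose_front (%e. qf (f e)) (%w r. H (f w) (map f r)) ys"
 by (induction ys arbitrary: H) auto

lemma symmetrize_map: "symmetrize qf n G (map f ys) = symmetrize (%e. qf (f e)) n (%zs. G (map f zs)) ys"
 by (induction n arbitrary: G ys) (auto simp: choose_front_map)

lemma choose_front_closed:
 assumes "C (%l. 0)" "!!f g. C f ==> C g ==> C (%l. f l + g l)" "!!f e. C f ==> C (%l. sm e (f l))"
 shows "(!!w r. mset (w # r) = mset ys ==> C (%l. H l w r)) ==> C (%l. choose_front qf (H l) ys)"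
proof (induction ys arbitrary: H)
 case (Cons y ys)
 have "C (%l. choose_front qf (%w r. sm (qf w * qf y) (H l w (y # r))) ys)"
  by (rule Cons.IH) (intro assms(3) Cons.prems, simp)
 thus ?case using assms(2) Cons.prems by simp
qed (use assms(1) in simp)

text \<open>All summands are signed values at permutations of \<open>ys\<close>, so a property
  closed under sums and signs is inherited. Used for polynomiality and for parity.\<close>

lemma symmetrize_closed:
 assumes "C (%l. 0)" "!!f g. C f ==> C g ==> C (%l. f l + g l)" "!!f e. C f ==> C (%l. sm e (f l))"
 shows "(!!zs. mset zs = mset ys ==> C (%l. G l zs)) ==> C (%l. symmetrize qf n (G l) ys)"
proof (induction n arbitrary: G ys)
 case (Suc n)
 show ?case unfolding symmetrize.simps
  by (rule choose_front_closed[OF assms]) (auto intro!: Suc.IH Suc.prems)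
qed simp

section \<open>Congruence modulo the image of \<partial> plus the sum of the variables\<close>

context pvm begin

text \<open>The function version of \<open>total_image\<close>; the preimage must be polynomial in
  the same n variables.\<close>

definition zn :: "nat => ((nat => 'f) => 'm) => bool" where
 "zn n f \<longleftrightarrow> (EX h. M.polyfun {..<n} h & (ALL l. f l = der M (h l) + scl M (SUM i<n. l i) (h l)))"

lemma zn_0: "zn n (%_. 0)"
 unfolding zn_def by (rule exI[of _ "%_. 0"]) (auto simp: M.polyfun_const lin_0[OF M.lin_der])

lemma zn_add: "zn n f ==> zn n g ==> zn n (%l. f l + g l)"
proof -
 assume "zn n f" "zn n g"
 then obtain h k where "M.polyfun {..<n} h" "ALL l. f l = der M (h l) + scl M (SUM i<n. l i) (h l)"
  "M.polyfun {..<n} k" "ALL l. g l = der M (k l) + scl M (SUM i<n. l i) (k l)" unfolding zn_def by blast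
 thus ?thesis unfolding zn_def
  by (intro exI[of _ "%l. h l + k l"]) (auto simp: M.polyfun_add lin_add[OF M.lin_der] M.scale_right_distrib)
qed

lemma zn_lin:
 assumes "zn n f" "lin M M T" "!!m. der M (T m) = T (der M m)" shows "zn n (%l. T (f l))"
proof -
 obtain h where "M.polyfun {..<n} h" "ALL l. f l = der M (h l) + scl M (SUM i<n. l i) (h l)" using assms(1) unfolding zn_def by blast
 thus ?thesis unfolding zn_def
  by (intro exI[of _ "%l. T (h l)"]) (auto simp: assms(3) lin_add[OF assms(2)] lin_scl[OF assms(2)] intro: M.polyfun_lin[OF _ assms(2)])
qed

lemma zn_scl: "zn n f ==> zn n (%l. scl M c (f l))"
 by (rule zn_lin) (auto simp: M.scl_lin lin_scl[OF M.lin_der])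

lemma zn_sm: "zn n f ==> zn n (%l. sm e (f l))"
 using zn_scl[of n f "sg e"] by (simp add: M.sg_sm)

lemma zn_mult: assumes "zn n f" "afn {..<n} \<phi>" shows "zn n (%l. scl M (\<phi> l) (f l))"
proof -
 obtain h where "M.polyfun {..<n} h" "ALL l. f l = der M (h l) + scl M (SUM i<n. l i) (h l)" using assms(1) unfolding zn_def by blast
 thus ?thesis unfolding zn_def
  by (intro exI[of _ "%l. scl M (\<phi> l) (h l)"]) (auto simp: assms M.polyfun_afn lin_scl[OF M.lin_der] M.scale_right_distrib mult.commute)
qed

lemma polyfun_exm_upd: "M.polyfun K f ==> m : K ==> M.polyfun K (%l. exm b (%r. f (l(m := r))) (l m))"
proof (induction arbitrary: b rule: M.polyfun.induct)
 case (polyfun_const m)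
 thus ?case by (simp add: exm_const M.polyfun_const)
next
 case (polyfun_add f g)
 thus ?case by (simp add: exm_add M.pf_polyfun_upd M.polyfun_add del: fun_upd_apply)
next
 case (polyfun_var i f)
 thus ?case
 proof (cases "i = m")
  case True
  have "exm b (%r. scl M ((l(m := r)) i) (f (l(m := r)))) (l m) = scl M (l m) (exm b (%r. f (l(m := r))) (l m)) + exm (der V b) (%r. f (l(m := r))) (l m)" for l
   unfolding True fun_upd_same by (rule exm_var[OF M.pf_polyfun_upd[OF polyfun_var.hyps(2)]])
  thus ?thesis using polyfun_var by (simp only: M.polyfun_add M.polyfun_var)
 next
  case False
  have "exm b (%r. scl M ((l(m := r)) i) (f (l(m := r)))) (l m) = scl M (l i) (exm b (%r. f (l(m := r))) (l m))" for l
   using exm_scl[OF M.pf_polyfun_upd[OF polyfun_var.hyps(2)]] False by (simp del: fun_upd_apply add: fun_upd_other)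
  thus ?thesis using polyfun_var by (simp only: M.polyfun_var)
 qed
qed

lemma sum_upd: "m < n ==> (SUM i<n. (l(m := r)) i) = r + (SUM i:{..<n} - {m}. l i)" for l :: "nat => 'f"
 by (simp add: sum.remove[of _ m])

text \<open>By \<open>exm_der\<close> the operator in variable m commutes with \<partial> plus that
  variable, and the other variables act as scalars.\<close>

lemma zn_exm: assumes "zn n f" "m < n" shows "zn n (%l. exm b (%r. f (l(m := r))) (l m))"
proof -
 obtain h where h: "M.polyfun {..<n} h" "!!l. f l = der M (h l) + scl M (SUM i<n. l i) (h l)" using assms(1) unfolding zn_def by blast
 have "exm b (%r. f (l(m := r))) (l m) = der M (exm b (%r. h (l(m := r))) (l m)) + scl M (SUM i<n. l i) (exm b (%r. h (l(m := r))) (l m))" for l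
 proof -
  let ?c = "SUM i:{..<n} - {m}. l i"
  let ?p = "%r. h (l(m := r))"
  have p: "pf M ?p" by (rule M.pf_polyfun_upd[OF h(1)])
  have pd: "pf M (%r. der M (?p r) + scl M r (?p r))" using p by (intro M.pf_add M.pf_var M.pf_lin'[OF _ M.lin_der])
  have "(%r. f (l(m := r))) = (%r. (der M (?p r) + scl M r (?p r)) + scl M ?c (?p r))"
   by (rule ext) (simp add: h(2) sum_upd[OF assms(2)] M.scale_left_distrib del: fun_upd_apply)
  hence "exm b (%r. f (l(m := r))) (l m) = exm b (%r. der M (?p r) + scl M r (?p r)) (l m) + scl M ?c (exm b ?p (l m))"
   using p pd by (simp only: exm_add exm_scl M.pf_scl)
  also have "... = der M (exm b ?p (l m)) + scl M (l m + ?c) (exm b ?p (l m))"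
   by (simp add: exm_der[OF p, symmetric] M.scale_left_distrib)
  also have "l m + ?c = (SUM i<n. l i)" using sum_upd[OF assms(2), of l "l m"] by simp
  finally show ?thesis .
 qed
 thus ?thesis unfolding zn_def using polyfun_exm_upd[OF h(1), of m b] assms(2) by blast
qed

definition eqv :: "nat => ((nat => 'f) => 'm) => ((nat => 'f) => 'm) => bool" where
 "eqv n f g \<longleftrightarrow> zn n (%l. f l - g l)"

lemma eqv_refl [simp]: "eqv n f f"
 by (simp add: eqv_def zn_0)

lemma eqv_sym: "eqv n f g ==> eqv n g f"
 using zn_sm[of n "%l. f l - g l" 1] by (simp add: eqv_def)

lemma eqv_trans [trans]: "eqv n f g ==> eqv n g h ==> eqv n f h"
 using zn_add[of n "%l. f l - g l" "%l. g l - h l"] by (simp add: eqv_def)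

lemma eqv_add: "eqv n f g ==> eqv n f' g' ==> eqv n (%l. f l + f' l) (%l. g l + g' l)"
 using zn_add[of n "%l. f l - g l" "%l. f' l - g' l"] by (simp add: eqv_def algebra_simps)

lemma eqv_scl: "eqv n f g ==> eqv n (%l. scl M c (f l)) (%l. scl M c (g l))"
 using zn_scl[of n "%l. f l - g l" c] by (simp add: eqv_def M.scale_right_diff_distrib)

lemma eqv_sm: "eqv n f g ==> eqv n (%l. sm e (f l)) (%l. sm e (g l))"
 using zn_sm[of n "%l. f l - g l" e] by (simp add: eqv_def sm_diff)

lemma eqv_neg: "eqv n f g ==> eqv n (%l. - f l) (%l. - g l)"
 using eqv_sm[of n f g 1] by simp

lemma eqv_diff: "eqv n f g ==> eqv n f' g' ==> eqv n (%l. f l - f' l) (%l. g l - g' l)"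
 using eqv_add[OF _ eqv_neg, of n f g f' g'] by simp

lemma eqv_sum: "(!!x. x : A ==> eqv n (f x) (g x)) ==> eqv n (%l. SUM x:A. f x l) (%l. SUM x:A. g x l)"
 by (induction A rule: infinite_finite_induct) (auto simp: eqv_add)

lemma eqv_mult: "eqv n f g ==> afn {..<n} \<phi> ==> eqv n (%l. scl M (\<phi> l) (f l)) (%l. scl M (\<phi> l) (g l))"
 using zn_mult[of n "%l. f l - g l" \<phi>] by (simp add: eqv_def M.scale_right_diff_distrib)

lemma eqv_exm:
 assumes "eqv n f g" "m < n" "M.polyfun {..<n} f" "M.polyfun {..<n} g"
 shows "eqv n (%l. exm b (%r. f (l(m := r))) (l m)) (%l. exm b (%r. g (l(m := r))) (l m))"
 using zn_exm[of n "%l. f l - g l" m b] assms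
 by (simp add: eqv_def exm_diff M.pf_polyfun_upd del: fun_upd_apply)

text \<open>If moving any entry to the front changes the value only by its sign, up to congruence,
  then all summands are congruent to the same \<open>K\<close>.\<close>

lemma choose_front_eqv:
 "(!!us w vs. ys = us @ w # vs ==> eqv n (%l. H l w (us @ vs)) (%l. sm (qf w * sum_list (map qf us)) (K l))) ==>
  eqv n (%l. choose_front qf (H l) ys) (%l. scl M (of_nat (length ys)) (K l))"
proof (induction ys arbitrary: H)
 case (Cons y ys)
 have "eqv n (%l. choose_front qf (%w r. sm (qf w * qf y) (H l w (y # r))) ys) (%l. scl M (of_nat (length ys)) (K l))"
 proof (rule Cons.IH)
  fix us w vs assume "ys = us @ w # vs"
  hence "eqv n (%l. H l w ((y # us) @ vs)) (%l. sm (qf w * sum_list (map qf (y # us))) (K l))"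
   by (intro Cons.prems) simp
  from eqv_sm[OF this, of "qf w * qf y"]
  show "eqv n (%l. sm (qf w * qf y) (H l w (y # us @ vs))) (%l. sm (qf w * sum_list (map qf us)) (K l))"
   by (simp add: sm_sm distrib_left)
 qed
 moreover have "eqv n (%l. H l y ys) K" using Cons.prems[of "[]" y ys] by simp
 ultimately have "eqv n (%l. H l y ys + choose_front qf (%w r. sm (qf w * qf y) (H l w (y # r))) ys) (%l. K l + scl M (of_nat (length ys)) (K l))"
  by (intro eqv_add)
 thus ?case by (simp add: M.scale_left_distrib)
qed simp

lemma move_front_eqv:
 assumes "!!us x z vs. mset (us @ x # z # vs) = S ==> eqv n (%l. G l (us @ x # z # vs)) (%l. sm (qf x * qf z) (G l (us @ z # x # vs)))"
 shows "mset (us @ w # vs) = S ==> eqv n (%l. G l (w # us @ vs)) (%l. sm (qf w * sum_list (map qf us)) (G l (us @ w # vs)))"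
proof (induction us arbitrary: vs rule: rev_induct)
 case (snoc u us)
 have "eqv n (%l. G l (w # us @ u # vs)) (%l. sm (qf w * sum_list (map qf us)) (G l (us @ w # u # vs)))"
  using snoc.prems by (intro snoc.IH) (simp add: add_mset_commute)
 also have "eqv n ... (%l. sm (qf w * sum_list (map qf us)) (sm (qf w * qf u) (G l (us @ u # w # vs))))"
  using snoc.prems by (intro eqv_sm assms) (simp add: add_mset_commute)
 finally show ?case by (simp add: sm_sm distrib_left)
qed simp

text \<open>What is already symmetric up to congruence is multiplied by m!, which is invertible in
  characteristic 0.\<close>

lemma symmetrize_eqv:
 "(!!us x z vs. mset (us @ x # z # vs) = mset ys ==> eqv n (%l. G l (us @ x # z # vs)) (%l. sm (qf x * qf z) (G l (us @ z # x # vs)))) ==>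
  length ys = m ==> eqv n (%l. symmetrize qf m (G l) ys) (%l. scl M (fact m) (G l ys))"
proof (induction m arbitrary: G ys)
 case (Suc m)
 have "eqv n (%l. choose_front qf (%w r. symmetrize qf m (%zs. G l (w # zs)) r) ys) (%l. scl M (of_nat (length ys)) (scl M (fact m) (G l ys)))"
 proof (rule choose_front_eqv)
  fix us w vs assume ys: "ys = us @ w # vs"
  have "eqv n (%l. symmetrize qf m (%zs. G l (w # zs)) (us @ vs)) (%l. scl M (fact m) (G l (w # us @ vs)))"
  proof (rule Suc.IH)
   fix us' x z vs' assume "mset (us' @ x # z # vs') = mset (us @ vs)"
   thus "eqv n (%l. G l (w # us' @ x # z # vs')) (%l. sm (qf x * qf z) (G l (w # us' @ z # x # vs')))"
    using Suc.prems(1)[of "w # us'" x z vs'] ys by simp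
  qed (use Suc.prems ys in simp)
  also have "eqv n ... (%l. scl M (fact m) (sm (qf w * sum_list (map qf us)) (G l (us @ w # vs))))"
   by (intro eqv_scl move_front_eqv[where S = "mset ys"] Suc.prems(1)) (auto simp: ys)
  finally show "eqv n (%l. symmetrize qf m (%zs. G l (w # zs)) (us @ vs)) (%l. sm (qf w * sum_list (map qf us)) (scl M (fact m) (G l ys)))"
   by (simp add: ys M.scl_sm)
 qed
 thus ?case using Suc.prems(2) by (simp add: mult.commute)
qed simp

text \<open>The class of a function, as a set of polynomials, so that it is literally an element of
  the quotient \<open>lquot\<close>.\<close>

definition cls :: "nat => ((nat => 'f) => 'm) => 'm lpoly set" where
 "cls n f = {P : M.lcar n. eqv n (evl M P) f}"

abbreviation pol where "pol n \<equiv> M.polyfun {..<n}"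

lemma carrier_lpoly: "carrier (lpoly_space M n) = M.lcar n"
 by (simp add: lpoly_space_def vspace_def)

lemma lpoly_ops [simp]: "x \<oplus>\<^bsub>lpoly_space M n\<^esub> y = x + y" "c \<odot>\<^bsub>lpoly_space M n\<^esub> x = Poly_Mapping.map (scl M c) x"
 "\<zero>\<^bsub>lpoly_space M n\<^esub> = 0"
 by (simp_all add: lpoly_space_def vspace_def)

lemma lcar_map: "P : M.lcar n ==> lin M M T ==> Poly_Mapping.map T P : M.lcar n"
proof -
 assume P: "P : M.lcar n" and T: "lin M M T"
 have "keys (Poly_Mapping.map T P) \<subseteq> keys P"
  by (auto simp: in_keys_iff Poly_Mapping.map.rep_eq when_def)
 thus ?thesis using P by auto
qed

lemma lcar_0: "0 : M.lcar n" by simp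

lemma lcar_neg: "P : M.lcar n ==> - P : M.lcar n"
 by (auto simp: in_keys_iff)

lemma lcar_diff: "P : M.lcar n ==> Q : M.lcar n ==> P - Q : M.lcar n"
 using M.lcar_add[OF _ lcar_neg, of P n Q] by simp

lemma lcar_sum: "(!!x. x : A ==> f x : M.lcar n) ==> sum f A : M.lcar n"
proof (induction A rule: infinite_finite_induct)
 case (insert x A)
 hence "f x + sum f A : M.lcar n" by (intro M.lcar_add insert.IH insert.prems) auto
 moreover have "sum f (insert x A) = f x + sum f A" using insert.hyps by simp
 ultimately show ?case by (simp only:)
qed (simp_all add: lcar_0)

lemma evl_total: "evl M (Poly_Mapping.map (der M) P + (SUM i<n. lam i P)) l = der M (evl M P l) + scl M (SUM i<n. l i) (evl M P l)"
 by (simp add: M.evl_add M.evl_map[OF M.lin_der] M.evl_sum M.evl_lam M.scale_sum_left)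

lemma total_image_iff: "P : total_image M n \<longleftrightarrow> P : M.lcar n & zn n (evl M P)"
proof
 assume "P : total_image M n"
 then obtain Q where Q: "Q : M.lcar n" "P = Poly_Mapping.map (der M) Q + (SUM i<n. lam i Q)"
  by (auto simp: total_image_def carrier_lpoly)
 have "P : M.lcar n" unfolding Q(2) using Q(1)
  by (intro M.lcar_add lcar_map M.lin_der lcar_sum M.lcar_lam) auto
 moreover have "zn n (evl M P)" unfolding zn_def Q(2) evl_total using M.polyfun_evl[OF Q(1)] by blast
 ultimately show "P : M.lcar n & zn n (evl M P)" by blast
next
 assume P: "P : M.lcar n & zn n (evl M P)"
 then obtain h where h: "pol n h" "!!l. evl M P l = der M (h l) + scl M (SUM i<n. l i) (h l)" unfolding zn_def by blast
 obtain Q where Q: "Q : M.lcar n" "evl M Q = h" using M.polyfun_ex_evl[OF h(1)] by blast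
 have "P = Poly_Mapping.map (der M) Q + (SUM i<n. lam i Q)"
  by (rule M.evl_inj) (auto simp: evl_total Q(2) h(2))
 thus "P : total_image M n" using Q(1) by (auto simp: total_image_def carrier_lpoly)
qed

lemma lclass_cls: assumes "P : M.lcar n" shows "lclass M n P = cls n (evl M P)"
proof -
 have "Q : lclass M n P \<longleftrightarrow> Q - P : total_image M n" for Q
  by (auto simp: lclass_def a_r_coset_def' intro: bexI[of _ "Q - P"])
 moreover have "Q - P : total_image M n \<longleftrightarrow> Q : cls n (evl M P)" for Q
 proof -
  have "Q - P : M.lcar n \<longleftrightarrow> Q : M.lcar n"
  proof
   assume "Q - P : M.lcar n"
   from M.lcar_add[OF this assms] show "Q : M.lcar n" unfolding diff_add_cancel .
  qed (rule lcar_diff[OF _ assms])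
  thus ?thesis unfolding total_image_iff cls_def eqv_def by (simp add: M.evl_diff[abs_def])
 qed
 ultimately show ?thesis by blast
qed

lemma cls_ex: "pol n f ==> EX P:M.lcar n. evl M P = f"
 by (rule M.polyfun_ex_evl)

lemma cls_eq: assumes "pol n f" shows "cls n f = cls n g \<longleftrightarrow> eqv n f g"
proof
 assume e: "cls n f = cls n g"
 obtain P where "P : M.lcar n" "evl M P = f" using cls_ex[OF assms] by blast
 hence "P : cls n f" by (simp add: cls_def)
 hence "P : cls n g" using e by (simp only:)
 thus "eqv n f g" using \<open>evl M P = f\<close> by (simp add: cls_def)
next
 assume "eqv n f g"
 thus "cls n f = cls n g" unfolding cls_def using eqv_trans eqv_sym by blast
qed

lemma rep_cls: assumes "pol n f" shows "rep (cls n f) : M.lcar n" "eqv n (evl M (rep (cls n f))) f" "pol n (evl M (rep (cls n f)))"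
proof -
 obtain P where "P : M.lcar n" "evl M P = f" using cls_ex[OF assms] by blast
 hence "P : cls n f" by (simp add: cls_def)
 hence "rep (cls n f) : cls n f" unfolding rep_def by (rule someI[of "%P. P : cls n f"])
 thus "rep (cls n f) : M.lcar n" "eqv n (evl M (rep (cls n f))) f" by (auto simp: cls_def)
 thus "pol n (evl M (rep (cls n f)))" by (intro M.polyfun_evl)
qed

lemma carrier_lquot: "carrier (lquot M n) = {cls n f | f. pol n f}"
proof -
 have "carrier (lquot M n) = {lclass M n P | P. P : M.lcar n}"
  by (auto simp: quotient_space_def vspace_def A_RCOSETS_def' carrier_lpoly lclass_def)
 also have "... = {cls n f | f. pol n f}"
 proof (intro equalityI subsetI)
  fix C assume "C : {lclass M n P | P. P : M.lcar n}"
  then obtain P where P: "P : M.lcar n" "C = lclass M n P" by blast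
  hence "C = cls n (evl M P) & pol n (evl M P)" using lclass_cls M.polyfun_evl by blast
  thus "C : {cls n f | f. pol n f}" by blast
 next
  fix C assume "C : {cls n f | f. pol n f}"
  then obtain f where f: "C = cls n f" "pol n f" by blast
  obtain P where P: "P : M.lcar n" "evl M P = f" using cls_ex[OF f(2)] by blast
  have "C = lclass M n P" using lclass_cls[OF P(1)] P(2) f(1) by simp
  thus "C : {lclass M n P | P. P : M.lcar n}" using P(1) by blast
 qed
 finally show ?thesis .
qed

lemma lquot_zero: "\<zero>\<^bsub>lquot M n\<^esub> = cls n (%_. 0)"
proof -
 have "total_image M n = cls n (%_. 0)"
 proof -
  have "P : total_image M n \<longleftrightarrow> P : cls n (%_. 0)" for P by (simp add: total_image_iff cls_def eqv_def)
  thus ?thesis by blast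
 qed
 thus ?thesis by (simp add: quotient_space_def vspace_def)
qed

lemma lquot_add: assumes "pol n f" "pol n g" shows "cls n f \<oplus>\<^bsub>lquot M n\<^esub> cls n g = cls n (%l. f l + g l)"
proof -
 have "cls n f \<oplus>\<^bsub>lquot M n\<^esub> cls n g = {P + Q | P Q. P : cls n f & Q : cls n g}"
  by (auto simp: quotient_space_def vspace_def set_add_def' )
 also have "... = cls n (%l. f l + g l)"
 proof (intro equalityI subsetI)
  fix R assume "R : {P + Q | P Q. P : cls n f & Q : cls n g}"
  then obtain P Q where "R = P + Q" "P : cls n f" "Q : cls n g" by blast
  thus "R : cls n (%l. f l + g l)" using M.lcar_add[of P n Q] eqv_add by (simp add: cls_def M.evl_add[abs_def])
 next
  fix R assume R: "R : cls n (%l. f l + g l)"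
  obtain P where P: "P : M.lcar n" "evl M P = f" using cls_ex[OF assms(1)] by blast
  have "R - P : cls n g"
   using R P lcar_diff[of R n P] eqv_diff[of n "evl M R" "%l. f l + g l" f f]
   by (simp add: cls_def M.evl_diff[abs_def])
  moreover have "P : cls n f" using P by (simp add: cls_def)
  moreover have "R = P + (R - P)" by simp
  ultimately show "R : {P + Q | P Q. P : cls n f & Q : cls n g}" by blast
 qed
 finally show ?thesis .
qed

lemma lquot_smult: assumes "pol n f" shows "c \<odot>\<^bsub>lquot M n\<^esub> cls n f = cls n (%l. scl M c (f l))"
proof -
 obtain P where "P : M.lcar n" "evl M P = f" using cls_ex[OF assms] by blast
 hence "P : cls n f" by (simp add: cls_def)
 hence ne: "cls n f ~= {}" by blast
 have "c \<odot>\<^bsub>lquot M n\<^esub> cls n f = (\<Union>P\<in>cls n f. lclass M n (Poly_Mapping.map (scl M c) P))"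
  by (simp add: quotient_space_def vspace_def lclass_def)
 also have "... = (\<Union>P\<in>cls n f. cls n (%l. scl M c (f l)))"
 proof (rule SUP_cong[OF refl])
  fix P assume P: "P : cls n f"
  have "Poly_Mapping.map (scl M c) P : M.lcar n" using P by (intro lcar_map M.scl_lin) (simp add: cls_def)
  thus "lclass M n (Poly_Mapping.map (scl M c) P) = cls n (%l. scl M c (f l))"
   using P eqv_scl[of n "evl M P" f c]
   by (simp add: lclass_cls cls_eq M.polyfun_evl M.evl_map[OF M.scl_lin, abs_def] cls_def[of n f] M.polyfun_scl)
 qed
 also have "... = cls n (%l. scl M c (f l))" using ne by simp
 finally show ?thesis .
qed

end

context pvm begin

lemma lcarI: assumes "pol n (evl M P)" shows "P : M.lcar n"
proof -
 obtain Q where "Q : M.lcar n" "evl M Q = evl M P" using cls_ex[OF assms] by blast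
 thus ?thesis using M.evl_inj[of Q P] by simp
qed

text \<open>A substitution that preserves the total sum of the variables maps the image of
  \<partial> plus that sum into the corresponding image.\<close>

lemma eqv_subst:
 assumes "eqv n f g" "!!k. k < n ==> afn {..<N} (\<psi> k)" "!!l. (SUM k<n. \<psi> k l) = (SUM k<N. l k)"
 shows "eqv N (%l. f (%k. \<psi> k l)) (%l. g (%k. \<psi> k l))"
proof -
 obtain h where h: "pol n h" "!!l. f l - g l = der M (h l) + scl M (SUM i<n. l i) (h l)"
  using assms(1) unfolding eqv_def zn_def by blast
 have "pol N (%l. h (%k. \<psi> k l))" using assms(2) by (intro M.polyfun_subst[OF h(1)]) simp
 thus ?thesis unfolding eqv_def zn_def h(2) assms(3) by blast
qed

lemma eqv_perm:
 assumes "eqv n f g" "mset js = mset [0..<n]"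
 shows "eqv n (%l. f (%k. l (js ! k))) (%l. g (%k. l (js ! k)))"
proof (rule eqv_subst[OF assms(1)])
 have len: "length js = n" using arg_cong[OF assms(2), of size] by simp
 have "set js = {..<n}" using arg_cong[OF assms(2), of set_mset] by (simp add: atLeast0LessThan)
 thus "afn {..<n} (%l. l (js ! k))" if "k < n" for k
  using len that nth_mem[of k js] by (intro afn_var) auto
 have "(SUM i<n. l (js ! i)) = sum_mset (mset (map l js))" for l :: "nat => 'f"
  unfolding sum_mset_sum_list sum_list_sum_nth by (simp add: len atLeast0LessThan)
 moreover have "sum_mset (mset (map l [0..<n])) = (SUM i<n. l i)" for l :: "nat => 'f"
  unfolding sum_mset_sum_list sum_list_sum_nth by (simp add: atLeast0LessThan)
 ultimately show "(SUM k<n. l (js ! k)) = (SUM k<n. l k)" for l :: "nat => 'f" using assms(2) by (simp only: mset_map)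
qed

text \<open>Attaches the variables number k, k + 1, ... to the homogeneous arguments.\<close>

fun mkl :: "nat => ('v \<times> bit) list => (nat => 'f) => ('v \<times> bit \<times> 'f) list" where
 "mkl k [] l = []"
| "mkl k ((a, \<alpha>) # as) l = (a, \<alpha>, l k) # mkl (Suc k) as l"

lemma length_mkl [simp]: "length (mkl k as l) = length as"
 by (induction as arbitrary: k) auto

lemma mkl_cong: "(!!j. k \<le> j ==> j < k + length as ==> l j = l' j) ==> mkl k as l = mkl k as l'"
proof (induction as arbitrary: k)
 case (Cons a as)
 have "mkl (Suc k) as l = mkl (Suc k) as l'" by (rule Cons.IH) (auto intro: Cons.prems)
 thus ?case using Cons.prems[of k] by (cases a) auto
qed simp

definition homl :: "('v \<times> bit) list => bool" where "homl as \<longleftrightarrow> (ALL (a, \<alpha>):set as. a : par V \<alpha>)"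

lemma mkl_inst: "homl as ==> EX ws:lists XF. ALL l. inst ws l = mkl k as l"
proof (induction as arbitrary: k)
 case (Cons z as)
 obtain a \<alpha> where z: "z = (a, \<alpha>)" by force
 have h: "homl as" "a : par V \<alpha>" using Cons.prems by (auto simp: homl_def z)
 obtain ws where ws: "ws : lists XF" "!!l. inst ws l = mkl (Suc k) as l" using Cons.IH[OF h(1), of "Suc k"] by blast
 show ?case
 proof (intro bexI allI)
  show "inst ((a, \<alpha>, %l. l k) # ws) l = mkl k (z # as) l" for l by (simp add: ws(2) z)
  show "(a, \<alpha>, %l. l k) # ws : lists XF" using ws(1) h(2) by (simp add: XF_def afn_var)
 qed
qed auto

lemma mkl_X: "homl as ==> mkl k as l : lists X"
proof (induction as arbitrary: k)
 case (Cons z as)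
 obtain a \<alpha> where z: "z = (a, \<alpha>)" by force
 have h: "homl as" "a : par V \<alpha>" using Cons.prems by (auto simp: homl_def z)
 thus ?case using Cons.IH[OF h(1), of "Suc k"] by (simp add: z)
qed simp

lemma pol_npow: "pol n f ==> m < n ==> pol n (%l. scl M ((- l m) ^ k) (f l))"
proof (induction k)
 case (Suc k)
 have "pol n (%l. - scl M (l m) (scl M ((- l m) ^ k) (f l)))"
  using Suc.prems by (intro M.polyfun_neg M.polyfun_var Suc.IH) simp_all
 thus ?case by simp
qed simp

lemma eqv_npow: "eqv n f g ==> m < n ==> eqv n (%l. scl M ((- l m) ^ k) (f l)) (%l. scl M ((- l m) ^ k) (g l))"
proof (induction k)
 case (Suc k)
 have "eqv n (%l. - scl M (l m) (scl M ((- l m) ^ k) (f l))) (%l. - scl M (l m) (scl M ((- l m) ^ k) (g l)))"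
  using Suc.prems by (intro eqv_neg eqv_mult afn_var Suc.IH) simp_all
 thus ?case by simp
qed simp

text \<open>Variables from n on are set to 0, which does not change the function.\<close>

lemma pol_restrict:
 assumes "M.polyfun UNIV f" "!!l l'. (!!j. j < n ==> l j = l' j) ==> f l = f l'" shows "pol n f"
proof -
 have "pol n (%l. f (%i. (if i < n then (%l. l i) else (%_. 0)) l))"
  by (rule M.polyfun_subst[OF assms(1)]) (auto intro: afn_var afn_const)
 moreover have "f (%i. (if i < n then (%l. l i) else (%_. 0)) l) = f l" for l by (rule assms(2)) simp
 ultimately show ?thesis by simp
qed

lemma PF_pol: assumes "PF (%_. y)" "homl as" shows "pol (length as) (%l. y (mkl 0 as l))"
proof (rule pol_restrict)
 obtain ws where "ws : lists XF" "!!l. inst ws l = mkl 0 as l" using mkl_inst[OF assms(2)] by blast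
 from bspec[OF assms(1)[unfolded PF_def] this(1)] this(2)
 show "M.polyfun UNIV (%l. y (mkl 0 as l))" by (simp only:)
next
 fix l l' :: "nat => 'f" assume "!!j. j < length as ==> l j = l' j"
 hence "mkl 0 as l = mkl 0 as l'" by (intro mkl_cong) auto
 thus "y (mkl 0 as l) = y (mkl 0 as l')" by simp
qed

end

section \<open>The conditions on a given cochain, read on representatives\<close>

locale hcochain = pvm V L M
 for V :: "('f::field_char_0, 'v::ring_1) pva" and L and M :: "('v, 'f, 'm::ab_group_add) pva_mod" +
 fixes n :: nat and \<pi> :: bit and Y :: "'v list => 'm lpoly set"
 assumes Y: "Y : homogeneous_cochains V M n \<pi>"
begin

text \<open>The value of the chosen representative. The choices are unrelated for different
  arguments, so each condition on \<open>Y\<close> becomes only a congruence for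
  \<open>y0\<close>.\<close>

definition y0 :: "'v list => (nat => 'f) => 'm" where "y0 xs = evl M (rep (Y xs))"

lemma Yrep:
 assumes "length xs = n"
 shows "rep (Y xs) : M.lcar n" "pol n (y0 xs)" "Y xs = cls n (y0 xs)"
proof -
 have "Y : lists_of n \<rightarrow>\<^sub>E carrier (lquot M n)" using Y by (auto simp: homogeneous_cochains_def multilinear_def)
 hence "Y xs : carrier (lquot M n)" using assms by auto
 then obtain f where f: "Y xs = cls n f" "pol n f" unfolding carrier_lquot by blast
 show "rep (Y xs) : M.lcar n" "pol n (y0 xs)" using rep_cls[OF f(2)] unfolding y0_def f(1) by blast+
 thus "Y xs = cls n (y0 xs)" using rep_cls[OF f(2)] cls_eq[of n "y0 xs" f] unfolding y0_def f(1) by blast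
qed

lemma Y_lclass: "length xs = n ==> Y xs = lclass M n P ==> pol n (evl M P) ==> eqv n (y0 xs) (evl M P)"
 using Yrep[of xs] lclass_cls[OF lcarI] cls_eq by auto

lemma Y_mult:
 assumes "length us + Suc (length vs) = n"
 shows "eqv n (y0 (us @ (scl V c a + b) # vs)) (%l. scl M c (y0 (us @ a # vs) l) + y0 (us @ b # vs) l)"
proof -
 have len: "length (us @ x # vs) = n" for x using assms by simp
 have m: "length us < n" using assms by simp
 have "multilinear V M n Y" using Y by (simp add: homogeneous_cochains_def)
 hence "Y ((us @ a # vs)[length us := scl V c a + b]) = c \<odot>\<^bsub>lquot M n\<^esub> Y ((us @ a # vs)[length us := a]) \<oplus>\<^bsub>lquot M n\<^esub> Y ((us @ a # vs)[length us := b])"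
  using len[of a] m unfolding multilinear_def by blast
 hence "cls n (y0 (us @ (scl V c a + b) # vs)) = cls n (%l. scl M c (y0 (us @ a # vs) l) + y0 (us @ b # vs) l)"
  using Yrep(2)[OF len] by (simp add: Yrep(3)[OF len] lquot_smult lquot_add M.polyfun_scl)
 thus ?thesis using cls_eq[OF Yrep(2)[OF len]] by simp
qed

lemma Y_ses:
 assumes "length us + Suc (length vs) = n"
 shows "eqv n (y0 (us @ der V a # vs)) (%l. - scl M (l (length us)) (y0 (us @ a # vs) l))"
proof -
 let ?xs = "us @ a # vs"
 have len: "length (us @ x # vs) = n" for x using assms by simp
 have i: "length us < n" using assms by simp
 have "ALL xs:lists_of n. ALL i<n. Y (xs[i := der V (xs ! i)]) = lclass M n (- lam i (rep (Y xs)))"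
  using Y unfolding homogeneous_cochains_def by blast
 hence "Y (?xs[length us := der V (?xs ! length us)]) = lclass M n (- lam (length us) (rep (Y ?xs)))"
  using len i by blast
 moreover have "evl M (- lam (length us) (rep (Y ?xs))) = (%l. - scl M (l (length us)) (y0 ?xs l))"
  by (auto simp: M.evl_minus M.evl_lam y0_def)
 moreover have "pol n (%l. - scl M (l (length us)) (y0 ?xs l))"
  using Yrep(2)[OF len] i by (intro M.polyfun_neg M.polyfun_var) auto
 ultimately show ?thesis using Y_lclass[OF len, of "der V a" "- lam (length us) (rep (Y ?xs))"] by simp
qed

lemma Y_leib:
 assumes "length us + Suc (length vs) = n" "!!j. j < length us ==> us ! j : par V (ps j)" "b : par V \<beta>" "c : par V \<gamma>"
  "s = \<pi> + (SUM j<length us. 1 + ps j)" "m = length us"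
 shows "eqv n (y0 (us @ (b * c) # vs)) (%l. sm (\<beta> * s) (exm b (%r. y0 (us @ c # vs) (l(m := r))) (l m))
   + sm (\<gamma> * (\<beta> + s)) (exm c (%r. y0 (us @ b # vs) (l(m := r))) (l m)))"
proof -
 let ?xs = "us @ c # vs" and ?ps = "map ps [0..<n]"
 have len: "length (us @ x # vs) = n" for x using assms by simp
 have i: "m < n" using assms by simp
 have ps: "ALL j<m. ?xs ! j : par V (?ps ! j)" using assms(2,6) i by (simp add: nth_append)
 have s: "\<pi> + (SUM j<m. 1 + ?ps ! j) = s" using i assms(5,6) by (auto intro!: sum.cong)
 let ?P = "Poly_Mapping.map (scl M (sg (\<beta> * s))) (exp_der V M m b (rep (Y (?xs[m := c]))))
       + Poly_Mapping.map (scl M (sg (\<gamma> * (\<beta> + s)))) (exp_der V M m c (rep (Y (?xs[m := b]))))"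
 have H: "ALL xs:lists_of n. ALL ps:lists_of n. ALL i<n. ALL \<beta> \<gamma>. ALL b:par V \<beta>. ALL c:par V \<gamma>.
     (ALL j<i. xs ! j : par V (ps ! j)) -->
     (let s = \<pi> + (SUM j<i. 1 + ps ! j) in
      Y (xs[i := b * c]) = lclass M n
       (Poly_Mapping.map (scl M (sg (\<beta> * s))) (exp_der V M i b (rep (Y (xs[i := c]))))
       + Poly_Mapping.map (scl M (sg (\<gamma> * (\<beta> + s))))
         (exp_der V M i c (rep (Y (xs[i := b]))))))"
  using Y unfolding homogeneous_cochains_def by blast
 have "Y (?xs[m := b * c]) = lclass M n ?P"
 proof -
  have "?xs : lists_of n" "?ps : lists_of n" using len[of c] by simp_all
  from this i assms(3,4) ps have "let s = \<pi> + (SUM j<m. 1 + ?ps ! j) in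
      Y (?xs[m := b * c]) = lclass M n
       (Poly_Mapping.map (scl M (sg (\<beta> * s))) (exp_der V M m b (rep (Y (?xs[m := c]))))
       + Poly_Mapping.map (scl M (sg (\<gamma> * (\<beta> + s))))
         (exp_der V M m c (rep (Y (?xs[m := b])))))"
   using H by blast
  thus ?thesis unfolding Let_def s .
 qed
 moreover have e: "evl M ?P = (%l. sm (\<beta> * s) (exm b (%r. y0 (us @ c # vs) (l(m := r))) (l m))
   + sm (\<gamma> * (\<beta> + s)) (exm c (%r. y0 (us @ b # vs) (l(m := r))) (l m)))"
  unfolding y0_def by (rule ext) (simp add: M.evl_add M.evl_map[OF M.scl_lin] M.sg_sm evl_exp_der assms(6) del: fun_upd_apply)
 moreover have "pol n (evl M ?P)"
  unfolding e using Yrep(2)[OF len] i by (intro M.polyfun_add M.polyfun_sm polyfun_exm_upd) auto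
 ultimately show ?thesis using Y_lclass[OF len, of "b * c" ?P] by (simp add: assms(6))
qed

lemma Y_sym:
 assumes "length us + length vs + 2 = n" "a : par V \<alpha>" "b : par V \<beta>" "js = [0..<n][length us := Suc (length us), Suc (length us) := length us]"
 shows "eqv n (%l. y0 (us @ b # a # vs) (%k. l (js ! k))) (%l. sm ((1 + \<alpha>) * (1 + \<beta>)) (y0 (us @ a # b # vs) l))"
proof -
 let ?i = "length us" and ?xs = "us @ a # b # vs" and ?xs' = "us @ b # a # vs"
 have len: "length ?xs = n" "length ?xs' = n" "length js = n" using assms by auto
 have "ALL xs:lists_of n. ALL i \<alpha> \<beta>. Suc i < n & xs ! i : par V \<alpha> & xs ! Suc i : par V \<beta> -->
     lclass M n (lsubst (map lam ([0..<n][i := Suc i, Suc i := i])) (rep (Y (xs[i := xs ! Suc i, Suc i := xs ! i]))))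
     = sg ((1 + \<alpha>) * (1 + \<beta>)) \<odot>\<^bsub>lquot M n\<^esub> Y xs"
  using Y unfolding homogeneous_cochains_def by blast
 moreover have "Suc ?i < n & ?xs ! ?i : par V \<alpha> & ?xs ! Suc ?i : par V \<beta>" using assms by (simp add: nth_append)
 ultimately have "lclass M n (lsubst (map lam js) (rep (Y (?xs[?i := ?xs ! Suc ?i, Suc ?i := ?xs ! ?i])))) = sg ((1 + \<alpha>) * (1 + \<beta>)) \<odot>\<^bsub>lquot M n\<^esub> Y ?xs"
  using len(1) unfolding assms(4) by blast
 moreover have "?xs[?i := ?xs ! Suc ?i, Suc ?i := ?xs ! ?i] = ?xs'" by (simp add: nth_append list_update_append)
 ultimately have 1: "lclass M n (lsubst (map lam js) (rep (Y ?xs'))) = cls n (%l. sm ((1 + \<alpha>) * (1 + \<beta>)) (y0 ?xs l))"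
  using lquot_smult[OF Yrep(2)[OF len(1)]] Yrep(3)[OF len(1)] by (simp add: M.sg_sm)
 have 2: "evl M (lsubst (map lam js) (rep (Y ?xs'))) = (%l. y0 ?xs' (%k. l (js ! k)))"
 proof
  fix l
  show "evl M (lsubst (map lam js) (rep (Y ?xs'))) l = y0 ?xs' (%k. l (js ! k))"
   unfolding y0_def using Yrep(1)[OF len(2)] len by (intro M.evl_lsubst) (auto simp: M.evl_lam)
 qed
 have js: "js ! k < n" if "k < n" for k using that assms by (auto simp: nth_list_update)
 have 3: "pol n (%l. y0 ?xs' (%k. l (js ! k)))"
  using js by (intro M.polyfun_subst[OF Yrep(2)[OF len(2)]] afn_var) auto
 show ?thesis using 1 lclass_cls[OF lcarI, of n "lsubst (map lam js) (rep (Y ?xs'))"] 3 cls_eq[OF 3] unfolding 2 by simp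
qed

end

section \<open>Lifting of cochains\<close>

locale lifting = pvm_poly V L M I u qu + hcochain V L M n \<pi> Y
 for V :: "('f::field_char_0, 'v::ring_1) pva" and L and M :: "('v, 'f, 'm::ab_group_add) pva_mod"
  and I :: "'i set" and u qu n \<pi> Y
begin

lemma exm_one: "pf M p ==> exm 1 p t = p t"
proof (induction rule: M.pf_induct)
 case (step m p)
 have "exm 0 p t = 0" by (rule exm_zero_arg[OF step.hyps])
 thus ?case using step by (simp add: exm_step vm_one der_one)
qed simp

text \<open>Both sides are linear in a and obey the same Leibniz rule, up to congruence, so it
  suffices to compare them on derivatives of generators and on 1. Here s is the parity of
  \<open>Y\<close> after insertion of the preceding arguments.\<close>

lemma slot_expand:
 assumes len: "length us + Suc (length vs) = n" and ps: "!!j. j < length us ==> us ! j : par V (ps j)"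
  and s: "s = \<pi> + (SUM j<length us. 1 + ps j)" and m: "m = length us" and a: "a : par V \<alpha>"
 shows "eqv n (y0 (us @ a # vs)) (%l. dext s \<alpha> (%x r. y0 (us @ u (fst x) # vs) (l(m := r))) a (l m))"
proof -
 define g where "g l x r = y0 (us @ u (fst x) # vs) (l(m := r))" for l and x :: "'i \<times> nat" and r
 define E where "E \<alpha> a l = dext s \<alpha> (g l) a (l m)" for \<alpha> a l
 have len': "length (us @ x # vs) = n" for x using len by simp
 have mn: "m < n" using len m by simp
 note pol0 = Yrep(2)[OF len']
 have w: "wpf (g l)" for l unfolding wpf_def g_def using M.pf_polyfun_upd[OF pol0] by blast
 have gu: "g (l(m := r)) = g l" for l r
 proof (intro ext)
  show "g (l(m := r)) x t = g l x t" for x t by (simp add: g_def)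
 qed
 have polE: "pol n (E \<alpha> a)" for \<alpha> a
 proof -
  have "pol n (%l. exm (D x a) (%r. scl M ((- r) ^ snd x) (y0 (us @ u (fst x) # vs) (l(m := r)))) (l m))" for x
  proof -
   have "pol n (%l. scl M ((- l m) ^ snd x) (y0 (us @ u (fst x) # vs) l))" by (rule pol_npow[OF pol0 mn])
   from polyfun_exm_upd[OF this, of m] mn show ?thesis by simp
  qed
  thus ?thesis unfolding E_def[abs_def] dext_def g_def by (intro M.polyfun_sum M.polyfun_sm)
 qed
 have zero: "eqv n (y0 (us @ 0 # vs)) (%_. 0)"
 proof -
  have "eqv n (y0 (us @ 0 # vs)) (%l. y0 (us @ 0 # vs) l + y0 (us @ 0 # vs) l)"
   using Y_mult[OF len, of 1 0 0] by simp
  from eqv_diff[OF this eqv_refl, of "y0 (us @ 0 # vs)"] show ?thesis using eqv_sym by simp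
 qed
 have E0: "E \<alpha> 0 = (%_. 0)" for \<alpha> unfolding E_def using lin_0[OF dext_lin[OF w]] by auto
 have scl0: "eqv n (y0 (us @ scl V c a # vs)) (%l. scl M c (y0 (us @ a # vs) l))" for c a
 proof -
  have "eqv n (y0 (us @ scl V c a # vs)) (%l. scl M c (y0 (us @ a # vs) l) + y0 (us @ 0 # vs) l)"
   using Y_mult[OF len, of c a 0] by simp
  also have "eqv n ... (%l. scl M c (y0 (us @ a # vs) l) + 0)" by (intro eqv_add eqv_refl zero)
  finally show ?thesis by simp
 qed
 \<comment> \<open>Sesquilinearity applied k times gives the factor (-\<lambda>)^k; on the other
   side a single partial derivative, equal to 1, survives.\<close>
 have gen: "eqv n (y0 (us @ ev x # vs)) (E (qq x) (ev x))" if x: "x : J" for x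
 proof -
  obtain i k where ik: "x = (i, k)" by force
  have "eqv n (y0 (us @ (der V ^^ k) (u i) # vs)) (%l. scl M ((- l m) ^ k) (y0 (us @ u i # vs) l))"
  proof (induction k)
   case (Suc k)
   have "eqv n (y0 (us @ (der V ^^ Suc k) (u i) # vs)) (%l. - scl M (l m) (y0 (us @ (der V ^^ k) (u i) # vs) l))"
    using Y_ses[OF len] m by simp
   also have "eqv n ... (%l. - scl M (l m) (scl M ((- l m) ^ k) (y0 (us @ u i # vs) l)))"
    using mn by (intro eqv_neg eqv_mult Suc afn_var) simp
   finally show ?case by simp
  qed simp
  moreover have "E (qq x) (ev x) = (%l. scl M ((- l m) ^ k) (y0 (us @ u i # vs) l))"
  proof
   fix l
   have "supp (ev x) \<subseteq> {x}" using D_ev[OF x] by (auto simp: supp_def split: if_splits)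
   hence "E (qq x) (ev x) l = exm 1 (%r. scl M ((- r) ^ snd x) (g l x r)) (l m)"
    unfolding E_def using dext_bound[OF w, of "{x}" "ev x"] x by (simp add: D_ev[OF x])
   also have "... = scl M ((- l m) ^ k) (y0 (us @ u i # vs) l)"
    using exm_one[OF wpf_pf[OF w x]] by (simp add: ik g_def)
   finally show "E (qq x) (ev x) l = scl M ((- l m) ^ k) (y0 (us @ u i # vs) l)" .
  qed
  ultimately show ?thesis by (simp add: ik ev_def)
 qed
 have leib: "eqv n (y0 (us @ (b * c) # vs)) (E (\<beta> + \<gamma>) (b * c))"
  if bc: "b : par V \<beta>" "c : par V \<gamma>" and h: "eqv n (y0 (us @ b # vs)) (E \<beta> b)" "eqv n (y0 (us @ c # vs)) (E \<gamma> c)" for b c \<beta> \<gamma>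
 proof -
  have "eqv n (y0 (us @ (b * c) # vs)) (%l. sm (\<beta> * s) (exm b (%r. y0 (us @ c # vs) (l(m := r))) (l m))
   + sm (\<gamma> * (\<beta> + s)) (exm c (%r. y0 (us @ b # vs) (l(m := r))) (l m)))"
   by (rule Y_leib[OF len ps bc s m])
  also have "eqv n ... (%l. sm (\<beta> * s) (exm b (%r. E \<gamma> c (l(m := r))) (l m)) + sm (\<gamma> * (\<beta> + s)) (exm c (%r. E \<beta> b (l(m := r))) (l m)))"
   by (intro eqv_add eqv_sm eqv_exm h mn pol0 polE)
  also have "... = E (\<beta> + \<gamma>) (b * c)"
   unfolding E_def gu fun_upd_same dext_mult[OF w bc] ..
  finally show ?thesis .
 qed
 \<comment> \<open>The Leibniz rule for 1 = 1 * 1 makes the value congruent to its double, hence to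
   0.\<close>
 have one: "eqv n (y0 (us @ 1 # vs)) (E 0 1)"
 proof -
  have "supp 1 = {}" by (auto simp: supp_def D_one)
  hence E1: "E 0 1 = (%_. 0)" by (auto simp: E_def dext_def)
  have "eqv n (y0 (us @ (1 * 1) # vs)) (%l. sm (0 * s) (exm 1 (%r. y0 (us @ 1 # vs) (l(m := r))) (l m))
   + sm (0 * (0 + s)) (exm 1 (%r. y0 (us @ 1 # vs) (l(m := r))) (l m)))"
   by (rule Y_leib[OF len ps one_par one_par s m])
  hence "eqv n (y0 (us @ 1 # vs)) (%l. y0 (us @ 1 # vs) l + y0 (us @ 1 # vs) l)"
   using exm_one[OF M.pf_polyfun_upd[OF pol0]] by (simp del: fun_upd_apply)
  from eqv_diff[OF this eqv_refl, of "y0 (us @ 1 # vs)"] show ?thesis unfolding E1 using eqv_sym by simp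
 qed
 have "eqv n (y0 (us @ a # vs)) (E \<alpha> a)"
  using a
 proof (rule hom_word_induct)
  show "eqv n (y0 (us @ 0 # vs)) (E \<alpha> 0)" using zero E0 by simp
 next
  fix a b assume h: "eqv n (y0 (us @ a # vs)) (E \<alpha> a)" "eqv n (y0 (us @ b # vs)) (E \<alpha> b)"
  have "eqv n (y0 (us @ (a + b) # vs)) (%l. y0 (us @ a # vs) l + y0 (us @ b # vs) l)"
   using Y_mult[OF len, of 1 a b] by simp
  also have "eqv n ... (%l. E \<alpha> a l + E \<alpha> b l)" by (intro eqv_add h)
  also have "... = E \<alpha> (a + b)" unfolding E_def using lin_add[OF dext_lin[OF w]] by auto
  finally show "eqv n (y0 (us @ (a + b) # vs)) (E \<alpha> (a + b))" .
 next
  fix c a assume h: "eqv n (y0 (us @ a # vs)) (E \<alpha> a)"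
  note scl0[of c a]
  also have "eqv n (%l. scl M c (y0 (us @ a # vs) l)) (%l. scl M c (E \<alpha> a l))" by (intro eqv_scl h)
  also have "... = E \<alpha> (scl V c a)" unfolding E_def using lin_scl[OF dext_lin[OF w]] by auto
  finally show "eqv n (y0 (us @ scl V c a # vs)) (E \<alpha> (scl V c a))" .
 next
  fix wd assume "wd : lists J" "wp wd = \<alpha>"
  thus "eqv n (y0 (us @ wv wd # vs)) (E \<alpha> (wv wd))"
  proof (induction wd arbitrary: \<alpha>)
   case Nil
   thus ?case using one by simp
  next
   case (Cons x wd)
   have "eqv n (y0 (us @ (ev x * wv wd) # vs)) (E (qq x + wp wd) (ev x * wv wd))"
    using Cons by (intro leib ev_par wv_par gen) auto
   thus ?case using Cons.prems by simp
  qed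
 qed
 thus ?thesis unfolding E_def g_def .
qed

end

context lifting begin

fun gz :: "nat => 'i list => (nat => 'f) => ('i \<times> 'f) list" where
 "gz k [] l = []"
| "gz k (i # is) l = (i, l k) # gz (Suc k) is l"

definition gq :: "'i list => bit" where "gq is = (SUM j<length is. 1 + qu (is ! j))"

lemma gq_snoc: "gq (is @ [i]) = gq is + 1 + qu i"
 by (simp add: gq_def nth_append add_ac)

lemma gz_append: "gz k (is @ js) l = gz k is l @ gz (k + length is) js l"
 by (induction "is" arbitrary: k) auto

lemma gz_cong: "(!!j. k \<le> j ==> j < k + length is ==> l j = l' j) ==> gz k is l = gz k is l'"
proof (induction "is" arbitrary: k)
 case (Cons i "is")
 have "gz (Suc k) is l = gz (Suc k) is l'" by (rule Cons.IH) (auto intro: Cons.prems)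
 thus ?case using Cons.prems[of k] by auto
qed simp

lemma gz_zip: "gz k is l = map (%(i, j). (i, l j)) (zip is [k..<k + length is])"
 by (induction "is" arbitrary: k) (auto simp: upt_conv_Cons simp del: upt_Suc)

lemma gz_inst: assumes "is : lists I" shows "EX pre:lists GXF. ALL l. ginst pre l = gz k is l"
proof
 let ?pre = "map (%(i, j). (i, %l. l j)) (zip is [k..<k + length is])"
 show "ALL l. ginst ?pre l = gz k is l" by (auto simp: gz_zip)
 show "?pre : lists GXF" using assms by (auto simp: GXF_def afn_var in_lists_conv_set dest: set_zip_leftD)
qed

lemma pol_ext_gz:
 assumes "GPoly G" "homl as" "is : lists I" "length is + length as = n"
 shows "pol n (%l. ext \<rho> (%zs. G (gz 0 is l @ zs)) (mkl (length is) as l))"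
proof (rule pol_restrict)
 obtain pre where p: "pre : lists GXF" "!!l. ginst pre l = gz 0 is l" using gz_inst[OF assms(3)] by blast
 obtain ws where w: "ws : lists XF" "!!l. inst ws l = mkl (length is) as l" using mkl_inst[OF assms(2)] by blast
 from PF_ext_aux[OF assms(1) w(1) p(1), of \<rho>]
 show "M.polyfun UNIV (%l. ext \<rho> (%zs. G (gz 0 is l @ zs)) (mkl (length is) as l))" unfolding p w .
next
 fix l l' :: "nat => 'f" assume "!!j. j < n ==> l j = l' j"
 hence "gz 0 is l = gz 0 is l'" "mkl (length is) as l = mkl (length is) as l'"
  using assms(4) by (auto intro!: gz_cong mkl_cong)
 thus "ext \<rho> (%zs. G (gz 0 is l @ zs)) (mkl (length is) as l) = ext \<rho> (%zs. G (gz 0 is l' @ zs)) (mkl (length is) as l')" by simp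
qed

text \<open>Arguments are replaced by generators from left to right: \<open>is\<close> are the
  generators already in place and \<open>as\<close> the arguments still to come.
  \<open>slot_expand\<close> treats the next one, and congruences survive the exponential operator
  by \<open>eqv_exm\<close>.\<close>

lemma lift_agrees:
 assumes G: "GPoly G" and base: "!!is. is : lists I ==> length is = n ==> eqv n (y0 (map u is)) (%l. G (gz 0 is l))"
 shows "homl as ==> is : lists I ==> length is + length as = n ==>
  eqv n (y0 (map u is @ map fst as)) (%l. ext (\<pi> + gq is) (%zs. G (gz 0 is l @ zs)) (mkl (length is) as l))"
proof (induction as arbitrary: "is")
 case Nil
 thus ?case using base[of "is"] by simp
next
 case (Cons z as)
 obtain a \<alpha> where z: "z = (a, \<alpha>)" by force
 have h: "homl as" "a : par V \<alpha>" using Cons.prems(1) by (auto simp: homl_def z)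
 define m where "m = length is"
 have mn: "m < n" using Cons.prems(3) by (simp add: m_def)
 define f where "f x = y0 (map u is @ u (fst x) # map fst as)" for x :: "'i \<times> nat"
 define F where "F x l = ext (\<pi> + gq is + 1 + qq x) (%zs. G (gz 0 is l @ (fst x, l m) # zs)) (mkl (Suc m) as l)" for x and l :: "nat => 'f"
 have IH: "eqv n (f x) (F x)" "pol n (f x)" "pol n (F x)" if x: "x : J" for x
 proof -
  have "is @ [fst x] : lists I" "length (is @ [fst x]) + length as = n"
   using x Cons.prems by auto
  from Cons.IH[OF h(1) this] pol_ext_gz[OF G h(1) this, of "\<pi> + gq is + 1 + qq x"]
  show "eqv n (f x) (F x)" "pol n (F x)"
   by (simp_all add: f_def[abs_def] F_def[abs_def] m_def gz_append gq_snoc qq_def add_ac)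
  show "pol n (f x)" unfolding f_def using Cons.prems by (intro Yrep(2)) simp
 qed
 have upd: "F x (l(m := r)) = ext (\<pi> + gq is + 1 + qq x) (%zs. G (gz 0 is l @ (fst x, r) # zs)) (mkl (Suc m) as l)" for x l r
 proof -
  have "gz 0 is (l(m := r)) = gz 0 is l" "mkl (Suc m) as (l(m := r)) = mkl (Suc m) as l"
   by (auto intro!: gz_cong mkl_cong simp: m_def)
  thus ?thesis by (simp add: F_def)
 qed
 have "eqv n (y0 (map u is @ a # map fst as)) (%l. dext (\<pi> + gq is) \<alpha> (%x r. y0 (map u is @ u (fst x) # map fst as) (l(m := r))) a (l m))"
 proof (rule slot_expand[where ps = "%j. qu (is ! j)"])
  show "map u is ! j : par V (qu (is ! j))" if "j < length (map u is)" for j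
   using that Cons.prems(2) by (auto intro!: u_par simp: in_lists_conv_set)
  show "length (map u is) + Suc (length (map fst as)) = n" using Cons.prems(3) by simp
  show "\<pi> + gq is = \<pi> + (SUM j<length (map u is). 1 + qu (is ! j))" unfolding gq_def by simp
  show "m = length (map u is)" by (simp add: m_def)
  show "a : par V \<alpha>" by (rule h(2))
 qed
 also have "eqv n ... (%l. dext (\<pi> + gq is) \<alpha> (%x r. F x (l(m := r))) a (l m))"
  unfolding dext_def f_def[symmetric]
 proof (intro eqv_sum eqv_sm)
  fix x assume "x : supp a"
  hence x: "x : J" using supp_J by blast
  from eqv_exm[OF eqv_npow[OF IH(1)[OF x] mn, where k = "snd x"] mn pol_npow[OF IH(2)[OF x] mn] pol_npow[OF IH(3)[OF x] mn], where b = "D x a"]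
  show "eqv n (%l. exm (D x a) (%r. scl M ((- r) ^ snd x) (f x (l(m := r)))) (l m))
    (%l. exm (D x a) (%r. scl M ((- r) ^ snd x) (F x (l(m := r)))) (l m))" by (simp only: fun_upd_same)
 qed
 finally show ?case by (simp only: z list.map fst_conv upd ext.simps mkl.simps m_def[symmetric] append_Cons append_assoc)
qed

text \<open>The arbitrary \<open>rep\<close> need not be homogeneous; the parity condition on
  \<open>Y\<close> supplies representatives that are.\<close>

lemma base_reps:
 obtains Pc where "!!is. is : lists I ==> length is = n ==> Pc is : M.lcar n"
  "!!is. is : lists I ==> length is = n ==> eqv n (y0 (map u is)) (evl M (Pc is))"
  "!!is l. is : lists I ==> length is = n ==> evl M (Pc is) l : par M (1 + \<pi> + gq is)"
proof -
 have "EX P. P : M.lcar n & eqv n (y0 (map u is)) (evl M P) & (ALL l. evl M P l : par M (1 + \<pi> + gq is))"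
  if i: "is : lists I" "length is = n" for "is"
 proof -
  have "ALL xs:lists_of n. ALL ps:lists_of n. (ALL j<n. xs ! j : par V (ps ! j)) -->
     Y xs : lclass M n ` {P : carrier (lpoly_space M n).
      ALL e. lookup P e : par M (1 + (\<pi> + (SUM j<n. 1 + ps ! j)))}"
   using Y unfolding homogeneous_cochains_def by blast
  moreover have "map u is : lists_of n" "map qu is : lists_of n" "ALL j<n. map u is ! j : par V (map qu is ! j)"
   using i by (auto intro!: u_par simp: in_lists_conv_set)
  ultimately have "Y (map u is) : lclass M n ` {P : carrier (lpoly_space M n).
      ALL e. lookup P e : par M (1 + (\<pi> + (SUM j<n. 1 + map qu is ! j)))}" by blast
  then obtain P where P: "P : M.lcar n" "Y (map u is) = lclass M n P"
   "!!e. lookup P e : par M (1 + (\<pi> + (SUM j<n. 1 + map qu is ! j)))" unfolding carrier_lpoly by blast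
  have "(SUM j<n. 1 + map qu is ! j) = gq is" unfolding gq_def i(2) using i(2) by (intro sum.cong) auto
  hence "evl M P l : par M (1 + \<pi> + gq is)" for l
   unfolding evl_def using P(3) by (intro M.par_sum M.par_scl) (simp add: add.assoc)
  moreover have "eqv n (y0 (map u is)) (evl M P)" using i by (intro Y_lclass P M.polyfun_evl) simp
  ultimately show ?thesis using P(1) by blast
 qed
 then obtain Pc where "ALL is. is : lists I & length is = n --> Pc is : M.lcar n & eqv n (y0 (map u is)) (evl M (Pc is)) & (ALL l. evl M (Pc is) l : par M (1 + \<pi> + gq is))"
  using choice[of "%is P. is : lists I & length is = n --> P : M.lcar n & eqv n (y0 (map u is)) (evl M P) & (ALL l. evl M P l : par M (1 + \<pi> + gq is))"] by blast
 thus thesis by (intro that[of Pc]) blast+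
qed

text \<open>Representatives on tuples of generators can be prescribed freely but are symmetric only
  up to congruence. Their symmetrization divided by n! is symmetric exactly and still congruent to
  the given values.\<close>

lemma lift_base:
 "EX G. GPoly G & GSym G & GPar \<pi> G & (ALL is:lists I. length is = n --> eqv n (y0 (map u is)) (%l. G (gz 0 is l)))"
proof -
 obtain Pc where Pc: "!!is. is : lists I ==> length is = n ==> Pc is : M.lcar n"
  "!!is. is : lists I ==> length is = n ==> eqv n (y0 (map u is)) (evl M (Pc is))"
  "!!is l. is : lists I ==> length is = n ==> evl M (Pc is) l : par M (1 + \<pi> + gq is)"
  by (rule base_reps) blast
 \<comment> \<open>The polynomial chosen for the tuple of generators, evaluated at the attached
   values.\<close>
 define G0 where "G0 zs = evl M (Pc (map fst zs)) (%k. snd (zs ! k))" for zs :: "('i \<times> 'f) list"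
 define G where "G zs = (if length zs = n then scl M (1 / fact n) (symmetrize qx n G0 zs) else 0)" for zs
 have poly: "GPoly G"
  unfolding GPoly_def
 proof (intro allI impI)
  fix ws :: "('i \<times> ((nat => 'f) => 'f)) list" assume ws: "ALL (i, \<phi>):set ws. i : I & afn UNIV \<phi>"
  show "M.polyfun UNIV (%l. G (ginst ws l))"
  proof (cases "length ws = n")
   case True
   have q: "(%e. qx (case e of (i, \<phi>) => (i, \<phi> l))) = (%e. 1 + qu (fst e))" for l :: "nat => 'f" by auto
   have "M.polyfun UNIV (%l. symmetrize (%e. 1 + qu (fst e)) n (%zs. G0 (ginst zs l)) ws)"
   proof (rule symmetrize_closed[where C = "M.polyfun UNIV"])
    fix zs :: "('i \<times> ((nat => 'f) => 'f)) list" assume m: "mset zs = mset ws"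
    have s: "set zs = set ws" "length zs = n" using mset_eq_setD[OF m] mset_eq_length[OF m] True by auto
    have f: "map fst (ginst zs l) = map fst zs" for l by (auto simp: case_prod_beta)
    have i: "map fst zs : lists I" using s(1) ws by (auto simp: in_lists_conv_set)
    have "M.polyfun UNIV (%l. evl M (Pc (map fst zs)) (%k. snd (ginst zs l ! k)))"
    proof (rule M.polyfun_subst[OF M.polyfun_evl[OF Pc(1)[OF i]]])
     fix k assume "k : {..<n}"
     hence k: "k < length zs" using s(2) by simp
     hence "zs ! k : set ws" using nth_mem[OF k] s(1) by simp
     from bspec[OF ws this] have "afn UNIV (snd (zs ! k))" by (simp add: case_prod_beta)
     thus "afn UNIV (%l. snd (ginst zs l ! k))" using k by (simp add: case_prod_beta)
    qed (use s in simp)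
    thus "M.polyfun UNIV (%l. G0 (ginst zs l))" unfolding G0_def f .
   next
    show "M.polyfun UNIV (%l. 0)" by (rule M.polyfun_const)
    show "M.polyfun UNIV f ==> M.polyfun UNIV g ==> M.polyfun UNIV (%l. f l + g l)" for f g by (rule M.polyfun_add)
    show "M.polyfun UNIV f ==> M.polyfun UNIV (%l. sm e (f l))" for f e by (rule M.polyfun_sm)
   qed
   thus ?thesis using True by (simp only: G_def symmetrize_map q length_map refl if_True M.polyfun_scl)
  qed (simp add: G_def M.polyfun_const)
 qed
 have sym: "GSym G"
  unfolding GSym_def
 proof (intro ballI)
  fix us vs x z assume "us : lists GX" "vs : lists GX" "x : GX" "z : GX"
  show "G (us @ x # z # vs) = sm (qx x * qx z) (G (us @ z # x # vs))"
  proof (cases "length us + length vs + 2 = n")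
   case True
   have e: "symmetrize qx n G0 (us @ x # z # vs) = sm (qx x * qx z) (symmetrize qx n G0 (us @ z # x # vs))"
    by (rule symm_symmetrize[of qx n G0, unfolded symm_def, rule_format, OF True])
   have "length (us @ x # z # vs) = n" "length (us @ z # x # vs) = n" using True by simp_all
   thus ?thesis unfolding G_def by (simp only: refl if_True e M.scl_sm)
  qed (simp add: G_def)
 qed
 have par: "GPar \<pi> G"
  unfolding GPar_def
 proof
  fix ys assume ys: "ys : lists GX"
  \<comment> \<open>The closure principle speaks of families; the trivial index turns a single value
    into one.\<close>
  have "ALL l::unit. symmetrize qx n G0 ys : par M (1 + \<pi> + sum_list (map qx ys))" if n: "length ys = n"
  proof (rule symmetrize_closed[where C = "%f. ALL l::unit. f l : par M (1 + \<pi> + sum_list (map qx ys))"])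
   fix zs assume m: "mset zs = mset ys"
   have s: "set zs = set ys" "length zs = n" using mset_eq_setD[OF m] mset_eq_length[OF m] n by auto
   have i: "map fst zs : lists I" using s(1) ys by (auto simp: in_lists_conv_set GX_def)
   have "gq (map fst zs) = sum_list (map qx zs)"
    by (auto simp: gq_def sum_list_sum_nth atLeast0LessThan qx_def case_prod_beta intro!: sum.cong)
   also have "... = sum_list (map qx ys)" using m by (metis mset_map sum_mset_sum_list)
   finally show "ALL l::unit. G0 zs : par M (1 + \<pi> + sum_list (map qx ys))" using Pc(3)[OF i] s by (simp add: G0_def)
  qed (simp_all add: M.par_0 M.par_add M.par_sm)
  thus "G ys : par M (1 + \<pi> + sum_list (map qx ys))" by (simp add: G_def M.par_scl M.par_0)
 qed
 have cl: "eqv n (y0 (map u is)) (%l. G (gz 0 is l))" if i: "is : lists I" "length is = n" for "is"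
 proof -
  \<comment> \<open>Each generator is paired with the number of its variable, so that permuting the
    pairs records how the variables are permuted.\<close>
  let ?ys = "zip is [0..<n]"
  define ml where "ml l = map (%(i, j :: nat). (i :: 'i, l j :: 'f))" for l
  define qf where "qf = (%e :: 'i \<times> nat. 1 + qu (fst e))"
  have main: "eqv n (%l. G0 (ml l zs)) (%l. y0 (map u (map fst zs)) (%k. l (map snd zs ! k)))"
   if m: "mset zs = mset ?ys" for zs
  proof -
   have s: "length zs = n" "set zs = set ?ys" using mset_eq_length[OF m] mset_eq_setD[OF m] i by auto
   have j: "mset (map snd zs) = mset [0..<n]" using arg_cong[OF m, of "image_mset snd"] i by (simp flip: mset_map)
   have "mset (map fst zs) = mset is" using arg_cong[OF m, of "image_mset fst"] i by (simp flip: mset_map)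
   hence I: "map fst zs : lists I" using i mset_eq_setD by (metis in_listsD in_listsI)
   have f: "map fst (ml l zs) = map fst zs" for l by (auto simp: ml_def case_prod_beta)
   have "G0 (ml l zs) = evl M (Pc (map fst zs)) (%k. l (map snd zs ! k))" for l
    unfolding G0_def f
    by (rule M.polyfun_cong[OF M.polyfun_evl[OF Pc(1)[OF I]]]) (auto simp: s ml_def case_prod_beta)
   moreover have "eqv n (%l. evl M (Pc (map fst zs)) (%k. l (map snd zs ! k))) (%l. y0 (map u (map fst zs)) (%k. l (map snd zs ! k)))"
    using eqv_perm[OF eqv_sym[OF Pc(2)[OF I]] j] s by simp
   ultimately show ?thesis by simp
  qed
  have "eqv n (%l. symmetrize qf n (%zs. G0 (ml l zs)) ?ys) (%l. scl M (fact n) (G0 (ml l ?ys)))"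
  proof (rule symmetrize_eqv)
   fix us x z vs assume m: "mset (us @ x # z # vs) = mset ?ys"
   let ?js = "map snd (us @ x # z # vs)" and ?js' = "map snd (us @ z # x # vs)" and ?f = "map (%e. u (fst e))"
   have m': "mset (us @ z # x # vs) = mset ?ys" using m by (simp add: add_mset_commute)
   have len: "length us + length vs + 2 = n" using mset_eq_length[OF m] i by simp
   have j: "mset ?js = mset [0..<n]" using arg_cong[OF m, of "image_mset snd"] i by (simp flip: mset_map)
   have "set (us @ x # z # vs) = set ?ys" using mset_eq_setD[OF m] .
   hence "x : set ?ys" "z : set ?ys" by auto
   moreover have "fst e : I" if "e : set ?ys" for e
    using set_zip_leftD[of "fst e" "snd e" "is" "[0..<n]"] that i(1) by (auto simp: in_lists_conv_set)
   ultimately have xz: "fst x : I" "fst z : I" by blast+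
   define t where "t = [0..<n][length (?f us) := Suc (length (?f us)), Suc (length (?f us)) := length (?f us)]"
   define js where "js = ?js"
   define js' where "js' = ?js'"
   define A where "A = ?f us @ u (fst x) # u (fst z) # ?f vs"
   define B where "B = ?f us @ u (fst z) # u (fst x) # ?f vs"
   have lB: "length B = n" using len by (simp add: B_def)
   have AB: "map u (map fst (us @ x # z # vs)) = A" "map u (map fst (us @ z # x # vs)) = B"
    by (simp_all add: A_def B_def)
   have "eqv n (%l. y0 B (%k. l (t ! k))) (%l. sm (qf x * qf z) (y0 A l))"
    unfolding qf_def A_def B_def by (rule Y_sym[OF _ u_par[OF xz(1)] u_par[OF xz(2)] t_def]) (use len in simp)
   from eqv_perm[OF this j]
   have 1: "eqv n (%l. y0 B (%k. l (js ! (t ! k)))) (%l. sm (qf x * qf z) (y0 A (%k. l (js ! k))))"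
    unfolding js_def .
   \<comment> \<open>The transposition of variables in the symmetry condition, followed by the
     numbering \<open>js\<close>, is the numbering after exchanging x and z.\<close>
   have t: "js ! (t ! k) = js' ! k" if "k < n" for k
   proof -
    consider "k = length us" | "k = Suc (length us)" | "k < length us" | "k > Suc (length us)" by linarith
    thus ?thesis unfolding js_def js'_def t_def using that len by cases (simp_all add: nth_append nth_list_update nth_Cons')
   qed
   have "y0 B (%k. l (js ! (t ! k))) = y0 B (%k. l (js' ! k))" for l
    by (rule M.polyfun_cong[OF Yrep(2)[OF lB]]) (simp add: t)
   with 1 have 2: "eqv n (%l. y0 B (%k. l (js' ! k))) (%l. sm (qf x * qf z) (y0 A (%k. l (js ! k))))"
    by (simp only:)
   have "eqv n (%l. sm (qf x * qf z) (G0 (ml l (us @ z # x # vs)))) (%l. sm (qf x * qf z) (y0 B (%k. l (js' ! k))))"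
    using main[OF m'] unfolding AB js'_def by (rule eqv_sm)
   also have "eqv n ... (%l. sm (qf x * qf z) (sm (qf x * qf z) (y0 A (%k. l (js ! k)))))"
    by (rule eqv_sm[OF 2])
   also have "... = (%l. y0 A (%k. l (js ! k)))" by (simp add: sm_sm)
   also have "eqv n ... (%l. G0 (ml l (us @ x # z # vs)))"
    using eqv_sym[OF main[OF m]] unfolding AB js_def .
   finally show "eqv n (%l. G0 (ml l (us @ x # z # vs))) (%l. sm (qf x * qf z) (G0 (ml l (us @ z # x # vs))))"
    by (rule eqv_sym)
  qed (use i in simp)
  from eqv_scl[OF this, of "1 / fact n"]
  have "eqv n (%l. scl M (1 / fact n) (symmetrize qf n (%zs. G0 (ml l zs)) ?ys)) (%l. G0 (ml l ?ys))"
   by simp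
  also have "(%l. scl M (1 / fact n) (symmetrize qf n (%zs. G0 (ml l zs)) ?ys)) = (%l. G (gz 0 is l))"
  proof
   fix l
   have "(%e. qx (case e of (i, j) => (i, l j))) = qf" by (auto simp: qf_def)
   thus "scl M (1 / fact n) (symmetrize qf n (%zs. G0 (ml l zs)) ?ys) = G (gz 0 is l)"
    using i by (simp add: gz_zip G_def symmetrize_map ml_def)
  qed
  finally have A: "eqv n (%l. G (gz 0 is l)) (%l. G0 (ml l ?ys))" .
  have "y0 (map u is) (%k. l ([0..<n] ! k)) = y0 (map u is) l" for l
   by (rule M.polyfun_cong[OF Yrep(2)]) (use i in auto)
  hence "eqv n (%l. G0 (ml l ?ys)) (y0 (map u is))"
   using main[OF refl] i by simp
  from eqv_sym[OF eqv_trans[OF A this]] show ?thesis .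
 qed
 show ?thesis using poly sym par cl by blast
qed

text \<open>The multiderivation extending the symmetrized generator values, cut off to n arguments.
  No polynomial relation among generators has to be checked beyond what made \<open>D\<close> well
  defined.\<close>

lemma lift: "EX y. BC \<pi> y & (ALL as. homl as --> length as = n --> eqv n (y0 (map fst as)) (%l. y (mkl 0 as l)))
  & (ALL w. length w ~= n --> y w = 0)"
proof -
 obtain G where G: "GPoly G" "GSym G" "GPar \<pi> G" "!!is. is : lists I ==> length is = n ==> eqv n (y0 (map u is)) (%l. G (gz 0 is l))"
  using lift_base by blast
 let ?y = "%w. if length w = n then ext \<pi> G w else 0"
 have "eqv n (y0 (map fst as)) (%l. ?y (mkl 0 as l))" if as: "homl as" "length as = n" for as
 proof -
  have "eqv n (y0 (map u [] @ map fst as)) (%l. ext (\<pi> + gq []) (%zs. G (gz 0 [] l @ zs)) (mkl (length ([] :: 'i list)) as l))"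
   by (rule lift_agrees[OF G(1) _ as(1)]) (use G(4) as(2) in simp_all)
  thus ?thesis by (simp only: gq_def length_mkl as(2) refl if_True list.map append_Nil gz.simps list.size lessThan_0 sum.empty add_0_right)
 qed
 moreover have "BC \<pi> ?y" by (rule BC_restrict[OF BC_ext[OF G(1-3)]])
 moreover have "ALL w. length w ~= n --> ?y w = 0" by simp
 ultimately show ?thesis by blast
qed

end

section \<open>Reduction of unreduced cochains, with arguments of mixed parity\<close>

lemma UNIV_bit: "UNIV = {0, 1 :: bit}"
proof -
 have "x : {0, 1}" for x :: bit by (cases x) auto
 thus ?thesis by blast
qed

lemma finite_UNIV_bit [simp]: "finite (UNIV :: bit set)"
 by (simp add: UNIV_bit)

lemma finite_bit_lists [simp]: "finite {ps :: bit list. length ps = n}"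
 using finite_lists_length_eq[OF finite_UNIV_bit, of n] by simp

lemma sum_bit: "(SUM \<alpha>:UNIV. f \<alpha>) = f 0 + f (1 :: bit)"
 by (simp add: UNIV_bit)

lemma sum_bit_lists_Suc:
 "(SUM ps:{ps :: bit list. length ps = Suc n}. f ps) = (SUM \<alpha>:UNIV. \<Sum>ps | length ps = n. f (\<alpha> # ps))"
proof -
 have "(SUM ps:{ps :: bit list. length ps = Suc n}. f ps) = (SUM (\<alpha>, ps):UNIV \<times> {ps. length ps = n}. f (\<alpha> # ps))"
  by (rule sum.reindex_bij_witness[of _ "%(\<alpha>, ps). \<alpha> # ps" "%ps. (hd ps, tl ps)"]) (auto simp: length_Suc_conv)
 thus ?thesis by (simp add: sum.cartesian_product)
qed

lemma sum_bit_lists_add: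
 "(SUM ps:{ps :: bit list. length ps = m + n}. f ps) = (\<Sum>ps | length ps = m. \<Sum>rs | length rs = n. f (ps @ rs))"
proof (induction m arbitrary: f)
 case (Suc m)
 show ?case by (simp only: add_Suc sum_bit_lists_Suc Suc.IH append_Cons)
qed simp

context pvm begin

definition hl :: "bit list => 'v list => ('v \<times> bit) list" where
 "hl ps xs = map2 (%\<alpha> x. (hcomp V \<alpha> x, \<alpha>)) ps xs"

lemma hl_simps [simp]: "hl [] xs = []" "hl ps [] = []" "hl (\<alpha> # ps) (x # xs) = (hcomp V \<alpha> x, \<alpha>) # hl ps xs"
 and length_hl [simp]: "length (hl ps xs) = min (length ps) (length xs)"
 and homl_hl [simp]: "homl (hl ps xs)"
 by (auto simp: hl_def homl_def)

lemma hl_append: "length ps = length us ==> hl (ps @ rs) (us @ vs) = hl ps us @ hl rs vs"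
 by (simp add: hl_def)

lemma fst_hl: "map fst (hl ps xs) = map2 (hcomp V) ps xs"
 by (simp add: hl_def case_prod_beta)

lemma mkl_append: "mkl k (as @ bs) l = mkl k as l @ mkl (k + length as) bs l"
 by (induction as arbitrary: k) auto

lemma homl_simps [simp]: "homl []" "homl ((a, \<alpha>) # as) \<longleftrightarrow> a : par V \<alpha> & homl as" "homl (as @ bs) \<longleftrightarrow> homl as & homl bs"
 by (auto simp: homl_def)

text \<open>The multilinear extension of \<open>y\<close> to arguments that need not be homogeneous.\<close>

definition Hs :: "nat => (('v \<times> bit \<times> 'f) list => 'm) => 'v list => (nat => 'f) => 'm" where
 "Hs n y xs l = (\<Sum>ps | length ps = n. y (mkl 0 (hl ps xs) l))"

text \<open>The map from unreduced to reduced cochains. The complex, its differential and the energy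
  are all described through it.\<close>

definition pr :: "nat => (('v \<times> bit \<times> 'f) list => 'm) => 'v list => 'm lpoly set" where
 "pr n y = (\<lambda>xs\<in>lists_of n. cls n (Hs n y xs))"

lemma pol_Hs: "PF (%_. y) ==> length xs = n ==> pol n (Hs n y xs)"
 unfolding Hs_def[abs_def]
proof (rule M.polyfun_sum)
 fix ps :: "bit list" assume "PF (%_. y)" "length xs = n" "ps : {ps. length ps = n}"
 thus "pol n (%l. y (mkl 0 (hl ps xs) l))" using PF_pol[OF _ homl_hl, of y ps xs] by simp
qed

lemma cls_eqI: "eqv n f g ==> cls n f = cls n g"
 unfolding cls_def using eqv_trans eqv_sym by blast

lemma lclass_pol: "pol n (evl M P) ==> lclass M n P = cls n (evl M P)"
 by (rule lclass_cls[OF lcarI])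

lemma Hs_slot:
 assumes "length us + Suc (length vs) = n"
 shows "Hs n y (us @ a # vs) l = (\<Sum>ps | length ps = length us. SUM \<alpha>:UNIV. \<Sum>rs | length rs = length vs.
   y (mkl 0 (hl ps us) l @ (hcomp V \<alpha> a, \<alpha>, l (length us)) # mkl (Suc (length us)) (hl rs vs) l))"
proof -
 have "Hs n y (us @ a # vs) l = (\<Sum>ps | length ps = length us. SUM \<alpha>:UNIV. \<Sum>rs | length rs = length vs.
   y (mkl 0 (hl (ps @ \<alpha> # rs) (us @ a # vs)) l))"
  unfolding Hs_def assms[symmetric] sum_bit_lists_add sum_bit_lists_Suc ..
 also have "... = (\<Sum>ps | length ps = length us. SUM \<alpha>:UNIV. \<Sum>rs | length rs = length vs.
   y (mkl 0 (hl ps us) l @ (hcomp V \<alpha> a, \<alpha>, l (length us)) # mkl (Suc (length us)) (hl rs vs) l))"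
  by (intro sum.cong refl) (simp add: hl_append mkl_append)
 finally show ?thesis .
qed

text \<open>In the sum over parities only the actual parity of a homogeneous argument survives. The
  prefix \<open>W\<close> collects the arguments already treated.\<close>

lemma Hs_collapse:
 assumes "slin y"
 shows "homl as ==> W : lists X ==> (\<Sum>ps | length ps = length as + length vs. y (W @ mkl k (hl ps (map fst as @ vs)) l))
  = (\<Sum>rs | length rs = length vs. y (W @ mkl k as l @ mkl (k + length as) (hl rs vs) l))"
proof (induction as arbitrary: k W)
 case (Cons z as)
 obtain a \<alpha> where z: "z = (a, \<alpha>)" by force
 have h: "homl as" "a : par V \<alpha>" using Cons.prems(1) by (auto simp: z)
 let ?m = "length as + length vs"
 have "(\<Sum>ps | length ps = length (z # as) + length vs. y (W @ mkl k (hl ps (map fst (z # as) @ vs)) l))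
  = (SUM \<beta>:UNIV. \<Sum>ps | length ps = ?m. y (W @ (hcomp V \<beta> a, \<beta>, l k) # mkl (Suc k) (hl ps (map fst as @ vs)) l))"
  by (simp add: sum_bit_lists_Suc z)
 also have "... = (SUM \<beta>:UNIV. if \<beta> = \<alpha> then (\<Sum>ps | length ps = ?m. y ((W @ [(a, \<alpha>, l k)]) @ mkl (Suc k) (hl ps (map fst as @ vs)) l)) else 0)"
 proof (rule sum.cong[OF refl])
  fix \<beta>
  have "y (W @ (0, \<beta>, l k) # mkl (Suc k) (hl ps (map fst as @ vs)) l) = 0" for ps
   using LinAt_D(6)[OF slinD[OF assms Cons.prems(2) mkl_X[OF homl_hl]] V.par_0] .
  thus "(\<Sum>ps | length ps = ?m. y (W @ (hcomp V \<beta> a, \<beta>, l k) # mkl (Suc k) (hl ps (map fst as @ vs)) l))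
   = (if \<beta> = \<alpha> then (\<Sum>ps | length ps = ?m. y ((W @ [(a, \<alpha>, l k)]) @ mkl (Suc k) (hl ps (map fst as @ vs)) l)) else 0)"
   using V.hcomp_hom[OF h(2), of \<beta>] by auto
 qed
 also have "... = (\<Sum>ps | length ps = ?m. y ((W @ [(a, \<alpha>, l k)]) @ mkl (Suc k) (hl ps (map fst as @ vs)) l))"
  by (subst sum.delta) simp_all
 also have "... = (\<Sum>rs | length rs = length vs. y ((W @ [(a, \<alpha>, l k)]) @ mkl (Suc k) as l @ mkl (Suc k + length as) (hl rs vs) l))"
  by (rule Cons.IH[OF h(1)]) (use Cons.prems(2) h(2) in simp)
 finally show ?case by (simp add: z)
qed simp

lemma Hs_prefix:
 assumes "slin y" "homl as" "length as + length vs = n"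
 shows "Hs n y (map fst as @ vs) l = (\<Sum>rs | length rs = length vs. y (mkl 0 as l @ mkl (length as) (hl rs vs) l))"
 using Hs_collapse[OF assms(1,2) lists.Nil, where vs = vs and k = 0 and l = l] assms(3) by (simp add: Hs_def)

lemma Hs_hom: "slin y ==> homl as ==> length as = n ==> Hs n y (map fst as) l = y (mkl 0 as l)"
 using Hs_prefix[of y as "[]" n l] by simp

lemma Hs_hom2:
 assumes "slin y" "homl as" "length us + length as + length vs = n"
 shows "Hs n y (us @ map fst as @ vs) l = (\<Sum>ps | length ps = length us. \<Sum>rs | length rs = length vs.
   y (mkl 0 (hl ps us) l @ mkl (length us) as l @ mkl (length us + length as) (hl rs vs) l))"
proof -
 have "Hs n y (us @ map fst as @ vs) l = (\<Sum>ps | length ps = length us. \<Sum>rs | length rs = length as + length vs.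
   y (mkl 0 (hl ps us) l @ mkl (length us) (hl rs (map fst as @ vs)) l))"
  unfolding Hs_def assms(3)[symmetric] add.assoc sum_bit_lists_add[of _ "length us"]
  by (intro sum.cong refl) (simp add: hl_append mkl_append)
 also have "... = (\<Sum>ps | length ps = length us. \<Sum>rs | length rs = length vs.
   y (mkl 0 (hl ps us) l @ mkl (length us) as l @ mkl (length us + length as) (hl rs vs) l))"
  by (intro sum.cong refl Hs_collapse[OF assms(1,2)] mkl_X homl_hl)
 finally show ?thesis .
qed

lemma Hs_lin:
 assumes "slin y" "length us + Suc (length vs) = n"
 shows "Hs n y (us @ (scl V c a + b) # vs) l = scl M c (Hs n y (us @ a # vs) l) + Hs n y (us @ b # vs) l"
  and "Hs n y (us @ der V a # vs) l = - scl M (l (length us)) (Hs n y (us @ a # vs) l)"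
proof -
 note D = LinAt_D[OF slinD[OF assms(1) mkl_X[OF homl_hl] mkl_X[OF homl_hl]] V.hcomp_par]
 have e: "y (mkl 0 (hl ps us) l @ (hcomp V \<alpha> (scl V c a + b), \<alpha>, l (length us)) # mkl (Suc (length us)) (hl rs vs) l)
   = scl M c (y (mkl 0 (hl ps us) l @ (hcomp V \<alpha> a, \<alpha>, l (length us)) # mkl (Suc (length us)) (hl rs vs) l))
   + y (mkl 0 (hl ps us) l @ (hcomp V \<alpha> b, \<alpha>, l (length us)) # mkl (Suc (length us)) (hl rs vs) l)" for ps rs \<alpha>
  using LinAt_D(1)[OF slinD[OF assms(1) mkl_X[OF homl_hl] mkl_X[OF homl_hl]] V.par_scl[OF V.hcomp_par] V.hcomp_par]
  by (simp add: lin_add[OF V.hcomp_lin] lin_scl[OF V.hcomp_lin] D(2))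
 show "Hs n y (us @ (scl V c a + b) # vs) l = scl M c (Hs n y (us @ a # vs) l) + Hs n y (us @ b # vs) l"
  unfolding Hs_slot[OF assms(2)] e by (simp add: sum.distrib M.scale_sum_right)
 show "Hs n y (us @ der V a # vs) l = - scl M (l (length us)) (Hs n y (us @ a # vs) l)"
  unfolding Hs_slot[OF assms(2)] V.hcomp_der D(3) by (simp add: sum_negf M.scale_sum_right)
qed

text \<open>The symmetry condition assumes homogeneity for the two exchanged arguments alone; the
  others are summed over their components.\<close>

lemma Hs_sym:
 assumes "slin y" "ssym y" "length us + length vs + 2 = n" "a : par V \<alpha>" "b : par V \<beta>" "k = length us"
 shows "Hs n y (us @ b # a # vs) (%j. l ([0..<n][k := Suc k, Suc k := k] ! j)) = sm ((1 + \<alpha>) * (1 + \<beta>)) (Hs n y (us @ a # b # vs) l)"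
proof -
 let ?l = "%j. l ([0..<n][k := Suc k, Suc k := k] ! j)"
 have h: "homl [(b, \<beta>), (a, \<alpha>)]" "homl [(a, \<alpha>), (b, \<beta>)]" using assms by simp_all
 have len: "length us + length [(b, \<beta>), (a, \<alpha>)] + length vs = n" "length us + length [(a, \<alpha>), (b, \<beta>)] + length vs = n" using assms by simp_all
 have m1: "mkl 0 (hl ps us) ?l = mkl 0 (hl ps us) l" for ps
  using assms(3,6) by (intro mkl_cong) (auto simp: nth_list_update)
 have m2: "mkl (k + 2) (hl rs vs) ?l = mkl (k + 2) (hl rs vs) l" for rs
  using assms(3,6) by (intro mkl_cong) (auto simp: nth_list_update)
 have k: "?l k = l (Suc k)" "?l (Suc k) = l k" using assms(3,6) by (simp_all add: nth_list_update)
 have s: "y (us' @ (b, \<beta>, s) # (a, \<alpha>, t) # vs') = sm ((1 + \<alpha>) * (1 + \<beta>)) (y (us' @ (a, \<alpha>, t) # (b, \<beta>, s) # vs'))"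
  if "us' : lists X" "vs' : lists X" for us' vs' s t
 proof -
  have "y (us' @ (b, \<beta>, s) # (a, \<alpha>, t) # vs') = sm (q (b, \<beta>, s) * q (a, \<alpha>, t)) (y (us' @ (a, \<alpha>, t) # (b, \<beta>, s) # vs'))"
   using ssymD[OF assms(2) that] assms(4,5) unfolding SymAt_def by (meson X_iff)
  thus ?thesis by (simp add: mult.commute)
 qed
 have "Hs n y (us @ map fst [(b, \<beta>), (a, \<alpha>)] @ vs) ?l = sm ((1 + \<alpha>) * (1 + \<beta>)) (Hs n y (us @ map fst [(a, \<alpha>), (b, \<beta>)] @ vs) l)"
  unfolding Hs_hom2[OF assms(1) h(1) len(1)] Hs_hom2[OF assms(1) h(2) len(2)] sm_sum
 proof (intro sum.cong refl)
  fix ps rs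
  show "y (mkl 0 (hl ps us) ?l @ mkl (length us) [(b, \<beta>), (a, \<alpha>)] ?l @ mkl (length us + length [(b, \<beta>), (a, \<alpha>)]) (hl rs vs) ?l)
   = sm ((1 + \<alpha>) * (1 + \<beta>)) (y (mkl 0 (hl ps us) l @ mkl (length us) [(a, \<alpha>), (b, \<beta>)] l @ mkl (length us + length [(a, \<alpha>), (b, \<beta>)]) (hl rs vs) l))"
   using s[OF mkl_X[OF homl_hl] mkl_X[OF homl_hl], of 0 ps us l "l (Suc k)" "l k" "k + 2" rs vs l] m1[of ps] m2[of rs] k
   by (simp add: assms(6))
 qed
 thus ?thesis by simp
qed

text \<open>The sign of the Leibniz rule involves the preceding arguments, so these must be
  homogeneous; the following ones are arbitrary.\<close>

lemma Hs_leib: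
 assumes "slin y" "PF (%_. y)" "sleib \<pi> y" "homl as" "length as + Suc (length vs) = n" "b : par V \<beta>" "c : par V \<gamma>" "m = length as"
  "s = \<pi> + sum_list (map (%z. 1 + snd z) as)"
 shows "Hs n y (map fst as @ (b * c) # vs) l = sm (\<beta> * s) (exm b (%r. Hs n y (map fst as @ c # vs) (l(m := r))) (l m))
   + sm (\<gamma> * (\<beta> + s)) (exm c (%r. Hs n y (map fst as @ b # vs) (l(m := r))) (l m))"
proof -
 have e: "Hs n y (map fst as @ x # vs) l' = (\<Sum>rs | length rs = length vs. y (mkl 0 as l @ (x, \<xi>, l' m) # mkl (Suc m) (hl rs vs) l))"
  if x: "x : par V \<xi>" and l': "!!j. j ~= m ==> l' j = l j" for x \<xi> and l' :: "nat => 'f"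
 proof -
  have "mkl 0 as l' = mkl 0 as l" "mkl (Suc m) (hl rs vs) l' = mkl (Suc m) (hl rs vs) l" for rs
   using assms(8) l' by (auto intro!: mkl_cong)
  thus ?thesis
   using Hs_prefix[OF assms(1), of "as @ [(x, \<xi>)]" vs n l'] assms(4,5,8) x by (simp add: mkl_append)
 qed
 have qs: "qs (mkl k as l) = sum_list (map (%z. 1 + snd z) as)" for k by (induction as arbitrary: k) auto
 have pf: "pf M (%r. y (mkl 0 as l @ (x, \<xi>, r) # mkl (Suc m) (hl rs vs) l))" if "x : par V \<xi>" for x \<xi> rs
  by (rule PF_pf[OF assms(2) mkl_X[OF assms(4)] mkl_X[OF homl_hl] that])
 have L: "y (mkl 0 as l @ (b * c, \<beta> + \<gamma>, t) # mkl (Suc m) (hl rs vs) l)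
   = sm (\<beta> * s) (exm b (%r. y (mkl 0 as l @ (c, \<gamma>, r) # mkl (Suc m) (hl rs vs) l)) t)
   + sm (\<gamma> * (\<beta> + s)) (exm c (%r. y (mkl 0 as l @ (b, \<beta>, r) # mkl (Suc m) (hl rs vs) l)) t)" for rs t
  using sleibD[OF assms(3) mkl_X[OF assms(4)] mkl_X[OF homl_hl]] assms(6,7) unfolding LeibAt_def by (simp add: qs assms(9))
 have "(%r. Hs n y (map fst as @ x # vs) (l(m := r))) = (%r. \<Sum>rs | length rs = length vs. y (mkl 0 as l @ (x, \<xi>, r) # mkl (Suc m) (hl rs vs) l))"
  if x: "x : par V \<xi>" for x \<xi>
  by (rule ext) (subst e[OF x], simp_all)
 note e2 = this[OF assms(6)] this[OF assms(7)]
 show ?thesis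
  unfolding e2 exm_sum[OF pf[OF assms(6)]] exm_sum[OF pf[OF assms(7)]] e[OF mult_par[OF assms(6,7)] refl] L sum.distrib sm_sum ..
qed

lemma pr_rep:
 assumes "PF (%_. y)" "length xs = n"
 shows "pr n y xs = cls n (Hs n y xs)" "rep (pr n y xs) : M.lcar n" "eqv n (evl M (rep (pr n y xs))) (Hs n y xs)"
  "pol n (evl M (rep (pr n y xs)))"
 using rep_cls[OF pol_Hs[OF assms]] assms(2) by (simp_all add: pr_def)

lemma pr_carrier: "PF (%_. y) ==> pr n y : lists_of n \<rightarrow>\<^sub>E carrier (lquot M n)"
 using pol_Hs unfolding carrier_lquot pr_def by (intro restrict_PiE[THEN iffD2] Pi_I) blast

text \<open>Projecting the coefficients of a polynomial to one parity does not change it as a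
  function when all its values have that parity.\<close>

lemma hom_rep:
 assumes "pol n f" "!!l. f l : par M \<beta>"
 shows "EX P:M.lcar n. evl M P = f & (ALL e. lookup P e : par M \<beta>)"
proof -
 obtain P where P: "P : M.lcar n" "evl M P = f" using cls_ex[OF assms(1)] by blast
 let ?Q = "Poly_Mapping.map (hcomp M \<beta>) P"
 have "?Q : M.lcar n" by (rule lcar_map[OF P(1) M.hcomp_lin])
 moreover have "evl M ?Q = f"
  by (rule ext) (simp add: M.evl_map[OF M.hcomp_lin] P(2) M.hcomp_hom[OF assms(2)])
 moreover have "lookup ?Q e : par M \<beta>" for e
  by (simp add: Poly_Mapping.map.rep_eq when_def M.par_0)
 ultimately show ?thesis by blast
qed

lemma homl_zip: "length xs = n ==> length ps = n ==> (ALL j<n. xs ! j : par V (ps ! j)) ==> homl (zip xs ps)"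
 by (auto simp: homl_def set_zip)

lemma qs_mkl: "qs (mkl k as l) = sum_list (map (%z. 1 + snd z) as)"
 by (induction as arbitrary: k) auto

lemma sum_zip: "length xs = n ==> length ps = n ==> sum_list (map (%z. 1 + snd z) (zip xs ps)) = (SUM j<n. 1 + ps ! j :: bit)"
 by (simp add: sum_list_sum_nth atLeast0LessThan)

lemma split_nth: "i < length xs ==> xs = take i xs @ (xs ! i) # drop (Suc i) xs"
 by (rule id_take_nth_drop)

text \<open>The linear, sesquilinear, symmetry and Leibniz identities hold exactly for
  \<open>Hs\<close>, while the conditions use an arbitrary representative of the class; every
  operation applied to it respects congruence.\<close>

lemma pr_cochain: assumes "BC \<pi> y" shows "pr n y : homogeneous_cochains V M n \<pi>"
proof -
 have y: "slin y" "spar \<pi> y" "ssym y" "sleib \<pi> y" "PF (%_. y)" using assms by (auto simp: BC_def)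
 note R = pr_rep[OF y(5)]
 have upd: "xs[i := a] = take i xs @ a # drop (Suc i) xs" if "i < n" "length xs = n" for xs :: "'v list" and i a
  using that by (simp add: upd_conv_take_nth_drop)
 have len: "length (take i xs) + Suc (length (drop (Suc i) xs)) = n" if "i < n" "length xs = n" for xs :: "'v list" and i using that by simp
 have 1: "multilinear V M n (pr n y)"
  unfolding multilinear_def
 proof (intro conjI pr_carrier[OF y(5)] ballI allI impI)
  fix xs :: "'v list" and i c a b assume xs: "xs : lists_of n" and i: "i < n"
  have p: "pol n (Hs n y (xs[i := a]))" for a using pol_Hs[OF y(5), of "xs[i := a]" n] xs by simp
  have "Hs n y (xs[i := scl V c a + b]) = (%l. scl M c (Hs n y (xs[i := a]) l) + Hs n y (xs[i := b]) l)"
   using i xs Hs_lin(1)[OF y(1) len[of i xs]] by (auto simp: upd)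
  thus "pr n y (xs[i := scl V c a + b]) = c \<odot>\<^bsub>lquot M n\<^esub> pr n y (xs[i := a]) \<oplus>\<^bsub>lquot M n\<^esub> pr n y (xs[i := b])"
   using xs p by (simp add: pr_def lquot_smult lquot_add M.polyfun_scl)
 qed
 have 2: "pr n y xs : lclass M n ` {P : carrier (lpoly_space M n). ALL e. lookup P e : par M (1 + (\<pi> + (SUM j<n. 1 + ps ! j)))}"
  if xs: "length xs = n" "length ps = n" "ALL j<n. xs ! j : par V (ps ! j)" for xs ps
 proof -
  have h: "homl (zip xs ps)" by (rule homl_zip[OF xs])
  have "Hs n y xs l : par M (1 + (\<pi> + (SUM j<n. 1 + ps ! j)))" for l
  proof -
   have "Hs n y xs l = y (mkl 0 (zip xs ps) l)" using Hs_hom[OF y(1) h, of n l] xs by simp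
   moreover have "y (mkl 0 (zip xs ps) l) : par M (1 + \<pi> + qs (mkl 0 (zip xs ps) l))"
    using y(2) mkl_X[OF h] unfolding spar_def by blast
   ultimately show ?thesis by (simp add: qs_mkl sum_zip[OF xs(1,2)] add.assoc)
  qed
  then obtain P where P: "P : M.lcar n" "evl M P = Hs n y xs" "ALL e. lookup P e : par M (1 + (\<pi> + (SUM j<n. 1 + ps ! j)))"
   using hom_rep[OF pol_Hs[OF y(5) xs(1)]] by blast
  have "pr n y xs = lclass M n P" using lclass_cls[OF P(1)] P(2) R(1)[OF xs(1)] by simp
  thus ?thesis using P unfolding carrier_lpoly by blast
 qed
 have 3: "pr n y (xs[i := der V (xs ! i)]) = lclass M n (- lam i (rep (pr n y xs)))" if xs: "length xs = n" and i: "i < n" for xs i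
 proof -
  have e: "evl M (- lam i (rep (pr n y xs))) = (%l. - scl M (l i) (evl M (rep (pr n y xs)) l))"
   by (auto simp: M.evl_minus M.evl_lam)
  have H: "Hs n y (xs[i := der V (xs ! i)]) = (%l. - scl M (l i) (Hs n y xs l))"
  proof
   fix l
   show "Hs n y (xs[i := der V (xs ! i)]) l = - scl M (l i) (Hs n y xs l)"
   using Hs_lin(2)[OF y(1) len[OF i xs], of "xs ! i" l] split_nth[of i xs] i xs by (simp add: upd)
  qed
  have "eqv n (Hs n y (xs[i := der V (xs ! i)])) (evl M (- lam i (rep (pr n y xs))))"
   unfolding e H using i by (intro eqv_neg eqv_mult eqv_sym[OF R(3)[OF xs]] afn_var) simp
  moreover have "pol n (evl M (- lam i (rep (pr n y xs))))"
   unfolding e using i by (intro M.polyfun_neg M.polyfun_var R(4)[OF xs]) simp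
  ultimately show ?thesis using R(1)[of "xs[i := der V (xs ! i)]" n] xs by (simp add: lclass_pol cls_eqI)
 qed
 have 4: "lclass M n (lsubst (map lam ([0..<n][i := Suc i, Suc i := i])) (rep (pr n y (xs[i := xs ! Suc i, Suc i := xs ! i]))))
     = sg ((1 + \<alpha>) * (1 + \<beta>)) \<odot>\<^bsub>lquot M n\<^esub> pr n y xs"
  if xs: "length xs = n" and i: "Suc i < n" and h: "xs ! i : par V \<alpha>" "xs ! Suc i : par V \<beta>" for xs i \<alpha> \<beta>
 proof -
  define us vs where "us = take i xs" and "vs = drop (Suc (Suc i)) xs"
  let ?a = "xs ! i" and ?b = "xs ! Suc i"
  have e: "xs = us @ ?a # ?b # vs" unfolding us_def vs_def using xs i by (metis Cons_nth_drop_Suc Suc_lessD append_take_drop_id)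
  have lu: "length us = i" and luv: "length us + length vs + 2 = n" using xs i by (simp_all add: us_def vs_def)
  have e': "xs[i := ?b, Suc i := ?a] = us @ ?b # ?a # vs"
   by (subst (1) e) (simp add: lu[symmetric] list_update_append)
  let ?js = "[0..<n][i := Suc i, Suc i := i]" and ?P = "rep (pr n y (us @ ?b # ?a # vs))"
  have lb: "length (us @ ?b # ?a # vs) = n" using luv by simp
  have s: "Hs n y (us @ ?b # ?a # vs) (%k. l (?js ! k)) = sm ((1 + \<alpha>) * (1 + \<beta>)) (Hs n y xs l)" for l
   using Hs_sym[OF y(1,3) luv h lu[symmetric], of l] e by simp
  have ev: "evl M (lsubst (map lam ?js) ?P) = (%l. evl M ?P (%k. l (?js ! k)))"
  proof
   fix l
   show "evl M (lsubst (map lam ?js) ?P) l = evl M ?P (%k. l (?js ! k))"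
    using R(2)[OF lb] by (intro M.evl_lsubst) (auto simp: M.evl_lam)
  qed
  have mj: "mset ?js = mset [0..<n]" using i mset_swap[of "Suc i" "[0..<n]" i] by simp
  have js: "?js ! k < n" if "k < n" for k using that i by (auto simp: nth_list_update)
  have "pol n (%l. evl M ?P (%k. l (?js ! k)))"
   using js by (intro M.polyfun_subst[OF R(4)[OF lb]] afn_var) auto
  moreover have "eqv n (%l. evl M ?P (%k. l (?js ! k))) (%l. sm ((1 + \<alpha>) * (1 + \<beta>)) (Hs n y xs l))"
   using eqv_perm[OF R(3)[OF lb] mj] unfolding s .
  ultimately show ?thesis
   unfolding e' using pol_Hs[OF y(5) xs] R(1)[OF xs] by (simp add: lclass_pol ev lquot_smult M.sg_sm cls_eqI)
 qed
 have 5: "let s = \<pi> + (SUM j<i. 1 + ps ! j) in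
      pr n y (xs[i := b * c]) = lclass M n
       (Poly_Mapping.map (scl M (sg (\<beta> * s))) (exp_der V M i b (rep (pr n y (xs[i := c]))))
       + Poly_Mapping.map (scl M (sg (\<gamma> * (\<beta> + s))))
         (exp_der V M i c (rep (pr n y (xs[i := b])))))"
  if xs: "length xs = n" "length ps = n" and i: "i < n" and bc: "b : par V \<beta>" "c : par V \<gamma>" and h: "ALL j<i. xs ! j : par V (ps ! j)" for xs ps i b c \<beta> \<gamma>
 proof -
  define s where "s = \<pi> + (SUM j<i. 1 + ps ! j)"
  define as where "as = zip (take i xs) (take i ps)"
  have as: "homl as" unfolding as_def using h i xs by (intro homl_zip[of _ i]) auto
  have la: "length as = i" and fa: "map fst as = take i xs" using i xs by (simp_all add: as_def)
  have sa: "s = \<pi> + sum_list (map (%z. 1 + snd z) as)"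
   unfolding s_def as_def using i xs by (subst sum_zip[of _ i]) (auto intro!: sum.cong)
  let ?P = "Poly_Mapping.map (scl M (sg (\<beta> * s))) (exp_der V M i b (rep (pr n y (xs[i := c]))))
       + Poly_Mapping.map (scl M (sg (\<gamma> * (\<beta> + s)))) (exp_der V M i c (rep (pr n y (xs[i := b]))))"
  let ?r = "%x. evl M (rep (pr n y (xs[i := x])))"
  have lx: "length (xs[i := x]) = n" for x using xs by simp
  have ev: "evl M ?P = (%l. sm (\<beta> * s) (exm b (%r. ?r c (l(i := r))) (l i)) + sm (\<gamma> * (\<beta> + s)) (exm c (%r. ?r b (l(i := r))) (l i)))"
   by (rule ext) (simp add: M.evl_add M.evl_map[OF M.scl_lin] M.sg_sm evl_exp_der del: fun_upd_apply)
  have H: "Hs n y (xs[i := b * c]) = (%l. sm (\<beta> * s) (exm b (%r. Hs n y (xs[i := c]) (l(i := r))) (l i)) + sm (\<gamma> * (\<beta> + s)) (exm c (%r. Hs n y (xs[i := b]) (l(i := r))) (l i)))"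
   unfolding upd[OF i xs(1)] fa[symmetric]
   by (rule ext, rule Hs_leib[OF y(1,5,4) as _ bc la[symmetric] sa]) (use la i xs in simp)
  have "eqv n (Hs n y (xs[i := b * c])) (evl M ?P)"
   unfolding H ev by (intro eqv_add eqv_sm eqv_exm eqv_sym[OF R(3)[OF lx]] i pol_Hs[OF y(5) lx] R(4)[OF lx])
  moreover have "pol n (evl M ?P)" unfolding ev using i by (intro M.polyfun_add M.polyfun_sm polyfun_exm_upd R(4)[OF lx]) simp_all
  ultimately have "pr n y (xs[i := b * c]) = lclass M n ?P" using R(1)[OF lx] by (simp add: lclass_pol cls_eqI)
  thus ?thesis unfolding Let_def s_def .
 qed
 show ?thesis
  unfolding homogeneous_cochains_def using 1 2 3 4 5 by blast
qed

end

context hcochain begin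

lemma y0_split:
 "length us + length xs = n ==> eqv n (y0 (us @ xs)) (%l. \<Sum>ps | length ps = length xs. y0 (us @ map2 (hcomp V) ps xs) l)"
proof (induction xs arbitrary: us)
 case (Cons x xs)
 have len: "length us + Suc (length xs) = n" using Cons.prems by simp
 have "eqv n (y0 (us @ (scl V 1 (hcomp V 0 x) + hcomp V 1 x) # xs)) (%l. scl M 1 (y0 (us @ hcomp V 0 x # xs) l) + y0 (us @ hcomp V 1 x # xs) l)"
  by (rule Y_mult[OF len])
 hence "eqv n (y0 (us @ x # xs)) (%l. SUM \<alpha>:UNIV. y0 (us @ hcomp V \<alpha> x # xs) l)"
  by (simp add: V.hcomp_sum sum_bit)
 also have "eqv n ... (%l. SUM \<alpha>:UNIV. \<Sum>ps | length ps = length xs. y0 (us @ hcomp V \<alpha> x # map2 (hcomp V) ps xs) l)"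
 proof (rule eqv_sum)
  fix \<alpha>
  show "eqv n (y0 (us @ hcomp V \<alpha> x # xs)) (%l. \<Sum>ps | length ps = length xs. y0 (us @ hcomp V \<alpha> x # map2 (hcomp V) ps xs) l)"
   using Cons.IH[of "us @ [hcomp V \<alpha> x]"] Cons.prems by simp
 qed
 finally show ?case by (simp add: sum_bit_lists_Suc)
qed simp

end

context lifting begin

text \<open>Surjectivity of \<open>pr\<close> on cochains of one parity. The lift agrees with
  \<open>Y\<close> on homogeneous arguments, and both sides are additive in each argument.\<close>

lemma cochain_pr: "EX y. BC \<pi> y & Y = pr n y & (ALL w. length w ~= n --> y w = 0)"
proof -
 obtain y where y: "BC \<pi> y" "!!as. homl as ==> length as = n ==> eqv n (y0 (map fst as)) (%l. y (mkl 0 as l))" "ALL w. length w ~= n --> y w = 0"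
  using lift by blast
 have "Y xs = pr n y xs" if xs: "length xs = n" for xs
 proof -
  have "eqv n (y0 xs) (%l. \<Sum>ps | length ps = n. y0 (map fst (hl ps xs)) l)"
   using y0_split[of "[]" xs] xs by (simp add: fst_hl)
  also have "eqv n ... (Hs n y xs)" unfolding Hs_def[abs_def]
   by (intro eqv_sum y(2)) (use xs in auto)
  finally show ?thesis using Yrep(3)[OF xs] xs by (simp add: pr_def cls_eqI)
 qed
 moreover have "Y : extensional (lists_of n)" using Y by (auto simp: homogeneous_cochains_def multilinear_def PiE_def)
 moreover have "pr n y : extensional (lists_of n)" by (simp add: pr_def)
 ultimately have "Y = pr n y" by (intro extensionalityI[of Y "lists_of n"]) auto
 thus ?thesis using y by blast
qed

end

section \<open>The differential on representatives\<close>

lemma length_omit: "i < length xs ==> length (omit i xs) = length xs - 1"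
 by (simp add: omit_def)

lemma omit_map: "omit i (map f xs) = map f (omit i xs)"
 by (simp add: omit_def take_map drop_map)

lemma omit_zip: "length xs = length ys ==> omit i (zip xs ys) = zip (omit i xs) (omit i ys)"
 by (simp add: omit_def take_zip drop_zip)

lemma set_omit: "set (omit i xs) \<subseteq> set xs"
 by (auto simp: omit_def dest: in_set_takeD in_set_dropD)

lemma omit_split: "i < length xs ==> xs = take i xs @ xs ! i # drop (Suc i) xs"
 by (rule id_take_nth_drop)

lemma sum_list_omit: "i < length js ==> sum_list (map l (omit i js)) + l (js ! i) = (sum_list (map l js) :: 'a::ab_group_add)"
 by (subst (3) omit_split[of i js]) (simp_all add: omit_def add_ac del: append_take_drop_id)

lemma omit_omit_nth: "i < j ==> j < length xs ==> omit j xs ! i = xs ! i"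
 by (simp add: omit_def nth_append)

text \<open>The recursion counts pairs by the first index and the distance to the second, the given
  formula by both positions.\<close>

lemma triangle_sum:
 fixes f :: "nat => nat => 'a::comm_monoid_add"
 shows "(SUM i<=n. SUM j<n - i. f i (Suc i + j)) = (SUM j<=n. SUM i<j. f i j)"
proof -
 have "(SUM j<n - i. f i (Suc i + j)) = (\<Sum>j | j : {..n} & i < j. f i j)" if "i \<le> n" for i
  by (rule sum.reindex_bij_witness[of _ "%j. j - Suc i" "%j. Suc i + j"]) (use that in auto)
 moreover have "{i. i : {..n} & i < j} = {..<j}" if "j \<le> n" for j using that by auto
 ultimately show ?thesis using sum.swap_restrict[of "{..n}" "{..n}" f "(<)"] by simp
qed

context leibniz_calculus begin

lemma Lie_sum:
 "Lie \<pi> x y zs = act x (y zs) - (SUM j<length zs. sm (p x * (\<pi> + sum_list (map q (take j zs)))) (y (zs[j := br x (zs ! j)])))"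
proof (induction zs arbitrary: \<pi> y)
 case (Cons z zs)
 show ?case
  by (simp add: Cons.IH sum.lessThan_Suc_shift add.assoc del: sum.lessThan_Suc)
qed simp

lemma dd_sum:
 "dd \<pi> y xs = (SUM i<length xs. sm (q (xs ! i) * (\<pi> + sum_list (map q (take i xs)) + 1) + 1)
   (Lie (\<pi> + sum_list (map q (take i xs))) (xs ! i) (%w. y (take i xs @ w)) (drop (Suc i) xs)))"
proof (induction xs arbitrary: \<pi> y)
 case (Cons x xs)
 show ?case
  by (simp add: Cons.IH sum.lessThan_Suc_shift add.assoc del: sum.lessThan_Suc)
qed simp

end

context pvm begin

lemma move_front:
 "ssym y ==> us : lists X ==> w : X ==> vs : lists X ==> y (us @ w # vs) = sm (q w * qs us) (y (w # us @ vs))"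
proof (induction us arbitrary: y)
 case (Cons u us)
 have u: "u : X" "us : lists X" using Cons.prems(2) by auto
 have "y (u # us @ w # vs) = sm (q w * qs us) (y (u # w # us @ vs))"
  using Cons.IH[OF ssym_ins[OF Cons.prems(1) u(1)] u(2) Cons.prems(3,4)] .
 also have "y (u # w # us @ vs) = sm (q u * q w) (y (w # u # us @ vs))"
  by (rule sym_head[OF Cons.prems(1,3) _ u(1)]) (use u Cons.prems in simp)
 finally show ?case by (simp add: sm_sm distrib_left mult.commute add.commute)
qed simp

text \<open>Unrolling the Cartan recursion leaves each bracket at the place of its second entry.
  Symmetry moves it to the front, and the combined signs are those of the given
  differential.\<close>

lemma dd_explicit:
 assumes "ssym y" "xs : lists X" "length xs = Suc n"
 shows "dd \<pi> y xs = (SUM i<=n. sm (q (xs ! i) * (\<pi> + (SUM l<i. q (xs ! l)) + 1) + 1) (xact (xs ! i) (y (omit i xs))))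
  + (SUM j<=n. SUM i<j. sm (\<pi> + q (xs ! i) * ((SUM l<i. q (xs ! l)) + 1) + q (xs ! j) * (SUM l:{..<j} - {i}. q (xs ! l)))
    (y (xbr (xs ! i) (xs ! j) # omit i (omit j xs))))"
proof -
 have X: "xs ! i : X" if "i \<le> n" for i using that assms(2,3) by (auto simp: in_lists_conv_set)
 have tk: "(SUM l<i. q (xs ! l)) = qs (take i xs)" if "i \<le> Suc n" for i
  using that assms(3) by (simp add: qs_def sum_list_sum_nth atLeast0LessThan)
 define S where "S i j = qs (take i xs @ take j (drop (Suc i) xs))" for i j
 have S: "(SUM l:{..<Suc i + j} - {i}. q (xs ! l)) = S i j" if "i \<le> n" "j < n - i" for i j
 proof -
  have "q (xs ! i) + (SUM l:{..<Suc i + j} - {i}. q (xs ! l)) = (SUM l<Suc i + j. q (xs ! l))"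
   by (subst (2) sum.remove[of _ i]) auto
  also have "... = qs (take (Suc i + j) xs)" using that by (intro tk) simp
  also have "take (Suc i + j) xs = take i xs @ xs ! i # take j (drop (Suc i) xs)"
   unfolding take_add using that assms(3) by (subst take_Suc_conv_app_nth) simp_all
  also have "qs ... = q (xs ! i) + S i j" by (simp add: S_def add_ac)
  finally show ?thesis by (simp only: add_left_cancel)
 qed
 \<comment> \<open>\<open>S i j\<close> is the opposite parity of the arguments in front of position
   \<open>Suc i + j\<close> other than the i-th: exactly what the bracket has to pass.\<close>
 have T: "sm (q (xs ! i) * (\<pi> + qs (take i xs) + 1) + 1)
    (sm (xp (xs ! i) * (\<pi> + qs (take i xs) + sum_list (map q (take j (drop (Suc i) xs)))))
     (y (take i xs @ (drop (Suc i) xs)[j := xbr (xs ! i) (drop (Suc i) xs ! j)])))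
   = - sm (\<pi> + q (xs ! i) * (qs (take i xs) + 1) + q (xs ! (Suc i + j)) * S i j) (y (xbr (xs ! i) (xs ! (Suc i + j)) # omit i (omit (Suc i + j) xs)))"
  if ij: "i \<le> n" "j < n - i" for i j
 proof -
  let ?zs = "drop (Suc i) xs" and ?w = "xbr (xs ! i) (xs ! (Suc i + j))"
  have len: "length ?zs = n - i" using assms(3) ij by simp
  have w: "?w : X" "q ?w = 1 + q (xs ! i) + q (xs ! (Suc i + j))"
  proof -
   have "xs ! i : X" "xs ! (Suc i + j) : X" using X ij by simp_all
   note q_br[OF this]
   moreover have "xp (xs ! i) = 1 + q (xs ! i)" by (simp add: q_def)
   ultimately show "?w : X" "q ?w = 1 + q (xs ! i) + q (xs ! (Suc i + j))"
    using br_X[OF \<open>xs ! i : X\<close> \<open>xs ! (Suc i + j) : X\<close>] by simp_all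
  qed
  have 1: "take i xs @ ?zs[j := xbr (xs ! i) (?zs ! j)] = (take i xs @ take j ?zs) @ ?w # drop (Suc j) ?zs"
   using ij len assms(3) by (simp add: upd_conv_take_nth_drop)
  have 2: "(take i xs @ take j ?zs) @ drop (Suc j) ?zs = omit i (omit (Suc i + j) xs)"
   using ij assms(3) by (simp add: omit_def drop_take min_def add.commute)
  have sub: "take i xs @ take j ?zs : lists X" "drop (Suc j) ?zs : lists X"
   using assms(2) by (auto simp: in_lists_conv_set dest: in_set_takeD in_set_dropD)
  have 3: "qs (take i xs) + sum_list (map q (take j ?zs)) = S i j" by (simp add: S_def qs_def)
  have mf: "y ((take i xs @ take j ?zs) @ ?w # drop (Suc j) ?zs) = sm (q ?w * S i j) (y (?w # omit i (omit (Suc i + j) xs)))"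
   using move_front[OF assms(1) sub(1) w(1) sub(2)] unfolding 2 S_def .
  have "xp (xs ! i) = 1 + q (xs ! i)" by (simp add: q_def)
  hence "sm (q (xs ! i) * (\<pi> + qs (take i xs) + 1) + 1) (sm (xp (xs ! i) * (\<pi> + qs (take i xs) + sum_list (map q (take j ?zs)))) (y (take i xs @ ?zs[j := xbr (xs ! i) (?zs ! j)])))
   = sm (q (xs ! i) * (\<pi> + qs (take i xs) + 1) + 1) (sm ((1 + q (xs ! i)) * (\<pi> + S i j)) (sm (q ?w * S i j) (y (?w # omit i (omit (Suc i + j) xs)))))"
   by (simp only: 1 mf add.assoc[of \<pi>] 3)
  also have "... = sm (\<pi> + q (xs ! i) * (qs (take i xs) + 1) + q (xs ! (Suc i + j)) * S i j + 1) (y (?w # omit i (omit (Suc i + j) xs)))"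
   unfolding sm_sm w(2)
   by (cases "q (xs ! i)"; cases \<pi>; cases "qs (take i xs)"; cases "S i j"; cases "q (xs ! (Suc i + j))"; simp)
  also have "... = - sm (\<pi> + q (xs ! i) * (qs (take i xs) + 1) + q (xs ! (Suc i + j)) * S i j) (y (?w # omit i (omit (Suc i + j) xs)))"
  proof -
   have "sm (e + 1) z = - sm e z" for e and z :: 'm by (cases e) simp_all
   thus ?thesis .
  qed
  finally show ?thesis .
 qed
 have L: "sm (q (xs ! i) * (\<pi> + qs (take i xs) + 1) + 1) (Lie (\<pi> + qs (take i xs)) (xs ! i) (%w. y (take i xs @ w)) (drop (Suc i) xs))
   = sm (q (xs ! i) * (\<pi> + qs (take i xs) + 1) + 1) (xact (xs ! i) (y (omit i xs)))
   + (SUM j<n - i. sm (\<pi> + q (xs ! i) * (qs (take i xs) + 1) + q (xs ! (Suc i + j)) * S i j) (y (xbr (xs ! i) (xs ! (Suc i + j)) # omit i (omit (Suc i + j) xs))))"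
  if i: "i \<le> n" for i
 proof -
  have len: "length (drop (Suc i) xs) = n - i" using assms(3) i by simp
  have o: "take i xs @ drop (Suc i) xs = omit i xs" by (simp add: omit_def)
  show ?thesis
   unfolding Lie_sum[of _ "xs ! i"] sm_diff len sm_sum o
   unfolding diff_conv_add_uminus sum_negf[symmetric]
  proof (intro arg_cong2[of _ _ _ _ "(+)"] sum.cong refl)
   fix j assume "j : {..<n - i}"
   hence j: "j < n - i" by simp
   show "- sm (q (xs ! i) * (\<pi> + qs (take i xs) + 1) + 1)
     (sm (xp (xs ! i) * (\<pi> + qs (take i xs) + sum_list (map q (take j (drop (Suc i) xs)))))
      (y (take i xs @ (drop (Suc i) xs)[j := xbr (xs ! i) (drop (Suc i) xs ! j)])))
    = sm (\<pi> + q (xs ! i) * (qs (take i xs) + 1) + q (xs ! (Suc i + j)) * S i j) (y (xbr (xs ! i) (xs ! (Suc i + j)) # omit i (omit (Suc i + j) xs)))"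
    unfolding T[OF i j] by (rule minus_minus)
  qed
 qed
 have "dd \<pi> y xs = (SUM i<=n. sm (q (xs ! i) * (\<pi> + qs (take i xs) + 1) + 1) (xact (xs ! i) (y (omit i xs)))
   + (SUM j<n - i. sm (\<pi> + q (xs ! i) * (qs (take i xs) + 1) + q (xs ! (Suc i + j)) * S i j) (y (xbr (xs ! i) (xs ! (Suc i + j)) # omit i (omit (Suc i + j) xs)))))"
  unfolding dd_sum assms(3) lessThan_Suc_atMost qs_def[symmetric] by (intro sum.cong refl L) simp
 also have "... = (SUM i<=n. sm (q (xs ! i) * (\<pi> + (SUM l<i. q (xs ! l)) + 1) + 1) (xact (xs ! i) (y (omit i xs)))
   + (SUM j<n - i. sm (\<pi> + q (xs ! i) * ((SUM l<i. q (xs ! l)) + 1) + q (xs ! (Suc i + j)) * (SUM l:{..<Suc i + j} - {i}. q (xs ! l))) (y (xbr (xs ! i) (xs ! (Suc i + j)) # omit i (omit (Suc i + j) xs)))))"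
  by (intro sum.cong refl arg_cong2[of _ _ _ _ "(+)"]) (simp_all only: tk S atMost_iff lessThan_iff le_SucI)
 finally show ?thesis
  unfolding sum.distrib
  using triangle_sum[of "%i j. sm (\<pi> + q (xs ! i) * ((SUM l<i. q (xs ! l)) + 1) + q (xs ! j) * (SUM l:{..<j} - {i}. q (xs ! l))) (y (xbr (xs ! i) (xs ! j) # omit i (omit j xs)))" n]
  by simp
qed

text \<open>Acting with a at the value \<phi> turns \<partial> into \<partial> + \<phi>, so the
  image in the variables \<psi> is sent to the image for the total sum.\<close>

lemma eqv_ac:
 assumes "eqv n f g" "!!k. k < n ==> afn {..<N} (\<psi> k)" "afn {..<N} \<phi>" "!!l. \<phi> l + (SUM k<n. \<psi> k l) = (SUM k<N. l k)"
 shows "eqv N (%l. ac a (\<phi> l) (f (%k. \<psi> k l))) (%l. ac a (\<phi> l) (g (%k. \<psi> k l)))"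
proof -
 obtain h where h: "pol n h" "!!l. f l - g l = der M (h l) + scl M (SUM i<n. l i) (h l)"
  using assms(1) unfolding eqv_def zn_def by blast
 have "ac a (\<phi> l) (f (%k. \<psi> k l)) - ac a (\<phi> l) (g (%k. \<psi> k l))
  = der M (ac a (\<phi> l) (h (%k. \<psi> k l))) + scl M (SUM k<N. l k) (ac a (\<phi> l) (h (%k. \<psi> k l)))" for l
  unfolding lin_diff[OF ac_lin2, symmetric] h(2) assms(4)[symmetric]
  by (simp add: lin_add[OF ac_lin2] lin_scl[OF ac_lin2] ac_sesq2 M.scale_left_distrib)
 moreover have "pol N (%l. ac a (\<phi> l) (h (%k. \<psi> k l)))"
  using assms(2) by (intro polyfun_ac assms(3) M.polyfun_subst[OF h(1)]) simp
 ultimately show ?thesis unfolding eqv_def zn_def by blast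
qed

lemma eqv_pow: "eqv n f g ==> m < n ==> eqv n (%l. scl M (l m ^ k) (f l)) (%l. scl M (l m ^ k) (g l))"
proof (induction k)
 case (Suc k)
 have "eqv n (%l. scl M (l m) (scl M (l m ^ k) (f l))) (%l. scl M (l m) (scl M (l m ^ k) (g l)))"
  using Suc.prems by (intro eqv_mult afn_var Suc.IH) simp_all
 thus ?case by simp
qed simp

definition mz :: "('v \<times> bit) list => nat list => (nat => 'f) => ('v \<times> bit \<times> 'f) list" where
 "mz as js l = map (%((a, \<alpha>), j). (a, \<alpha>, l j)) (zip as js)"

lemma mkl_nth: "j < length as ==> mkl k as l ! j = (fst (as ! j), snd (as ! j), l (k + j))"
proof (induction as arbitrary: k j)
 case (Cons z as)
 thus ?case by (cases z; cases j) auto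
qed simp

lemma mkl_mz: "length js = length as ==> mkl 0 as (%k. l (js ! k)) = mz as js l"
 and mkl_mz_upt: "length as = n ==> mkl 0 as l = mz as [0..<n] l"
 and mkl_mz_Cons: "length js = length as ==> mkl (Suc 0) as (%k. (c # map l js) ! k) = mz as js l"
 by (auto simp: mz_def mkl_nth case_prod_beta intro!: nth_equalityI)

lemma omit_mz: "length js = length as ==> omit i (mz as js l) = mz (omit i as) (omit i js) l"
 by (simp add: mz_def omit_map omit_zip)

lemma homl_omit: "homl as ==> homl (omit i as)"
 using set_omit[of i as] unfolding homl_def by blast

text \<open>Term by term comparison with \<open>dd_explicit\<close>. Every representative in the
  formula may be replaced by the exact value, since the two kinds of substitution preserve
  congruence.\<close>

lemma differential_value_dd:
 assumes y: "slin y" "ssym y" "PF (%_. y)" and as: "homl as" "length as = Suc n"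
  and D_def: "D = differential_value V M n \<pi> (pr n y) (%i. 1 + map snd as ! i) (map fst as)"
 shows "pol (Suc n) (evl M D)" "eqv (Suc n) (evl M D) (%l. dd \<pi> y (mkl 0 as l))"
proof -
 note R = pr_rep[OF y(3)]
 define q' where "q' i = 1 + map snd as ! i" for i
 let ?xs = "map fst as"
 define \<epsilon> where "\<epsilon> i = q' i * (\<pi> + (SUM l<i. q' l) + 1) + 1" for i
 define \<delta> where "\<delta> i j = \<pi> + q' i * ((SUM l<i. q' l) + 1) + q' j * (SUM l:{..<j} - {i}. q' l)" for i j
 define c where "c i j k = coeff (lbr V (?xs ! i) (?xs ! j)) k" for i j k
 define d where "d i j = degree (lbr V (?xs ! i) (?xs ! j))" for i j
 define js where "js = (%i. omit i [0..<Suc n])"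
 define js2 where "js2 = (%i j. omit i (omit j [0..<Suc n]))"
 define r1 where "r1 i = evl M (rep (pr n y (omit i ?xs)))" for i
 define r2 where "r2 i j k = evl M (rep (pr n y (c i j k # omit i (omit j ?xs))))" for i j k
 have len1: "length (omit i ?xs) = n" "length (omit i as) = n" "length (js i) = n" if "i \<le> n" for i
  using that as(2) by (simp_all add: length_omit js_def)
 have len2: "length (omit i (omit j ?xs)) = n - 1" "length (omit i (omit j as)) = n - 1" "length (js2 i j) = n - 1" "n > 0" if "i < j" "j \<le> n" for i j
  using that as(2) by (simp_all add: length_omit js2_def)
 have len3: "length (c i j k # omit i (omit j ?xs)) = n" if "i < j" "j \<le> n" for i j k
  using len2[OF that] by simp
 have js_lt: "x < Suc n" if "x : set (js i)" for x i using that set_omit[of i "[0..<Suc n]"] by (auto simp: js_def)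
 have js2_lt: "x < Suc n" if "x : set (js2 i j)" for x i j
  using that set_omit[of i "omit j [0..<Suc n]"] set_omit[of j "[0..<Suc n]"] by (auto simp: js2_def)
 \<comment> \<open>The variables of the bracket terms: the sum of the i-th and the j-th first, then
   the remaining ones.\<close>
 define \<psi> where "\<psi> i j m l = ((l i + l j) # map l (js2 i j)) ! m" for i j m and l :: "nat => 'f"
 have \<psi>: "afn {..<Suc n} (\<psi> i j m)" if ij: "i < j" "j \<le> n" and m: "m < n" for i j m
 proof (cases m)
  case 0
  thus ?thesis using ij by (auto simp: \<psi>_def[abs_def] intro!: afn_add afn_var)
 next
  case (Suc k)
  hence k: "k < length (js2 i j)" using m len2[OF ij] by simp
  hence "\<psi> i j m = (%l. l (js2 i j ! k))" by (auto simp: \<psi>_def Suc)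
  thus ?thesis using js2_lt[of "js2 i j ! k" i j] k by (auto intro!: afn_var)
 qed
 have sum1: "l i + (SUM k<n. l (js i ! k)) = (SUM k<Suc n. l k)" if "i \<le> n" for i and l :: "nat => 'f"
 proof -
  have "(SUM k<n. l (js i ! k)) = sum_list (map l (js i))" using len1[OF that] by (simp add: sum_list_sum_nth atLeast0LessThan)
  moreover have "sum_list (map l (js i)) + l ([0..<Suc n] ! i) = sum_list (map l [0..<Suc n])"
   unfolding js_def using that by (intro sum_list_omit) simp
  moreover have "sum_list (map l [0..<Suc n]) = (SUM k<Suc n. l k)"
   by (subst sum_list_sum_nth) (simp add: atLeast0LessThan del: upt_Suc sum.lessThan_Suc)
  moreover have "[0..<Suc n] ! i = i" using that by (subst nth_upt) auto
  ultimately show ?thesis by (simp add: add.commute del: upt_Suc sum.lessThan_Suc)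
 qed
 have sum2: "(SUM m<n. \<psi> i j m l) = (SUM k<Suc n. l k)" if ij: "i < j" "j \<le> n" for i j l
 proof -
  have "(SUM m<n. \<psi> i j m l) = sum_list ((l i + l j) # map l (js2 i j))"
   unfolding \<psi>_def using len2[OF ij] by (subst sum_list_sum_nth) (simp add: atLeast0LessThan)
  moreover have "sum_list (map l (js2 i j)) + l (omit j [0..<Suc n] ! i) = sum_list (map l (js j))"
   unfolding js2_def js_def using ij by (intro sum_list_omit) (simp add: length_omit del: upt_Suc)
  moreover have "omit j [0..<Suc n] ! i = i" using ij by (subst omit_omit_nth) (auto simp del: upt_Suc)
  moreover have "sum_list (map l (js j)) = (SUM k<n. l (js j ! k))" using len1[OF ij(2)] by (simp add: sum_list_sum_nth atLeast0LessThan)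
  moreover have "l i + l j + S = l j + (S + l i)" for S by (simp add: add_ac)
  ultimately show ?thesis using sum1[OF ij(2), of l] by (simp del: upt_Suc sum.lessThan_Suc)
 qed
 have ev1: "evl M (lact (vact M) (lam i) (?xs ! i) (lsubst (map lam (js i)) (rep (pr n y (omit i ?xs))))) l = ac (?xs ! i) (l i) (r1 i (%k. l (js i ! k)))"
  if "i \<le> n" for i l
 proof -
  have "evl M (lsubst (map lam (js i)) (rep (pr n y (omit i ?xs)))) l = r1 i (%k. l (js i ! k))"
   unfolding r1_def using R(2)[OF len1(1)[OF that]] len1(3)[OF that] by (intro M.evl_lsubst) (auto simp: M.evl_lam)
  moreover have "lin M M (%m. pev M (vact M (?xs ! i) m) (l i))" using ac_lin2[of "?xs ! i" "l i"] by (simp add: ac_def[abs_def])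
  ultimately show ?thesis by (subst M.evl_lact[where c = "l i"]) (simp_all add: M.evl_lam ac_def)
 qed
 have ev2: "evl M ((lam i ^^ k) (lsubst ((%P. lam i P + lam j P) # map lam (js2 i j)) (rep (pr n y (c i j k # omit i (omit j ?xs)))))) l
   = scl M (l i ^ k) (r2 i j k (%m. \<psi> i j m l))" if ij: "i < j" "j \<le> n" for i j k l
 proof -
  let ?Ts = "(%P. lam i P + lam j P) # map lam (js2 i j)"
  have "evl M ((?Ts ! m) Q) l = scl M (\<psi> i j m l) (evl M Q l)" if "m < length ?Ts" for m Q
   using that by (cases m) (auto simp: \<psi>_def M.evl_add M.evl_lam M.scale_left_distrib)
  moreover have "keys e \<subseteq> {..<length ?Ts}" if "e : keys (rep (pr n y (c i j k # omit i (omit j ?xs))))" for e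
   using R(2)[OF len3[OF ij]] that len2[OF ij] by auto
  ultimately have "evl M (lsubst ?Ts (rep (pr n y (c i j k # omit i (omit j ?xs))))) l = r2 i j k (%m. \<psi> i j m l)"
   unfolding r2_def by (rule M.evl_lsubst)
  thus ?thesis using M.evl_funpow[of "lam i" l "l i" k, OF M.evl_lam] by simp
 qed
 have D: "evl M D = (%l. (SUM i<=n. sm (\<epsilon> i) (ac (?xs ! i) (l i) (r1 i (%k. l (js i ! k)))))
   + (SUM j<=n. SUM i<j. sm (\<delta> i j) (SUM k<=d i j. scl M (l i ^ k) (r2 i j k (%m. \<psi> i j m l)))))"
 proof
  fix l
  show "evl M D l = (SUM i<=n. sm (\<epsilon> i) (ac (?xs ! i) (l i) (r1 i (%k. l (js i ! k)))))
   + (SUM j<=n. SUM i<j. sm (\<delta> i j) (SUM k<=d i j. scl M (l i ^ k) (r2 i j k (%m. \<psi> i j m l))))"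
   unfolding D_def differential_value_def q'_def[symmetric] \<epsilon>_def[symmetric] \<delta>_def[symmetric] c_def[symmetric] d_def[symmetric]
    js_def[symmetric] M.evl_add M.evl_sum M.evl_map[OF M.scl_lin] M.sg_sm
   using ev1 ev2 by (simp add: js_def js2_def del: upt_Suc cong: sum.cong_simp)
 qed
 have p1: "pol n (r1 i)" if "i \<le> n" for i unfolding r1_def by (rule R(4)[OF len1(1)[OF that]])
 have p2: "pol n (r2 i j k)" if "i < j" "j \<le> n" for i j k unfolding r2_def by (rule R(4)[OF len3[OF that]])
 have jsn: "afn {..<Suc n} (%l. l (js i ! k))" if "i \<le> n" "k < n" for i k
  using js_lt[of "js i ! k" i] len1(3)[OF that(1)] that(2) by (intro afn_var) auto
 have pp: "pol (Suc n) (%l. scl M (l i ^ k) (f l))" if "pol (Suc n) f" "i \<le> n" for f i k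
  by (rule M.polyfun_afn_pow[OF afn_var that(1)]) (use that(2) in simp)
 show "pol (Suc n) (evl M D)"
  unfolding D
 proof (intro M.polyfun_add M.polyfun_sum M.polyfun_sm)
  fix i assume "i : {..n}"
  thus "pol (Suc n) (%l. ac (?xs ! i) (l i) (r1 i (%k. l (js i ! k))))"
   by (intro polyfun_ac M.polyfun_subst[OF p1] jsn) (auto intro: afn_var)
 next
  fix j i k assume "j : {..n}" "i : {..<j}"
  thus "pol (Suc n) (%l. scl M (l i ^ k) (r2 i j k (%m. \<psi> i j m l)))"
   using \<psi> by (intro pp M.polyfun_subst[OF p2]) auto
 qed
 define par1 where "par1 i = snd (as ! i)" for i
 have asp: "?xs ! i : par V (par1 i)" "as ! i = (?xs ! i, par1 i)" if "i \<le> n" for i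
 proof -
  show e: "as ! i = (?xs ! i, par1 i)" using that as(2) by (simp add: par1_def)
  have "as ! i : set as" using that as(2) by simp
  from bspec[OF as(1)[unfolded homl_def] this] show "?xs ! i : par V (par1 i)" unfolding e by simp
 qed
 have cp: "c i j k : par V (par1 i + par1 j)" if "i \<le> n" "j \<le> n" for i j k
 proof -
  show ?thesis unfolding c_def using lcaV asp(1)[OF that(1)] asp(1)[OF that(2)] unfolding lca_action_def by blast
 qed
 have mX: "mkl 0 as l : lists X" for l by (rule mkl_X[OF as(1)])
 have nth: "mkl 0 as l ! i = (?xs ! i, par1 i, l i)" if "i \<le> n" for i l
  using that as(2) by (simp add: mkl_nth par1_def)
 have q': "q (mkl 0 as l ! i) = q' i" if "i \<le> n" for i l using nth[OF that] that as(2) by (simp add: q'_def par1_def)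
 have om1: "omit i (mkl 0 as l) = mz (omit i as) (js i) l" if "i \<le> n" for i l
  using that as(2) by (simp add: mkl_mz_upt[OF as(2)] omit_mz js_def del: upt_Suc)
 have om2: "omit i (omit j (mkl 0 as l)) = mz (omit i (omit j as)) (js2 i j) l" if "i < j" "j \<le> n" for i j l
  using that as(2) by (simp add: mkl_mz_upt[OF as(2)] omit_mz js2_def length_omit del: upt_Suc)
 have E1: "eqv (Suc n) (%l. ac (?xs ! i) (l i) (r1 i (%k. l (js i ! k)))) (%l. xact (mkl 0 as l ! i) (y (omit i (mkl 0 as l))))"
  if i: "i \<le> n" for i
 proof -
  have "eqv n (r1 i) (Hs n y (omit i ?xs))" unfolding r1_def by (rule R(3)[OF len1(1)[OF i]])
  also have "Hs n y (omit i ?xs) = (%l. y (mkl 0 (omit i as) l))"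
   by (rule ext) (simp add: omit_map Hs_hom[OF y(1) homl_omit[OF as(1)] len1(2)[OF i]])
  finally have "eqv (Suc n) (%l. ac (?xs ! i) (l i) (r1 i (%k. l (js i ! k)))) (%l. ac (?xs ! i) (l i) (y (mkl 0 (omit i as) (%k. l (js i ! k)))))"
   using i by (intro eqv_ac[where \<psi> = "%k l. l (js i ! k)" and n = n] jsn sum1 afn_var) auto
  thus ?thesis using mkl_mz[of "js i" "omit i as"] len1[OF i] by (simp add: nth[OF i] xact_simp om1[OF i])
 qed
 have E2: "eqv (Suc n) (%l. SUM k<=d i j. scl M (l i ^ k) (r2 i j k (%m. \<psi> i j m l))) (%l. y (xbr (mkl 0 as l ! i) (mkl 0 as l ! j) # omit i (omit j (mkl 0 as l))))"
  if ij: "i < j" "j \<le> n" for i j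
 proof -
  have i: "i \<le> n" using ij by simp
  let ?bs = "omit i (omit j as)" and ?\<alpha> = "par1 i + par1 j"
  have hb: "homl ?bs" by (intro homl_omit as)
  have mzX: "mz ?bs (js2 i j) l : lists X" for l
   using mkl_X[OF hb, of 0 "%k. l (js2 i j ! k)"] mkl_mz[of "js2 i j" ?bs l] len2[OF ij] by simp
  have "eqv (Suc n) (%l. scl M (l i ^ k) (r2 i j k (%m. \<psi> i j m l))) (%l. scl M (l i ^ k) (y ((c i j k, ?\<alpha>, l i + l j) # mz ?bs (js2 i j) l)))" for k
  proof (rule eqv_pow)
   have hc: "homl ((c i j k, ?\<alpha>) # ?bs)" using cp[OF i ij(2)] hb by simp
   have lc: "length ((c i j k, ?\<alpha>) # ?bs) = n" using len2[OF ij] by simp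
   have "eqv n (r2 i j k) (Hs n y (c i j k # omit i (omit j ?xs)))" unfolding r2_def by (rule R(3)[OF len3[OF ij]])
   also have "Hs n y (c i j k # omit i (omit j ?xs)) = (%l. y (mkl 0 ((c i j k, ?\<alpha>) # ?bs) l))"
    using Hs_hom[OF y(1) hc lc] by (auto simp: omit_map)
   finally have "eqv n (r2 i j k) (%l. y (mkl 0 ((c i j k, ?\<alpha>) # ?bs) l))" .
   from eqv_subst[OF this, of "Suc n" "\<psi> i j", OF \<psi>[OF ij] sum2[OF ij]]
   have "eqv (Suc n) (%l. r2 i j k (%m. \<psi> i j m l)) (%l. y (mkl 0 ((c i j k, ?\<alpha>) # ?bs) (%m. \<psi> i j m l)))" .
   moreover have "mkl 0 ((c i j k, ?\<alpha>) # ?bs) (%m. \<psi> i j m l) = (c i j k, ?\<alpha>, l i + l j) # mz ?bs (js2 i j) l" for l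
    using mkl_mz_Cons[of "js2 i j" ?bs "l i + l j" l] len2[OF ij] by (simp add: \<psi>_def)
   ultimately show "eqv (Suc n) (%l. r2 i j k (%m. \<psi> i j m l)) (%l. y ((c i j k, ?\<alpha>, l i + l j) # mz ?bs (js2 i j) l))" by (simp only:)
  qed (use i in simp)
  hence "eqv (Suc n) (%l. SUM k<=d i j. scl M (l i ^ k) (r2 i j k (%m. \<psi> i j m l))) (%l. SUM k<=d i j. scl M (l i ^ k) (y ((c i j k, ?\<alpha>, l i + l j) # mz ?bs (js2 i j) l)))"
   by (rule eqv_sum)
  also have "... = (%l. y (xbr (mkl 0 as l ! i) (mkl 0 as l ! j) # omit i (omit j (mkl 0 as l))))"
  proof
   fix l
   note N = slinD[OF y(1) lists.Nil mzX[of l]]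
   have "y ([] @ (SUM k<=d i j. scl V (l i ^ k) (c i j k), ?\<alpha>, l i + l j) # mz ?bs (js2 i j) l) = (SUM k<=d i j. y ([] @ (scl V (l i ^ k) (c i j k), ?\<alpha>, l i + l j) # mz ?bs (js2 i j) l))"
    by (rule LinAt_sum[OF N]) (simp add: V.par_scl cp[OF i ij(2)])
   also have "... = (SUM k<=d i j. scl M (l i ^ k) (y ((c i j k, ?\<alpha>, l i + l j) # mz ?bs (js2 i j) l)))"
    using LinAt_D(2)[OF N cp[OF i ij(2)]] by simp
   finally show "(SUM k<=d i j. scl M (l i ^ k) (y ((c i j k, ?\<alpha>, l i + l j) # mz ?bs (js2 i j) l))) = y (xbr (mkl 0 as l ! i) (mkl 0 as l ! j) # omit i (omit j (mkl 0 as l)))"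
    by (simp add: nth i ij om2 xbr_simp bk_def pev_def c_def d_def)
  qed
  finally show ?thesis .
 qed
 have "(%l. dd \<pi> y (mkl 0 as l)) = (%l. (SUM i<=n. sm (\<epsilon> i) (xact (mkl 0 as l ! i) (y (omit i (mkl 0 as l)))))
   + (SUM j<=n. SUM i<j. sm (\<delta> i j) (y (xbr (mkl 0 as l ! i) (mkl 0 as l ! j) # omit i (omit j (mkl 0 as l))))))"
 proof
  fix l
  have s1: "(SUM m<i. q (mkl 0 as l ! m)) = (SUM m<i. q' m)" if "i \<le> n" for i
   using that by (intro sum.cong refl q') simp
  have s2: "(SUM m:{..<j} - {i}. q (mkl 0 as l ! m)) = (SUM m:{..<j} - {i}. q' m)" if "j \<le> n" for i j
   using that by (intro sum.cong refl q') simp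
  show "dd \<pi> y (mkl 0 as l) = (SUM i<=n. sm (\<epsilon> i) (xact (mkl 0 as l ! i) (y (omit i (mkl 0 as l)))))
   + (SUM j<=n. SUM i<j. sm (\<delta> i j) (y (xbr (mkl 0 as l ! i) (mkl 0 as l ! j) # omit i (omit j (mkl 0 as l)))))"
   unfolding dd_explicit[OF y(2) mX, of l n \<pi>, unfolded length_mkl, OF as(2)] \<epsilon>_def \<delta>_def
   using q'[of _ l] s1 s2 by (intro arg_cong2[of _ _ _ _ "(+)"] sum.cong refl) simp_all
 qed
 thus "eqv (Suc n) (evl M D) (%l. dd \<pi> y (mkl 0 as l))"
  unfolding D by (simp only:) (intro eqv_add eqv_sum eqv_sm E1 E2; simp)
qed

lemma differential_pr:
 assumes "slin y" "ssym y" "PF (%_. y)"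
 shows "homogeneous_differential V M n \<pi> (pr n y) = pr (Suc n) (dd \<pi> y)"
proof -
 have "lclass M (Suc n) (SUM ps:lists_of (Suc n). differential_value V M n \<pi> (pr n y) (%i. 1 + ps ! i) (map2 (hcomp V) ps xs))
  = cls (Suc n) (Hs (Suc n) (dd \<pi> y) xs)" if xs: "length xs = Suc n" for xs
 proof -
  let ?D = "%ps. differential_value V M n \<pi> (pr n y) (%i. 1 + ps ! i) (map2 (hcomp V) ps xs)"
  have d: "pol (Suc n) (evl M (?D ps))" "eqv (Suc n) (evl M (?D ps)) (%l. dd \<pi> y (mkl 0 (hl ps xs) l))" if "length ps = Suc n" for ps
  proof -
   have "map snd (hl ps xs) = ps" using that xs by (intro nth_equalityI) (simp_all add: hl_def)
   thus "pol (Suc n) (evl M (?D ps))" "eqv (Suc n) (evl M (?D ps)) (%l. dd \<pi> y (mkl 0 (hl ps xs) l))"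
    using differential_value_dd[OF assms homl_hl _ refl, of ps xs n \<pi>] that xs by (simp_all add: fst_hl)
  qed
  have e: "evl M (SUM ps:lists_of (Suc n). ?D ps) = (%l. SUM ps:lists_of (Suc n). evl M (?D ps) l)" by (auto simp: M.evl_sum)
  have "eqv (Suc n) (evl M (SUM ps:lists_of (Suc n). ?D ps)) (Hs (Suc n) (dd \<pi> y) xs)"
   unfolding e Hs_def[abs_def] by (intro eqv_sum d(2)) simp
  moreover have "pol (Suc n) (evl M (SUM ps:lists_of (Suc n). ?D ps))" unfolding e by (intro M.polyfun_sum d(1)) simp
  ultimately show ?thesis by (simp only: lclass_pol cls_eqI)
 qed
 thus ?thesis unfolding homogeneous_differential_def pr_def by (intro restrict_ext) simp
qed

end

section \<open>The energy operator on representatives\<close>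

context pvm begin

definition L1 :: "'m => 'm" where "L1 m = coeff (vact M L m) 1"

definition L1V :: "'v => 'v" where "L1V a = coeff (lbr V L a) 1"

lemma L1_lin: "lin M M L1"
proof -
 have "Vector_Spaces.linear (scl M) (scl M) (%m. coeff (vact M L m) 1)" using lcaM unfolding lca_action_def by blast
 thus ?thesis unfolding L1_def[abs_def] by (auto intro!: linI simp: Vector_Spaces.linear_iff)
qed

lemma L1V_lin: "lin V V L1V"
proof -
 have "Vector_Spaces.linear (scl V) (scl V) (%m. coeff (lbr V L m) 1)" using lcaV unfolding lca_action_def by blast
 thus ?thesis unfolding L1V_def[abs_def] by (auto intro!: linI simp: Vector_Spaces.linear_iff)
qed

text \<open>The linear coefficient of the sesquilinearity rule (\<lambda> + \<partial>), with
  \<partial> as the constant coefficient of the action of L.\<close>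

lemma L1_der: "L1 (der M m) = der M m + der M (L1 m)"
proof -
 have "vact M L (der M m) = pCons 0 (vact M L m) + map_poly (der M) (vact M L m)"
  using lcaM unfolding lca_action_def by blast
 thus ?thesis by (simp add: L1_def LM_0 coeff_map_poly lin_0[OF M.lin_der])
qed

lemma hcomp_L1V: "hcomp V \<alpha> (L1V a) = L1V (hcomp V \<alpha> a)"
proof (rule V.hcomp_eqI)
 show "L1V (hcomp V \<alpha> a) : par V \<alpha>" unfolding L1V_def by (intro coeff_L_par V.hcomp_par)
 show "L1V a - L1V (hcomp V \<alpha> a) : par V (1 + \<alpha>)"
  unfolding lin_diff[OF L1V_lin, symmetric] unfolding L1V_def by (intro coeff_L_par V.hcomp_diff)
qed

definition Eop :: "nat => ((nat => 'f) => 'm) => (nat => 'f) => 'm" where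
 "Eop n f l = L1 (f l) + (SUM i<n. scl M (l i) (Dv M (%t. f (l(i := t))) (l i)))"

lemma evl_poly_energy: "evl M (poly_energy L M n P) = Eop n (evl M P)"
proof -
 have "lin M M (%m. coeff (vact M L m) 1)" using L1_lin by (simp add: L1_def[abs_def])
 thus ?thesis
  by (intro ext) (simp add: poly_energy_def Eop_def M.evl_add M.evl_map M.evl_sum M.evl_lam M.evl_lder L1_def)
qed

lemma Dv_lin: "pf M p ==> lin M M T ==> Dv M (%t. T (p t)) s = T (Dv M p s)"
 unfolding Dv_def by (intro M.cof_lin' M.pf_shift)

lemma Dv_const: "Dv M (%_. m) s = 0"
 by (simp add: Dv_def M.cof_const)

lemma Dv_var: "pf M p ==> Dv M (%t. scl M t (p t)) s = p s + scl M s (Dv M p s)"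
 using M.Dv_step[of p 0 s] by simp

lemma polyfun_Dv: "M.polyfun K f ==> M.polyfun K (%l. Dv M (%t. f (l(m := t))) (l m))"
proof (induction rule: M.polyfun.induct)
 case (polyfun_const m)
 thus ?case by (simp add: Dv_const M.polyfun_const)
next
 case (polyfun_add f g)
 thus ?case by (simp add: M.Dv_add M.pf_polyfun_upd M.polyfun_add del: fun_upd_apply)
next
 case (polyfun_var i f)
 note p = M.pf_polyfun_upd[OF polyfun_var.hyps(2)]
 show ?case
 proof (cases "i = m")
  case True
  have "Dv M (%t. scl M ((l(m := t)) i) (f (l(m := t)))) (l m) = f l + scl M (l m) (Dv M (%t. f (l(m := t))) (l m))" for l
   unfolding True fun_upd_same using Dv_var[OF p, of l m "l m"] by simp
  thus ?thesis using polyfun_var True by (simp only: M.polyfun_add M.polyfun_var)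
 next
  case False
  have "Dv M (%t. scl M ((l(m := t)) i) (f (l(m := t)))) (l m) = scl M (l i) (Dv M (%t. f (l(m := t))) (l m))" for l
   using Dv_lin[OF p M.scl_lin[of "l i"]] False by (simp del: fun_upd_apply add: fun_upd_other)
  thus ?thesis using polyfun_var by (simp only: M.polyfun_var)
 qed
qed

lemma pol_Eop: "pol n f ==> pol n (Eop n f)"
 unfolding Eop_def[abs_def] by (intro M.polyfun_add M.polyfun_lin[OF _ L1_lin] M.polyfun_sum M.polyfun_var polyfun_Dv) simp_all

lemma Eop_add: "pol n f ==> pol n g ==> Eop n (%l. f l + g l) l = Eop n f l + Eop n g l"
 by (simp add: Eop_def lin_add[OF L1_lin] M.Dv_add M.pf_polyfun_upd M.scale_right_distrib sum.distrib del: fun_upd_apply)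

lemma Eop_sum: "(!!x. x : A ==> pol n (f x)) ==> Eop n (%l. SUM x:A. f x l) l = (SUM x:A. Eop n (f x) l)"
proof (induction A rule: infinite_finite_induct)
 case (insert x A)
 thus ?case by (simp add: Eop_add M.polyfun_sum)
qed (simp_all add: Eop_def lin_0[OF L1_lin])

lemma zn_pol: "zn n f ==> pol n f"
proof -
 assume "zn n f"
 then obtain h where h: "pol n h" "f = (%l. der M (h l) + scl M (SUM i<n. l i) (h l))" unfolding zn_def by blast
 show "pol n f" unfolding h(2)
  by (intro M.polyfun_add M.polyfun_lin[OF h(1) M.lin_der] M.polyfun_afn h(1) afn_sum afn_var) simp
qed

text \<open>Both \<partial> and the sum of the variables have energy 1: applying the operator to the
  image of h gives the image of E h + h, so the energy descends to the quotient.\<close>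

lemma zn_Eop: assumes "zn n f" shows "zn n (Eop n f)"
proof -
 obtain h where h: "pol n h" "!!l. f l = der M (h l) + scl M (SUM i<n. l i) (h l)" using assms unfolding zn_def by blast
 define D where "D i l = Dv M (%t. h (l(i := t))) (l i)" for i l
 have Df: "Dv M (%t. f (l(i := t))) (l i) = der M (D i l) + h l + scl M (SUM k<n. l k) (D i l)" if i: "i < n" for i l
 proof -
  let ?p = "%t. h (l(i := t))" and ?c = "SUM k:{..<n} - {i}. l k"
  have p: "pf M ?p" by (rule M.pf_polyfun_upd[OF h(1)])
  have "(%t. f (l(i := t))) = (%t. (der M (?p t) + scl M t (?p t)) + scl M ?c (?p t))"
   by (rule ext) (simp add: h(2) sum_upd[OF i] M.scale_left_distrib del: fun_upd_apply)
  hence "Dv M (%t. f (l(i := t))) (l i) = (der M (D i l) + (?p (l i) + scl M (l i) (D i l))) + scl M ?c (D i l)"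
   unfolding D_def using p
   by (simp only: M.Dv_add M.pf_add M.pf_scl M.pf_var M.pf_lin'[OF _ M.lin_der] Dv_lin[OF _ M.lin_der] Dv_lin[OF _ M.scl_lin] Dv_var)
  also have "... = der M (D i l) + h l + scl M (l i + ?c) (D i l)" by (simp add: M.scale_left_distrib add_ac)
  also have "l i + ?c = (SUM k<n. l k)" using sum_upd[OF i, of l "l i"] by simp
  finally show ?thesis .
 qed
 have "Eop n f l = der M (Eop n h l + h l) + scl M (SUM k<n. l k) (Eop n h l + h l)" for l
 proof -
  let ?\<Lambda> = "SUM k<n. l k"
  have "(SUM i<n. scl M (l i) (Dv M (%t. f (l(i := t))) (l i))) = (SUM i<n. der M (scl M (l i) (D i l)) + scl M (l i) (h l) + scl M ?\<Lambda> (scl M (l i) (D i l)))"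
   by (rule sum.cong) (simp_all add: Df M.scale_right_distrib lin_scl[OF M.lin_der] mult.commute del: fun_upd_apply)
  also have "... = der M (SUM i<n. scl M (l i) (D i l)) + scl M ?\<Lambda> (h l) + scl M ?\<Lambda> (SUM i<n. scl M (l i) (D i l))"
   by (simp only: sum.distrib lin_sum[OF M.lin_der] M.scale_sum_left M.scale_sum_right)
  finally have "Eop n f l = L1 (f l) + (der M (SUM i<n. scl M (l i) (D i l)) + scl M ?\<Lambda> (h l) + scl M ?\<Lambda> (SUM i<n. scl M (l i) (D i l)))"
   by (simp only: Eop_def)
  moreover have "L1 (f l) = der M (h l) + der M (L1 (h l)) + scl M ?\<Lambda> (L1 (h l))"
   by (simp add: h(2) lin_add[OF L1_lin] lin_scl[OF L1_lin] L1_der)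
  moreover have "Eop n h l = L1 (h l) + (SUM i<n. scl M (l i) (D i l))" by (simp only: Eop_def D_def)
  ultimately show ?thesis by (simp only: lin_add[OF M.lin_der] M.scale_right_distrib add_ac)
 qed
 moreover have "pol n (%l. Eop n h l + h l)" by (intro M.polyfun_add pol_Eop h(1))
 ultimately show ?thesis unfolding zn_def by blast
qed

lemma eqv_Eop: assumes "eqv n f g" "pol n g" shows "eqv n (Eop n f) (Eop n g)"
proof -
 have z: "zn n (%l. f l - g l)" using assms(1) by (simp add: eqv_def)
 have "Eop n (%l. (f l - g l) + g l) l = Eop n (%l. f l - g l) l + Eop n g l" for l
  by (rule Eop_add[OF zn_pol[OF z] assms(2)])
 hence "(%l. Eop n f l - Eop n g l) = Eop n (%l. f l - g l)" by auto
 thus ?thesis using zn_Eop[OF z] by (simp add: eqv_def)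
qed

lemma En_explicit:
 "En y (mkl k as l) = L1 (y (mkl k as l)) + (SUM j<length as. scl M (l (k + j)) (Dv M (%t. y (mkl k as (l(k + j := t)))) (l (k + j)))
   + y (mkl k as l) - y (mkl k (as[j := (L1V (fst (as ! j)), snd (as ! j))]) l))"
proof (induction as arbitrary: y k)
 case Nil
 show ?case by (simp add: L1_def)
next
 case (Cons z as)
 obtain a \<alpha> where z: "z = (a, \<alpha>)" by force
 have u: "mkl (Suc k) as (l(k := t)) = mkl (Suc k) as l" for t by (rule mkl_cong) simp
 have e: "mkl k (z # as) (l(k + Suc j := t)) = (a, \<alpha>, l k) # mkl (Suc k) as (l(Suc k + j := t))" for j t
  by (simp add: z)
 have IH: "En (ins y (a, \<alpha>, l k)) (mkl (Suc k) as l) = L1 (y ((a, \<alpha>, l k) # mkl (Suc k) as l))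
   + (SUM j<length as. scl M (l (k + Suc j)) (Dv M (%t. y (mkl k (z # as) (l(k + Suc j := t)))) (l (k + Suc j)))
   + y ((a, \<alpha>, l k) # mkl (Suc k) as l) - y ((a, \<alpha>, l k) # mkl (Suc k) (as[j := (L1V (fst (as ! j)), snd (as ! j))]) l))"
  unfolding e using Cons.IH[of "ins y (a, \<alpha>, l k)" "Suc k"] by (simp only: add_Suc_shift)
 show ?case
  by (simp add: z IH[unfolded z] u sum.lessThan_Suc_shift L1V_def del: sum.lessThan_Suc fun_upd_apply) (simp only: fun_upd_same algebra_simps simp_thms)
qed

lemma hl_update: "length ps = length xs ==> i < length xs ==> hl ps (xs[i := L1V (xs ! i)]) = (hl ps xs)[i := (L1V (fst (hl ps xs ! i)), snd (hl ps xs ! i))]"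
 by (intro nth_equalityI) (auto simp: hl_def nth_list_update hcomp_L1V)

lemma energy_pr:
 assumes y: "slin y" "PF (%_. y)"
 shows "cochain_energy V L M n (pr n y) = pr n (En y)"
proof -
 note R = pr_rep[OF y(2)]
 have "lclass M n (poly_energy L M n (rep (pr n y xs)) + Poly_Mapping.map (scl M (of_nat n)) (rep (pr n y xs))
    - (SUM i<n. rep (pr n y (xs[i := coeff (lbr V L (xs ! i)) 1])))) = cls n (Hs n (En y) xs)" if xs: "length xs = n" for xs
 proof -
  let ?R = "evl M (rep (pr n y xs))" and ?R' = "%i. evl M (rep (pr n y (xs[i := L1V (xs ! i)])))"
  let ?P = "poly_energy L M n (rep (pr n y xs)) + Poly_Mapping.map (scl M (of_nat n)) (rep (pr n y xs)) - (SUM i<n. rep (pr n y (xs[i := L1V (xs ! i)])))"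
  have lx: "length (xs[i := x]) = n" for i x using xs by simp
  have e: "evl M ?P = (%l. Eop n ?R l + scl M (of_nat n) (?R l) - (SUM i<n. ?R' i l))"
   by (auto simp: M.evl_diff M.evl_add M.evl_map[OF M.scl_lin] M.evl_sum evl_poly_energy)
  have p: "pol n (evl M ?P)" unfolding e
   by (intro M.polyfun_diff M.polyfun_add pol_Eop M.polyfun_scl M.polyfun_sum R(4)[OF xs] R(4)[OF lx])
  have "eqv n (evl M ?P) (%l. Eop n (Hs n y xs) l + scl M (of_nat n) (Hs n y xs l) - (SUM i<n. Hs n y (xs[i := L1V (xs ! i)]) l))"
   unfolding e by (intro eqv_diff eqv_add eqv_Eop eqv_scl eqv_sum R(3)[OF xs] R(3)[OF lx] pol_Hs[OF y(2) xs])
  also have "... = Hs n (En y) xs"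
  proof
   fix l
   have pp: "pol n (%l. y (mkl 0 (hl ps xs) l))" if "length ps = n" for ps
    using PF_pol[OF y(2) homl_hl, of ps xs] that xs by simp
   have "Eop n (Hs n y xs) l = (\<Sum>ps | length ps = n. Eop n (%l. y (mkl 0 (hl ps xs) l)) l)"
    unfolding Hs_def[abs_def] by (rule Eop_sum) (simp add: pp)
   moreover have "En y (mkl 0 (hl ps xs) l) = Eop n (%l. y (mkl 0 (hl ps xs) l)) l + scl M (of_nat n) (y (mkl 0 (hl ps xs) l))
     - (SUM i<n. y (mkl 0 (hl ps (xs[i := L1V (xs ! i)])) l))" if ps: "length ps = n" for ps
   proof -
    have c: "(SUM i<k. m) = scl M (of_nat k) m" for m and k :: nat
     by (induction k) (simp_all add: M.scale_left_distrib add.commute del: sum_constant)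
    have "length (hl ps xs) = n" using ps xs by simp
    thus ?thesis
     unfolding En_explicit[of y 0 "hl ps xs" l] Eop_def using ps xs
     by (simp add: hl_update sum.distrib sum_subtractf c del: sum_constant fun_upd_apply)
   qed
   ultimately show "Eop n (Hs n y xs) l + scl M (of_nat n) (Hs n y xs l) - (SUM i<n. Hs n y (xs[i := L1V (xs ! i)]) l) = Hs n (En y) xs l"
    unfolding Hs_def by (simp add: sum.distrib sum_subtractf M.scale_sum_right sum.swap[of _ "{..<n}"])
  qed
  finally show ?thesis using lclass_pol[OF p] by (simp add: L1V_def cls_eqI)
 qed
 thus ?thesis unfolding cochain_energy_def pr_def[of n "En y"] by (intro restrict_ext) simp
qed

text \<open>The kernel of the reduction: by \<open>pr_null\<close> these are the cochains with zero
  class in degree n.\<close>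

definition null :: "nat => (('v \<times> bit \<times> 'f) list => 'm) => bool" where
 "null n y \<longleftrightarrow> (ALL as. homl as --> length as = n --> zn n (%l. y (mkl 0 as l)))"

lemma nullD: "null n y ==> homl as ==> length as = n ==> zn n (%l. y (mkl 0 as l))"
 by (simp add: null_def)

lemma null_add: "null n y ==> null n y' ==> null n (%w. y w + y' w)"
 and null_sm: "null n y ==> null n (%w. sm e (y w))"
 and null_0: "null n (%_. 0)"
 by (auto simp: null_def zn_add zn_sm zn_0)

lemma null_cong: "(!!w. w : lists X ==> length w = n ==> y w = y' w) ==> null n y ==> null n y'"
 unfolding null_def using mkl_X by auto

lemma pr_eq_iff:
 assumes "slin y" "PF (%_. y)" "slin y'" "PF (%_. y')"
 shows "pr n y = pr n y' \<longleftrightarrow> null n (%w. y w - y' w)"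
proof
 assume e: "pr n y = pr n y'"
 show "null n (%w. y w - y' w)"
  unfolding null_def
 proof (intro allI impI)
  fix as assume as: "homl as" "length as = n"
  have "cls n (Hs n y (map fst as)) = cls n (Hs n y' (map fst as))"
   using fun_cong[OF e, of "map fst as"] as by (simp add: pr_def)
  hence "eqv n (Hs n y (map fst as)) (Hs n y' (map fst as))" using cls_eq[OF pol_Hs[OF assms(2)], of "map fst as" n] as by simp
  thus "zn n (%l. y (mkl 0 as l) - y' (mkl 0 as l))"
   by (simp add: eqv_def Hs_hom[OF assms(1) as] Hs_hom[OF assms(3) as])
 qed
next
 assume n: "null n (%w. y w - y' w)"
 have "cls n (Hs n y xs) = cls n (Hs n y' xs)" if xs: "length xs = n" for xs
  unfolding Hs_def[abs_def]
 proof (intro cls_eqI eqv_sum)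
  fix ps assume "ps : {ps :: bit list. length ps = n}"
  thus "eqv n (%l. y (mkl 0 (hl ps xs) l)) (%l. y' (mkl 0 (hl ps xs) l))"
   using nullD[OF n homl_hl, of ps xs] xs by (simp add: eqv_def)
 qed
 thus "pr n y = pr n y'" unfolding pr_def by (intro restrict_ext) simp
qed

lemma lsum_mkl: "lsum (mkl k as l) = (SUM j<length as. l (k + j))"
 by (induction as arbitrary: k) (auto simp: sum.lessThan_Suc_shift simp del: sum.lessThan_Suc)

lemma null_TT: assumes "PF (%_. z)" shows "null n (TT z)"
 unfolding null_def zn_def
proof (intro allI impI)
 fix as assume as: "homl as" "length as = n"
 have "pol n (%l. z (mkl 0 as l))" using PF_pol[OF assms as(1)] as(2) by simp
 moreover have "TT z (mkl 0 as l) = der M (z (mkl 0 as l)) + scl M (SUM i<n. l i) (z (mkl 0 as l))" for l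
  by (simp add: TT_def lsum_mkl as(2))
 ultimately show "EX h. pol n h & (ALL l. TT z (mkl 0 as l) = der M (h l) + scl M (SUM i<n. l i) (h l))" by blast
qed

text \<open>The projection to one parity commutes with \<partial> and so preserves the image; it
  separates the two summands.\<close>

lemma null_part:
 assumes "null n (%w. y w + y' w)" "spar \<pi> y" "spar (\<pi> + 1) y'" shows "null n y"
 unfolding null_def
proof (intro allI impI)
 fix as assume as: "homl as" "length as = n"
 define \<beta> where "\<beta> = 1 + \<pi> + sum_list (map (%z. 1 + snd z) as)"
 have y: "y (mkl 0 as l) : par M \<beta>" for l
  using bspec[OF assms(2)[unfolded spar_def] mkl_X[OF as(1)], of 0 l] by (simp add: \<beta>_def qs_mkl)
 have y': "y' (mkl 0 as l) : par M (1 + \<beta>)" for l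
  using bspec[OF assms(3)[unfolded spar_def] mkl_X[OF as(1)], of 0 l] by (simp add: \<beta>_def qs_mkl add_ac)
 have "hcomp M \<beta> (y (mkl 0 as l) + y' (mkl 0 as l)) = y (mkl 0 as l)" for l
  using M.hcomp_hom[OF y, of \<beta> l] M.hcomp_hom[OF y', of \<beta> l] by (simp add: lin_add[OF M.hcomp_lin])
 thus "zn n (%l. y (mkl 0 as l))"
  using zn_lin[OF nullD[OF assms(1) as] M.hcomp_lin, of \<beta>] by (simp add: M.hcomp_der)
qed

section \<open>Division by \<partial> plus the sum of the variables\<close>

lemma shifted_der_unique:
 assumes "pf M p" "pf M p'" "!!t. der M (p t) + scl M (t + c) (p t) = der M (p' t) + scl M (t + c) (p' t)"
 shows "p t = p' t"
proof -
 have "(%t. p t - p' t) t = 0"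
 proof (rule M.shifted_der_injective)
  show "pf M (%t. p t - p' t)" by (intro M.pf_diff assms)
  show "der M (p t - p' t) + scl M (t + c) (p t - p' t) = 0" for t
   using assms(3)[of t] by (simp add: lin_diff[OF M.lin_der] M.scale_right_diff_distrib algebra_simps)
 qed
 thus ?thesis by simp
qed

text \<open>Preimages of the values are chosen separately for each list of elements. With at least
  one argument, \<open>TT\<close> is injective on polynomial functions of that argument's value, so
  each identity for \<open>Y\<close> forces the same identity for z. Lists of other lengths get 0,
  which is why \<open>Y\<close> must vanish there.\<close>

lemma TT_lift:
 assumes Y: "BC \<rho> Y" and null: "null (Suc n) Y" and off: "!!w. w : lists X ==> length w ~= Suc n ==> Y w = 0"
 shows "EX z. BC \<rho> z & (ALL w:lists X. TT z w = Y w)"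
proof -
 have y: "slin Y" "spar \<rho> Y" "ssym Y" "sleib \<rho> Y" "PF (%_. Y)" using Y by (auto simp: BC_def)
 have "EX h. ALL as. homl as & length as = Suc n --> pol (Suc n) (h as) & (ALL l. Y (mkl 0 as l) = der M (h as l) + scl M (SUM i<Suc n. l i) (h as l))"
  by (rule choice) (use null in \<open>auto simp: null_def zn_def\<close>)
 then obtain h where h: "!!as. homl as ==> length as = Suc n ==> pol (Suc n) (h as)"
  "!!as l. homl as ==> length as = Suc n ==> Y (mkl 0 as l) = der M (h as l) + scl M (SUM i<Suc n. l i) (h as l)" by blast
 \<comment> \<open>\<open>h\<close> depends on the elements and parities only; the values in
   \<open>w\<close> are substituted for its variables.\<close>
 define z where "z w = (if length w = Suc n then h (map (%(a, \<alpha>, t). (a, \<alpha>)) w) (%k. snd (snd (w ! k))) else 0)" for w :: "('v \<times> bit \<times> 'f) list"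
 have E: "der M (z w) + scl M (lsum w) (z w) = Y w" if w: "w : lists X" for w
 proof (cases "length w = Suc n")
  case True
  let ?as = "map (%(a, \<alpha>, t). (a, \<alpha>)) w" and ?l = "%k. snd (snd (w ! k))"
  have "homl ?as" using w by (auto simp: homl_def in_lists_conv_set)
  moreover have m: "mkl 0 ?as ?l = w" by (rule nth_equalityI) (auto simp: mkl_nth case_prod_beta)
  moreover have "lsum w = (SUM i<Suc n. ?l i)" using lsum_mkl[of 0 ?as ?l] True unfolding m by simp
  ultimately show ?thesis using h(2)[of ?as ?l] True by (simp add: z_def del: sum.lessThan_Suc)
 next
  case False
  thus ?thesis using off[OF w] by (simp add: z_def lin_0[OF M.lin_der])
 qed
 have PF: "PF (%_. z)"
  unfolding PF_def
 proof
  fix ws assume ws: "ws : lists XF"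
  show "M.polyfun UNIV (%l. z (inst ws l))"
  proof (cases "length ws = Suc n")
   case True
   have m: "map (%(a, \<alpha>, t). (a, \<alpha>)) (inst ws l) = map (%(a, \<alpha>, \<phi>). (a, \<alpha>)) ws" for l by (auto simp: case_prod_beta)
   have "homl (map (%(a, \<alpha>, \<phi>). (a, \<alpha>)) ws)" using ws by (auto simp: homl_def XF_def in_lists_conv_set)
   hence p: "pol (Suc n) (h (map (%(a, \<alpha>, \<phi>). (a, \<alpha>)) ws))" using True by (intro h) simp_all
   have "M.polyfun UNIV (%l. h (map (%(a, \<alpha>, \<phi>). (a, \<alpha>)) ws) (%k. snd (snd (inst ws l ! k))))"
   proof (rule M.polyfun_subst[OF p])
    fix k assume "k : {..<Suc n}"
    hence k: "k < length ws" using True by simp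
    hence "ws ! k : XF" using ws nth_mem by (auto simp: in_lists_conv_set)
    thus "afn UNIV (%l. snd (snd (inst ws l ! k)))" using k by (auto simp: XF_def case_prod_beta)
   qed
   thus ?thesis using True by (simp only: z_def m length_map refl if_True)
  qed (simp add: z_def M.polyfun_const)
 qed
 note pf = PF_pf[OF PF]
 have Es: "der M (z (us @ (a, \<alpha>, t) # vs)) + scl M (t + (lsum us + lsum vs)) (z (us @ (a, \<alpha>, t) # vs)) = Y (us @ (a, \<alpha>, t) # vs)"
  if "us : lists X" "vs : lists X" "a : par V \<alpha>" for us vs a \<alpha> t
 proof -
  have "us @ (a, \<alpha>, t) # vs : lists X" using that by simp
  moreover have "lsum (us @ (a, \<alpha>, t) # vs) = t + (lsum us + lsum vs)" by simp
  ultimately show ?thesis using E[of "us @ (a, \<alpha>, t) # vs"] by (simp only:)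
 qed
 have A: "LinAt z us vs" if uv: "us : lists X" "vs : lists X" for us vs
  unfolding LinAt_def
 proof (intro allI ballI conjI)
  fix \<alpha> t a assume a: "a : par V \<alpha>"
  note D = LinAt_D[OF slinD[OF y(1) uv] a]
  have S: "der M (z (us @ (b, \<alpha>, t) # vs)) + scl M (t + (lsum us + lsum vs)) (z (us @ (b, \<alpha>, t) # vs)) = Y (us @ (b, \<alpha>, t) # vs)"
   if "b : par V \<alpha>" for b t using Es[OF uv that] .
  note U = shifted_der_unique[where c = "lsum us + lsum vs", OF pf[OF uv]]
  show "z (us @ (a + b, \<alpha>, t) # vs) = z (us @ (a, \<alpha>, t) # vs) + z (us @ (b, \<alpha>, t) # vs)" if b: "b : par V \<alpha>" for b
  proof (rule U[OF V.par_add[OF a b] M.pf_add[OF pf[OF uv a] pf[OF uv b]]], goal_cases)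
   case (1 t)
   show ?case
    unfolding S[OF V.par_add[OF a b]] D(1)[OF b] S[OF a, symmetric] S[OF b, symmetric] lin_add[OF M.lin_der] M.scale_right_distrib
    by (simp only: add_ac)
  qed
  show "z (us @ (scl V c a, \<alpha>, t) # vs) = scl M c (z (us @ (a, \<alpha>, t) # vs))" for c
  proof (rule U[OF V.par_scl[OF a] M.pf_scl[OF pf[OF uv a]]], goal_cases)
   case (1 t)
   show ?case
    unfolding S[OF V.par_scl[OF a]] D(2) S[OF a, symmetric] lin_scl[OF M.lin_der] M.scale_right_distrib M.scale_scale
    by (simp only: mult.commute)
  qed
  show "z (us @ (der V a, \<alpha>, t) # vs) = - scl M t (z (us @ (a, \<alpha>, t) # vs))"
  proof (rule U[OF V.der_par[OF a] M.pf_neg[OF M.pf_var[OF pf[OF uv a]]]], goal_cases)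
   case (1 t)
   show ?case
    unfolding S[OF V.der_par[OF a]] D(3) S[OF a, symmetric] lin_minus[OF M.lin_der] lin_scl[OF M.lin_der] M.scale_right_distrib M.scale_scale M.scale_minus_right
    by (simp only: mult.commute minus_add_distrib)
  qed
 qed
 have B: "SymAt z us vs" if uv: "us : lists X" "vs : lists X" for us vs
  unfolding SymAt_def
 proof (intro ballI)
  fix x x' assume xX: "x : X" "x' : X"
  obtain a \<alpha> t0 where x: "x = (a, \<alpha>, t0)" by (metis prod_cases3)
  have a: "a : par V \<alpha>" using xX x by simp
  have l1: "x' # vs : lists X" "us @ [x'] : lists X" using uv xX by simp_all
  let ?c = "lsum us + lsum (x' # vs)"
  have c: "lsum (us @ [x']) + lsum vs = ?c" by (cases x') (simp add: add_ac)
  have "z (us @ (a, \<alpha>, t0) # x' # vs) = sm (q x * q x') (z ((us @ [x']) @ (a, \<alpha>, t0) # vs))"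
  proof (rule shifted_der_unique[where c = ?c, OF pf[OF uv(1) l1(1) a] M.pf_sm[OF pf[OF l1(2) uv(2) a]]], goal_cases)
   case (1 t)
   have aX: "(a, \<alpha>, t) : X" using a by simp
   have s: "Y (us @ (a, \<alpha>, t) # x' # vs) = sm (q x * q x') (Y (us @ x' # (a, \<alpha>, t) # vs))"
    using bspec[OF bspec[OF ssymD[OF y(3) uv, unfolded SymAt_def] aX] xX(2)] by (simp only: x q_simp)
   show ?case
    unfolding Es[OF uv(1) l1(1) a] lin_sm[OF M.lin_der] M.scl_sm sm_add[symmetric] Es[OF l1(2) uv(2) a, unfolded c] s
    by (simp only: append_assoc append_Cons append_Nil)
  qed
  thus "z (us @ x # x' # vs) = sm (q x * q x') (z (us @ x' # x # vs))"
   by (simp only: x append_assoc append_Cons append_Nil)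
 qed
 have C: "LeibAt \<rho> z us vs" if uv: "us : lists X" "vs : lists X" for us vs
  unfolding LeibAt_def
 proof (intro allI ballI)
  fix \<beta> \<gamma> t b c assume bc: "b : par V \<beta>" "c : par V \<gamma>"
  let ?c = "lsum us + lsum vs"
  let ?p = "%d \<delta> r. z (us @ (d, \<delta>, r) # vs)"
  have pfd: "pf M (?p d \<delta>)" if "d : par V \<delta>" for d \<delta> by (rule pf[OF uv that])
  have X: "der M (exm e (?p d \<delta>) t) + scl M (t + ?c) (exm e (?p d \<delta>) t) = exm e (%r. Y (us @ (d, \<delta>, r) # vs)) t" if d: "d : par V \<delta>" for e d \<delta> t
  proof -
   note p = pfd[OF d]
   have pd: "pf M (%r. der M (?p d \<delta> r) + scl M r (?p d \<delta> r))" using p by (intro M.pf_add M.pf_var M.pf_lin'[OF _ M.lin_der])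
   have "(%r. Y (us @ (d, \<delta>, r) # vs)) = (%r. (der M (?p d \<delta> r) + scl M r (?p d \<delta> r)) + scl M ?c (?p d \<delta> r))"
    by (rule ext) (simp only: Es[OF uv d, symmetric] M.scale_left_distrib add.assoc)
   hence "exm e (%r. Y (us @ (d, \<delta>, r) # vs)) t = exm e (%r. der M (?p d \<delta> r) + scl M r (?p d \<delta> r)) t + scl M ?c (exm e (?p d \<delta>) t)"
    using p pd by (simp only: exm_add exm_scl M.pf_scl)
   thus ?thesis by (simp only: exm_der[OF p, symmetric] M.scale_left_distrib add.assoc)
  qed
  show "z (us @ (b * c, \<beta> + \<gamma>, t) # vs) = sm (\<beta> * (\<rho> + qs us)) (exm b (?p c \<gamma>) t) + sm (\<gamma> * (\<beta> + (\<rho> + qs us))) (exm c (?p b \<beta>) t)"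
  proof (rule shifted_der_unique[where c = ?c, OF pfd[OF mult_par[OF bc]]], goal_cases)
   case 1
   show ?case by (intro M.pf_add M.pf_sm pf_exm pfd bc)
  next
   case (2 t)
   have YL: "Y (us @ (b * c, \<beta> + \<gamma>, t) # vs) = sm (\<beta> * (\<rho> + qs us)) (exm b (%r. Y (us @ (c, \<gamma>, r) # vs)) t) + sm (\<gamma> * (\<beta> + (\<rho> + qs us))) (exm c (%r. Y (us @ (b, \<beta>, r) # vs)) t)"
    using sleibD[OF y(4) uv] bc unfolding LeibAt_def by blast
   show ?case
    unfolding Es[OF uv mult_par[OF bc]] YL X[OF bc(1), symmetric] X[OF bc(2), symmetric] lin_add[OF M.lin_der] lin_sm[OF M.lin_der] M.scale_right_distrib M.scl_sm sm_add
    by (simp only: add_ac)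
  qed
 qed
 have S: "z w : par M (1 + \<rho> + qs w)" if w: "w : lists X" for w
 proof (cases w)
  case Nil
  thus ?thesis by (simp add: z_def M.par_0)
 next
  case (Cons x vs)
  obtain a \<alpha> t0 where x: "x = (a, \<alpha>, t0)" by (metis prod_cases3)
  have a: "a : par V \<alpha>" "vs : lists X" using w x Cons by simp_all
  let ?\<beta> = "1 + (1 + \<rho> + qs w)"
  have "hcomp M ?\<beta> (z ([] @ (a, \<alpha>, t0) # vs)) = (%_. 0) t0"
  proof (rule shifted_der_unique[where c = "lsum [] + lsum vs"])
   show "pf M (%t. hcomp M ?\<beta> (z ([] @ (a, \<alpha>, t) # vs)))" by (rule M.pf_lin'[OF pf[OF lists.Nil a(2,1)] M.hcomp_lin])
   fix t
   have "(a, \<alpha>, t) # vs : lists X" using a by simp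
   from bspec[OF y(2)[unfolded spar_def] this] have "Y ([] @ (a, \<alpha>, t) # vs) : par M (1 + \<rho> + qs w)" by (simp add: Cons x)
   hence "hcomp M ?\<beta> (Y ([] @ (a, \<alpha>, t) # vs)) = 0" by (simp only: M.par_iff)
   thus "der M (hcomp M ?\<beta> (z ([] @ (a, \<alpha>, t) # vs))) + scl M (t + (lsum [] + lsum vs)) (hcomp M ?\<beta> (z ([] @ (a, \<alpha>, t) # vs)))
     = der M 0 + scl M (t + (lsum [] + lsum vs)) 0"
    unfolding Es[OF lists.Nil a(2,1), symmetric] lin_add[OF M.hcomp_lin] lin_scl[OF M.hcomp_lin] M.hcomp_der by (simp add: lin_0[OF M.lin_der])
  qed simp
  hence "hcomp M ?\<beta> (z w) = 0" by (simp only: Cons x append_Nil)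
  thus ?thesis unfolding M.par_iff .
 qed
 have "BC \<rho> z" unfolding BC_def slin_def ssym_def sleib_def spar_def using A B C S PF by blast
 moreover have "ALL w:lists X. TT z w = Y w" using E by (simp add: TT_def)
 ultimately show ?thesis by blast
qed

text \<open>On the empty list \<open>TT\<close> is \<partial> on \<open>M\<close>, for which nothing
  is claimed; one variable suffices for injectivity.\<close>

lemma TT_injective:
 assumes "PF (%_. w)" "!!xs. xs : lists X ==> TT w xs = 0" "xs : lists X" "xs ~= []"
 shows "w xs = 0"
proof -
 obtain a \<alpha> t0 vs where xs: "xs = (a, \<alpha>, t0) # vs" using assms(4) by (metis list.exhaust prod_cases3)
 have a: "a : par V \<alpha>" "vs : lists X" using assms(3) xs by auto
 have "w ([] @ (a, \<alpha>, t0) # vs) = 0"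
 proof (rule M.shifted_der_injective[where c = "lsum vs"])
  show "pf M (%t. w ([] @ (a, \<alpha>, t) # vs))" by (rule PF_pf[OF assms(1) lists.Nil a(2,1)])
  show "der M (w ([] @ (a, \<alpha>, t) # vs)) + scl M (t + lsum vs) (w ([] @ (a, \<alpha>, t) # vs)) = 0" for t
   using assms(2)[of "(a, \<alpha>, t) # vs"] a by (simp add: TT_def)
 qed
 thus ?thesis by (simp add: xs)
qed

text \<open>Closedness of z: \<open>TT\<close> commutes with the differential, so \<open>TT\<close>
  of d z is d d y = 0, and injectivity applies. On the empty list d z is 0 by definition.\<close>

lemma closed_lift:
 assumes y: "BC \<pi> y" and null: "null (Suc n) (dd \<pi> y)" and off: "!!w. length w ~= n ==> y w = 0"
 shows "EX z. BC (\<pi> + 1) z & (ALL xs:lists X. dd \<pi> y xs = TT z xs & dd (\<pi> + 1) z xs = 0)"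
proof -
 have "dd \<pi> y w = 0" if "w : lists X" "length w ~= Suc n" for w
 proof -
  have "dd \<pi> y w = dd \<pi> (%_. 0) w" using that by (intro dd_cong) (auto intro: off)
  thus ?thesis by (simp add: dd_0)
 qed
 then obtain z where z: "BC (\<pi> + 1) z" "ALL w:lists X. TT z w = dd \<pi> y w" using TT_lift[OF BC_dd[OF y] null] by blast
 have dz: "dd (\<pi> + 1) z xs = 0" if xs: "xs : lists X" for xs
 proof (cases xs)
  case (Cons x w)
  show ?thesis
  proof (rule TT_injective[OF _ _ xs])
   show "PF (%_. dd (\<pi> + 1) z)" using BC_dd[OF z(1)] by (simp add: BC_def)
   fix vs assume vs: "vs : lists X"
   have "TT (dd (\<pi> + 1) z) vs = dd (\<pi> + 1) (TT z) vs" by (rule TT_dd[OF z(1) vs, symmetric])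
   also have "... = dd (\<pi> + 1) (dd \<pi> y) vs" by (rule dd_cong[OF vs]) (use z(2) in blast)
   finally show "TT (dd (\<pi> + 1) z) vs = 0" using dd_dd_0[OF y vs] by simp
  qed (use Cons in simp)
 qed simp
 have "ALL xs:lists X. dd \<pi> y xs = TT z xs & dd (\<pi> + 1) z xs = 0"
  using z(2) dz by (metis (no_types, lifting))
 thus ?thesis using z(1) by blast
qed

end

section \<open>Vector spaces with a carrier: quotients, direct sums and idempotents\<close>

locale vspace_laws =
 fixes pl :: "'y => 'y => 'y" and ze :: 'y and sc :: "'f::field => 'y => 'y"
 assumes pl_assoc: "pl (pl x y) z = pl x (pl y z)" and pl_comm: "pl x y = pl y x" and pl_ze: "pl ze y = y"
  and sc_pl: "sc c (pl x y) = pl (sc c x) (sc c y)" and sc_add: "sc (c + d) y = pl (sc c y) (sc d y)"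
  and sc_sc: "sc c (sc d y) = sc (c * d) y" and sc_1: "sc 1 y = y" and sc_0: "sc 0 y = ze"
begin

lemma pl_ze': "pl y ze = y"
 using pl_comm pl_ze by metis

lemma pl_lcomm: "pl x (pl y z) = pl y (pl x z)"
 using pl_assoc pl_comm by metis

lemmas pl_ac = pl_assoc pl_comm pl_lcomm

lemma sc_ze: "sc c ze = ze"
 using sc_sc[of c 0 ze] by (simp add: sc_0)

lemma pl_neg: "pl y (sc (- 1) y) = ze" "pl (sc (- 1) y) y = ze"
 using sc_add[of 1 "- 1" y] pl_comm by (simp_all add: sc_0 sc_1)

end

text \<open>The operations of a vector space with a carrier, described on representatives.\<close>

locale presented = vspace_laws pl ze sc
 for pl :: "'y => 'y => 'y" and ze :: 'y and sc :: "'f::field => 'y => 'y" +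
 fixes A :: "'y set" and W :: "('f, 'a) module" and \<phi> :: "'y => 'a"
 assumes A_ze: "ze : A" and A_pl: "x : A ==> y : A ==> pl x y : A" and A_sc: "y : A ==> sc c y : A"
  and carrier: "carrier W = \<phi> ` A" and zero: "\<zero>\<^bsub>W\<^esub> = \<phi> ze"
  and add: "x : A ==> y : A ==> \<phi> x \<oplus>\<^bsub>W\<^esub> \<phi> y = \<phi> (pl x y)"
  and smult: "y : A ==> c \<odot>\<^bsub>W\<^esub> \<phi> y = \<phi> (sc c y)"
begin

lemma \<phi>_carrier: "y : A ==> \<phi> y : carrier W"
 by (simp add: carrier)

lemma abelian: "abelian_monoid W"
 by (rule abelian_monoidI) (auto simp: carrier zero add A_pl A_ze pl_ac pl_ze pl_ze')

text \<open>For an idempotent T, w is the sum of w - T w in the kernel and of T w, which is fixed;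
  an eigenvalue satisfies c c = c.\<close>

lemma projection_diagonalizable:
 assumes T: "!!x. x : carrier W ==> T x : carrier W"
  and T_add: "!!x y. x : carrier W ==> y : carrier W ==> T (x \<oplus>\<^bsub>W\<^esub> y) = T x \<oplus>\<^bsub>W\<^esub> T y"
  and T_smult: "!!x c. x : carrier W ==> T (c \<odot>\<^bsub>W\<^esub> x) = c \<odot>\<^bsub>W\<^esub> T x"
  and idem: "!!x. x : carrier W ==> T (T x) = T x"
 shows "diagonalizable W T & (ALL c. is_eigenvalue W T c --> c = 0 | c = 1)"
proof (intro conjI allI impI)
 interpret abelian_monoid W by (rule abelian)
 show "diagonalizable W T"
  unfolding diagonalizable_def
 proof
  fix w assume w: "w : carrier W"
  obtain y e where y: "y : A" "w = \<phi> y" and e: "e : A" "T w = \<phi> e" using w T[OF w] unfolding carrier by blast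
  define h where "h = \<phi> (pl y (sc (- 1) e))"
  have hA: "pl y (sc (- 1) e) : A" by (intro A_pl A_sc y e)
  have c: "h : carrier W" "\<phi> e : carrier W" unfolding h_def by (intro \<phi>_carrier hA e)+
  have sum: "h \<oplus>\<^bsub>W\<^esub> \<phi> e = w" unfolding h_def add[OF hA e(1)] by (simp add: pl_assoc pl_neg pl_ze' y(2))
  have Te: "T (\<phi> e) = \<phi> e" using idem[OF w] by (simp add: e)
  have "h = w \<oplus>\<^bsub>W\<^esub> (- 1) \<odot>\<^bsub>W\<^esub> \<phi> e" using add y e A_sc by (simp add: h_def smult)
  hence "T h = \<phi> e \<oplus>\<^bsub>W\<^esub> (- 1) \<odot>\<^bsub>W\<^esub> \<phi> e"
   using w c A_sc[OF e(1), of "- 1"] by (simp add: T_add T_smult Te e(2) smult[OF e(1)] \<phi>_carrier) (metis T_smult Te c(2) smult[OF e(1)])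
  hence Th: "T h = \<zero>\<^bsub>W\<^esub>" using add[OF e(1) A_sc[OF e(1)]] by (simp add: smult[OF e(1)] pl_neg zero)
  have "0 \<odot>\<^bsub>W\<^esub> h = \<zero>\<^bsub>W\<^esub>" using smult[OF hA, of 0] by (simp add: h_def sc_0 zero)
  hence eh: "EX c. T h = c \<odot>\<^bsub>W\<^esub> h" using Th by metis
  have "1 \<odot>\<^bsub>W\<^esub> \<phi> e = \<phi> e" using smult[OF e(1), of 1] by (simp add: sc_1)
  hence ee: "EX c. T (\<phi> e) = c \<odot>\<^bsub>W\<^esub> \<phi> e" using Te by metis
  show "EX B. finite B & B \<subseteq> {x : carrier W. EX c. T x = c \<odot>\<^bsub>W\<^esub> x} & w = (\<Oplus>\<^bsub>W\<^esub>x\<in>B. x)"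
  \<comment> \<open>The eigenvectors form a set, so coinciding summands would be counted once. In
    that case both are zero and the empty sum serves.\<close>
  proof (cases "h = \<phi> e")
   case True
   hence "h = \<zero>\<^bsub>W\<^esub>" using Th Te by simp
   hence "w = \<zero>\<^bsub>W\<^esub>" using sum True by simp
   thus ?thesis by (intro exI[of _ "{}"]) simp
  next
   case False
   have "(\<Oplus>\<^bsub>W\<^esub>x\<in>{h, \<phi> e}. x) = h \<oplus>\<^bsub>W\<^esub> \<phi> e" using False c by simp
   thus ?thesis using c eh ee sum by (intro exI[of _ "{h, \<phi> e}"]) auto
  qed
 qed
next
 fix c assume "is_eigenvalue W T c"
 then obtain x where x: "x : carrier W" "x ~= \<zero>\<^bsub>W\<^esub>" "T x = c \<odot>\<^bsub>W\<^esub> x" unfolding is_eigenvalue_def by blast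
 then obtain y where y: "y : A" "x = \<phi> y" unfolding carrier by blast
 have Tx: "T x = \<phi> (sc c y)" using x(3) smult y by simp
 have "T (T x) = c \<odot>\<^bsub>W\<^esub> T x" by (simp only: x(3) T_smult[OF x(1)])
 \<comment> \<open>Idempotence on an eigenvector; below, if c c - c were invertible, the eigenvector
   would vanish.\<close>
 hence eq: "\<phi> (sc (c * c) y) = \<phi> (sc c y)"
  using idem[OF x(1)] smult[OF A_sc[OF y(1)], of c c] by (simp add: Tx sc_sc)
 have "\<phi> (sc (c * c - c) y) = \<phi> (sc (c * c) y) \<oplus>\<^bsub>W\<^esub> \<phi> (sc (- c) y)"
  using add[OF A_sc[OF y(1)] A_sc[OF y(1)], of "c * c" "- c"] sc_add[of "c * c" "- c" y] by simp
 also have "... = \<phi> ze"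
  unfolding eq using add[OF A_sc[OF y(1)] A_sc[OF y(1)], of c "- c"] sc_add[of c "- c" y] by (simp add: sc_0)
 finally have d: "\<phi> (sc (c * c - c) y) = \<phi> ze" .
 show "c = 0 | c = 1"
 proof (rule ccontr)
  assume "\<not> (c = 0 | c = 1)"
  hence d0: "c * c - c ~= 0" by simp
  have "x = \<phi> (sc (1 / (c * c - c)) (sc (c * c - c) y))" using d0 by (simp add: sc_sc sc_1 y(2))
  also have "... = (1 / (c * c - c)) \<odot>\<^bsub>W\<^esub> \<phi> ze" using smult[OF A_sc[OF y(1)]] by (simp only: d[symmetric])
  also have "... = \<zero>\<^bsub>W\<^esub>" using smult[OF A_ze] by (simp add: sc_ze zero)
  finally show False using x(2) by simp
 qed
qed

end

locale presented_quotient = presented pl ze sc A W \<phi>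
 for pl :: "'y => 'y => 'y" and ze :: 'y and sc :: "'f::field => 'y => 'y" and A and W :: "('f, 'a) module" and \<phi> +
 fixes B :: "'y set" and N :: "'a set"
 assumes B_A: "B \<subseteq> A" and B_ze: "ze : B" and B_pl: "x : B ==> y : B ==> pl x y : B" and B_sc: "y : B ==> sc c y : B"
  and N: "N = \<phi> ` B"
begin

definition \<Phi> :: "'y => 'a set" where "\<Phi> y = N +>\<^bsub>W\<^esub> \<phi> y"

lemma \<Phi>_eq: "y : A ==> \<Phi> y = {\<phi> (pl b y) | b. b : B}"
proof -
 assume y: "y : A"
 have "\<phi> b \<oplus>\<^bsub>W\<^esub> \<phi> y = \<phi> (pl b y)" if "b : B" for b using add[of b y] that y B_A by blast
 thus ?thesis unfolding \<Phi>_def a_r_coset_def' unfolding N by auto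
qed

text \<open>Cosets depend on representatives only modulo \<open>B\<close>; closure of
  \<open>B\<close> under negation gives the inclusion back.\<close>

lemma \<Phi>_absorb: assumes "y : A" "b : B" shows "\<Phi> (pl b y) = \<Phi> y"
proof -
 have "pl b y : A" using assms B_A A_pl by blast
 moreover have "EX b'':B. pl b' (pl b y) = pl b'' y" if "b' : B" for b'
  using B_pl[OF that assms(2)] pl_assoc by metis
 moreover have "EX b'':B. pl b' y = pl b'' (pl b y)" if "b' : B" for b'
 proof -
  have "pl (pl b' (sc (- 1) b)) (pl b y) = pl b' y"
   using pl_assoc[of "sc (- 1) b" b y] by (simp add: pl_assoc pl_neg pl_ze)
  thus ?thesis using B_pl[OF that B_sc[OF assms(2)]] by metis
 qed
 ultimately show ?thesis using assms(1) by (simp add: \<Phi>_eq) (metis (no_types, lifting))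
qed

sublocale Q: presented pl ze sc A "quotient_space W N" \<Phi>
proof
 show "carrier (quotient_space W N) = \<Phi> ` A"
  by (auto simp: quotient_space_def vspace_def A_RCOSETS_def' carrier \<Phi>_def)
 show "\<zero>\<^bsub>quotient_space W N\<^esub> = \<Phi> ze"
  unfolding \<Phi>_eq[OF A_ze] pl_ze' using N by (auto simp: quotient_space_def vspace_def)
next
 fix x y assume xy: "x : A" "y : A"
 have e: "\<phi> (pl b x) \<oplus>\<^bsub>W\<^esub> \<phi> (pl b' y) = \<phi> (pl (pl b b') (pl x y))" if "b : B" "b' : B" for b b'
 proof -
  have "pl b x : A" "pl b' y : A" using that xy B_A A_pl by blast+
  hence "\<phi> (pl b x) \<oplus>\<^bsub>W\<^esub> \<phi> (pl b' y) = \<phi> (pl (pl b x) (pl b' y))" by (rule add)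
  also have "pl (pl b x) (pl b' y) = pl (pl b b') (pl x y)" by (simp only: pl_ac)
  finally show ?thesis .
 qed
 have "\<Phi> x <+>\<^bsub>W\<^esub> \<Phi> y = (\<Union>b\<in>B. \<Union>b'\<in>B. {\<phi> (pl b x) \<oplus>\<^bsub>W\<^esub> \<phi> (pl b' y)})"
  unfolding set_add_def' \<Phi>_eq[OF xy(1)] \<Phi>_eq[OF xy(2)] by blast
 also have "... = (\<Union>b\<in>B. \<Union>b'\<in>B. {\<phi> (pl (pl b b') (pl x y))})" using e by (intro SUP_cong refl) simp
 also have "... = \<Phi> (pl x y)"
 proof -
  have "EX b:B. EX b':B. pl b b' = d" if "d : B" for d using that B_ze pl_ze by blast
  thus ?thesis unfolding \<Phi>_eq[OF A_pl[OF xy]] using B_pl by (intro equalityI subsetI) (auto, metis)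
 qed
 finally show "\<Phi> x \<oplus>\<^bsub>quotient_space W N\<^esub> \<Phi> y = \<Phi> (pl x y)" by (simp add: quotient_space_def vspace_def)
next
 fix y c assume y: "y : A"
 have "c \<odot>\<^bsub>quotient_space W N\<^esub> \<Phi> y = (\<Union>x\<in>\<Phi> y. N +>\<^bsub>W\<^esub> (c \<odot>\<^bsub>W\<^esub> x))" by (simp add: quotient_space_def vspace_def)
 also have "... = (\<Union>b\<in>B. \<Phi> (pl (sc c b) (sc c y)))"
 proof -
  have "c \<odot>\<^bsub>W\<^esub> \<phi> (pl b y) = \<phi> (pl (sc c b) (sc c y))" if "b : B" for b
  proof -
   have "pl b y : A" using that y B_A A_pl by blast
   thus ?thesis using smult sc_pl by simp
  qed
  hence "N +>\<^bsub>W\<^esub> (c \<odot>\<^bsub>W\<^esub> \<phi> (pl b y)) = \<Phi> (pl (sc c b) (sc c y))" if "b : B" for b using that by (simp add: \<Phi>_def)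
  thus ?thesis unfolding \<Phi>_eq[OF y] by blast
 qed
 also have "... = \<Phi> (sc c y)" using \<Phi>_absorb[OF A_sc[OF y] B_sc] B_ze by auto
 finally show "c \<odot>\<^bsub>quotient_space W N\<^esub> \<Phi> y = \<Phi> (sc c y)" .
qed (fact A_ze A_pl A_sc)+

lemma coset_N: assumes "x : carrier W" "b : N" shows "N +>\<^bsub>W\<^esub> (b \<oplus>\<^bsub>W\<^esub> x) = N +>\<^bsub>W\<^esub> x"
proof -
 obtain y b' where "y : A" "x = \<phi> y" "b' : B" "b = \<phi> b'" using assms unfolding carrier N by blast
 thus ?thesis using \<Phi>_absorb[of y b'] add[of b' y] B_A by (auto simp: \<Phi>_def)
qed

context
 fixes T :: "'a => 'a"
 assumes T: "!!x. x : carrier W ==> T x : carrier W"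
  and T_add: "!!x y. x : carrier W ==> y : carrier W ==> T (x \<oplus>\<^bsub>W\<^esub> y) = T x \<oplus>\<^bsub>W\<^esub> T y"
  and T_smult: "!!x c. x : carrier W ==> T (c \<odot>\<^bsub>W\<^esub> x) = c \<odot>\<^bsub>W\<^esub> T x"
  and T_N: "!!x. x : N ==> T x : N"
  and T_idem: "!!x. x : carrier W ==> EX w:carrier W. EX b:N. EX b':N. T x = b \<oplus>\<^bsub>W\<^esub> w & T w = b' \<oplus>\<^bsub>W\<^esub> w"
begin

lemma induced_coset: assumes "x : carrier W" shows "induced_map W N T (N +>\<^bsub>W\<^esub> x) = N +>\<^bsub>W\<^esub> T x"
proof -
 have "N \<subseteq> carrier W" using B_A by (auto simp: N carrier)
 have "N +>\<^bsub>W\<^esub> T y = N +>\<^bsub>W\<^esub> T x" if y: "y : N +>\<^bsub>W\<^esub> x" for y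
 proof -
  obtain b where b: "b : N" "y = b \<oplus>\<^bsub>W\<^esub> x" using y unfolding a_r_coset_def' by blast
  hence "T y = T b \<oplus>\<^bsub>W\<^esub> T x" using T_add assms \<open>N \<subseteq> carrier W\<close> by blast
  thus ?thesis using coset_N[OF T[OF assms] T_N[OF b(1)]] by simp
 qed
 moreover have "N +>\<^bsub>W\<^esub> x ~= {}" using B_ze N unfolding a_r_coset_def' by blast
 ultimately show ?thesis unfolding induced_map_def by auto
qed

lemma coset_ops:
 assumes "x : carrier W" "y : carrier W"
 shows "(N +>\<^bsub>W\<^esub> x) \<oplus>\<^bsub>quotient_space W N\<^esub> (N +>\<^bsub>W\<^esub> y) = N +>\<^bsub>W\<^esub> (x \<oplus>\<^bsub>W\<^esub> y)"
  "c \<odot>\<^bsub>quotient_space W N\<^esub> (N +>\<^bsub>W\<^esub> x) = N +>\<^bsub>W\<^esub> (c \<odot>\<^bsub>W\<^esub> x)"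
proof -
 obtain a b where "a : A" "x = \<phi> a" "b : A" "y = \<phi> b" using assms unfolding carrier by blast
 thus "(N +>\<^bsub>W\<^esub> x) \<oplus>\<^bsub>quotient_space W N\<^esub> (N +>\<^bsub>W\<^esub> y) = N +>\<^bsub>W\<^esub> (x \<oplus>\<^bsub>W\<^esub> y)"
  "c \<odot>\<^bsub>quotient_space W N\<^esub> (N +>\<^bsub>W\<^esub> x) = N +>\<^bsub>W\<^esub> (c \<odot>\<^bsub>W\<^esub> x)"
  using Q.add[of a b] Q.smult[of a c] by (simp_all add: \<Phi>_def add smult)
qed

text \<open>For idempotence, \<open>T_idem\<close> supplies w in the coset of T x whose image T w
  lies in the same coset; hence applying the induced map again changes nothing.\<close>

lemma induced_map_laws:
 assumes "X : carrier (quotient_space W N)"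
 shows "induced_map W N T X : carrier (quotient_space W N)"
  and "Y : carrier (quotient_space W N) ==>
   induced_map W N T (X \<oplus>\<^bsub>quotient_space W N\<^esub> Y) = induced_map W N T X \<oplus>\<^bsub>quotient_space W N\<^esub> induced_map W N T Y"
  and "induced_map W N T (c \<odot>\<^bsub>quotient_space W N\<^esub> X) = c \<odot>\<^bsub>quotient_space W N\<^esub> induced_map W N T X"
  and "induced_map W N T (induced_map W N T X) = induced_map W N T X"
proof -
 interpret abelian_monoid W by (rule abelian)
 have car: "carrier (quotient_space W N) = {N +>\<^bsub>W\<^esub> x | x. x : carrier W}" by (auto simp: Q.carrier \<Phi>_def carrier)
 obtain x where x: "x : carrier W" "X = N +>\<^bsub>W\<^esub> x" using assms unfolding car by blast
 have sc: "c \<odot>\<^bsub>W\<^esub> x : carrier W" using x(1) A_sc smult unfolding carrier by auto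
 show "induced_map W N T X : carrier (quotient_space W N)" using induced_coset[OF x(1)] x T[OF x(1)] unfolding car by blast
 show "induced_map W N T (c \<odot>\<^bsub>quotient_space W N\<^esub> X) = c \<odot>\<^bsub>quotient_space W N\<^esub> induced_map W N T X"
  by (simp add: x(2) coset_ops(2)[OF x(1) x(1)] induced_coset[OF x(1)] induced_coset[OF sc] T_smult[OF x(1)] coset_ops(2)[OF T[OF x(1)] x(1)])
 show "induced_map W N T (X \<oplus>\<^bsub>quotient_space W N\<^esub> Y) = induced_map W N T X \<oplus>\<^bsub>quotient_space W N\<^esub> induced_map W N T Y"
  if Y: "Y : carrier (quotient_space W N)"
 proof -
  obtain y where y: "y : carrier W" "Y = N +>\<^bsub>W\<^esub> y" using Y unfolding car by blast
  show ?thesis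
   by (simp add: x(2) y(2) coset_ops(1)[OF x(1) y(1)] induced_coset[OF x(1)] induced_coset[OF y(1)] induced_coset[OF a_closed[OF x(1) y(1)]]
     T_add[OF x(1) y(1)] coset_ops(1)[OF T[OF x(1)] T[OF y(1)]])
 qed
 obtain w b b' where w: "w : carrier W" "b : N" "b' : N" "T x = b \<oplus>\<^bsub>W\<^esub> w" "T w = b' \<oplus>\<^bsub>W\<^esub> w" using T_idem[OF x(1)] by blast
 hence "N +>\<^bsub>W\<^esub> T x = N +>\<^bsub>W\<^esub> w" "N +>\<^bsub>W\<^esub> T w = N +>\<^bsub>W\<^esub> w" using coset_N by simp_all
 thus "induced_map W N T (induced_map W N T X) = induced_map W N T X"
  by (simp only: x(2) induced_coset[OF x(1)] induced_coset[OF w(1)])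
qed

end

end

text \<open>All laws hold degree by degree, so the direct sum is again presented by sequences of
  representatives and the operator is idempotent on it.\<close>

lemma direct_sum_projection:
 fixes W :: "nat => ('f::field, 'a) module"
 assumes P: "!!n. presented pl ze sc (A n) (W n) (\<phi> n)"
  and T: "!!n x. x : carrier (W n) ==> T n x : carrier (W n)"
  and T_add: "!!n x y. x : carrier (W n) ==> y : carrier (W n) ==> T n (x \<oplus>\<^bsub>W n\<^esub> y) = T n x \<oplus>\<^bsub>W n\<^esub> T n y"
  and T_smult: "!!n x c. x : carrier (W n) ==> T n (c \<odot>\<^bsub>W n\<^esub> x) = c \<odot>\<^bsub>W n\<^esub> T n x"
  and idem: "!!n x. x : carrier (W n) ==> T n (T n x) = T n x"
 shows "diagonalizable (direct_sum W) (%h n. T n (h n)) \<and>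
  (ALL c. is_eigenvalue (direct_sum W) (%h n. T n (h n)) c --> c = 0 | c = 1)"
proof -
 interpret P: presented pl ze sc "A n" "W n" "\<phi> n" for n by (rule P)
 define D where "D = {ys. (ALL n. ys n : A n) & finite {n. \<phi> n (ys n) ~= \<zero>\<^bsub>W n\<^esub>}}"
 have zs: "\<phi> n (pl x y) = \<zero>\<^bsub>W n\<^esub>" if "\<phi> n x = \<zero>\<^bsub>W n\<^esub>" "\<phi> n y = \<zero>\<^bsub>W n\<^esub>" "x : A n" "y : A n" for n x y
  using P.add[OF that(3,4)] P.add[OF P.A_ze P.A_ze, of n] that by (simp add: P.zero P.pl_ze)
 have zc: "\<phi> n (sc c x) = \<zero>\<^bsub>W n\<^esub>" if "\<phi> n x = \<zero>\<^bsub>W n\<^esub>" "x : A n" for n x c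
  using P.smult[OF that(2), of c] P.smult[OF P.A_ze, of n c] that by (simp add: P.zero P.sc_ze)
 interpret S: presented "%f g n. pl (f n) (g n)" "%_. ze" "%c f n. sc c (f n)" D "direct_sum W" "%ys n. \<phi> n (ys n)"
 proof
  fix f g :: "nat => 'b" and c assume f: "f : D"
  show "(%n. sc c (f n)) : D"
  proof -
   have "{n. \<phi> n (sc c (f n)) ~= \<zero>\<^bsub>W n\<^esub>} \<subseteq> {n. \<phi> n (f n) ~= \<zero>\<^bsub>W n\<^esub>}" using f zc by (auto simp: D_def)
   hence "finite {n. \<phi> n (sc c (f n)) ~= \<zero>\<^bsub>W n\<^esub>}" using f by (auto simp: D_def intro: finite_subset)
   thus ?thesis using f P.A_sc by (simp add: D_def)
  qed
  show "c \<odot>\<^bsub>direct_sum W\<^esub> (%n. \<phi> n (f n)) = (%n. \<phi> n (sc c (f n)))"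
   using f P.smult by (auto simp: direct_sum_def vspace_def D_def)
  assume g: "g : D"
  show "(%n. pl (f n) (g n)) : D"
  proof -
   have "{n. \<phi> n (pl (f n) (g n)) ~= \<zero>\<^bsub>W n\<^esub>} \<subseteq> {n. \<phi> n (f n) ~= \<zero>\<^bsub>W n\<^esub>} \<union> {n. \<phi> n (g n) ~= \<zero>\<^bsub>W n\<^esub>}"
    using f g zs by (auto simp: D_def)
   moreover have "finite ({n. \<phi> n (f n) ~= \<zero>\<^bsub>W n\<^esub>} \<union> {n. \<phi> n (g n) ~= \<zero>\<^bsub>W n\<^esub>})" using f g by (simp add: D_def)
   ultimately have "finite {n. \<phi> n (pl (f n) (g n)) ~= \<zero>\<^bsub>W n\<^esub>}" by (rule finite_subset)
   thus ?thesis using f g P.A_pl by (simp add: D_def)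
  qed
  show "(%n. \<phi> n (f n)) \<oplus>\<^bsub>direct_sum W\<^esub> (%n. \<phi> n (g n)) = (%n. \<phi> n (pl (f n) (g n)))"
   using f g P.add by (auto simp: direct_sum_def vspace_def D_def)
 next
  show "(%_. ze) : D" using P.A_ze by (simp add: D_def P.zero[symmetric])
  show "\<zero>\<^bsub>direct_sum W\<^esub> = (%n. \<phi> n ze)" by (simp add: direct_sum_def vspace_def P.zero)
  show "carrier (direct_sum W) = (%ys n. \<phi> n (ys n)) ` D"
  proof (intro equalityI subsetI)
   fix h assume h: "h : carrier (direct_sum W)"
   hence "ALL n. EX y:A n. h n = \<phi> n y" by (auto simp: direct_sum_def vspace_def P.carrier)
   then obtain ys where ys: "!!n. ys n : A n" "!!n. h n = \<phi> n (ys n)" by metis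
   hence "ys : D" "h = (%n. \<phi> n (ys n))" using h by (auto simp: D_def direct_sum_def vspace_def)
   thus "h : (%ys n. \<phi> n (ys n)) ` D" by blast
  qed (auto simp: D_def direct_sum_def vspace_def P.carrier)
 qed (auto simp: P.pl_ac P.pl_ze P.sc_pl P.sc_add P.sc_sc P.sc_1 P.sc_0)
 \<comment> \<open>Needed to keep the support finite.\<close>
 have T0: "T n \<zero>\<^bsub>W n\<^esub> = \<zero>\<^bsub>W n\<^esub>" for n
 proof -
  have c: "\<zero>\<^bsub>W n\<^esub> : carrier (W n)" by (simp add: P.zero P.\<phi>_carrier P.A_ze)
  have z: "0 \<odot>\<^bsub>W n\<^esub> x = \<zero>\<^bsub>W n\<^esub>" if "x : carrier (W n)" for x
   using that P.smult[of _ n 0] by (auto simp: P.carrier P.sc_0 P.zero)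
  show ?thesis using T_smult[OF c, of 0] z[OF c] z[OF T[OF c]] by simp
 qed
 have car: "h : carrier (direct_sum W) \<longleftrightarrow> (ALL n. h n : carrier (W n)) & finite {n. h n ~= \<zero>\<^bsub>W n\<^esub>}" for h
  by (simp add: direct_sum_def vspace_def)
 show ?thesis
 proof (rule S.projection_diagonalizable)
  fix h assume h: "h : carrier (direct_sum W)"
  have "{n. T n (h n) ~= \<zero>\<^bsub>W n\<^esub>} \<subseteq> {n. h n ~= \<zero>\<^bsub>W n\<^esub>}" using T0 by auto
  hence "finite {n. T n (h n) ~= \<zero>\<^bsub>W n\<^esub>}" using h unfolding car by (auto intro: finite_subset)
  thus "(%n. T n (h n)) : carrier (direct_sum W)" using h T unfolding car by simp
 qed (auto simp: car T_add T_smult idem direct_sum_def vspace_def)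
qed

section \<open>Cohomology through unreduced representatives, and the conclusion\<close>

lemma map_space_ops [simp]:
 "carrier (map_space M n C) = C" "\<zero>\<^bsub>map_space M n C\<^esub> = (\<lambda>xs\<in>lists_of n. \<zero>\<^bsub>lquot M n\<^esub>)"
 "Y \<oplus>\<^bsub>map_space M n C\<^esub> Z = (\<lambda>xs\<in>lists_of n. Y xs \<oplus>\<^bsub>lquot M n\<^esub> Z xs)"
 "c \<odot>\<^bsub>map_space M n C\<^esub> Y = (\<lambda>xs\<in>lists_of n. c \<odot>\<^bsub>lquot M n\<^esub> Y xs)"
 by (simp_all add: map_space_def vspace_def)

context pvm begin

text \<open>The parity-free part of the cochain conditions. It survives adding cochains of different
  parities and suffices for the additive behaviour of \<open>pr\<close>.\<close>

definition LP :: "(('v \<times> bit \<times> 'f) list => 'm) => bool" where "LP y \<longleftrightarrow> slin y & PF (%_. y)"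

lemma LP_BC: "BC \<pi> y ==> LP y"
 by (simp add: LP_def BC_def)

lemma LP_add: "LP y ==> LP y' ==> LP (%w. y w + y' w)"
 using LinAt_comb[where c = 0] by (auto simp: LP_def slin_def PF_def M.polyfun_add)

lemma BC_plus: "BC \<pi> y ==> BC \<pi> y' ==> BC \<pi> (%w. y w + y' w)"
 using BC_add[of \<pi> y y' 0] by simp

lemma pr_cong: "(!!w. w : lists X ==> y w = y' w) ==> pr n y = pr n y'"
 by (auto simp: pr_def Hs_def[abs_def] mkl_X)

lemma pr_add:
 assumes "LP y" "LP y'"
 shows "(\<lambda>xs\<in>lists_of n. pr n y xs \<oplus>\<^bsub>lquot M n\<^esub> pr n y' xs) = pr n (%w. y w + y' w)"
proof -
 have "cls n (Hs n y xs) \<oplus>\<^bsub>lquot M n\<^esub> cls n (Hs n y' xs) = cls n (Hs n (%w. y w + y' w) xs)" if "length xs = n" for xs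
  using assms pol_Hs that by (simp add: LP_def lquot_add) (simp add: Hs_def[abs_def] sum.distrib)
 thus ?thesis unfolding pr_def by (intro restrict_ext) simp
qed

lemma pr_smult:
 assumes "LP y"
 shows "(\<lambda>xs\<in>lists_of n. c \<odot>\<^bsub>lquot M n\<^esub> pr n y xs) = pr n (%w. scl M c (y w))"
proof -
 have "c \<odot>\<^bsub>lquot M n\<^esub> cls n (Hs n y xs) = cls n (Hs n (%w. scl M c (y w)) xs)" if "length xs = n" for xs
  using assms pol_Hs that by (simp add: LP_def lquot_smult) (simp add: Hs_def[abs_def] M.scale_sum_right)
 thus ?thesis unfolding pr_def by (intro restrict_ext) simp
qed

lemma pr_zero: "(\<lambda>xs\<in>lists_of n. \<zero>\<^bsub>lquot M n\<^esub>) = pr n (%_. 0)"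
 by (simp add: pr_def lquot_zero Hs_def[abs_def])

lemma pr_null: "LP y ==> pr n y = pr n (%_. 0) \<longleftrightarrow> null n y"
 using pr_eq_iff[of y "%_. 0" n] LP_BC[OF BC_0[of 0]] by (simp add: LP_def)

lemma En_add: "PF (%_. y) ==> PF (%_. y') ==> xs : lists X ==> En (%w. y w + y' w) xs = En y xs + En y' xs"
proof (induction xs arbitrary: y y')
 case Nil
 show ?case using lin_add[OF L1_lin] by (simp add: L1_def)
next
 case (Cons z zs)
 obtain a \<alpha> r where z: "z = (a, \<alpha>, r)" by (metis prod_cases3)
 have a: "a : par V \<alpha>" "zs : lists X" using Cons.prems z by auto
 have "pf M (%t. y ((a, \<alpha>, t) # zs))" "pf M (%t. y' ((a, \<alpha>, t) # zs))"
  using PF_pf[OF Cons.prems(1) lists.Nil a(2,1)] PF_pf[OF Cons.prems(2) lists.Nil a(2,1)] by simp_all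
 moreover have "En (%w. y (z # w) + y' (z # w)) zs = En (ins y z) zs + En (ins y' z) zs"
  using PF_ins[OF Cons.prems(1) a(1) afn_const] PF_ins[OF Cons.prems(2) a(1) afn_const] a(2) unfolding z by (rule Cons.IH)
 ultimately show ?case by (simp add: z M.Dv_add M.scale_right_distrib)
qed

lemma En_scl: "PF (%_. y) ==> xs : lists X ==> En (%w. scl M c (y w)) xs = scl M c (En y xs)"
proof (induction xs arbitrary: y)
 case Nil
 show ?case using lin_scl[OF L1_lin] by (simp add: L1_def)
next
 case (Cons z zs)
 obtain a \<alpha> r where z: "z = (a, \<alpha>, r)" by (metis prod_cases3)
 have a: "a : par V \<alpha>" "zs : lists X" using Cons.prems z by auto
 have "pf M (%t. y ((a, \<alpha>, t) # zs))" using PF_pf[OF Cons.prems(1) lists.Nil a(2,1)] by simp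
 moreover have "En (%w. scl M c (y (z # w))) zs = scl M c (En (ins y z) zs)"
  using PF_ins[OF Cons.prems(1) a(1) afn_const] a(2) unfolding z by (rule Cons.IH)
 ultimately show ?case by (simp add: z Dv_lin[OF _ M.scl_lin] M.scale_right_distrib M.scale_right_diff_distrib mult.commute)
qed

lemma null_dd_add:
 assumes "null n (dd \<pi> y)" "null n (dd \<pi> y')" shows "null n (dd \<pi> (%w. y w + y' w))"
 using null_add[OF assms] by (simp add: dd_add[abs_def])

lemma null_dd_scl:
 assumes "BC \<pi> y" "null n (dd \<pi> y)" shows "null n (dd \<pi> (%w. scl M c (y w)))"
proof -
 have "null n (%w. scl M c (dd \<pi> y w))" using assms(2) by (simp add: null_def zn_scl)
 thus ?thesis by (rule null_cong[rotated]) (simp add: dd_scl)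
qed

text \<open>w is a cocycle cohomologous to the energy of y, and the energy of w is cohomologous to
  w. This is idempotence in cohomology, expressed with a single intermediate representative.\<close>

lemma cocycle_energy:
 assumes y: "BC \<pi> y" and n: "null (Suc n) (dd \<pi> y)"
 shows "EX w b b'. BC \<pi> w & null (Suc n) (dd \<pi> w) & BC (\<pi> + 1) b & BC (\<pi> + 1) b' \<and>
  pr n (En y) = pr n (%x. dd (\<pi> + 1) b x + w x) & pr n (En w) = pr n (%x. dd (\<pi> + 1) b' x + w x)"
proof -
 \<comment> \<open>\<open>closed_lift\<close> requires a cochain supported on n arguments; the
   values on other lengths do not affect the class.\<close>
 define y' where "y' w = (if length w = n then y w else 0)" for w
 have y': "BC \<pi> y'" using BC_restrict[OF y, of n] by (simp add: y'_def[abs_def])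
 have "null (Suc n) (dd \<pi> y')"
  using n by (rule null_cong[rotated]) (rule dd_cong, simp_all add: y'_def)
 then obtain z where z: "BC (\<pi> + 1) z" "!!xs. xs : lists X ==> dd \<pi> y' xs = TT z xs" "!!xs. xs : lists X ==> dd (\<pi> + 1) z xs = 0"
  using closed_lift[OF y', of n] by (auto simp: y'_def)
 have R1: "dd \<pi> (i0 z) x = sm \<pi> (TT z x)"
  and R2: "En y' x = sm \<pi> (i0 z x) + sm \<pi> (TT (i1 z) x) - sm \<pi> (dd (\<pi> + 1) (i1 y') x)"
  and R3: "En (i0 z) x = i0 z x + TT (i1 z) x + sm \<pi> (dd (\<pi> + 1) (i0 (i1 z)) x)" if "x : lists X" for x
  by (rule reduced_cocycle[OF y' z(1) _ _ that], erule z(2), erule z(3))+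
 have B: "BC \<pi> (i0 z)" "BC \<pi> (i1 z)" using BC_i0[OF z(1)] BC_i1[OF z(1)] by (simp_all add: add.commute)
 \<comment> \<open>The sign is that of \<open>i0\<close> z in the second fact of
   \<open>reduced_cocycle\<close>; b and b' collect the exact terms of the second and third.\<close>
 define w where "w = (%x. sm \<pi> (i0 z x))"
 define b where "b = (%x. sm (\<pi> + 1) (i1 y' x))"
 define b' where "b' = i0 (i1 z)"
 have BC: "BC \<pi> w" "BC (\<pi> + 1) b" "BC (\<pi> + 1) b'"
  unfolding w_def b_def b'_def by (intro BC_sm B BC_i1[OF y'] BC_i0)+
 have neg: "sm (\<pi> + 1) m = - sm \<pi> m" for m :: 'm by (cases \<pi>) simp_all
 have eq: "En y' x = sm \<pi> (TT (i1 z) x) + (dd (\<pi> + 1) b x + w x)" if "x : lists X" for x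
 proof -
  have "dd (\<pi> + 1) b x = - sm \<pi> (dd (\<pi> + 1) (i1 y') x)" unfolding b_def dd_sm by (rule neg)
  thus ?thesis unfolding R2[OF that] w_def by simp
 qed
 have eq': "En w x = sm \<pi> (TT (i1 z) x) + (dd (\<pi> + 1) b' x + w x)" if "x : lists X" for x
 proof -
  have "En w x = sm \<pi> (En (i0 z) x)"
   using En_scl[OF _ that, of "i0 z" "sg \<pi>"] B by (simp add: w_def M.sg_sm BC_def)
  thus ?thesis unfolding R3[OF that] w_def b'_def by (simp add: sm_add sm_sm add_ac)
 qed
 have dw: "null (Suc n) (dd \<pi> w)"
 proof (rule null_cong)
  show "null (Suc n) (TT z)" using z(1) by (intro null_TT) (simp add: BC_def)
  show "TT z x = dd \<pi> w x" if "x : lists X" for x unfolding w_def dd_sm using R1[OF that] by (simp add: sm_sm)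
 qed
 have LT: "LP (%x. sm \<pi> (TT (i1 z) x))" by (rule LP_BC[OF BC_sm[OF BC_TT[OF B(2)]]])
 have nT: "null n (%x. sm \<pi> (TT (i1 z) x))" using B(2) by (intro null_sm null_TT) (simp add: BC_def)
 have drop: "pr n (%x. sm \<pi> (TT (i1 z) x) + v x) = pr n v" if "LP v" for v
  using pr_eq_iff[of "%x. sm \<pi> (TT (i1 z) x) + v x" v n] LP_add[OF LT that] that nT by (simp add: LP_def)
 have LPw: "LP (%x. dd (\<pi> + 1) b x + w x)" "LP (%x. dd (\<pi> + 1) b' x + w x)"
  using LP_add[OF LP_BC[OF BC_dd[OF BC(2)]] LP_BC[OF BC(1)]] LP_add[OF LP_BC[OF BC_dd[OF BC(3)]] LP_BC[OF BC(1)]] by simp_all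
 have "pr n y = pr n y'"
 proof -
  have "null n (%w. y w - y' w)" by (rule null_cong[OF _ null_0]) (simp add: y'_def)
  thus ?thesis using pr_eq_iff[of y y' n] LP_BC[OF y] LP_BC[OF y'] by (simp add: LP_def)
 qed
 hence "pr n (En y) = pr n (En y')"
  using energy_pr[of y n] energy_pr[of y' n] LP_BC[OF y] LP_BC[OF y'] by (simp add: LP_def)
 also have "... = pr n (%x. sm \<pi> (TT (i1 z) x) + (dd (\<pi> + 1) b x + w x))" by (rule pr_cong[OF eq])
 also have "... = pr n (%x. dd (\<pi> + 1) b x + w x)" by (rule drop[OF LPw(1)])
 finally have 1: "pr n (En y) = pr n (%x. dd (\<pi> + 1) b x + w x)" .
 have "pr n (En w) = pr n (%x. sm \<pi> (TT (i1 z) x) + (dd (\<pi> + 1) b' x + w x))" by (rule pr_cong[OF eq'])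
 also have "... = pr n (%x. dd (\<pi> + 1) b' x + w x)" by (rule drop[OF LPw(2)])
 finally show ?thesis using 1 BC dw by blast
qed

text \<open>Unreduced representatives of n-cocycles. Each parity part is required to be closed
  modulo the image, which by \<open>null_part\<close> follows from closedness of the sum.\<close>

definition AA :: "nat => (('v \<times> bit \<times> 'f) list => 'm) set" where
 "AA n = {(%w. y w + y' w) | y y'. BC 0 y & BC 1 y' & null (Suc n) (dd 0 y) & null (Suc n) (dd 1 y')}"

lemma AA_I: "BC 0 y ==> BC 1 y' ==> null (Suc n) (dd 0 y) ==> null (Suc n) (dd 1 y') ==> (%w. y w + y' w) : AA n"
 by (auto simp: AA_def)

lemma AA_E:
 assumes "x : AA n" obtains y y' where "x = (%w. y w + y' w)" "BC 0 y" "BC 1 y'" "null (Suc n) (dd 0 y)" "null (Suc n) (dd 1 y')"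
 using assms by (auto simp: AA_def)

lemma AA_LP: "x : AA n ==> LP x"
 by (auto simp: AA_def intro: LP_add LP_BC)

lemma AA_ze: "(%_. 0) : AA n"
 using AA_I[OF BC_0 BC_0, of n] by (simp add: dd_0[abs_def] null_0)

lemma AA_pl: assumes "x : AA n" "z : AA n" shows "(%w. x w + z w) : AA n"
proof -
 obtain y y' v v' where e: "x = (%w. y w + y' w)" "BC 0 y" "BC 1 y'" "null (Suc n) (dd 0 y)" "null (Suc n) (dd 1 y')"
  "z = (%w. v w + v' w)" "BC 0 v" "BC 1 v'" "null (Suc n) (dd 0 v)" "null (Suc n) (dd 1 v')"
  using assms by (elim AA_E)
 have "(%w. (y w + v w) + (y' w + v' w)) : AA n" by (intro AA_I BC_plus null_dd_add e)
 thus ?thesis by (simp add: e(1,6) add_ac)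
qed

lemma AA_sc: assumes "x : AA n" shows "(%w. scl M c (x w)) : AA n"
proof -
 obtain y y' where e: "x = (%w. y w + y' w)" "BC 0 y" "BC 1 y'" "null (Suc n) (dd 0 y)" "null (Suc n) (dd 1 y')"
  using assms by (rule AA_E)
 have "(%w. scl M c (y w) + scl M c (y' w)) : AA n" by (intro AA_I BC_scl null_dd_scl e)
 thus ?thesis by (simp add: e(1) M.scale_right_distrib)
qed

lemma energy_sum:
 assumes "LP y" "LP y'" shows "cochain_energy V L M n (pr n (%w. y w + y' w)) = pr n (%w. En y w + En y' w)"
proof -
 have "cochain_energy V L M n (pr n (%w. y w + y' w)) = pr n (En (%w. y w + y' w))"
  using energy_pr LP_add[OF assms] by (simp add: LP_def)
 also have "... = pr n (%w. En y w + En y' w)" using assms by (intro pr_cong En_add) (simp_all add: LP_def)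
 finally show ?thesis .
qed

lemma BC_dd': "BC 0 y ==> BC 1 (dd 0 y)" "BC 1 y ==> BC 0 (dd 1 y)"
 using BC_dd[of 0 y] BC_dd[of 1 y] by simp_all

text \<open>The differential changes the parity, so the two summands change places as even and odd
  parts.\<close>

lemma exact_AA: assumes "BC 0 c" "BC 1 c'" shows "(%w. dd 0 c w + dd 1 c' w) : AA n"
proof -
 have d: "0 = dd 1 (dd 0 c) w" "0 = dd 0 (dd 1 c') w" if "w : lists X" for w
  using dd_dd_0[OF assms(1) that] dd_dd_0[OF assms(2) that] by simp_all
 have "null (Suc n) (dd 1 (dd 0 c))" by (rule null_cong[OF _ null_0]) (erule d(1))
 moreover have "null (Suc n) (dd 0 (dd 1 c'))" by (rule null_cong[OF _ null_0]) (erule d(2))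
 ultimately have n: "null (Suc n) (dd 1 (dd 0 c))" "null (Suc n) (dd 0 (dd 1 c'))" .
 from AA_I[OF BC_dd'(2)[OF assms(2)] BC_dd'(1)[OF assms(1)] n(2,1)]
 show ?thesis by (simp add: add.commute)
qed

end

context pvm_poly begin

text \<open>Combines surjectivity of the reduction, which needs freeness of \<open>V\<close>, with
  \<open>pr_cochain\<close>.\<close>

lemma homogeneous_cochains_pr: "homogeneous_cochains V M n \<pi> = {pr n y | y. BC \<pi> y}"
proof (intro equalityI subsetI)
 fix Y assume "Y : homogeneous_cochains V M n \<pi>"
 then interpret lifting V L M I u qu n \<pi> Y by unfold_locales
 show "Y : {pr n y | y. BC \<pi> y}" using cochain_pr by blast
qed (auto intro: pr_cochain)

lemma cochains_pr: "carrier (cochains V M n) = {pr n (%w. y w + y' w) | y y'. BC 0 y & BC 1 y'}"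
proof -
 have "carrier (cochains V M n) = {Y \<oplus>\<^bsub>map_space M n UNIV\<^esub> Z | Y Z. Y : homogeneous_cochains V M n 0 & Z : homogeneous_cochains V M n 1}"
  by (simp only: cochains_def map_space_ops)
 also have "... = {pr n y \<oplus>\<^bsub>map_space M n UNIV\<^esub> pr n y' | y y'. BC 0 y & BC 1 y'}"
  unfolding homogeneous_cochains_pr by blast
 also have "... = {pr n (%w. y w + y' w) | y y'. BC 0 y & BC 1 y'}"
 proof -
  have "pr n y \<oplus>\<^bsub>map_space M n UNIV\<^esub> pr n y' = pr n (%w. y w + y' w)" if "BC 0 y" "BC 1 y'" for y y'
   unfolding map_space_ops by (rule pr_add[OF LP_BC[OF that(1)] LP_BC[OF that(2)]])
  thus ?thesis by (metis (no_types, lifting))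
 qed
 finally show ?thesis .
qed

lemma cochains_add: "LP y ==> LP y' ==> pr n y \<oplus>\<^bsub>cochains V M n\<^esub> pr n y' = pr n (%w. y w + y' w)"
 unfolding cochains_def map_space_ops by (rule pr_add)

text \<open>The parity decomposition of a reduced cochain is unique because a sum of parts of
  different parity has zero class only if both parts do.\<close>

lemma cochain_part_pr:
 assumes "BC \<pi> y" "BC (1 + \<pi>) y'" shows "cochain_part V M n \<pi> (pr n (%w. y w + y' w)) = pr n y"
 unfolding cochain_part_def
proof (rule the_equality)
 show "pr n y : homogeneous_cochains V M n \<pi> & (EX W:homogeneous_cochains V M n (1 + \<pi>). pr n (%w. y w + y' w) = pr n y \<oplus>\<^bsub>cochains V M n\<^esub> W)"
  using assms cochains_add[OF LP_BC[OF assms(1)] LP_BC[OF assms(2)]] unfolding homogeneous_cochains_pr by (metis (mono_tags, lifting) mem_Collect_eq)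
next
 fix Z assume "Z : homogeneous_cochains V M n \<pi> & (EX W:homogeneous_cochains V M n (1 + \<pi>). pr n (%w. y w + y' w) = Z \<oplus>\<^bsub>cochains V M n\<^esub> W)"
 then obtain z z' where z: "BC \<pi> z" "Z = pr n z" "BC (1 + \<pi>) z'" "pr n (%w. y w + y' w) = pr n z \<oplus>\<^bsub>cochains V M n\<^esub> pr n z'"
  unfolding homogeneous_cochains_pr by blast
 have L: "LP y" "LP y'" "LP z" "LP z'" using assms z LP_BC by blast+
 have "pr n (%w. y w + y' w) = pr n (%w. z w + z' w)" using z(4) cochains_add[OF L(3,4)] by simp
 hence "null n (%w. (y w + y' w) - (z w + z' w))"
  using pr_eq_iff[of "%w. y w + y' w" "%w. z w + z' w" n] LP_add[OF L(1,2)] LP_add[OF L(3,4)] by (simp add: LP_def)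
 hence "null n (%w. (sm 1 (z w) + y w) + (sm 1 (z' w) + y' w))" by (simp add: algebra_simps)
 moreover have "spar \<pi> (%w. sm 1 (z w) + y w)" "spar (\<pi> + 1) (%w. sm 1 (z' w) + y' w)"
  using BC_add[OF z(1) assms(1), of 1] BC_add[OF z(3) assms(2), of 1] by (simp_all add: BC_def add.commute)
 ultimately have "null n (%w. sm 1 (z w) + y w)" by (rule null_part)
 hence "null n (%w. y w - z w)" by (simp add: algebra_simps)
 thus "Z = pr n y" using pr_eq_iff[of y z n] L by (simp add: LP_def z(2))
qed

lemma differential_sum:
 assumes "BC 0 y" "BC 1 y'"
 shows "differential V M n (pr n (%w. y w + y' w)) = pr (Suc n) (%w. dd 0 y w + dd 1 y' w)"
proof -
 have 0: "cochain_part V M n 0 (pr n (%w. y w + y' w)) = pr n y" using assms by (intro cochain_part_pr) simp_all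
 have "cochain_part V M n 1 (pr n (%w. y' w + y w)) = pr n y'" using assms by (intro cochain_part_pr) simp_all
 hence 1: "cochain_part V M n 1 (pr n (%w. y w + y' w)) = pr n y'" by (simp add: add.commute)
 have "homogeneous_differential V M n 0 (pr n y) = pr (Suc n) (dd 0 y)" "homogeneous_differential V M n 1 (pr n y') = pr (Suc n) (dd 1 y')"
  using assms by (auto simp: BC_def intro!: differential_pr)
 thus ?thesis unfolding differential_def 0 1
  using cochains_add[OF LP_BC[OF BC_dd[OF assms(1)]] LP_BC[OF BC_dd[OF assms(2)]]] by simp
qed

lemma cochains_zero: "\<zero>\<^bsub>cochains V M n\<^esub> = pr n (%_. 0)"
 unfolding cochains_def map_space_ops by (rule pr_zero)

lemma cocycles_pr: "carrier (cocycles V M n) = pr n ` AA n"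
proof -
 have "differential V M n (pr n (%w. y w + y' w)) = \<zero>\<^bsub>cochains V M (Suc n)\<^esub> \<longleftrightarrow> null (Suc n) (dd 0 y) & null (Suc n) (dd 1 y')"
  if b: "BC 0 y" "BC 1 y'" for y y'
 proof -
  note d = BC_dd'(1)[OF b(1)] BC_dd'(2)[OF b(2)]
  have "differential V M n (pr n (%w. y w + y' w)) = \<zero>\<^bsub>cochains V M (Suc n)\<^esub> \<longleftrightarrow> null (Suc n) (%w. dd 0 y w + dd 1 y' w)"
   unfolding differential_sum[OF b] cochains_zero by (rule pr_null[OF LP_add[OF LP_BC[OF d(1)] LP_BC[OF d(2)]]])
  also have "... \<longleftrightarrow> null (Suc n) (dd 0 y) & null (Suc n) (dd 1 y')"
  proof
   assume N: "null (Suc n) (%w. dd 0 y w + dd 1 y' w)"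
   hence N': "null (Suc n) (%w. dd 1 y' w + dd 0 y w)" by (simp add: add.commute)
   show "null (Suc n) (dd 0 y) & null (Suc n) (dd 1 y')"
    using null_part[OF N, of 1] null_part[OF N', of 0] d by (simp add: BC_def)
  qed (simp add: null_add)
  finally show ?thesis .
 qed
 thus ?thesis unfolding cocycles_def map_space_ops cochains_pr AA_def by blast
qed

lemma coboundaries_pr: "coboundaries V M n = {pr n (%w. dd 0 c w + dd 1 c' w) | c c'. BC 0 c & BC 1 c'}"
proof (cases n)
 case 0
 \<comment> \<open>On the empty list \<open>dd\<close> is 0, so the description by exact cochains
   also covers degree 0, where the zero cochain is the only coboundary.\<close>
 have z: "pr 0 (%w. dd 0 c w + dd 1 c' w) = pr 0 (%_. 0)" for c c' :: "('v \<times> bit \<times> 'f) list => 'm"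
  by (simp add: pr_def Hs_def[abs_def] restrict_def fun_eq_iff)
 show ?thesis unfolding 0 coboundaries.simps cochains_zero z using BC_0 by blast
next
 case (Suc m)
 show ?thesis unfolding Suc coboundaries.simps cochains_pr
 proof (intro equalityI subsetI)
  fix Z assume "Z : differential V M m ` {pr m (%w. y w + y' w) | y y'. BC 0 y & BC 1 y'}"
  then obtain y y' where "BC 0 y" "BC 1 y'" "Z = differential V M m (pr m (%w. y w + y' w))" by blast
  thus "Z : {pr (Suc m) (%w. dd 0 c w + dd 1 c' w) | c c'. BC 0 c & BC 1 c'}" using differential_sum by blast
 next
  fix Z assume "Z : {pr (Suc m) (%w. dd 0 c w + dd 1 c' w) | c c'. BC 0 c & BC 1 c'}"
  then obtain c c' where c: "BC 0 c" "BC 1 c'" "Z = pr (Suc m) (%w. dd 0 c w + dd 1 c' w)" by blast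
  hence "Z = differential V M m (pr m (%w. c w + c' w))" using differential_sum by simp
  thus "Z : differential V M m ` {pr m (%w. y w + y' w) | y y'. BC 0 y & BC 1 y'}" using c(1,2) by blast
 qed
qed

text \<open>Defined by the class being a coboundary, not by being exact before reduction, so that
  \<open>BB\<close> is saturated under \<open>pr\<close>.\<close>

definition BB :: "nat => (('v \<times> bit \<times> 'f) list => 'm) set" where
 "BB n = {y : AA n. pr n y : coboundaries V M n}"

lemma coboundaries_add:
 assumes "LP x" "LP z" "pr n x : coboundaries V M n" "pr n z : coboundaries V M n"
 shows "pr n (%w. x w + z w) : coboundaries V M n"
proof -
 obtain c c' d d' where e: "BC 0 c" "BC 1 c'" "pr n x = pr n (%w. dd 0 c w + dd 1 c' w)"
  "BC 0 d" "BC 1 d'" "pr n z = pr n (%w. dd 0 d w + dd 1 d' w)" using assms(3,4) unfolding coboundaries_pr by blast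
 have "pr n (%w. x w + z w) = pr n (%w. (dd 0 c w + dd 1 c' w) + (dd 0 d w + dd 1 d' w))"
  unfolding pr_add[OF assms(1,2), symmetric] e(3,6) by (rule pr_add[OF AA_LP[OF exact_AA[OF e(1,2)]] AA_LP[OF exact_AA[OF e(4,5)]]])
 also have "... = pr n (%w. dd 0 (%w. c w + d w) w + dd 1 (%w. c' w + d' w) w)" by (simp add: dd_add add_ac)
 finally show ?thesis unfolding coboundaries_pr using BC_plus[OF e(1,4)] BC_plus[OF e(2,5)] by blast
qed

lemma coboundaries_smult:
 assumes "LP x" "pr n x : coboundaries V M n"
 shows "pr n (%w. scl M k (x w)) : coboundaries V M n"
proof -
 obtain c c' where e: "BC 0 c" "BC 1 c'" "pr n x = pr n (%w. dd 0 c w + dd 1 c' w)"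
  using assms(2) unfolding coboundaries_pr by blast
 have "pr n (%w. scl M k (x w)) = pr n (%w. scl M k (dd 0 c w + dd 1 c' w))"
  unfolding pr_smult[OF assms(1), symmetric] e(3) by (rule pr_smult[OF AA_LP[OF exact_AA[OF e(1,2)]]])
 also have "... = pr n (%w. dd 0 (%w. scl M k (c w)) w + dd 1 (%w. scl M k (c' w)) w)"
  by (rule pr_cong) (simp add: dd_scl M.scale_right_distrib)
 finally show ?thesis unfolding coboundaries_pr using BC_scl[OF e(1)] BC_scl[OF e(2)] by blast
qed

sublocale H: presented_quotient "%y y' w. y w + y' w" "%_. 0" "%c y w. scl M c (y w)" "AA n" "cocycles V M n" "pr n" "BB n" "coboundaries V M n" for n
proof
 show "carrier (cocycles V M n) = pr n ` AA n" by (rule cocycles_pr)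
 show "\<zero>\<^bsub>cocycles V M n\<^esub> = pr n (%_. 0)" unfolding cocycles_def map_space_ops by (rule pr_zero)
 show "pr n x \<oplus>\<^bsub>cocycles V M n\<^esub> pr n y = pr n (%w. x w + y w)" if "x : AA n" "y : AA n" for x y
  unfolding cocycles_def map_space_ops by (rule pr_add[OF AA_LP[OF that(1)] AA_LP[OF that(2)]])
 show "c \<odot>\<^bsub>cocycles V M n\<^esub> pr n y = pr n (%w. scl M c (y w))" if "y : AA n" for y c
  unfolding cocycles_def map_space_ops by (rule pr_smult[OF AA_LP[OF that]])
 show "BB n \<subseteq> AA n" by (auto simp: BB_def)
 show "(%_. 0) : BB n"
 proof -
  have "pr n (%_. 0) = pr n (%w. dd 0 (%_. 0) w + dd 1 (%_. 0) w)" by (simp add: dd_0)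
  thus ?thesis using AA_ze BC_0 unfolding BB_def coboundaries_pr by blast
 qed
 show "(%w. x w + y w) : BB n" if "x : BB n" "y : BB n" for x y
  using that AA_pl[of x n y] coboundaries_add[of x y n] AA_LP[of x n] AA_LP[of y n] by (simp add: BB_def)
 show "(%w. scl M c (y w)) : BB n" if "y : BB n" for y c
  using that AA_sc[of y n c] coboundaries_smult[of y n c] AA_LP[of y n] by (simp add: BB_def)
 show "coboundaries V M n = pr n ` BB n"
  using exact_AA by (auto simp: BB_def coboundaries_pr)
qed (auto intro: AA_ze AA_pl AA_sc simp: add_ac M.scale_right_distrib M.scale_left_distrib)

text \<open>The hypotheses of \<open>induced_map_laws\<close> for the energy. Stability of the
  cocycles is read off from the last law: the image is a coboundary plus a cocycle.\<close>

lemma energy_laws: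
 fixes n defines "W \<equiv> cocycles V M n" and "N \<equiv> coboundaries V M n" and "T \<equiv> cochain_energy V L M n"
 shows "x : carrier W ==> T x : carrier W"
  and "x : carrier W ==> y : carrier W ==> T (x \<oplus>\<^bsub>W\<^esub> y) = T x \<oplus>\<^bsub>W\<^esub> T y"
  and "x : carrier W ==> T (c \<odot>\<^bsub>W\<^esub> x) = c \<odot>\<^bsub>W\<^esub> T x"
  and "x : N ==> T x : N"
  and "x : carrier W ==> EX w:carrier W. EX b:N. EX b':N. T x = b \<oplus>\<^bsub>W\<^esub> w & T w = b' \<oplus>\<^bsub>W\<^esub> w"
proof -
 have Wadd: "pr n y \<oplus>\<^bsub>W\<^esub> pr n y' = pr n (%w. y w + y' w)" if "LP y" "LP y'" for y y'
  unfolding W_def cocycles_def map_space_ops by (rule pr_add[OF that])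
 have Wsmult: "c \<odot>\<^bsub>W\<^esub> pr n y = pr n (%w. scl M c (y w))" if "LP y" for y c
  unfolding W_def cocycles_def map_space_ops by (rule pr_smult[OF that])
 have LE: "LP (%w. En y w + En y' w)" if "BC 0 y" "BC 1 y'" for y y'
  by (rule LP_add[OF LP_BC[OF BC_En[OF that(1)]] LP_BC[OF BC_En[OF that(2)]]])
 have Tsum: "T (pr n (%w. y w + y' w)) = pr n (%w. En y w + En y' w)" if "BC 0 y" "BC 1 y'" for y y'
  unfolding T_def by (rule energy_sum[OF LP_BC[OF that(1)] LP_BC[OF that(2)]])
 have WE: "EX y y'. x = pr n (%w. y w + y' w) & BC 0 y & BC 1 y' & null (Suc n) (dd 0 y) & null (Suc n) (dd 1 y')" if "x : carrier W" for x
  using that unfolding W_def cocycles_pr AA_def by blast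
 show idem: "EX w:carrier W. EX b:N. EX b':N. T x = b \<oplus>\<^bsub>W\<^esub> w & T w = b' \<oplus>\<^bsub>W\<^esub> w" if x: "x : carrier W" for x
 proof -
  obtain y y' where y: "x = pr n (%w. y w + y' w)" "BC 0 y" "BC 1 y'" "null (Suc n) (dd 0 y)" "null (Suc n) (dd 1 y')" using WE[OF x] by blast
  obtain w b d where w: "BC 0 w" "null (Suc n) (dd 0 w)" "BC 1 b" "BC 1 d" "pr n (En y) = pr n (%x. dd 1 b x + w x)" "pr n (En w) = pr n (%x. dd 1 d x + w x)"
   using cocycle_energy[OF y(2,4)] by auto
  obtain w' b' d' where w': "BC 1 w'" "null (Suc n) (dd 1 w')" "BC 0 b'" "BC 0 d'" "pr n (En y') = pr n (%x. dd 0 b' x + w' x)" "pr n (En w') = pr n (%x. dd 0 d' x + w' x)"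
   using cocycle_energy[OF y(3,5)] by auto
  \<comment> \<open>The exact term belonging to the even part is d of an odd cochain and conversely;
    regrouping gives one coboundary plus one cocycle.\<close>
  have E: "pr n (%x. En v x + En v' x) = pr n (%x. dd 0 c' x + dd 1 c x) \<oplus>\<^bsub>W\<^esub> pr n (%x. w x + w' x)"
   if v: "BC 0 v" "BC 1 v'" "BC 1 c" "BC 0 c'" "pr n (En v) = pr n (%x. dd 1 c x + w x)" "pr n (En v') = pr n (%x. dd 0 c' x + w' x)" for v v' c c'
  proof -
   have l: "LP (%x. dd 1 c x + w x)" "LP (%x. dd 0 c' x + w' x)" "LP (%x. dd 0 c' x + dd 1 c x)" "LP (%x. w x + w' x)"
    by (intro LP_add LP_BC[OF BC_dd[OF v(3)]] LP_BC[OF BC_dd[OF v(4)]] LP_BC[OF w(1)] LP_BC[OF w'(1)])+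
   have "pr n (%x. En v x + En v' x) = pr n (En v) \<oplus>\<^bsub>W\<^esub> pr n (En v')" using Wadd LP_BC[OF BC_En[OF v(1)]] LP_BC[OF BC_En[OF v(2)]] by simp
   also have "... = pr n (%x. (dd 1 c x + w x) + (dd 0 c' x + w' x))" unfolding v(5,6) by (rule Wadd[OF l(1,2)])
   also have "... = pr n (%x. (dd 0 c' x + dd 1 c x) + (w x + w' x))" by (simp add: add_ac)
   also have "... = pr n (%x. dd 0 c' x + dd 1 c x) \<oplus>\<^bsub>W\<^esub> pr n (%x. w x + w' x)" by (rule Wadd[OF l(3,4), symmetric])
   finally show ?thesis .
  qed
  have "pr n (%x. w x + w' x) : carrier W" unfolding W_def cocycles_pr by (intro imageI AA_I w w')
  moreover have "pr n (%x. dd 0 b' x + dd 1 b x) : N" "pr n (%x. dd 0 d' x + dd 1 d x) : N"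
   unfolding N_def coboundaries_pr using w w' by blast+
  moreover have "T x = pr n (%x. dd 0 b' x + dd 1 b x) \<oplus>\<^bsub>W\<^esub> pr n (%x. w x + w' x)"
   unfolding y(1) Tsum[OF y(2,3)] by (rule E[OF y(2,3) w(3) w'(3) w(5) w'(5)])
  moreover have "T (pr n (%x. w x + w' x)) = pr n (%x. dd 0 d' x + dd 1 d x) \<oplus>\<^bsub>W\<^esub> pr n (%x. w x + w' x)"
   unfolding Tsum[OF w(1) w'(1)] by (rule E[OF w(1) w'(1) w(4) w'(4) w(6) w'(6)])
  ultimately show ?thesis by blast
 qed
 have NW: "N \<subseteq> carrier W" unfolding N_def W_def H.N H.carrier using H.B_A by blast
 interpret abelian_monoid W unfolding W_def by (rule H.abelian)
 show "T x : carrier W" if "x : carrier W" for x using idem[OF that] NW by auto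
 show "T (x \<oplus>\<^bsub>W\<^esub> z) = T x \<oplus>\<^bsub>W\<^esub> T z" if xz: "x : carrier W" "z : carrier W" for x z
 proof -
  obtain y y' where y: "x = pr n (%w. y w + y' w)" "BC 0 y" "BC 1 y'" using WE[OF xz(1)] by blast
  obtain v v' where v: "z = pr n (%w. v w + v' w)" "BC 0 v" "BC 1 v'" using WE[OF xz(2)] by blast
  have "x \<oplus>\<^bsub>W\<^esub> z = pr n (%w. (y w + y' w) + (v w + v' w))" unfolding y(1) v(1)
   by (rule Wadd) (intro LP_add LP_BC[OF y(2)] LP_BC[OF y(3)] LP_BC[OF v(2)] LP_BC[OF v(3)])+
  also have "... = pr n (%w. (y w + v w) + (y' w + v' w))" by (simp add: add_ac)
  finally have "T (x \<oplus>\<^bsub>W\<^esub> z) = pr n (%w. En (%w. y w + v w) w + En (%w. y' w + v' w) w)"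
   using Tsum[OF BC_plus[OF y(2) v(2)] BC_plus[OF y(3) v(3)]] by simp
  also have "... = pr n (%w. (En y w + En y' w) + (En v w + En v' w))"
  proof (rule pr_cong)
   fix w assume w: "w : lists X"
   show "En (%w. y w + v w) w + En (%w. y' w + v' w) w = (En y w + En y' w) + (En v w + En v' w)"
    using En_add[OF _ _ w, of y v] En_add[OF _ _ w, of y' v'] y v by (simp add: BC_def add_ac)
  qed
  also have "... = T x \<oplus>\<^bsub>W\<^esub> T z" unfolding y(1) v(1) Tsum[OF y(2,3)] Tsum[OF v(2,3)] by (rule Wadd[OF LE[OF y(2,3)] LE[OF v(2,3)], symmetric])
  finally show ?thesis .
 qed
 show "T (c \<odot>\<^bsub>W\<^esub> x) = c \<odot>\<^bsub>W\<^esub> T x" if x: "x : carrier W" for x c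
 proof -
  obtain y y' where y: "x = pr n (%w. y w + y' w)" "BC 0 y" "BC 1 y'" using WE[OF x] by blast
  have "c \<odot>\<^bsub>W\<^esub> x = pr n (%w. scl M c (y w) + scl M c (y' w))"
   unfolding y(1) Wsmult[OF LP_add[OF LP_BC[OF y(2)] LP_BC[OF y(3)]]] by (simp add: M.scale_right_distrib)
  hence "T (c \<odot>\<^bsub>W\<^esub> x) = pr n (%w. En (%w. scl M c (y w)) w + En (%w. scl M c (y' w)) w)"
   using Tsum[OF BC_scl[OF y(2)] BC_scl[OF y(3)]] by simp
  also have "... = pr n (%w. scl M c (En y w + En y' w))"
  proof (rule pr_cong)
   fix w assume w: "w : lists X"
   show "En (%w. scl M c (y w)) w + En (%w. scl M c (y' w)) w = scl M c (En y w + En y' w)"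
    using En_scl[OF _ w, of y c] En_scl[OF _ w, of y' c] y by (simp add: BC_def M.scale_right_distrib)
  qed
  also have "... = c \<odot>\<^bsub>W\<^esub> T x" unfolding y(1) Tsum[OF y(2,3)] by (rule Wsmult[OF LE[OF y(2,3)], symmetric])
  finally show ?thesis .
 qed
 show "T x : N" if "x : N" for x
 proof -
  obtain c c' where c: "x = pr n (%w. dd 0 c w + dd 1 c' w)" "BC 0 c" "BC 1 c'" using \<open>x : N\<close> unfolding N_def coboundaries_pr by blast
  have "T x = pr n (%w. En (dd 0 c) w + En (dd 1 c') w)"
   unfolding c(1) T_def by (rule energy_sum[OF LP_BC[OF BC_dd[OF c(2)]] LP_BC[OF BC_dd[OF c(3)]]])
  \<comment> \<open>An exact cochain is closed, so by \<open>En_dd\<close> its energy is again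
    exact; the sign for \<pi> = 1 is moved inside the differential.\<close>
  also have "... = pr n (%w. dd 0 (i1 (dd 0 c)) w + dd 1 (%w. sm 1 (i1 (dd 1 c') w)) w)"
   by (rule pr_cong) (simp only: En_dd[OF c(2)] En_dd[OF c(3)] dd_sm, simp)
  finally have e: "T x = pr n (%w. dd 0 (i1 (dd 0 c)) w + dd 1 (%w. sm 1 (i1 (dd 1 c') w)) w)" .
  have "BC 0 (i1 (dd 0 c))" "BC 1 (%w. sm 1 (i1 (dd 1 c') w))"
   using BC_i1[OF BC_dd[OF c(2)]] BC_sm[OF BC_i1[OF BC_dd[OF c(3)]], of 1] by simp_all
  thus ?thesis unfolding e N_def coboundaries_pr by blast
 qed
qed

text \<open>The energy is idempotent on each cohomology space, and
  \<open>direct_sum_projection\<close> passes to the total cohomology.\<close>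

lemma energy_diagonalizable:
 "diagonalizable (total_cohomology V M) (energy V L M) \<and>
  (ALL c. is_eigenvalue (total_cohomology V M) (energy V L M) c --> c = 0 | c = 1)"
proof -
 note laws = H.induced_map_laws[where T = "cochain_energy V L M n" and n = n for n, OF energy_laws]
 have "diagonalizable (direct_sum (cohomology V M)) (%h n. induced_map (cocycles V M n) (coboundaries V M n) (cochain_energy V L M n) (h n)) \<and>
  (ALL c. is_eigenvalue (direct_sum (cohomology V M)) (%h n. induced_map (cocycles V M n) (coboundaries V M n) (cochain_energy V L M n) (h n)) c --> c = 0 | c = 1)"
  by (rule direct_sum_projection, unfold cohomology_def) (rule H.Q.presented_axioms | rule laws, assumption+ | rule laws)+
 thus ?thesis unfolding total_cohomology_def energy_def[abs_def] .
qed

end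

theorem theorem3p26:
  fixes V :: "('f::field_char_0, 'v::ring_1) pva"
    and L :: 'v
    and M :: "('v, 'f, 'm::ab_group_add) pva_mod"
    and I :: "'i set"
    and u :: "'i \<Rightarrow> 'v"
  assumes "conformal_pva V L"
    and "conformal_module V L M"
    and "diff_polynomials V I u"
  shows "diagonalizable (total_cohomology V M) (energy V L M)
    \<and> (\<forall>c. is_eigenvalue (total_cohomology V M) (energy V L M) c \<longrightarrow> c = 0 \<or> c = 1)"
proof -
 obtain q where q: "ALL i:I. u i : par V (q i)" "word_eval V u ` {f. keys f \<subseteq> lists (I \<times> UNIV)} = UNIV"
  "{f. keys f \<subseteq> lists (I \<times> UNIV) & word_eval V u f = 0} = supercommutator_ideal I q"
  using assms(3) unfolding diff_polynomials_def by blast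
 have "pvm V L M" using assms(1,2) by (rule pvm.intro)
 then interpret pvm_poly V L M I u q using q by (intro pvm_poly.intro pvm_poly_axioms.intro) blast+
 show ?thesis by (rule energy_diagonalizable)
qed

end
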